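(* Let $d\ge2$, $m\ge1$, and let $\Omega=\{(x',x_d)\in\mathbb{R}^d: x_d>\psi(x')\}$ be a fixed graph domain, where $\psi:\mathbb{R}^{d-1}\to\mathbb{R}$ is a Lipschitz function with $\|\nabla\psi\|_\infty\le M$. Let $1<p_0<\frac{2(d-1)}{d-2}$. Let $\mathcal{L}$ be a second-order linear elliptic operator (an $m\times m$ system with complex coefficients) satisfying the following boundary Caccioppoli condition with a constant $\kappa>0$: $$\int_{B(x_0,r)\cap\Omega}|\nabla u|^2\,dx\le\frac{\kappa}{r^2}\int_{B(x_0,2r)\cap\Omega}|u|^2\,dx$$ whenever $x_0\in\partial\Omega$, $0<r<\infty$, and $u\in W^{1,2}(B(x_0,2r)\cap\Omega;\mathbb{C}^m)$ is a weak solution to $\mathcal{L}(u)=0$ in $B(x_0,2r)\cap\Omega$ with $u=0$ on $B(x_0,2r)\cap\partial\Omega$. Assume that there is a constant $C_0$ such that for any $f\in C_0^\infty(\mathbb{R}^d;\mathbb{C}^m)$ there exists a weak solution $u\in W^{1,2}_{loc}(\overline\Omega;\mathbb{C}^m)$ to $\mathcal{L}(u)=0$ in $\Omega$ such that $u=f$ on $\partial\Omega$ in the sense of trace and $$\|N(u)\|_{L^{p_0}(\partial\Omega)}\le C_0\|f\|_{L^{p_0}(\partial\Omega)}.$$ Then there exists $\varepsilon>0$, depending only on $d$, $m$, $p_0$, $\kappa$, $C_0$ and $M$, such that for any $p$ with $$p_0<p<\frac{2(d-1)}{d-2}+\varepsilon$$ and any $f\in C_0^\infty(\mathbb{R}^d;\mathbb{C}^m)$,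 the weak solution $u$ satisfies $$\|N(u)\|_{L^p(\partial\Omega)}\le C\|f\|_{L^p(\partial\Omega)},$$ where $C$ depends only on $d$, $m$, $p_0$, $p$, $\kappa$, $C_0$ and $M$.
   Context: Operator: $\mathcal{L}$ is a second-order linear elliptic operator acting on $\mathbb{C}^m$-valued functions, with complex coefficients; it may contain lower-order terms and need not be in divergence form. The condition imposed on it is the boundary Caccioppoli inequality stated in the claim. $B(x,r)$ is the open ball in $\mathbb{R}^d$. $u\in W^{1,2}_{loc}(\overline\Omega;\mathbb{C}^m)$ means $u\in W^{1,2}(B\cap\Omega;\mathbb{C}^m)$ for every ball $B$. Modified nontangential maximal function: let $\delta(x)=\mathrm{dist}(x,\partial\Omega)$, and fix $a>1+2M$ once and for all (constants may depend on this fixed $a$). For $z\in\partial\Omega$, let $\Gamma_a(z)=\{x\in\Omega: |x-z|<a\,\delta(x)\}$. For $u\in L^2_{loc}(\Omega)$, $$N(u)(z)=N_a(u)(z)=\sup\left\{\left(\frac{1}{|B(x,\frac14\delta(x))|}\int_{B(x,\frac14\delta(x))}|u|^2\right)^{1/2}: x\in\Gamma_a(z)\right\}.$$ $L^p(\partial\Omega)$ is taken with respect to surface measure $\sigma$. Convention for $d=2$: $\frac{2(d-1)}{d-2}$ is read as $\infty$, so that the hypothesis is $1<p_0<\infty$ and the conclusion holds for all $p_0<p<\infty$. *)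

theory Defs
  imports "HOL-Analysis.Analysis"
begin

text \<open>
  The ambient space is modelled as the product of \<open>real ^ 'n\<close> (the variable \<open>x'\<close>, so that
  \<open>d = CARD('n) + 1\<close>) and \<open>real\<close> (the variable \<open>x\<^sub>d\<close>); its norm is the Euclidean one.
  Weak derivatives are recorded as \<open>G e x\<close>, the value at \<open>x\<close> of the partial derivative in the
  coordinate direction \<open>e \<in> Basis\<close>.
\<close>

subsection \<open>Smooth functions and weak derivatives\<close>

primrec C_k :: "nat \<Rightarrow> ('a::euclidean_space \<Rightarrow> 'b::real_normed_vector) \<Rightarrow> bool" where
  "C_k 0 f \<longleftrightarrow> continuous_on UNIV f"
| "C_k (Suc k) f \<longleftrightarrow>
     (\<forall>x. f differentiable (at x)) \<and> (\<forall>e\<in>Basis. C_k k (\<lambda>x. frechet_derivative f (at x) e))"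

definition smooth :: "('a::euclidean_space \<Rightarrow> 'b::real_normed_vector) \<Rightarrow> bool" where
  "smooth f \<longleftrightarrow> (\<forall>k. C_k k f)"

definition test_functions :: "'a set \<Rightarrow> ('a::euclidean_space \<Rightarrow> 'b::real_normed_vector) set" where
  "test_functions D = {\<phi>. smooth \<phi> \<and> compact (closure {x. \<phi> x \<noteq> 0}) \<and> closure {x. \<phi> x \<noteq> 0} \<subseteq> D}"

definition loc_integrable ::
    "'a set \<Rightarrow> ('a::euclidean_space \<Rightarrow> 'b::euclidean_space) \<Rightarrow> bool" where
  "loc_integrable D g \<longleftrightarrow> (\<forall>K. compact K \<and> K \<subseteq> D \<longrightarrow> set_integrable lebesgue K g)"

definition square_integrable ::
    "'a set \<Rightarrow> ('a::euclidean_space \<Rightarrow> 'b::euclidean_space) \<Rightarrow> bool" where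
  "square_integrable D g \<longleftrightarrow>
     g \<in> borel_measurable (lebesgue_on D) \<and> integrable (lebesgue_on D) (\<lambda>x. (norm (g x))\<^sup>2)"

definition weak_partial ::
    "'a set \<Rightarrow> 'a \<Rightarrow> ('a::euclidean_space \<Rightarrow> 'b::euclidean_space) \<Rightarrow> ('a \<Rightarrow> 'b) \<Rightarrow> bool" where
  "weak_partial D e u g \<longleftrightarrow> loc_integrable D u \<and> loc_integrable D g \<and>
     (\<forall>\<phi>::'a \<Rightarrow> real. \<phi> \<in> test_functions D \<longrightarrow>
        (LINT x:D|lebesgue. frechet_derivative \<phi> (at x) e *\<^sub>R u x)
          = - (LINT x:D|lebesgue. \<phi> x *\<^sub>R g x))"

definition grad_norm_sq :: "('a::euclidean_space \<Rightarrow> 'a \<Rightarrow> 'b::euclidean_space) \<Rightarrow> 'a \<Rightarrow> real" where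
  "grad_norm_sq G x = (\<Sum>e\<in>Basis. (norm (G e x))\<^sup>2)"

text \<open>\<open>W12 D u G\<close>: \<open>u\<close> belongs to \<open>W\<^sup>1\<^sup>,\<^sup>2(D)\<close>, with weak gradient \<open>G\<close>.\<close>

definition W12 ::
    "'a set \<Rightarrow> ('a::euclidean_space \<Rightarrow> 'b::euclidean_space) \<Rightarrow> ('a \<Rightarrow> 'a \<Rightarrow> 'b) \<Rightarrow> bool" where
  "W12 D u G \<longleftrightarrow> square_integrable D u \<and>
     (\<forall>e\<in>Basis. weak_partial D e u (G e) \<and> square_integrable D (G e))"

text \<open>Up to the boundary: membership in \<open>W\<^sup>1\<^sup>,\<^sup>2(B \<inter> D)\<close> for every ball \<open>B\<close>.\<close>

definition W12_loc ::
    "'a set \<Rightarrow> ('a::euclidean_space \<Rightarrow> 'b::euclidean_space) \<Rightarrow> ('a \<Rightarrow> 'a \<Rightarrow> 'b) \<Rightarrow> bool" where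
  "W12_loc D u G \<longleftrightarrow> (\<forall>x r. W12 (ball x r \<inter> D) u G)"

subsection \<open>Graph domains and surface measure\<close>

definition graph_domain :: "(real ^ 'n \<Rightarrow> real) \<Rightarrow> ((real ^ 'n) \<times> real) set" where
  "graph_domain \<psi> = {x. \<psi> (fst x) < snd x}"

text \<open>The a.e. existence of the gradient is automatic for a Lipschitz function (Rademacher).\<close>

definition lipschitz_graph :: "real \<Rightarrow> (real ^ 'n \<Rightarrow> real) \<Rightarrow> bool" where
  "lipschitz_graph M \<psi> \<longleftrightarrow>
     (\<exists>L. L-lipschitz_on UNIV \<psi>) \<and> (AE y in lebesgue. \<exists>D. GDERIV \<psi> y :> D \<and> norm D \<le> M)"

definition gradient :: "('a::euclidean_space \<Rightarrow> real) \<Rightarrow> 'a \<Rightarrow> 'a" where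
  "gradient \<psi> y = (if \<exists>D. GDERIV \<psi> y :> D then THE D. GDERIV \<psi> y :> D else 0)"

text \<open>
  The measure \<open>d\<sigma> = sqrt (1 + \<bar>\<nabla>\<psi>\<bar>\<^sup>2) dx'\<close> on the graph of \<open>\<psi>\<close>, viewed as a Borel measure on the
  ambient space that is concentrated on the graph.
\<close>

definition surface_measure :: "(real ^ 'n \<Rightarrow> real) \<Rightarrow> ((real ^ 'n) \<times> real) measure" where
  "surface_measure \<psi> =
     distr (density lebesgue (\<lambda>y. ennreal (sqrt (1 + (norm (gradient \<psi> y))\<^sup>2)))) borel (\<lambda>y. (y, \<psi> y))"

subsection \<open>Traces\<close>

text \<open>
  \<open>has_trace \<psi> U u G g\<close>: \<open>u = g\<close> on \<open>U \<inter> \<partial>\<Omega>\<close> in the sense of trace, where \<open>\<Omega>\<close> is the graph domain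
  and \<open>u\<close>, with weak gradient \<open>G\<close>, is \<open>W\<^sup>1\<^sup>,\<^sup>2\<close> near each point of \<open>U\<close>.  As usual the trace operator is
  the continuous extension of the restriction of smooth functions to the boundary; convergence is
  local in \<open>U\<close> since \<open>U \<inter> \<Omega>\<close> need not be a Lipschitz domain when \<open>U\<close> is a ball.
\<close>

definition has_trace ::
    "(real ^ 'n \<Rightarrow> real) \<Rightarrow> ((real ^ 'n) \<times> real) set \<Rightarrow> ((real ^ 'n) \<times> real \<Rightarrow> 'b::euclidean_space) \<Rightarrow>
     ((real ^ 'n) \<times> real \<Rightarrow> (real ^ 'n) \<times> real \<Rightarrow> 'b) \<Rightarrow> ((real ^ 'n) \<times> real \<Rightarrow> 'b) \<Rightarrow> bool" where
  "has_trace \<psi> U u G g \<longleftrightarrow>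
     (\<exists>v. (\<forall>k::nat. smooth (v k)) \<and>
        (\<forall>K. compact K \<and> K \<subseteq> U \<longrightarrow>
           (\<lambda>k. \<integral>\<^sup>+x\<in>K \<inter> graph_domain \<psi>. ennreal ((norm (v k x - u x))\<^sup>2
                + grad_norm_sq (\<lambda>e x. frechet_derivative (v k) (at x) e - G e x) x) \<partial>lebesgue)
             \<longlonglongrightarrow> 0 \<and>
           (\<lambda>k. \<integral>\<^sup>+z\<in>K. ennreal ((norm (v k z - g z))\<^sup>2) \<partial>surface_measure \<psi>) \<longlonglongrightarrow> 0))"

subsection \<open>Second-order elliptic systems\<close>

text \<open>
  \<open>DivForm A V B c\<close> is the operator
  \<open>u \<mapsto> - \<Sum>\<^sub>i \<partial>\<^sub>i (\<Sum>\<^sub>j A\<^sub>i\<^sub>j \<partial>\<^sub>j u + V\<^sub>i u) + \<Sum>\<^sub>i B\<^sub>i \<partial>\<^sub>i u + c u\<close> and \<open>NonDivForm A B c\<close> is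
  \<open>u \<mapsto> - \<Sum>\<^sub>i\<^sub>j A\<^sub>i\<^sub>j \<partial>\<^sub>i \<partial>\<^sub>j u + \<Sum>\<^sub>i B\<^sub>i \<partial>\<^sub>i u + c u\<close>; the values of the coefficients are complex
  \<open>m \<times> m\<close> matrices, and the indices range over \<open>Basis\<close>.
\<close>

datatype ('a, 'm::finite) elliptic_op =
    DivForm "'a \<Rightarrow> 'a \<Rightarrow> 'a \<Rightarrow> complex ^ 'm ^ 'm" "'a \<Rightarrow> 'a \<Rightarrow> complex ^ 'm ^ 'm"
      "'a \<Rightarrow> 'a \<Rightarrow> complex ^ 'm ^ 'm" "'a \<Rightarrow> complex ^ 'm ^ 'm"
  | NonDivForm "'a \<Rightarrow> 'a \<Rightarrow> 'a \<Rightarrow> complex ^ 'm ^ 'm"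
      "'a \<Rightarrow> 'a \<Rightarrow> complex ^ 'm ^ 'm" "'a \<Rightarrow> complex ^ 'm ^ 'm"

fun principal :: "('a, 'm::finite) elliptic_op \<Rightarrow> 'a \<Rightarrow> 'a \<Rightarrow> 'a \<Rightarrow> complex ^ 'm ^ 'm" where
  "principal (DivForm A V B c) = A"
| "principal (NonDivForm A B c) = A"

fun measurable_coeffs :: "'a::euclidean_space set \<Rightarrow> ('a, 'm::finite) elliptic_op \<Rightarrow> bool" where
  "measurable_coeffs D (DivForm A V B c) \<longleftrightarrow>
     (\<forall>i\<in>Basis. \<forall>j\<in>Basis. A i j \<in> borel_measurable (lebesgue_on D)) \<and>
     (\<forall>i\<in>Basis. V i \<in> borel_measurable (lebesgue_on D) \<and> B i \<in> borel_measurable (lebesgue_on D)) \<and>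
     c \<in> borel_measurable (lebesgue_on D)"
| "measurable_coeffs D (NonDivForm A B c) \<longleftrightarrow>
     (\<forall>i\<in>Basis. \<forall>j\<in>Basis. A i j \<in> borel_measurable (lebesgue_on D)) \<and>
     (\<forall>i\<in>Basis. B i \<in> borel_measurable (lebesgue_on D)) \<and>
     c \<in> borel_measurable (lebesgue_on D)"

text \<open>Ellipticity: the principal symbol is invertible for every nonzero real covector.\<close>

definition elliptic :: "'a::euclidean_space set \<Rightarrow> ('a, 'm::finite) elliptic_op \<Rightarrow> bool" where
  "elliptic D \<L> \<longleftrightarrow> measurable_coeffs D \<L> \<and>
     (AE x in lebesgue_on D. \<forall>\<xi>. \<xi> \<noteq> 0 \<longrightarrow>
        invertible (\<Sum>i\<in>Basis. \<Sum>j\<in>Basis. ((\<xi> \<bullet> i) * (\<xi> \<bullet> j)) *\<^sub>R principal \<L> i j x))"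

text \<open>
  \<open>weak_equation \<L> D u G\<close>: \<open>\<L>(u) = 0\<close> holds in the open set \<open>D\<close>, where \<open>G\<close> is the weak gradient of
  \<open>u\<close>.  In divergence form the system holds in the sense of distributions; scalar real test
  functions and a vector-valued identity amount to vector-valued test functions.  The coefficients
  are only measurable, so the local integrability needed for the identity to make sense is part of
  the definition.  Out of divergence form, \<open>u\<close> has second weak derivatives in \<open>L\<^sup>2\<close> locally in \<open>D\<close>
  and the system holds a.e.; if the principal coefficients are regular enough to be differentiated,
  the operator can also be written in divergence form.
\<close>

fun weak_equation ::
    "('a::euclidean_space, 'm::finite) elliptic_op \<Rightarrow> 'a set \<Rightarrow> ('a \<Rightarrow> complex ^ 'm) \<Rightarrow>
     ('a \<Rightarrow> 'a \<Rightarrow> complex ^ 'm) \<Rightarrow> bool" where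
  "weak_equation (DivForm A V B c) D u G \<longleftrightarrow>
     (let F = (\<lambda>i x. (\<Sum>j\<in>Basis. A i j x *v G j x) + V i x *v u x);
          h = (\<lambda>x. (\<Sum>i\<in>Basis. B i x *v G i x) + c x *v u x)
      in (\<forall>i\<in>Basis. loc_integrable D (F i)) \<and> loc_integrable D h \<and>
         (\<forall>\<phi>::'a \<Rightarrow> real. \<phi> \<in> test_functions D \<longrightarrow>
            (LINT x:D|lebesgue.
               (\<Sum>i\<in>Basis. frechet_derivative \<phi> (at x) i *\<^sub>R F i x) + \<phi> x *\<^sub>R h x) = 0))"
| "weak_equation (NonDivForm A B c) D u G \<longleftrightarrow>
     (\<exists>H. (\<forall>i\<in>Basis. \<forall>j\<in>Basis. weak_partial D i (G j) (H i j) \<and>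
             (\<forall>K. compact K \<and> K \<subseteq> D \<longrightarrow> square_integrable K (H i j))) \<and>
          (AE x in lebesgue_on D.
             - (\<Sum>i\<in>Basis. \<Sum>j\<in>Basis. A i j x *v H i j x) + (\<Sum>i\<in>Basis. B i x *v G i x)
               + c x *v u x = 0))"

definition boundary_caccioppoli ::
    "(real ^ 'n \<Rightarrow> real) \<Rightarrow> ((real ^ 'n) \<times> real, 'm::finite) elliptic_op \<Rightarrow> real \<Rightarrow> bool" where
  "boundary_caccioppoli \<psi> \<L> \<kappa> \<longleftrightarrow>
     (\<forall>x0 r u G.
        x0 \<in> frontier (graph_domain \<psi>) \<and> 0 < r \<and>
        W12 (ball x0 (2 * r) \<inter> graph_domain \<psi>) u G \<and>
        weak_equation \<L> (ball x0 (2 * r) \<inter> graph_domain \<psi>) u G \<and>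
        has_trace \<psi> (ball x0 (2 * r)) u G (\<lambda>_. 0) \<longrightarrow>
        (LINT x:ball x0 r \<inter> graph_domain \<psi>|lebesgue. grad_norm_sq G x)
          \<le> \<kappa> / r\<^sup>2 * (LINT x:ball x0 (2 * r) \<inter> graph_domain \<psi>|lebesgue. (norm (u x))\<^sup>2))"

subsection \<open>Nontangential maximal function and the Dirichlet problem\<close>

definition ennreal_powr :: "ennreal \<Rightarrow> real \<Rightarrow> ennreal" where
  "ennreal_powr t p = (if t = \<infinity> then \<infinity> else ennreal (enn2real t powr p))"

definition Lp_norm :: "'a measure \<Rightarrow> real \<Rightarrow> ('a \<Rightarrow> ennreal) \<Rightarrow> ennreal" where
  "Lp_norm \<mu> p F = ennreal_powr (\<integral>\<^sup>+x. ennreal_powr (F x) p \<partial>\<mu>) (1 / p)"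

definition cone :: "'a::euclidean_space set \<Rightarrow> real \<Rightarrow> 'a \<Rightarrow> 'a set" where
  "cone \<Omega> a z = {x \<in> \<Omega>. dist x z < a * infdist x (frontier \<Omega>)}"

definition nontangential_max ::
    "'a::euclidean_space set \<Rightarrow> real \<Rightarrow> ('a \<Rightarrow> 'b::euclidean_space) \<Rightarrow> 'a \<Rightarrow> ennreal" where
  "nontangential_max \<Omega> a u z =
     (SUP x\<in>cone \<Omega> a z.
        let B = ball x (infdist x (frontier \<Omega>) / 4)
        in ennreal_powr ((\<integral>\<^sup>+y\<in>B. ennreal ((norm (u y))\<^sup>2) \<partial>lebesgue) / emeasure lebesgue B) (1/2))"

definition dirichlet_solution ::
    "(real ^ 'n \<Rightarrow> real) \<Rightarrow> ((real ^ 'n) \<times> real, 'm::finite) elliptic_op \<Rightarrow>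
     ((real ^ 'n) \<times> real \<Rightarrow> complex ^ 'm) \<Rightarrow> ((real ^ 'n) \<times> real \<Rightarrow> complex ^ 'm) \<Rightarrow> bool" where
  "dirichlet_solution \<psi> \<L> f u \<longleftrightarrow>
     (\<exists>G. W12_loc (graph_domain \<psi>) u G \<and> weak_equation \<L> (graph_domain \<psi>) u G \<and>
          has_trace \<psi> UNIV u G f)"

definition nontangential_bound ::
    "(real ^ 'n \<Rightarrow> real) \<Rightarrow> real \<Rightarrow> real \<Rightarrow> real \<Rightarrow> ((real ^ 'n) \<times> real \<Rightarrow> complex ^ 'm::finite) \<Rightarrow>
     ((real ^ 'n) \<times> real \<Rightarrow> complex ^ 'm) \<Rightarrow> bool" where
  "nontangential_bound \<psi> a p C f u \<longleftrightarrow>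
     Lp_norm (surface_measure \<psi>) p (nontangential_max (graph_domain \<psi>) a u)
       \<le> ennreal C * Lp_norm (surface_measure \<psi>) p (\<lambda>z. ennreal (norm (f z)))"

definition crit_exponent :: "nat \<Rightarrow> ereal" where
  "crit_exponent d = (if d = 2 then \<infinity> else ereal (2 * (real d - 1) / (real d - 2)))"

end

theory Submission
  imports Defs
begin

text \<open>
  Why the theorem is true.  Let \<open>n = d - 1\<close>, let \<open>F y\<close> be the value of \<open>N(u)\<close> at the boundary point above
  \<open>y \<in> \<real>\<^sup>n\<close>, and let \<open>g y\<close> be the size of the data there.  Surface measure is comparable with Lebesgue measure
  on \<open>\<real>\<^sup>n\<close>, so the claim is an inequality between the \<open>L\<^sup>p\<close> norms of \<open>F\<close> and \<open>g\<close> on \<open>\<real>\<^sup>n\<close>, known for \<open>p = p0\<close>.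

  The proof extrapolates from \<open>p0\<close> to larger \<open>p\<close> by a good-lambda argument.  Consider a stopping ball of radius
  \<open>\<rho>\<close>, where the mean of order \<open>p0\<close> of \<open>F\<close> over every concentric ball of radius at least \<open>2 * \<rho>\<close> is at most \<open>\<tau>\<close>
  while that of \<open>g\<close> is at most \<open>\<gamma> * \<tau>\<close>.  Write \<open>u = v + w\<close>, where \<open>v\<close> is the solution for the data cut off outside a large multiple
  of the ball.  The assumed estimate shows that \<open>N(v)\<close> is small, of size \<open>\<gamma> * \<tau>\<close>, in the mean.  The function \<open>w\<close>
  vanishes on the boundary near the ball.  The points of the cones at distance more than \<open>\<rho>\<close> from the boundary
  contribute at most a multiple of \<open>\<tau>\<close> to \<open>F\<close>, since they are seen from a whole boundary ball of radius
  comparable to their depth (\<open>whitney_le_average\<close>).  If the contribution to \<open>N(w)\<close> of the points close to the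
  boundary is of weak type \<open>q\<close>, with the constant \<open>\<tau>\<close>, then a covering argument and an integration over all
  levels \<open>\<tau>\<close> yield the estimate for all \<open>p\<close> between \<open>p0\<close> and \<open>q\<close> (\<open>real_variable_extrapolation\<close>).

  So everything depends on the weak-type estimate, for some \<open>q\<close> above the critical exponent, near a part of the
  boundary where \<open>w\<close> vanishes.  Its source is the boundary Caccioppoli inequality.  Let \<open>E(y, s)\<close> be the integral
  of \<open>\<bar>\<nabla>w\<bar>\<^sup>2\<close> over the part of the domain that lies above \<open>ball y s\<close> at height less than \<open>s\<close>.

  \<^item> As \<open>w\<close> vanishes on the boundary, integrating \<open>\<nabla>w\<close> along vertical segments bounds the integral of \<open>\<bar>w\<bar>\<^sup>2\<close> in
    such a slab by \<open>s\<^sup>2\<close> times that of \<open>\<bar>\<nabla>w\<bar>\<^sup>2\<close>.  If the Whitney average of \<open>w\<close> at a point of depth comparable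
    to \<open>s\<close> exceeds \<open>t\<close>, then \<open>E(y, s)\<close> exceeds a multiple of \<open>t\<^sup>2 * s ^ (n - 1)\<close> (\<open>near_weak_type\<close>).

  \<^item> Hole filling: Caccioppoli bounds the energy of a slab by the mass \<open>\<bar>w\<bar>\<^sup>2\<close> of a larger one, and the mass is
    bounded by the energy outside the small slab and a small multiple of the total energy.  Consequently \<open>E(y, s)\<close>
    decays like \<open>s powr \<eta>\<close> for some \<open>\<eta> > 0\<close> (\<open>energy_decay\<close>).

  \<^item> The total energy is bounded.  Away from the boundary \<open>w\<close> is bounded by a negative power of the height, because
    averages of \<open>F\<close> and of \<open>N(v)\<close> are bounded; an iteration over thin strips removes the singularity at the boundary
    (\<open>strip_iteration\<close>).

  \<^item> Decay restricts the radii with \<open>E(y, s) > t\<^sup>2 * s ^ (n - 1)\<close> to \<open>s powr (n - 1 - \<eta>) \<lesssim> t powr -2\<close>, and Vitali's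
    lemma bounds the volume of the set of such \<open>y\<close> by \<open>t powr -q\<close> with \<open>q = 2 + 2 / (n - 1 - \<eta>)\<close> (\<open>weak_type\<close>).

  Without decay this exponent would be \<open>2 + 2 / (n - 1) = 2 (d - 1) / (d - 2)\<close>, the critical one; the gain \<open>\<eta>\<close>
  produces the \<open>\<epsilon>\<close> of the theorem.  For \<open>d = 2\<close> the threshold for \<open>E(y, s)\<close> is \<open>t\<^sup>2\<close> for all \<open>s\<close>, so it is not
  exceeded for large \<open>t\<close>, and every \<open>q\<close> is possible.
\<close>

section \<open>Powers of extended reals and geometric levels\<close>

lemma ennreal_powr_ennreal: "0 \<le> x \<Longrightarrow> ennreal_powr (ennreal x) p = ennreal (x powr p)"
  by (simp add: ennreal_powr_def)

lemma ennreal_powr_top [simp]: "ennreal_powr top p = top"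
  by (simp add: ennreal_powr_def)

lemma ennreal_powr_0 [simp]: "ennreal_powr 0 p = 0"
  by (simp add: ennreal_powr_def)

lemma ennreal_powr_mono: "s \<le> t \<Longrightarrow> 0 \<le> p \<Longrightarrow> ennreal_powr s p \<le> ennreal_powr t p"
  by (cases s; cases t) (auto simp: ennreal_powr_ennreal intro!: ennreal_leI powr_mono2 simp: top_unique)

lemma ennreal_powr_mult:
  assumes "0 < c"
  shows "ennreal_powr (ennreal c * t) p = ennreal (c powr p) * ennreal_powr t p"
proof (cases t)
  case (real r)
  then show ?thesis using assms
    by (simp add: ennreal_powr_ennreal powr_mult flip: ennreal_mult)
next
  case top
  then show ?thesis using assms by (simp add: ennreal_mult_top)
qed

lemma ennreal_powr_add:
  "ennreal_powr t (p + q) = ennreal_powr t p * ennreal_powr t q"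
  by (cases t) (auto simp: ennreal_powr_ennreal powr_add ennreal_mult)

lemma ennreal_powr_powr: "0 < p \<Longrightarrow> ennreal_powr (ennreal_powr t p) q = ennreal_powr t (p * q)"
  by (cases t) (auto simp: ennreal_powr_ennreal powr_powr)

lemma ennreal_powr_1 [simp]: "ennreal_powr t 1 = t"
  by (cases t) (auto simp: ennreal_powr_ennreal)

lemma measurable_ennreal_powr [measurable (raw)]:
  assumes [measurable]: "f \<in> borel_measurable M"
  shows "(\<lambda>x. ennreal_powr (f x) p) \<in> borel_measurable M"
  unfolding ennreal_powr_def by measurable

lemma geometric_level:
  fixes x b K :: real
  assumes "1 < b" "0 < K" "0 < x" "x \<le> K"
  obtains j :: nat where "K / b ^ Suc j < x" "x \<le> K / b ^ j"
proof -
  obtain m where m: "K / x < b ^ m"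
    using real_arch_pow[OF assms(1)] by blast
  define l where "l = (LEAST m. K / x < b ^ m)"
  have l: "K / x < b ^ l" unfolding l_def by (rule LeastI[of _ m]) (rule m)
  have "l \<noteq> 0"
  proof
    assume "l = 0"
    then have "K / x < 1" using l by simp
    then show False using assms by (simp add: field_simps)
  qed
  then obtain j where j: "l = Suc j" using not0_implies_Suc by blast
  have "\<not> K / x < b ^ j"
    using not_less_Least[of j "\<lambda>m. K / x < b ^ m"] j unfolding l_def by simp
  with l j that[of j] assms show thesis by (simp add: field_simps)
qed

lemma suminf_const_top: "0 < (c::ennreal) \<Longrightarrow> (\<Sum>k. c) = top"
proof -
  assume "0 < c"
  have "\<And>n. of_nat n * c \<le> (\<Sum>k::nat. c)"
    using sum_le_suminf[of "\<lambda>k::nat. c" "{..<n}" for n] by simp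
  moreover have "(SUP n. of_nat n * c) = top"
    by (simp add: ennreal_SUP_of_nat_eq_top \<open>0 < c\<close> flip: SUP_mult_right_ennreal)
       (use \<open>0 < c\<close> in \<open>auto simp: ennreal_top_mult\<close>)
  ultimately show ?thesis
    by (metis SUP_le_iff top_unique)
qed

lemma suminf_geometric_ennreal:
  fixes r c :: real assumes "0 \<le> r" "r < 1" "0 \<le> c"
  shows "(\<Sum>k. ennreal (c * r ^ k)) = ennreal (c / (1 - r))"
proof -
  have "(\<lambda>k. c * r ^ k) sums (c * (1 / (1 - r)))"
    using assms by (intro sums_mult geometric_sums) auto
  then show ?thesis using assms
    by (intro suminf_ennreal_eq) auto
qed

text \<open>The levels \<open>K, K / b, K / b\<^sup>2, \<dots>\<close> sample a power closely enough: the largest level below \<open>t\<close> already gives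
  \<open>t powr s\<close> up to the factor \<open>b powr s\<close>, and the levels below it form a geometric series.  Sums over such
  levels replace the layer-cake integral.  Cutting off at \<open>K\<close> keeps them finite, so that a fraction of
  such a sum can later be subtracted from both sides.\<close>

lemma level_sum_lower:
  fixes b s K :: real and t :: ennreal
  assumes "1 < b" "0 < s" "0 < K"
  shows "ennreal_powr (min t (ennreal K)) s \<le>
     ennreal (b powr s) * (\<Sum>j. ennreal ((K / b ^ j) powr s) * (if ennreal (K / b ^ j) < t then 1 else 0))"
proof (cases "ennreal K < t")
  case True
  have "ennreal_powr (min t (ennreal K)) s = ennreal ((K / b ^ 0) powr s) * (if ennreal (K / b ^ 0) < t then 1 else 0)"
    using True assms by (simp add: min_absorb2 less_imp_le ennreal_powr_ennreal)
  also have "\<dots> \<le> (\<Sum>j. ennreal ((K / b ^ j) powr s) * (if ennreal (K / b ^ j) < t then 1 else 0))"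
    using sum_le_suminf[of "\<lambda>j. ennreal ((K / b ^ j) powr s) * (if ennreal (K / b ^ j) < t then 1 else 0)" "{0}"] by simp
  also have "\<dots> \<le> ennreal (b powr s) * \<dots>"
  proof -
    have "1 * y \<le> ennreal (b powr s) * y" for y :: ennreal
      using assms by (intro mult_right_mono) (auto simp: ge_one_powr_ge_zero)
    then show ?thesis by simp
  qed
  finally show ?thesis .
next
  case False
  then obtain x where x: "t = ennreal x" "0 \<le> x" "x \<le> K"
    using assms by (cases t) (auto simp: not_less ennreal_le_iff)
  show ?thesis
  proof (cases "x = 0")
    case True then show ?thesis using x by simp
  next
    case False
    with x obtain j where j: "K / b ^ Suc j < x" "x \<le> K / b ^ j"
      using geometric_level[OF assms(1,3), of x] by (metis less_eq_real_def)
    have "ennreal_powr (min t (ennreal K)) s = ennreal (x powr s)"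
      using x assms by (simp add: min_def ennreal_powr_ennreal)
    also have "\<dots> \<le> ennreal (b powr s * (K / b ^ Suc j) powr s)"
      using j assms x by (intro ennreal_leI) (auto simp: powr_mult[symmetric] intro!: powr_mono2)
    also have "\<dots> = ennreal (b powr s) * (ennreal ((K / b ^ Suc j) powr s) * (if ennreal (K / b ^ Suc j) < t then 1 else 0))"
      using j assms x by (auto simp: ennreal_mult ennreal_less_iff)
    also have "\<dots> \<le> ennreal (b powr s) * (\<Sum>j. ennreal ((K / b ^ j) powr s) * (if ennreal (K / b ^ j) < t then 1 else 0))"
      using sum_le_suminf[of "\<lambda>j. ennreal ((K / b ^ j) powr s) * (if ennreal (K / b ^ j) < t then 1 else 0)" "{Suc j}"]
      by (intro mult_left_mono) auto
    finally show ?thesis .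
  qed
qed

lemma level_sum_upper:
  fixes b s K :: real and t :: ennreal
  assumes "1 < b" "0 < s" "0 < K"
  shows "(\<Sum>j. ennreal ((K / b ^ j) powr s) * (if ennreal (K / b ^ j) < t then 1 else 0))
    \<le> ennreal (1 / (1 - b powr (-s))) * ennreal_powr t s"
proof (cases "\<exists>j. ennreal (K / b ^ j) < t")
  case False
  then show ?thesis by simp
next
  case True
  show ?thesis
  proof (cases t)
    case top
    have "b powr (-s) < 1" using assms by (simp add: powr_less_one)
    then show ?thesis using top by (simp add: ennreal_mult_top)
  next
    case (real x)
    define l where "l = (LEAST j. ennreal (K / b ^ j) < t)"
    have l: "ennreal (K / b ^ l) < t" unfolding l_def using True by (rule LeastI_ex)
    have lx: "K / b ^ l < x" using l real assms by (simp add: ennreal_less_iff)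
    have r: "b powr (-s) < 1" using assms by (simp add: powr_less_one)
    let ?f = "\<lambda>j. ennreal ((K / b ^ j) powr s) * (if ennreal (K / b ^ j) < t then 1 else 0)"
    have "(\<Sum>j. ?f j) = (\<Sum>j. ?f (j + l)) + sum ?f {..<l}"
      by (rule suminf_offset) auto
    also have "sum ?f {..<l} = 0"
      using not_less_Least[of _ "\<lambda>j. ennreal (K / b ^ j) < t"] unfolding l_def[symmetric]
      by (intro sum.neutral) auto
    also have "(\<Sum>j. ?f (j + l)) + 0 \<le> (\<Sum>j. ennreal (x powr s * (b powr (-s)) ^ j))"
    proof (simp only: add_0_right, rule suminf_le)
      fix j
      have "(K / b ^ (j + l)) powr s \<le> (x * b powr (-real j)) powr s"
        using assms lx
        by (intro powr_mono2) (auto simp: power_add powr_minus powr_realpow field_simps)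
      also have "\<dots> = x powr s * (b powr (-s)) ^ j"
        using assms real by (simp add: powr_mult powr_powr mult.commute flip: powr_realpow)
      finally have "ennreal ((K / b ^ (j + l)) powr s) \<le> ennreal (x powr s * (b powr (-s)) ^ j)"
        by (rule ennreal_leI)
      then show "?f (j + l) \<le> ennreal (x powr s * (b powr (-s)) ^ j)"
        by (auto intro: order_trans)
    qed auto
    also have "\<dots> = ennreal (x powr s / (1 - b powr (-s)))"
      using r by (intro suminf_geometric_ennreal) auto
    also have "\<dots> = ennreal (1 / (1 - b powr (-s))) * ennreal_powr t s"
      using real r by (simp add: ennreal_powr_ennreal flip: ennreal_mult)
    finally show ?thesis .
  qed
qed

lemma half_absorb:
  fixes x y e :: ennreal
  assumes "x \<le> e * (x + y)" "e \<le> ennreal (1/2)" "x < top"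
  shows "x \<le> y"
proof -
  have "x \<le> ennreal (1/2) * (x + y)" using assms(1,2) by (meson mult_right_mono order_trans zero_le)
  show ?thesis
  proof (cases y)
    case (real r)
    obtain x' where x': "x = ennreal x'" "0 \<le> x'" using assms(3) by (cases x) auto
    have "ennreal x' \<le> ennreal (1/2 * (x' + r))"
      using \<open>x \<le> ennreal (1/2) * (x + y)\<close> real x'
      by (subst ennreal_mult) (auto)
    then have "x' \<le> 1/2 * (x' + r)" using x' real by (subst (asm) ennreal_le_iff) auto
    then show ?thesis using x' real by (simp add: ennreal_leI)
  qed simp
qed

section \<open>Good-lambda inequalities and extrapolation\<close>

definition level_mass :: "'a measure \<Rightarrow> real \<Rightarrow> ('a \<Rightarrow> ennreal) \<Rightarrow> real \<Rightarrow> ennreal" where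
  "level_mass M p F t = (\<integral>\<^sup>+x. ennreal_powr (F x) p * (if ennreal t < F x then 1 else 0) \<partial>M)"

text \<open>Weight the inequality at the level \<open>K / b ^ j\<close> with \<open>(K / b ^ j) powr s\<close> and sum over \<open>j\<close>.  On the
  right-hand side all levels are lower by one step, which costs the factor \<open>b powr s\<close>; since
  \<open>\<epsilon> * b powr s \<le> 1/2\<close>, half of the left-hand side absorbs the term with \<open>F\<close>.  The sum is finite because
  the levels stop at \<open>K\<close> and the integral of \<open>F powr p0\<close> is finite; then \<open>K\<close> tends to infinity.\<close>

lemma integrate_good_lambda:
  fixes b s p0 \<gamma> :: real and \<epsilon> :: ennreal
  assumes b: "1 < b" and s: "0 < s" and \<gamma>: "0 < \<gamma>" and p0: "0 < p0"
    and small: "\<epsilon> * ennreal (b powr s) \<le> ennreal (1/2)"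
  assumes [measurable]: "F \<in> borel_measurable M" "g \<in> borel_measurable M"
    and fin: "(\<integral>\<^sup>+x. ennreal_powr (F x) p0 \<partial>M) < top"
    and good: "\<And>\<mu>. 0 < \<mu> \<Longrightarrow>
       level_mass M p0 F \<mu>
        \<le> \<epsilon> * (level_mass M p0 F (\<mu> / b)
           + ennreal (\<gamma> powr (-p0)) *
             level_mass M p0 g (\<gamma> * (\<mu> / b)))"
  shows "(\<integral>\<^sup>+x. ennreal_powr (F x) (p0 + s) \<partial>M) \<le>
     ennreal (b powr s * (1 / (1 - b powr (-s))) * \<gamma> powr (-p0-s)) * (\<integral>\<^sup>+x. ennreal_powr (g x) (p0 + s) \<partial>M)"
proof -
  note good = good[unfolded level_mass_def]
  define x where "x \<mu> = (\<integral>\<^sup>+x. ennreal_powr (F x) p0 * (if ennreal \<mu> < F x then 1 else 0) \<partial>M)" for \<mu>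
  \<comment> \<open>Absorbing the factor \<open>\<gamma>\<close> into the data gives both terms the same levels.\<close>
  define g' where "g' y = ennreal (1/\<gamma>) * g y" for y
  have [measurable]: "g' \<in> borel_measurable M" unfolding g'_def by measurable
  define y where "y \<mu> = (\<integral>\<^sup>+x. ennreal_powr (g' x) p0 * (if ennreal \<mu> < g' x then 1 else 0) \<partial>M)" for \<mu>
  have level: "ennreal (\<gamma> * \<mu>) < g z \<longleftrightarrow> ennreal \<mu> < g' z" if "0 < \<mu>" for \<mu> z
    using \<gamma> that unfolding g'_def
    by (cases "g z") (auto simp: ennreal_less_iff ennreal_mult_top field_simps simp flip: ennreal_mult)
  have pw: "ennreal_powr (g' z) p0 = ennreal (\<gamma> powr (-p0)) * ennreal_powr (g z) p0" for z
    using \<gamma> unfolding g'_def by (subst ennreal_powr_mult) (auto simp: powr_divide powr_minus divide_simps)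
  have xy: "x \<mu> \<le> \<epsilon> * (x (\<mu> / b) + y (\<mu> / b))" if "0 < \<mu>" for \<mu>
  proof -
    have lev: "ennreal (\<gamma> * (\<mu> / b)) < g z \<longleftrightarrow> ennreal (\<mu> / b) < g' z" for z
      using that b by (intro level) simp
    have "ennreal (\<gamma> powr (-p0)) *
             (\<integral>\<^sup>+x. ennreal_powr (g x) p0 * (if ennreal (\<gamma> * (\<mu> / b)) < g x then 1 else 0) \<partial>M) = y (\<mu> / b)"
    proof -
      have "y (\<mu> / b) = (\<integral>\<^sup>+x. ennreal (\<gamma> powr (-p0)) * (ennreal_powr (g x) p0 * (if ennreal (\<gamma> * (\<mu> / b)) < g x then 1 else 0)) \<partial>M)"
        unfolding y_def by (intro nn_integral_cong) (simp only: pw lev mult.assoc)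
      also have "\<dots> = ennreal (\<gamma> powr (-p0)) *
             (\<integral>\<^sup>+x. ennreal_powr (g x) p0 * (if ennreal (\<gamma> * (\<mu> / b)) < g x then 1 else 0) \<partial>M)"
        by (rule nn_integral_cmult) measurable
      finally show ?thesis by (rule sym)
    qed
    then show ?thesis using good[OF that] unfolding x_def by simp
  qed
  have key: "(\<integral>\<^sup>+z. ennreal_powr (F z) p0 * ennreal_powr (min (F z) (ennreal K)) s \<partial>M)
     \<le> ennreal (b powr s) * (ennreal (1 / (1 - b powr (-s))) * (\<integral>\<^sup>+z. ennreal_powr (g' z) (p0 + s) \<partial>M))"
    if K: "0 < K" for K
  proof -
    define w where "w j = ennreal ((K / b ^ j) powr s)" for j :: nat
    define X where "X = (\<Sum>j. w j * x (K / b ^ j))"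
    define Y where "Y = (\<Sum>j. w j * y (K / b ^ j))"
    have wS: "w j = ennreal (b powr s) * w (Suc j)" for j
      using b K unfolding w_def by (simp add: powr_mult[symmetric] flip: ennreal_mult)
    have Xeq: "X = (\<integral>\<^sup>+z. ennreal_powr (F z) p0 * (\<Sum>j. w j * (if ennreal (K / b ^ j) < F z then 1 else 0)) \<partial>M)"
      unfolding X_def x_def
      by (subst nn_integral_cmult[symmetric], measurable)
         (subst nn_integral_suminf[symmetric], auto intro!: nn_integral_cong simp: mult.left_commute simp flip: ennreal_suminf_cmult)
    have Yeq: "Y = (\<integral>\<^sup>+z. ennreal_powr (g' z) p0 * (\<Sum>j. w j * (if ennreal (K / b ^ j) < g' z then 1 else 0)) \<partial>M)"
      unfolding Y_def y_def
      by (subst nn_integral_cmult[symmetric], measurable)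
         (subst nn_integral_suminf[symmetric], auto intro!: nn_integral_cong simp: mult.left_commute simp flip: ennreal_suminf_cmult)
    have "X \<le> (\<Sum>j. \<epsilon> * ennreal (b powr s) * (w (Suc j) * x (K / b ^ Suc j) + w (Suc j) * y (K / b ^ Suc j)))"
      unfolding X_def
    proof (intro suminf_le)
      fix j
      have "w j * x (K / b ^ j) \<le> w j * (\<epsilon> * (x (K / b ^ Suc j) + y (K / b ^ Suc j)))"
        using xy[of "K / b ^ j"] K b by (intro mult_left_mono) (auto simp: mult.commute)
      then show "w j * x (K / b ^ j) \<le> \<epsilon> * ennreal (b powr s) * (w (Suc j) * x (K / b ^ Suc j) + w (Suc j) * y (K / b ^ Suc j))"
        by (simp add: wS[of j] algebra_simps)
    qed auto
    also have "\<dots> = \<epsilon> * ennreal (b powr s) * ((\<Sum>j. w (Suc j) * x (K / b ^ Suc j)) + (\<Sum>j. w (Suc j) * y (K / b ^ Suc j)))"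
      by (subst ennreal_suminf_cmult, subst suminf_add[symmetric]) auto
    also have "\<dots> \<le> \<epsilon> * ennreal (b powr s) * (X + Y)"
      unfolding X_def Y_def
      by (intro mult_left_mono add_mono)
         (simp_all add: suminf_offset[of "\<lambda>j. w j * x (K / b ^ j)" 1] suminf_offset[of "\<lambda>j. w j * y (K / b ^ j)" 1] del: power_Suc)
    finally have XY: "X \<le> \<epsilon> * ennreal (b powr s) * (X + Y)" .
    have "X \<le> (\<Sum>j. w j * (\<integral>\<^sup>+x. ennreal_powr (F x) p0 \<partial>M))"
      unfolding X_def x_def by (intro suminf_le mult_left_mono nn_integral_mono) auto
    also have "\<dots> = (\<integral>\<^sup>+x. ennreal_powr (F x) p0 \<partial>M) * (\<Sum>j. w j)"
      by (subst ennreal_suminf_cmult[symmetric]) (auto simp: mult.commute)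
    also have "(\<Sum>j. w j) = (\<Sum>j. ennreal (K powr s * (b powr (-s)) ^ j))"
      unfolding w_def
    proof (intro suminf_cong arg_cong[of _ _ ennreal])
      fix j
      have 1: "b ^ j = b powr real j" using b by (simp add: powr_realpow)
      have 2: "(b powr (-s)) ^ j = b powr (-s * real j)"
        using b by (simp add: powr_powr flip: powr_realpow)
      show "(K / b ^ j) powr s = K powr s * (b powr (-s)) ^ j"
        unfolding 1 2 using b K by (simp add: powr_divide powr_powr powr_minus_divide mult.commute)
    qed
    also have "\<dots> = ennreal (K powr s / (1 - b powr (-s)))"
      using b s by (intro suminf_geometric_ennreal) (auto simp: powr_less_one)
    finally have "X < top"
      using fin by (auto simp: ennreal_mult_less_top order_le_less_trans)
    then have "X \<le> Y" using half_absorb[OF XY small] by simp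
    have "(\<integral>\<^sup>+z. ennreal_powr (F z) p0 * ennreal_powr (min (F z) (ennreal K)) s \<partial>M)
       \<le> (\<integral>\<^sup>+z. ennreal (b powr s) * (ennreal_powr (F z) p0 * (\<Sum>j. w j * (if ennreal (K / b ^ j) < F z then 1 else 0))) \<partial>M)"
      using level_sum_lower[OF b s K] unfolding w_def
      by (intro nn_integral_mono) (auto simp: mult.left_commute[of "ennreal (b powr s)"] intro!: mult_left_mono)
    also have "\<dots> = ennreal (b powr s) * X"
      unfolding Xeq by (intro nn_integral_cmult) measurable
    also have "\<dots> \<le> ennreal (b powr s) * Y" using \<open>X \<le> Y\<close> by (intro mult_left_mono) auto
    also have "Y \<le> (\<integral>\<^sup>+z. ennreal (1 / (1 - b powr (-s))) * ennreal_powr (g' z) (p0 + s) \<partial>M)"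
      unfolding Yeq ennreal_powr_add using level_sum_upper[OF b s K] unfolding w_def
      by (intro nn_integral_mono) (auto simp: mult.left_commute[of "ennreal (1 / (1 - b powr (-s)))"] intro!: mult_left_mono)
    also have "\<dots> = ennreal (1 / (1 - b powr (-s))) * (\<integral>\<^sup>+z. ennreal_powr (g' z) (p0 + s) \<partial>M)"
      by (intro nn_integral_cmult) measurable
    finally show ?thesis by (simp add: mult_left_mono)
  qed
  have sup: "ennreal_powr t s \<le> (SUP k. ennreal_powr (min t (ennreal (real (Suc k)))) s)" for t
  proof (cases t)
    case (real r)
    obtain k where "r \<le> real k" using real_arch_simple by blast
    then have "r \<le> real (Suc k)" by simp
    then have "ennreal_powr t s = ennreal_powr (min t (ennreal (real (Suc k)))) s"
      using real by (simp add: min_absorb1 ennreal_leI del: of_nat_Suc)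
    then show ?thesis using SUP_upper[of k UNIV "\<lambda>k. ennreal_powr (min t (ennreal (real (Suc k)))) s"] by (simp del: of_nat_Suc)
  next
    case top
    have "(SUP k. ennreal_powr (min t (ennreal (real (Suc k)))) s) = top"
    proof (rule ennreal_SUP_eq_top)
      fix n :: nat
      obtain k where k: "real n powr (1/s) \<le> real k" using real_arch_simple by blast
      have "real n = (real n powr (1/s)) powr s" using s by (simp add: powr_powr)
      also have "\<dots> \<le> real (Suc k) powr s" using s k by (intro powr_mono2) auto
      finally have "of_nat n \<le> ennreal_powr (min t (ennreal (real (Suc k)))) s"
        using top by (simp add: min_absorb2 ennreal_powr_ennreal ennreal_of_nat_eq_real_of_nat del: of_nat_Suc)
      then show "\<exists>i\<in>UNIV. of_nat n \<le> ennreal_powr (min t (ennreal (real (Suc i)))) s" by blast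
    qed
    then show ?thesis by (simp only: top_greatest)
  qed
  have "(\<integral>\<^sup>+x. ennreal_powr (F x) (p0 + s) \<partial>M)
      \<le> (\<integral>\<^sup>+z. (SUP k. ennreal_powr (F z) p0 * ennreal_powr (min (F z) (ennreal (real (Suc k)))) s) \<partial>M)"
    using sup by (intro nn_integral_mono) (auto simp: ennreal_powr_add SUP_mult_left_ennreal[symmetric] intro!: mult_left_mono)
  also have "\<dots> = (SUP k. \<integral>\<^sup>+z. ennreal_powr (F z) p0 * ennreal_powr (min (F z) (ennreal (real (Suc k)))) s \<partial>M)"
    using s by (intro nn_integral_monotone_convergence_SUP)
       (auto simp: incseq_def le_fun_def intro!: mult_left_mono ennreal_powr_mono min.mono ennreal_leI)
  also have "\<dots> \<le> ennreal (b powr s) * (ennreal (1 / (1 - b powr (-s))) * (\<integral>\<^sup>+z. ennreal_powr (g' z) (p0 + s) \<partial>M))"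
    by (intro SUP_least key) auto
  also have "(\<integral>\<^sup>+z. ennreal_powr (g' z) (p0 + s) \<partial>M)
      = ennreal (\<gamma> powr (-p0-s)) * (\<integral>\<^sup>+x. ennreal_powr (g x) (p0 + s) \<partial>M)"
  proof -
    have "(1 / \<gamma>) powr (p0 + s) = \<gamma> powr (-p0-s)"
      using \<gamma> powr_minus_divide[of \<gamma> "p0 + s"] by (simp add: powr_divide)
    then have "ennreal_powr (g' z) (p0 + s) = ennreal (\<gamma> powr (-p0-s)) * ennreal_powr (g z) (p0 + s)" for z
      unfolding g'_def using \<gamma> by (simp add: ennreal_powr_mult)
    then show ?thesis by (simp add: nn_integral_cmult)
  qed
  finally have bound: "(\<integral>\<^sup>+x. ennreal_powr (F x) (p0 + s) \<partial>M) \<le> ennreal (b powr s) *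
      (ennreal (1 / (1 - b powr (-s))) * (ennreal (\<gamma> powr (-p0-s)) * (\<integral>\<^sup>+x. ennreal_powr (g x) (p0 + s) \<partial>M)))" .
  have "b powr (-s) < 1" using b s by (simp add: powr_less_one)
  then have "ennreal (b powr s * (1 / (1 - b powr (-s))) * \<gamma> powr (-p0-s))
     = ennreal (b powr s) * (ennreal (1 / (1 - b powr (-s))) * ennreal (\<gamma> powr (-p0-s)))"
    by (simp add: mult.assoc flip: ennreal_mult)
  with bound show ?thesis by (simp only: mult.assoc)
qed

text \<open>Dyadic levels above \<open>t0\<close>: the contribution of the level \<open>2 ^ k * t0\<close> is at most
  \<open>(2 powr (p0 - q)) ^ k\<close> times that of \<open>t0\<close>, and \<open>p0 < q\<close> makes this summable.\<close>

lemma tail_integral: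
  fixes q p0 D t0 :: real
  assumes "0 < p0" "p0 < q" "0 < t0" "0 \<le> D"
    and [measurable]: "R \<in> borel_measurable M"
    and tail: "\<And>t. t0 \<le> t \<Longrightarrow> emeasure M {x\<in>space M. ennreal t < R x} \<le> ennreal (D * t powr (-q))"
  shows "level_mass M p0 R t0
    \<le> ennreal (2 powr p0 / (1 - 2 powr (p0 - q)) * D * t0 powr (p0 - q))"
proof -
  have pt: "ennreal_powr r p0 * (if ennreal t0 < r then 1 else 0) \<le>
      (\<Sum>k. ennreal ((2 ^ Suc k * t0) powr p0) * (if ennreal (2 ^ k * t0) < r then 1 else 0))" for r
  proof (cases r)
    case top
    have "top = (\<Sum>k::nat. ennreal (t0 powr p0))"
      using assms by (intro suminf_const_top[symmetric]) auto
    also have "\<dots> \<le> (\<Sum>k. ennreal ((2 ^ Suc k * t0) powr p0) * (if ennreal (2 ^ k * t0) < r then 1 else 0))"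
    proof (intro suminf_le)
      fix k :: nat
      have "1 * t0 \<le> 2 ^ Suc k * t0" using assms by (intro mult_right_mono one_le_power) auto
      then have "t0 powr p0 \<le> (2 ^ Suc k * t0) powr p0"
        using assms by (intro powr_mono2) auto
      then show "ennreal (t0 powr p0) \<le> ennreal ((2 ^ Suc k * t0) powr p0) * (if ennreal (2 ^ k * t0) < r then 1 else 0)"
        using top by (simp add: ennreal_leI)
    qed auto
    finally show ?thesis by (simp add: top_unique)
  next
    case (real x)
    show ?thesis
    proof (cases "t0 < x")
      case True
      obtain m where "x < 2 ^ m * t0"
        using real_arch_pow[of 2 "x / t0"] assms by (auto simp: field_simps)
      then have "x / 2 ^ m < t0" by (simp add: field_simps)
      obtain j where j: "x / 2 ^ Suc j < t0" "t0 \<le> x / 2 ^ j"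
        using geometric_level[of 2 x t0] True assms by auto
      have "\<exists>k. 2 ^ k * t0 < x \<and> x \<le> 2 ^ Suc k * t0"
      proof (cases "2 ^ j * t0 = x")
        case True
        then have "j \<noteq> 0" using \<open>t0 < x\<close> by (intro notI) simp
        then obtain i where "j = Suc i" using not0_implies_Suc by blast
        then show ?thesis using True assms by (intro exI[of _ i]) auto
      next
        case False
        then show ?thesis using j by (intro exI[of _ j]) (auto simp: field_simps)
      qed
      then obtain k where k: "2 ^ k * t0 < x" "x \<le> 2 ^ Suc k * t0" by blast
      have "ennreal_powr r p0 * (if ennreal t0 < r then 1 else 0) \<le> ennreal ((2 ^ Suc k * t0) powr p0) * (if ennreal (2 ^ k * t0) < r then 1 else 0)"
        using k real assms by (auto simp: ennreal_powr_ennreal ennreal_less_iff intro!: ennreal_leI powr_mono2)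
      also have "\<dots> \<le> (\<Sum>k. ennreal ((2 ^ Suc k * t0) powr p0) * (if ennreal (2 ^ k * t0) < r then 1 else 0))"
        using sum_le_suminf[of "\<lambda>k. ennreal ((2 ^ Suc k * t0) powr p0) * (if ennreal (2 ^ k * t0) < r then 1 else 0)" "{k}"] by simp
      finally show ?thesis .
    next
      case False
      then show ?thesis using real assms by (auto simp: ennreal_less_iff)
    qed
  qed
  have "(\<integral>\<^sup>+x. ennreal_powr (R x) p0 * (if ennreal t0 < R x then 1 else 0) \<partial>M)
    \<le> (\<integral>\<^sup>+x. (\<Sum>k. ennreal ((2 ^ Suc k * t0) powr p0) * (if ennreal (2 ^ k * t0) < R x then 1 else 0)) \<partial>M)"
    by (intro nn_integral_mono pt)
  also have "\<dots> = (\<Sum>k. ennreal ((2 ^ Suc k * t0) powr p0) * emeasure M {x\<in>space M. ennreal (2 ^ k * t0) < R x})"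
  proof (subst nn_integral_suminf, measurable, intro suminf_cong)
    fix k
    have "(\<integral>\<^sup>+x. ennreal ((2 ^ Suc k * t0) powr p0) * (if ennreal (2 ^ k * t0) < R x then 1 else 0) \<partial>M)
      = (\<integral>\<^sup>+x. ennreal ((2 ^ Suc k * t0) powr p0) * indicator {x\<in>space M. ennreal (2 ^ k * t0) < R x} x \<partial>M)"
      by (intro nn_integral_cong) (auto simp: indicator_def)
    also have "\<dots> = ennreal ((2 ^ Suc k * t0) powr p0) * emeasure M {x\<in>space M. ennreal (2 ^ k * t0) < R x}"
      by (intro nn_integral_cmult_indicator) measurable
    finally show "(\<integral>\<^sup>+x. ennreal ((2 ^ Suc k * t0) powr p0) * (if ennreal (2 ^ k * t0) < R x then 1 else 0) \<partial>M) = \<dots>" .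
  qed
  also have "\<dots> \<le> (\<Sum>k. ennreal (2 powr p0 * D * t0 powr (p0 - q) * (2 powr (p0 - q)) ^ k))"
  proof (intro suminf_le)
    fix k :: nat
    have "1 * t0 \<le> 2 ^ k * t0" using assms by (intro mult_right_mono one_le_power) auto
    then have "ennreal ((2 ^ Suc k * t0) powr p0) * emeasure M {x\<in>space M. ennreal (2 ^ k * t0) < R x}
      \<le> ennreal ((2 ^ Suc k * t0) powr p0) * ennreal (D * (2 ^ k * t0) powr (-q))"
      using assms by (intro mult_left_mono tail) auto
    also have "\<dots> = ennreal ((2 ^ Suc k * t0) powr p0 * (D * (2 ^ k * t0) powr (-q)))"
      by (simp add: ennreal_mult assms)
    also have "(2 ^ Suc k * t0) powr p0 * (D * (2 ^ k * t0) powr (-q)) = 2 powr p0 * D * t0 powr (p0 - q) * (2 powr (p0 - q)) ^ k"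
    proof -
      have 1: "(2::real) ^ k = 2 powr real k" by (simp add: powr_realpow)
      have 2: "(2 powr (p0 - q)) ^ k = 2 powr ((p0 - q) * real k)"
        by (simp add: powr_powr flip: powr_realpow)
      have "(2 ^ Suc k * t0) powr p0 = 2 powr p0 * 2 powr (real k * p0) * t0 powr p0"
        using assms by (simp add: powr_mult 1 powr_powr)
      moreover have "(2 ^ k * t0) powr (-q) = 2 powr (real k * (-q)) * t0 powr (-q)"
        using assms by (simp add: powr_mult 1 powr_powr)
      moreover have "t0 powr (p0 - q) = t0 powr p0 * t0 powr (-q)" by (simp flip: powr_add)
      moreover have "2 powr ((p0 - q) * real k) = 2 powr (real k * p0) * 2 powr (real k * (-q))"
        by (simp add: algebra_simps flip: powr_add)
      ultimately show ?thesis unfolding 2 by (simp add: mult_ac)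
    qed
    finally show "ennreal ((2 ^ Suc k * t0) powr p0) * emeasure M {x\<in>space M. ennreal (2 ^ k * t0) < R x}
      \<le> ennreal (2 powr p0 * D * t0 powr (p0 - q) * (2 powr (p0 - q)) ^ k)" .
  qed auto
  also have "\<dots> = ennreal (2 powr p0 * D * t0 powr (p0 - q) / (1 - 2 powr (p0 - q)))"
    using assms by (intro suminf_geometric_ennreal) (auto simp: powr_less_one)
  finally show ?thesis unfolding level_mass_def by (simp add: mult_ac)
qed

text \<open>Among the balls \<open>ball y (r y)\<close> a disjoint subfamily can be chosen whose fivefold dilates still cover \<open>S\<close>
  (Vitali).  Dilates are charged to \<open>\<mu>\<close>, disjoint balls to \<open>\<nu>\<close>.  Both covering arguments of the proof, the
  one for stopping balls and the weak-type estimate for the energy, are instances.\<close>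

lemma vitali_comparison:
  fixes S T :: "'a::euclidean_space set" and \<mu> \<nu> :: "'a measure"
  assumes sets: "sets \<mu> = sets borel" "sets \<nu> = sets borel"
    and r: "\<And>y. y \<in> S \<Longrightarrow> 0 < r y \<and> r y \<le> B"
    and le: "\<And>y. y \<in> S \<Longrightarrow> emeasure \<mu> (ball y (5 * r y)) \<le> emeasure \<nu> (ball y (r y))"
    and T: "T \<subseteq> S"
    and D: "\<And>y. y \<in> S \<Longrightarrow> ball y (r y) \<subseteq> D" "D \<in> sets borel"
  shows "emeasure \<mu> T \<le> emeasure \<nu> D"
proof -
  have "S \<subseteq> (\<Union>i\<in>S. ball i (r i))" using r by force
  then obtain C where C: "countable C" "C \<subseteq> S"
     "pairwise (\<lambda>i j. disjnt (ball i (r i)) (ball j (r j))) C"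
     "S \<subseteq> (\<Union>i\<in>C. ball i (5 * r i))"
    by (rule Vitali_covering_lemma_balls[where S=S and K=S and a="\<lambda>y. y" and r=r and B=B]) (use r in blast)+
  define X where "X c n = (if n \<in> to_nat_on C ` C then ball (from_nat_into C n) (c * r (from_nat_into C n)) else {})" for c :: real and n
  have mem: "from_nat_into C n \<in> C" if "n \<in> to_nat_on C ` C" for n using that C by auto
  have [measurable]: "X c n \<in> sets borel" for c n unfolding X_def by auto
  have "T \<subseteq> (\<Union>n. X 5 n)"
  proof
    fix x assume "x \<in> T"
    then obtain i where i: "i \<in> C" "x \<in> ball i (5 * r i)" using T C(4) by blast
    then have "x \<in> X 5 (to_nat_on C i)" using C(1) by (simp add: X_def)
    then show "x \<in> (\<Union>n. X 5 n)" by blast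
  qed
  then have "emeasure \<mu> T \<le> emeasure \<mu> (\<Union>n. X 5 n)"
    by (intro emeasure_mono) (auto simp: sets)
  also have "\<dots> \<le> (\<Sum>n. emeasure \<mu> (X 5 n))"
    by (intro emeasure_subadditive_countably) (auto simp: sets)
  also have "\<dots> \<le> (\<Sum>n. emeasure \<nu> (X 1 n))"
    using le mem C(2) by (intro suminf_le) (auto simp: X_def)
  also have "\<dots> = emeasure \<nu> (\<Union>n. X 1 n)"
  proof (intro suminf_emeasure)
    show "disjoint_family (X 1)"
      unfolding disjoint_family_on_def
    proof (intro ballI impI)
      fix m n :: nat assume "m \<noteq> n"
      show "X 1 m \<inter> X 1 n = {}"
      proof (cases "m \<in> to_nat_on C ` C \<and> n \<in> to_nat_on C ` C")
        case True
        then have "from_nat_into C m \<noteq> from_nat_into C n"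
          using \<open>m \<noteq> n\<close> C(1) by auto
        then show ?thesis
          using C(3) True mem[of m] mem[of n] by (auto simp: X_def pairwise_def disjnt_def)
      qed (auto simp: X_def)
    qed
  qed (auto simp: sets)
  also have "\<dots> \<le> emeasure \<nu> D"
    using D mem C(2) sets by (intro emeasure_mono) (auto simp: X_def split: if_splits)
  finally show ?thesis .
qed

text \<open>The average of \<open>h\<close> over the ball is at most \<open>\<theta>\<close>, multiplied out so that no division of infinite values
  occurs.\<close>

definition ball_average_le :: "'a::euclidean_space \<Rightarrow> real \<Rightarrow> ('a \<Rightarrow> ennreal) \<Rightarrow> real \<Rightarrow> bool" where
  "ball_average_le y \<rho> h \<theta> \<longleftrightarrow> (\<integral>\<^sup>+x. h x * indicator (ball y \<rho>) x \<partial>lborel) \<le> ennreal \<theta> * emeasure lborel (ball y \<rho>)"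

lemma emeasure_ball_pos:
  assumes "0 < \<rho>"
  obtains m where "0 < m" "emeasure lborel (ball (y::'a::euclidean_space) \<rho>) = ennreal m"
proof
  show "0 < unit_ball_vol (real DIM('a)) * \<rho> ^ DIM('a)" using assms by simp
  show "emeasure lborel (ball y \<rho>) = ennreal (unit_ball_vol (real DIM('a)) * \<rho> ^ DIM('a))"
    using assms by (simp add: emeasure_ball)
qed

text \<open>The radii with a large average are bounded, because the integral of \<open>h\<close> is finite; any of them above
  half of their supremum is a stopping radius.\<close>

lemma stopping_radius:
  fixes y :: "'a::euclidean_space"
  assumes [measurable]: "h \<in> borel_measurable borel" and fin: "(\<integral>\<^sup>+x. h x \<partial>lborel) < top"
    and "0 < \<theta>" "0 < r0" and start: "\<not> ball_average_le y r0 h \<theta>"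
  obtains \<rho> where "0 < \<rho>" "\<rho> \<le> 1 + enn2real (\<integral>\<^sup>+x. h x \<partial>lborel) / (\<theta> * unit_ball_vol (real DIM('a)))"
     "\<not> ball_average_le y \<rho> h \<theta>" "\<And>\<rho>'. 2 * \<rho> \<le> \<rho>' \<Longrightarrow> ball_average_le y \<rho>' h \<theta>"
proof -
  let ?n = "DIM('a)" let ?w = "unit_ball_vol (real DIM('a))"
  define I where "I = enn2real (\<integral>\<^sup>+x. h x \<partial>lborel)"
  define S where "S = {\<rho>. 0 < \<rho> \<and> \<not> ball_average_le y \<rho> h \<theta>}"
  have bd: "\<rho> \<le> 1 + I / (\<theta> * ?w)" if "\<rho> \<in> S" for \<rho>
  proof -
    have \<rho>: "0 < \<rho>" "\<not> ball_average_le y \<rho> h \<theta>" using that by (auto simp: S_def)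
    have "ennreal (\<theta> * (?w * \<rho> ^ ?n)) < (\<integral>\<^sup>+x. h x * indicator (ball y \<rho>) x \<partial>lborel)"
      using \<rho> \<open>0 < \<theta>\<close> by (simp add: ball_average_le_def emeasure_ball ennreal_mult not_le)
    also have "\<dots> \<le> (\<integral>\<^sup>+x. h x \<partial>lborel)" by (intro nn_integral_mono) (auto simp: indicator_def)
    also have "\<dots> = ennreal I" using fin unfolding I_def by (simp add: less_top)
    finally have "\<theta> * (?w * \<rho> ^ ?n) < I" by (subst (asm) ennreal_less_iff) (use \<rho> \<open>0 < \<theta>\<close> in auto)
    moreover have "0 < \<theta> * ?w" using \<open>0 < \<theta>\<close> by simp
    ultimately have *: "\<rho> ^ ?n < I / (\<theta> * ?w)" by (simp add: field_simps)
    show ?thesis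
    proof (cases "\<rho> \<le> 1")
      case True
      have "0 \<le> I / (\<theta> * ?w)" using * \<rho> by (smt (verit) zero_less_power)
      then show ?thesis using True by simp
    next
      case False
      have "\<rho> \<le> \<rho> ^ ?n" using False by (intro self_le_power) auto
      then show ?thesis using * by simp
    qed
  qed
  have "r0 \<in> S" using assms by (simp add: S_def)
  have bdd: "bdd_above S" using bd by (meson bdd_aboveI)
  have "0 < Sup S" using cSup_upper[OF \<open>r0 \<in> S\<close> bdd] \<open>0 < r0\<close> by simp
  then obtain \<rho> where \<rho>: "\<rho> \<in> S" "Sup S / 2 < \<rho>"
    using less_cSup_iff[of S "Sup S / 2"] \<open>r0 \<in> S\<close> bdd by auto
  show thesis
  proof
    show "0 < \<rho>" "\<not> ball_average_le y \<rho> h \<theta>" using \<rho> by (auto simp: S_def)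
    show "\<rho> \<le> 1 + enn2real (\<integral>\<^sup>+x. h x \<partial>lborel) / (\<theta> * unit_ball_vol (real DIM('a)))"
      using bd[OF \<rho>(1)] by (simp add: I_def)
    fix \<rho>' assume "2 * \<rho> \<le> \<rho>'"
    then have "Sup S < \<rho>'" using \<rho> by simp
    then have "\<rho>' \<notin> S" using cSup_upper[OF _ bdd, of \<rho>'] by auto
    then show "ball_average_le y \<rho>' h \<theta>" using \<open>Sup S < \<rho>'\<close> \<open>0 < Sup S\<close> by (auto simp: S_def)
  qed
qed

text \<open>For a lower semicontinuous function a large value at \<open>y\<close> persists on a whole ball around \<open>y\<close>; this takes
  the place of the Lebesgue differentiation theorem.\<close>

lemma lsc_average:
  fixes F :: "'a::euclidean_space \<Rightarrow> ennreal"
  assumes [measurable]: "F \<in> borel_measurable borel" and lsc: "\<And>t. open {x. ennreal t < F x}"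
    and "0 < p0" "0 < \<tau>" and y: "ennreal \<tau> < F y"
  obtains r0 where "0 < r0" "\<not> ball_average_le y r0 (\<lambda>x. ennreal_powr (F x) p0) (\<tau> powr p0)"
proof -
  obtain c where c: "ennreal \<tau> < c" "c < F y" using dense[OF y] by blast
  then obtain t where t: "c = ennreal t" "0 \<le> t"
    by (cases c) (use c in auto)
  have tt: "\<tau> < t" using c t \<open>0 < \<tau>\<close> by (simp add: ennreal_less_iff)
  have "y \<in> {x. ennreal t < F x}" using c t by simp
  then obtain r0 where r0: "0 < r0" "ball y r0 \<subseteq> {x. ennreal t < F x}"
    using lsc[of t] open_contains_ball by blast
  obtain m where m: "0 < m" "emeasure lborel (ball y r0) = ennreal m" using emeasure_ball_pos[OF r0(1)] .
  have "ennreal (\<tau> powr p0) * emeasure lborel (ball y r0) < ennreal (t powr p0) * emeasure lborel (ball y r0)"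
    using m tt \<open>0 < \<tau>\<close> \<open>0 < p0\<close> by (simp flip: ennreal_mult add: ennreal_less_iff powr_less_mono2)
  also have "\<dots> = (\<integral>\<^sup>+x. ennreal (t powr p0) * indicator (ball y r0) x \<partial>lborel)"
    by (subst nn_integral_cmult_indicator) auto
  also have "\<dots> \<le> (\<integral>\<^sup>+x. ennreal_powr (F x) p0 * indicator (ball y r0) x \<partial>lborel)"
  proof (intro nn_integral_mono)
    fix x
    have "ennreal (t powr p0) \<le> ennreal_powr (F x) p0" if "x \<in> ball y r0"
      using ennreal_powr_mono[of "ennreal t" "F x" p0] r0 that t \<open>0 < p0\<close>
      by (auto simp: ennreal_powr_ennreal less_imp_le)
    then show "ennreal (t powr p0) * indicator (ball y r0) x \<le> ennreal_powr (F x) p0 * indicator (ball y r0) x"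
      by (auto simp: indicator_def)
  qed
  finally have "\<not> ball_average_le y r0 (\<lambda>x. ennreal_powr (F x) p0) (\<tau> powr p0)"
    by (simp add: ball_average_le_def not_le)
  with r0(1) that show thesis by blast
qed

lemma half_absorb_real:
  assumes "ennreal x \<le> J + ennreal (x / 2)" "0 \<le> x"
  shows "ennreal x \<le> 2 * J"
proof (cases J)
  case (real j)
  then have "ennreal x \<le> ennreal (j + x / 2)" using assms by (simp add: ennreal_plus)
  then have "x \<le> j + x / 2" using real assms by (subst (asm) ennreal_le_iff) auto
  then have "ennreal x \<le> ennreal (2 * j)" by (intro ennreal_leI) simp
  also have "\<dots> = 2 * J" using real by (simp add: ennreal_mult)
  finally show ?thesis .
next
  case top
  then show ?thesis by (simp add: ennreal_mult_top)
qed

text \<open>What has to be known about \<open>F\<close> near a stopping ball.  Where \<open>F\<close> exceeds a multiple of the average \<open>\<tau>\<close>, it is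
  dominated by a part \<open>V\<close> that is small in the mean of order \<open>p0\<close>, since it comes from data of relative
  size \<open>\<gamma>\<close>, and by a part \<open>R\<close> of weak type \<open>q\<close>.\<close>

definition local_splitting :: "real \<Rightarrow> real \<Rightarrow> real \<Rightarrow> real \<Rightarrow> real \<Rightarrow> real \<Rightarrow> 'a \<Rightarrow> real \<Rightarrow> ('a::euclidean_space \<Rightarrow> ennreal) \<Rightarrow> bool" where
  "local_splitting p0 q A0 K \<gamma> \<tau> y \<rho> F \<longleftrightarrow>
     (\<exists>V R. V \<in> borel_measurable borel \<and> R \<in> borel_measurable borel \<and>
        (\<forall>x\<in>ball y (5 * \<rho>). ennreal (A0 * \<tau>) < F x \<longrightarrow> F x \<le> 2 * max (V x) (R x)) \<and>
        (\<integral>\<^sup>+x. ennreal_powr (V x) p0 \<partial>lborel) \<le> ennreal (K * (\<gamma> * \<tau>) powr p0) * emeasure lborel (ball y \<rho>) \<and>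
        (\<forall>t>0. emeasure lborel {x\<in>ball y (5 * \<rho>). ennreal t < R x}
            \<le> ennreal (K * (\<tau> / t) powr q) * emeasure lborel (ball y \<rho>)))"

text \<open>At every point of \<open>{F > \<tau>}\<close> take a stopping radius at height \<open>\<tau> powr p0\<close> for the combined density
  \<open>h = F powr p0 + \<gamma> powr -p0 * g powr p0\<close>.  All larger averages being controlled, the splitting applies on
  the stopping ball \<open>B\<close> and shows that the mass of \<open>F powr p0\<close> in \<open>5 B \<inter> {F > A * \<tau>}\<close> is at most
  \<open>\<epsilon> * \<tau> powr p0 * \<bar>B\<bar>\<close>.  The average over \<open>B\<close> itself is large, so \<open>\<tau> powr p0 * \<bar>B\<bar>\<close> is at most the mass of
  \<open>h\<close> in \<open>B\<close>, hence at most twice the mass of the part of \<open>h\<close> above a fixed fraction of the level.  Vitali's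
  lemma sums this over the stopping balls.\<close>

lemma good_lambda:
  fixes F g :: "'a::euclidean_space \<Rightarrow> ennreal" and p0 q \<gamma> A A0 K \<tau> :: real
  assumes p: "0 < p0" "p0 < q" and \<gamma>: "0 < \<gamma>" and A: "A0 \<le> A" "1 \<le> A" and K: "0 < K" and \<tau>: "0 < \<tau>"
    and [measurable]: "F \<in> borel_measurable borel" "g \<in> borel_measurable borel"
    and lsc: "\<And>t. open {x. ennreal t < F x}"
    and fin: "(\<integral>\<^sup>+x. ennreal_powr (F x) p0 \<partial>lborel) < top" "(\<integral>\<^sup>+x. ennreal_powr (g x) p0 \<partial>lborel) < top"
    and loc: "\<And>y \<rho>. 0 < \<rho> \<Longrightarrow>
        (\<And>\<rho>'. 2 * \<rho> \<le> \<rho>' \<Longrightarrow> ball_average_le y \<rho>' (\<lambda>x. ennreal_powr (F x) p0) (\<tau> powr p0)) \<Longrightarrow>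
        (\<And>\<rho>'. 2 * \<rho> \<le> \<rho>' \<Longrightarrow> ball_average_le y \<rho>' (\<lambda>x. ennreal_powr (g x) p0) ((\<gamma> * \<tau>) powr p0)) \<Longrightarrow>
        local_splitting p0 q A0 K \<gamma> \<tau> y \<rho> F"
  shows "level_mass lborel p0 F (A * \<tau>)
    \<le> ennreal (2 * (2 powr p0 * K * (\<gamma> powr p0 + 2 powr p0 / (1 - 2 powr (p0 - q)) * (A / 2) powr (p0 - q)))) *
       (level_mass lborel p0 F (4 powr (-1/p0) * \<tau>)
        + ennreal (\<gamma> powr (-p0)) *
          level_mass lborel p0 g (\<gamma> * (4 powr (-1/p0) * \<tau>)))"
proof -
  have [measurable]: "ball y \<rho> \<in> sets borel" for y :: 'a and \<rho> by simp
  \<comment> \<open>The parts of \<open>F powr p0\<close> and of the data term below the level \<open>c * \<tau>\<close> are each at most a quarter of \<open>\<tau> powr p0\<close>.\<close>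
  define c where "c = 4 powr (-1/p0)"
  have c: "0 < c" "c powr p0 = 1/4" using p by (auto simp: c_def powr_powr)
  define C' where "C' = 2 powr p0 / (1 - 2 powr (p0 - q))"
  have C': "0 \<le> C'" using p by (simp add: C'_def powr_le_one_le powr_less_one less_imp_le)
  define \<epsilon> where "\<epsilon> = 2 powr p0 * K * (\<gamma> powr p0 + C' * (A / 2) powr (p0 - q))"
  have \<epsilon>: "0 \<le> \<epsilon>" using K C' by (simp add: \<epsilon>_def)
  define h where "h x = ennreal_powr (F x) p0 + ennreal (\<gamma> powr (-p0)) * ennreal_powr (g x) p0" for x
  have [measurable]: "h \<in> borel_measurable borel" unfolding h_def by measurable
  have hfin: "(\<integral>\<^sup>+x. h x \<partial>lborel) < top"
    unfolding h_def using fin by (simp add: nn_integral_add nn_integral_cmult ennreal_mult_less_top)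
  define PF where "PF a x = ennreal_powr (F x) p0 * (if ennreal a < F x then 1 else 0)" for a x
  define Pg where "Pg a x = ennreal_powr (g x) p0 * (if ennreal a < g x then 1 else 0)" for a x
  have [measurable]: "PF a \<in> borel_measurable borel" "Pg a \<in> borel_measurable borel" for a
    unfolding PF_def Pg_def by measurable
  define J where "J x = PF (c * \<tau>) x + ennreal (\<gamma> powr (-p0)) * Pg (\<gamma> * (c * \<tau>)) x" for x
  have [measurable]: "J \<in> borel_measurable borel" unfolding J_def by measurable
  define S where "S = {y. ennreal \<tau> < F y}"
  define B where "B = 1 + enn2real (\<integral>\<^sup>+x. h x \<partial>lborel) / (\<tau> powr p0 * unit_ball_vol (real DIM('a)))"
  have "\<exists>\<rho>. 0 < \<rho> \<and> \<rho> \<le> B \<and> \<not> ball_average_le y \<rho> h (\<tau> powr p0) \<and>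
      (\<forall>\<rho>'. 2 * \<rho> \<le> \<rho>' \<longrightarrow> ball_average_le y \<rho>' h (\<tau> powr p0))" if yS: "y \<in> S" for y
  proof -
    obtain r0 where r0: "0 < r0" "\<not> ball_average_le y r0 (\<lambda>x. ennreal_powr (F x) p0) (\<tau> powr p0)"
      by (rule lsc_average[of F p0 \<tau> y]) (use lsc p \<tau> yS in \<open>auto simp: S_def\<close>)
    have "(\<integral>\<^sup>+x. ennreal_powr (F x) p0 * indicator (ball y r0) x \<partial>lborel) \<le> (\<integral>\<^sup>+x. h x * indicator (ball y r0) x \<partial>lborel)"
      unfolding h_def by (intro nn_integral_mono mult_right_mono) auto
    then have "\<not> ball_average_le y r0 h (\<tau> powr p0)"
      using r0(2) unfolding ball_average_le_def by (meson order_trans)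
    then obtain \<rho> where "0 < \<rho>" "\<rho> \<le> B" "\<not> ball_average_le y \<rho> h (\<tau> powr p0)"
        "\<And>\<rho>'. 2 * \<rho> \<le> \<rho>' \<Longrightarrow> ball_average_le y \<rho>' h (\<tau> powr p0)"
      unfolding B_def by (rule stopping_radius[of h "\<tau> powr p0" r0 y, rotated 4]) (use hfin r0(1) \<tau> in auto)
    then show ?thesis by blast
  qed
  then obtain r where r: "\<And>y. y \<in> S \<Longrightarrow> 0 < r y \<and> r y \<le> B"
      "\<And>y. y \<in> S \<Longrightarrow> \<not> ball_average_le y (r y) h (\<tau> powr p0)"
      "\<And>y \<rho>'. y \<in> S \<Longrightarrow> 2 * r y \<le> \<rho>' \<Longrightarrow> ball_average_le y \<rho>' h (\<tau> powr p0)"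
    by metis
  define \<mu> where "\<mu> = density lborel (PF (A * \<tau>))"
  define \<nu> where "\<nu> = density lborel (\<lambda>x. ennreal (2 * \<epsilon>) * J x)"
  have per_ball: "emeasure \<mu> (ball y (5 * r y)) \<le> emeasure \<nu> (ball y (r y))" if y: "y \<in> S" for y
  proof -
    define \<rho> where "\<rho> = r y"
    have \<rho>: "0 < \<rho>" using r(1)[OF y] by (simp add: \<rho>_def)
    obtain m where m: "0 < m" "emeasure lborel (ball y \<rho>) = ennreal m" using emeasure_ball_pos[OF \<rho>] .
    have av: "ball_average_le y \<rho>' h (\<tau> powr p0)" if "2 * \<rho> \<le> \<rho>'" for \<rho>'
      using r(3)[OF y] that by (simp add: \<rho>_def)
    have "ball_average_le y \<rho>' (\<lambda>x. ennreal_powr (F x) p0) (\<tau> powr p0)" if "2 * \<rho> \<le> \<rho>'" for \<rho>'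
    proof -
      have "(\<integral>\<^sup>+x. ennreal_powr (F x) p0 * indicator (ball y \<rho>') x \<partial>lborel) \<le> (\<integral>\<^sup>+x. h x * indicator (ball y \<rho>') x \<partial>lborel)"
        unfolding h_def by (intro nn_integral_mono mult_right_mono) auto
      then show ?thesis using av[OF that] unfolding ball_average_le_def by (rule order_trans)
    qed
    moreover have "ball_average_le y \<rho>' (\<lambda>x. ennreal_powr (g x) p0) ((\<gamma> * \<tau>) powr p0)" if "2 * \<rho> \<le> \<rho>'" for \<rho>'
    proof -
      have g1: "ennreal (\<gamma> powr p0) * (ennreal (\<gamma> powr (-p0)) * z) = z" for z
        using \<gamma> by (simp add: mult.assoc[symmetric] powr_add[symmetric] flip: ennreal_mult)
      have "(\<integral>\<^sup>+x. ennreal_powr (g x) p0 * indicator (ball y \<rho>') x \<partial>lborel)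
         \<le> (\<integral>\<^sup>+x. ennreal (\<gamma> powr p0) * (h x * indicator (ball y \<rho>') x) \<partial>lborel)"
        unfolding h_def by (intro nn_integral_mono) (auto simp: indicator_def distrib_left g1)
      also have "\<dots> = ennreal (\<gamma> powr p0) * (\<integral>\<^sup>+x. h x * indicator (ball y \<rho>') x \<partial>lborel)"
        by (rule nn_integral_cmult) measurable
      also have "\<dots> \<le> ennreal (\<gamma> powr p0) * (ennreal (\<tau> powr p0) * emeasure lborel (ball y \<rho>'))"
        using av[OF that] unfolding ball_average_le_def by (intro mult_left_mono) auto
      also have "\<dots> = ennreal ((\<gamma> * \<tau>) powr p0) * emeasure lborel (ball y \<rho>')"
        using \<gamma> \<tau> by (simp add: powr_mult ennreal_mult mult.assoc)
      finally show ?thesis unfolding ball_average_le_def .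
    qed
    ultimately obtain V R where [measurable]: "V \<in> borel_measurable borel" "R \<in> borel_measurable borel"
      and FVR: "\<And>x. x \<in> ball y (5 * \<rho>) \<Longrightarrow> ennreal (A0 * \<tau>) < F x \<Longrightarrow> F x \<le> 2 * max (V x) (R x)"
      and V: "(\<integral>\<^sup>+x. ennreal_powr (V x) p0 \<partial>lborel) \<le> ennreal (K * (\<gamma> * \<tau>) powr p0) * ennreal m"
      and R: "\<And>t. 0 < t \<Longrightarrow> emeasure lborel {x\<in>ball y (5 * \<rho>). ennreal t < R x}
              \<le> ennreal (K * (\<tau> / t) powr q) * ennreal m"
      using loc[OF \<rho>, of y] unfolding local_splitting_def m(2) by auto
    define R' where "R' x = R x * indicator (ball y (5 * \<rho>)) x" for x
    have [measurable]: "R' \<in> borel_measurable borel" unfolding R'_def by measurable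
    define t0 where "t0 = A * \<tau> / 2"
    have t0: "0 < t0" using A \<tau> by (simp add: t0_def)
    have R'bd: "(\<integral>\<^sup>+x. ennreal_powr (R' x) p0 * (if ennreal t0 < R' x then 1 else 0) \<partial>lborel)
       \<le> ennreal (2 powr p0 / (1 - 2 powr (p0 - q)) * (K * m * \<tau> powr q) * t0 powr (p0 - q))"
    proof (rule tail_integral[unfolded level_mass_def, OF p t0])
      fix t assume "t0 \<le> t"
      then have t: "0 < t" using t0 by simp
      have "{x \<in> space lborel. ennreal t < R' x} = {x\<in>ball y (5 * \<rho>). ennreal t < R x}"
        using t by (auto simp: R'_def indicator_def split: if_splits)
      then show "emeasure lborel {x \<in> space lborel. ennreal t < R' x} \<le> ennreal (K * m * \<tau> powr q * t powr (-q))"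
        using R[OF t] m K t \<tau> by (simp add: powr_divide powr_minus_divide mult_ac flip: ennreal_mult)
    qed (use K m in auto)
    \<comment> \<open>If \<open>V x < R x\<close>, then \<open>A * \<tau> < F x \<le> 2 * R x\<close>, so only the tail of \<open>R\<close> above \<open>A * \<tau> / 2\<close> counts.\<close>
    have pt: "PF (A * \<tau>) x * indicator (ball y (5 * \<rho>)) x \<le>
        ennreal (2 powr p0) * (ennreal_powr (V x) p0 + ennreal_powr (R' x) p0 * (if ennreal t0 < R' x then 1 else 0))" for x
    proof (cases "x \<in> ball y (5 * \<rho>) \<and> ennreal (A * \<tau>) < F x")
      case True
      have "A0 * \<tau> \<le> A * \<tau>" using A \<tau> by simp
      then have "ennreal (A0 * \<tau>) < F x" using True by (meson ennreal_leI order_le_less_trans)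
      then have "F x \<le> 2 * max (V x) (R x)" using FVR True by blast
      then have Fp: "ennreal_powr (F x) p0 \<le> ennreal (2 powr p0) * ennreal_powr (max (V x) (R x)) p0"
        using ennreal_powr_mono[of "F x" "2 * max (V x) (R x)" p0] ennreal_powr_mult[of 2 "max (V x) (R x)" p0] p by simp
      show ?thesis
      proof (cases "R x \<le> V x")
        case True
        then have "ennreal_powr (F x) p0 \<le> ennreal (2 powr p0) * ennreal_powr (V x) p0"
          using Fp by (simp add: max_absorb1)
        then have "PF (A * \<tau>) x * indicator (ball y (5 * \<rho>)) x \<le> ennreal (2 powr p0) * ennreal_powr (V x) p0"
          by (auto simp: PF_def indicator_def)
        also have "\<dots> \<le> ennreal (2 powr p0) * (ennreal_powr (V x) p0 + ennreal_powr (R' x) p0 * (if ennreal t0 < R' x then 1 else 0))"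
          by (intro mult_left_mono) auto
        finally show ?thesis .
      next
        case False
        then have Fp2: "ennreal_powr (F x) p0 \<le> ennreal (2 powr p0) * ennreal_powr (R x) p0"
          using Fp by (simp add: max_absorb2)
        have "R' x = R x" using True by (simp add: R'_def)
        have "F x \<le> 2 * R x" using \<open>F x \<le> 2 * max (V x) (R x)\<close> False by (simp add: max_absorb2)
        have "ennreal t0 < R x"
        proof (rule ccontr)
          assume "\<not> ennreal t0 < R x"
          then have "2 * R x \<le> 2 * ennreal t0" by (intro mult_left_mono) auto
          also have "2 * ennreal t0 = ennreal (A * \<tau>)" using t0 by (simp add: t0_def flip: ennreal_numeral ennreal_mult)
          finally show False using \<open>F x \<le> 2 * R x\<close> True by (meson leD order_trans)
        qed
        have "PF (A * \<tau>) x * indicator (ball y (5 * \<rho>)) x \<le> ennreal (2 powr p0) * ennreal_powr (R x) p0"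
          using Fp2 by (auto simp: PF_def indicator_def)
        also have "\<dots> \<le> ennreal (2 powr p0) * (ennreal_powr (V x) p0 + ennreal_powr (R' x) p0 * (if ennreal t0 < R' x then 1 else 0))"
          using \<open>ennreal t0 < R x\<close> \<open>R' x = R x\<close> by (intro mult_left_mono) auto
        finally show ?thesis .
      qed
    qed (auto simp: PF_def)
    have "emeasure \<mu> (ball y (5 * \<rho>)) = (\<integral>\<^sup>+x. PF (A * \<tau>) x * indicator (ball y (5 * \<rho>)) x \<partial>lborel)"
      unfolding \<mu>_def by (intro emeasure_density) auto
    also have "\<dots> \<le> (\<integral>\<^sup>+x. ennreal (2 powr p0) * (ennreal_powr (V x) p0 + ennreal_powr (R' x) p0 * (if ennreal t0 < R' x then 1 else 0)) \<partial>lborel)"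
      by (intro nn_integral_mono pt)
    also have "\<dots> = ennreal (2 powr p0) * ((\<integral>\<^sup>+x. ennreal_powr (V x) p0 \<partial>lborel)
        + (\<integral>\<^sup>+x. ennreal_powr (R' x) p0 * (if ennreal t0 < R' x then 1 else 0) \<partial>lborel))"
      by (subst nn_integral_cmult, measurable, subst nn_integral_add, measurable)
    also have "\<dots> \<le> ennreal (2 powr p0) * (ennreal (K * (\<gamma> * \<tau>) powr p0) * ennreal m + ennreal (C' * (K * m * \<tau> powr q) * t0 powr (p0 - q)))"
      using R'bd V unfolding C'_def by (intro mult_left_mono add_mono) auto
    also have "\<dots> = ennreal (2 powr p0 * (K * (\<gamma> * \<tau>) powr p0 * m + C' * (K * m * \<tau> powr q) * t0 powr (p0 - q)))"
      using K m C' by (simp flip: ennreal_mult ennreal_plus)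
    also have "2 powr p0 * (K * (\<gamma> * \<tau>) powr p0 * m + C' * (K * m * \<tau> powr q) * t0 powr (p0 - q)) = \<epsilon> * (\<tau> powr p0 * m)"
    proof -
      have "t0 powr (p0 - q) = (A / 2) powr (p0 - q) * \<tau> powr (p0 - q)"
        using A \<tau> by (simp add: t0_def flip: powr_mult)
      moreover have "\<tau> powr q * \<tau> powr (p0 - q) = \<tau> powr p0" by (simp flip: powr_add)
      ultimately have "\<tau> powr q * t0 powr (p0 - q) = (A / 2) powr (p0 - q) * \<tau> powr p0"
        by (metis mult.left_commute)
      then have "C' * (K * m * \<tau> powr q) * t0 powr (p0 - q) = C' * K * m * ((A / 2) powr (p0 - q) * \<tau> powr p0)"
        by (metis (no_types, opaque_lifting) mult.assoc)
      then show ?thesis unfolding \<epsilon>_def using \<gamma> \<tau> by (simp add: powr_mult algebra_simps)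
    qed
    also have "ennreal (\<epsilon> * (\<tau> powr p0 * m)) = ennreal \<epsilon> * ennreal (\<tau> powr p0 * m)"
      using \<epsilon> m by (simp add: ennreal_mult)
    also have "ennreal (\<tau> powr p0 * m) \<le> 2 * (\<integral>\<^sup>+x. J x * indicator (ball y \<rho>) x \<partial>lborel)"
    proof (rule half_absorb_real)
      \<comment> \<open>The low parts of \<open>h\<close> make up at most half of the average over the stopping ball.\<close>
      have hJ: "h x \<le> J x + ennreal (\<tau> powr p0 / 2)" for x
      proof -
        have 1: "ennreal_powr (F x) p0 \<le> PF (c * \<tau>) x + ennreal (\<tau> powr p0 / 4)"
        proof (cases "ennreal (c * \<tau>) < F x")
          case True then show ?thesis by (simp add: PF_def)
        next
          case False
          then have "ennreal_powr (F x) p0 \<le> ennreal_powr (ennreal (c * \<tau>)) p0"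
            using p by (intro ennreal_powr_mono) auto
          also have "\<dots> = ennreal (\<tau> powr p0 / 4)"
            using c \<tau> by (simp add: ennreal_powr_ennreal powr_mult)
          finally show ?thesis by (simp add: PF_def)
        qed
        have 2: "ennreal (\<gamma> powr (-p0)) * ennreal_powr (g x) p0 \<le> ennreal (\<gamma> powr (-p0)) * Pg (\<gamma> * (c * \<tau>)) x + ennreal (\<tau> powr p0 / 4)"
        proof (cases "ennreal (\<gamma> * (c * \<tau>)) < g x")
          case True then show ?thesis by (simp add: Pg_def)
        next
          case False
          then have "ennreal_powr (g x) p0 \<le> ennreal_powr (ennreal (\<gamma> * (c * \<tau>))) p0"
            using p by (intro ennreal_powr_mono) auto
          also have "\<dots> = ennreal (\<gamma> powr p0 * (\<tau> powr p0 / 4))"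
            using c \<tau> \<gamma> by (simp add: ennreal_powr_ennreal powr_mult)
          finally have "ennreal (\<gamma> powr (-p0)) * ennreal_powr (g x) p0 \<le> ennreal (\<gamma> powr (-p0)) * ennreal (\<gamma> powr p0 * (\<tau> powr p0 / 4))"
            by (intro mult_left_mono) auto
          also have "\<dots> = ennreal ((\<gamma> powr (-p0) * \<gamma> powr p0) * (\<tau> powr p0 / 4))"
            by (simp add: mult.assoc flip: ennreal_mult)
          also have "\<gamma> powr (-p0) * \<gamma> powr p0 = 1" using \<gamma> by (simp flip: powr_add)
          finally show ?thesis by (simp add: Pg_def)
        qed
        have "h x \<le> (PF (c * \<tau>) x + ennreal (\<tau> powr p0 / 4)) + (ennreal (\<gamma> powr (-p0)) * Pg (\<gamma> * (c * \<tau>)) x + ennreal (\<tau> powr p0 / 4))"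
          unfolding h_def by (intro add_mono 1 2)
        also have "\<dots> = J x + (ennreal (\<tau> powr p0 / 4) + ennreal (\<tau> powr p0 / 4))"
          unfolding J_def by (simp add: add_ac)
        also have "ennreal (\<tau> powr p0 / 4) + ennreal (\<tau> powr p0 / 4) = ennreal (\<tau> powr p0 / 2)"
          by (simp flip: ennreal_plus)
        finally show ?thesis .
      qed
      have "ennreal (\<tau> powr p0 * m) = ennreal (\<tau> powr p0) * emeasure lborel (ball y \<rho>)"
        using m by (simp add: ennreal_mult)
      also have "\<dots> \<le> (\<integral>\<^sup>+x. h x * indicator (ball y \<rho>) x \<partial>lborel)"
        using r(2)[OF y] by (simp add: ball_average_le_def \<rho>_def)
      also have "\<dots> \<le> (\<integral>\<^sup>+x. J x * indicator (ball y \<rho>) x + ennreal (\<tau> powr p0 / 2) * indicator (ball y \<rho>) x \<partial>lborel)"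
        using hJ by (intro nn_integral_mono) (auto simp: indicator_def)
      also have "\<dots> = (\<integral>\<^sup>+x. J x * indicator (ball y \<rho>) x \<partial>lborel) + ennreal (\<tau> powr p0 / 2) * ennreal m"
        by (subst nn_integral_add, measurable, subst nn_integral_cmult_indicator) (auto simp: m)
      also have "ennreal (\<tau> powr p0 / 2) * ennreal m = ennreal (\<tau> powr p0 * m / 2)"
        using m by (simp flip: ennreal_mult)
      finally show "ennreal (\<tau> powr p0 * m) \<le> (\<integral>\<^sup>+x. J x * indicator (ball y \<rho>) x \<partial>lborel) + ennreal (\<tau> powr p0 * m / 2)" .
    qed (use m in auto)
    also have "ennreal \<epsilon> * (2 * (\<integral>\<^sup>+x. J x * indicator (ball y \<rho>) x \<partial>lborel)) = emeasure \<nu> (ball y \<rho>)"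
    proof -
      have "emeasure \<nu> (ball y \<rho>) = (\<integral>\<^sup>+x. ennreal (2 * \<epsilon>) * (J x * indicator (ball y \<rho>) x) \<partial>lborel)"
        unfolding \<nu>_def by (subst emeasure_density) (auto simp: mult.assoc)
      also have "\<dots> = ennreal (2 * \<epsilon>) * (\<integral>\<^sup>+x. J x * indicator (ball y \<rho>) x \<partial>lborel)"
        by (rule nn_integral_cmult) measurable
      also have "ennreal (2 * \<epsilon>) = ennreal \<epsilon> * 2" using \<epsilon> by (simp add: ennreal_mult mult.commute)
      finally show ?thesis by (simp add: mult.assoc)
    qed
    finally show ?thesis by (simp add: \<rho>_def mult_left_mono)
  qed
  have "(\<integral>\<^sup>+x. PF (A * \<tau>) x \<partial>lborel) = emeasure \<mu> {x. ennreal (A * \<tau>) < F x}"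
    unfolding \<mu>_def by (subst emeasure_density) (auto simp: PF_def indicator_def intro!: nn_integral_cong)
  also have "\<dots> \<le> emeasure \<nu> UNIV"
  proof (rule vitali_comparison[of \<mu> \<nu> S r B])
    have "\<tau> \<le> A * \<tau>" using A \<tau> by simp
    then show "{x. ennreal (A * \<tau>) < F x} \<subseteq> S"
      unfolding S_def by (auto intro: order_le_less_trans ennreal_leI)
  qed (use r(1) per_ball in \<open>auto simp: \<mu>_def \<nu>_def\<close>)
  also have "\<dots> = ennreal (2 * \<epsilon>) * (\<integral>\<^sup>+x. J x \<partial>lborel)"
    unfolding \<nu>_def by (subst emeasure_density) (auto simp: nn_integral_cmult)
  also have "(\<integral>\<^sup>+x. J x \<partial>lborel) = (\<integral>\<^sup>+x. PF (c * \<tau>) x \<partial>lborel) + ennreal (\<gamma> powr (-p0)) * (\<integral>\<^sup>+x. Pg (\<gamma> * (c * \<tau>)) x \<partial>lborel)"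
    unfolding J_def by (simp add: nn_integral_add nn_integral_cmult)
  finally show ?thesis unfolding level_mass_def PF_def Pg_def \<epsilon>_def C'_def c_def .
qed

text \<open>In the factor of \<open>good_lambda\<close> the part of weak type contributes \<open>A powr (p0 - q)\<close> and the small
  part \<open>\<gamma> powr p0\<close>, while integration over the levels costs \<open>A powr (p - p0)\<close>.  Since \<open>p < q\<close>, a large \<open>A\<close>
  makes the first product small; afterwards \<open>\<gamma>\<close> is chosen small in terms of \<open>A\<close>.\<close>

theorem real_variable_extrapolation:
  fixes p0 p q A0 K :: real
  assumes p: "0 < p0" "p0 < p" "p < q" and K: "0 < K"
  obtains C where "0 < C" and "\<forall>F g :: 'a::euclidean_space \<Rightarrow> ennreal.
     F \<in> borel_measurable borel \<longrightarrow> g \<in> borel_measurable borel \<longrightarrow>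
     (\<forall>t. open {x. ennreal t < F x}) \<longrightarrow>
     (\<integral>\<^sup>+x. ennreal_powr (F x) p0 \<partial>lborel) < top \<longrightarrow> (\<integral>\<^sup>+x. ennreal_powr (g x) p0 \<partial>lborel) < top \<longrightarrow>
     (\<forall>\<gamma> y \<rho> \<tau>. 0 < \<gamma> \<longrightarrow> \<gamma> \<le> 1 \<longrightarrow> 0 < \<rho> \<longrightarrow> 0 < \<tau> \<longrightarrow>
        (\<forall>\<rho>'\<ge>2 * \<rho>. ball_average_le y \<rho>' (\<lambda>x. ennreal_powr (F x) p0) (\<tau> powr p0)) \<longrightarrow>
        (\<forall>\<rho>'\<ge>2 * \<rho>. ball_average_le y \<rho>' (\<lambda>x. ennreal_powr (g x) p0) ((\<gamma> * \<tau>) powr p0)) \<longrightarrow>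
        local_splitting p0 q A0 K \<gamma> \<tau> y \<rho> F) \<longrightarrow>
     (\<integral>\<^sup>+x. ennreal_powr (F x) p \<partial>lborel) \<le> ennreal C * (\<integral>\<^sup>+x. ennreal_powr (g x) p \<partial>lborel)"
proof -
  define s where "s = p - p0"
  define c :: real where "c = 4 powr (-1/p0)"
  define C' :: real where "C' = 2 powr p0 / (1 - 2 powr (p0 - q))"
  define D where "D = 2 * (2 powr p0 * K) * c powr (-s)"
  have s: "0 < s" using p by (simp add: s_def)
  have c: "0 < c" "c < 1" using p by (auto simp: c_def powr_less_one)
  have D: "0 < D" using K c by (simp add: D_def)
  have "((\<lambda>A. D * (C' * 2 powr (q - p0)) * A powr (p - q)) \<longlongrightarrow> D * (C' * 2 powr (q - p0)) * 0) at_top"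
    using p by (intro tendsto_mult_left tendsto_neg_powr filterlim_ident) auto
  then have "eventually (\<lambda>A. D * (C' * 2 powr (q - p0)) * A powr (p - q) < 1/4) at_top"
    by (intro order_tendstoD(2)) auto
  then have "eventually (\<lambda>A. D * (C' * 2 powr (q - p0)) * A powr (p - q) < 1/4 \<and> max 1 A0 \<le> A) at_top"
    by (intro eventually_conj eventually_ge_at_top)
  then obtain A where A: "D * (C' * 2 powr (q - p0)) * A powr (p - q) < 1/4" "A0 \<le> A" "1 \<le> A"
    by (auto simp: eventually_at_top_linorder)
  define \<gamma> where "\<gamma> = min 1 ((1 / (4 * (D * A powr s))) powr (1/p0))"
  have DA: "0 < D * A powr s" using D A by simp
  have \<gamma>: "0 < \<gamma>" "\<gamma> \<le> 1" using DA by (auto simp: \<gamma>_def)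
  have "\<gamma> powr p0 \<le> ((1 / (4 * (D * A powr s))) powr (1/p0)) powr p0"
    using p \<gamma> by (intro powr_mono2) (auto simp: \<gamma>_def)
  also have "\<dots> = 1 / (4 * (D * A powr s))" using p DA by (simp add: powr_powr)
  finally have \<gamma>D: "D * A powr s * \<gamma> powr p0 \<le> 1/4" using DA by (simp add: field_simps)
  define \<epsilon> where "\<epsilon> = 2 * (2 powr p0 * K * (\<gamma> powr p0 + C' * (A / 2) powr (p0 - q)))"
  define b where "b = A / c"
  have b: "1 < b" using A c by (simp add: b_def)
  have "\<epsilon> * b powr s = D * A powr s * \<gamma> powr p0 + D * (C' * 2 powr (q - p0)) * A powr (p - q)"
  proof -
    have 1: "b powr s = A powr s * c powr (-s)"
      using A c by (simp add: b_def powr_divide powr_minus_divide)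
    have 2: "(A / 2) powr (p0 - q) = A powr (p0 - q) * 2 powr (q - p0)"
      using A powr_minus_divide[of 2 "q - p0"] by (simp add: powr_divide)
    have 3: "A powr (p - q) = A powr (p0 - q) * A powr s" by (simp add: s_def flip: powr_add)
    show ?thesis unfolding \<epsilon>_def 1 2 3 D_def by (simp add: algebra_simps)
  qed
  then have \<epsilon>b: "\<epsilon> * b powr s \<le> 1/2" using A(1) \<gamma>D by linarith
  have C'0: "0 \<le> C'" using p by (simp add: C'_def powr_less_one less_imp_le)
  have \<epsilon>0: "0 \<le> \<epsilon>" using K C'0 by (simp add: \<epsilon>_def)
  define C where "C = b powr s * (1 / (1 - b powr (-s))) * \<gamma> powr (-p0-s)"
  have "b powr (-s) < 1" using b s by (simp add: powr_less_one)
  then have C: "0 < C" using b \<gamma> by (simp add: C_def)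
  show ?thesis
  proof (rule that[OF C], intro allI impI)
    fix F g :: "'a \<Rightarrow> ennreal"
    assume [measurable]: "F \<in> borel_measurable borel" "g \<in> borel_measurable borel"
      and lsc: "\<forall>t. open {x. ennreal t < F x}"
      and fin: "(\<integral>\<^sup>+x. ennreal_powr (F x) p0 \<partial>lborel) < top" "(\<integral>\<^sup>+x. ennreal_powr (g x) p0 \<partial>lborel) < top"
      and loc: "\<forall>\<gamma> y \<rho> \<tau>. 0 < \<gamma> \<longrightarrow> \<gamma> \<le> 1 \<longrightarrow> 0 < \<rho> \<longrightarrow> 0 < \<tau> \<longrightarrow>
        (\<forall>\<rho>'\<ge>2 * \<rho>. ball_average_le y \<rho>' (\<lambda>x. ennreal_powr (F x) p0) (\<tau> powr p0)) \<longrightarrow>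
        (\<forall>\<rho>'\<ge>2 * \<rho>. ball_average_le y \<rho>' (\<lambda>x. ennreal_powr (g x) p0) ((\<gamma> * \<tau>) powr p0)) \<longrightarrow>
        local_splitting p0 q A0 K \<gamma> \<tau> y \<rho> F"
    have st: "(\<integral>\<^sup>+x. ennreal_powr (F x) (p0 + s) \<partial>lborel) \<le> ennreal C * (\<integral>\<^sup>+x. ennreal_powr (g x) (p0 + s) \<partial>lborel)"
      unfolding C_def
    proof (rule integrate_good_lambda[where \<epsilon>="ennreal \<epsilon>"])
      show "ennreal \<epsilon> * ennreal (b powr s) \<le> ennreal (1/2)"
        using ennreal_leI[OF \<epsilon>b] \<epsilon>0 by (simp only: ennreal_mult powr_ge_zero)
      fix \<mu> :: real assume \<mu>: "0 < \<mu>"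
      define \<tau> where "\<tau> = \<mu> / A"
      have \<tau>: "0 < \<tau>" using \<mu> A by (simp add: \<tau>_def)
      have eqs: "\<mu> = A * \<tau>" "\<mu> / b = c * \<tau>" using A c by (auto simp: \<tau>_def b_def)
      have "level_mass lborel p0 F (A * \<tau>)
        \<le> ennreal (2 * (2 powr p0 * K * (\<gamma> powr p0 + 2 powr p0 / (1 - 2 powr (p0 - q)) * (A / 2) powr (p0 - q)))) *
         (level_mass lborel p0 F (4 powr (-1/p0) * \<tau>)
        + ennreal (\<gamma> powr (-p0)) *
          level_mass lborel p0 g (\<gamma> * (4 powr (-1/p0) * \<tau>)))"
      proof (rule good_lambda[where ?p0.0=p0 and q=q and \<gamma>=\<gamma> and A=A and ?A0.0=A0 and K=K and \<tau>=\<tau> and F=F and g=g])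
        show "p0 < q" using p by simp
        show "open {x. ennreal t < F x}" for t using lsc by blast
        fix y :: 'a and \<rho> :: real
        assume 1: "0 < \<rho>" "\<And>\<rho>'. 2 * \<rho> \<le> \<rho>' \<Longrightarrow> ball_average_le y \<rho>' (\<lambda>x. ennreal_powr (F x) p0) (\<tau> powr p0)"
          "\<And>\<rho>'. 2 * \<rho> \<le> \<rho>' \<Longrightarrow> ball_average_le y \<rho>' (\<lambda>x. ennreal_powr (g x) p0) ((\<gamma> * \<tau>) powr p0)"
        show "local_splitting p0 q A0 K \<gamma> \<tau> y \<rho> F"
          by (rule loc[rule_format, OF \<gamma> 1(1) \<tau> 1(2,3)])
      qed (use p \<gamma> A K \<tau> fin in auto)
      then show "level_mass lborel p0 F \<mu>
        \<le> ennreal \<epsilon> * (level_mass lborel p0 F (\<mu> / b)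
           + ennreal (\<gamma> powr (-p0)) *
             level_mass lborel p0 g (\<gamma> * (\<mu> / b)))"
        by (simp only: eqs(2)) (simp only: eqs(1) \<epsilon>_def C'_def c_def)
    qed (use b s \<gamma> p fin in \<open>auto\<close>)
    show "(\<integral>\<^sup>+x. ennreal_powr (F x) p \<partial>lborel) \<le> ennreal C * (\<integral>\<^sup>+x. ennreal_powr (g x) p \<partial>lborel)"
      using st by (simp add: s_def)
  qed
qed

section \<open>Energy decay at the boundary by hole filling\<close>

definition slab :: "('a \<Rightarrow> real) \<Rightarrow> 'a set \<Rightarrow> real \<Rightarrow> ('a \<times> real) set" where
  "slab \<psi> A h = {x. fst x \<in> A \<and> \<psi> (fst x) < snd x \<and> snd x < \<psi> (fst x) + h}"

lemma slab_mono: "A \<subseteq> B \<Longrightarrow> h \<le> h' \<Longrightarrow> slab \<psi> A h \<subseteq> slab \<psi> B h'"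
  by (auto simp: slab_def)

lemma sets_slab [measurable]:
  fixes \<psi> :: "'a::euclidean_space \<Rightarrow> real"
  assumes [measurable]: "\<psi> \<in> borel_measurable borel" "A \<in> sets borel"
  shows "slab \<psi> A h \<in> sets borel"
proof -
  have "{x \<in> space (borel :: ('a \<times> real) measure). fst x \<in> A \<and> \<psi> (fst x) < snd x \<and> snd x < \<psi> (fst x) + h} \<in> sets borel"
    unfolding borel_prod[symmetric] by measurable
  then show ?thesis by (simp add: slab_def)
qed

text \<open>The ratio of the hole to the surrounding ball in the hole-filling step.  It is so small that the dilated
  hole fits into the ball and that the energy term produced by moving the hole is at most half of the
  total energy.\<close>

definition hole_ratio :: "real \<Rightarrow> real \<Rightarrow> real \<Rightarrow> real" where
  "hole_ratio k \<beta> Cs = 1 / (3 + \<beta> + 2 * k * \<beta>\<^sup>2 * Cs)"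

text \<open>Filling the hole turns \<open>E\<^sub>i\<^sub>n \<le> A * (E - E\<^sub>i\<^sub>n) + E / 2\<close> into \<open>E\<^sub>i\<^sub>n \<le> (A + 1/2) / (A + 1) * E\<close>.  In
  the number \<open>72 = 8 + 8 * 8\<close> each \<open>8\<close> is the constant of a Poincare or shift inequality: the mass outside the hole is
  estimated directly, the mass over the hole after it has been moved.\<close>

definition hole_factor :: "real \<Rightarrow> real \<Rightarrow> real \<Rightarrow> real" where
  "hole_factor k \<beta> M = (72 * k * \<beta>\<^sup>2 * (1 + 4 * M)\<^sup>2 + 1/2) / (72 * k * \<beta>\<^sup>2 * (1 + 4 * M)\<^sup>2 + 1)"

definition decay_ratio :: "real \<Rightarrow> real \<Rightarrow> real \<Rightarrow> real \<Rightarrow> real" where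
  "decay_ratio k \<beta> M Cs = (1 + 4 * M) / hole_ratio k \<beta> Cs"

text \<open>The exponent for which one hole-filling step, a decrease of the radius by \<open>decay_ratio\<close> against a decrease of
  the energy by \<open>hole_factor\<close>, is a power law.  The bound \<open>1/2\<close> keeps \<open>n - 1 - decay_exponent\<close> positive for
  \<open>n \<ge> 2\<close>.\<close>

definition decay_exponent :: "real \<Rightarrow> real \<Rightarrow> real \<Rightarrow> real \<Rightarrow> real" where
  "decay_exponent k \<beta> M Cs = min (1/2) (- ln (hole_factor k \<beta> M) / ln (decay_ratio k \<beta> M Cs))"

lemma decay_exponent_range:
  assumes "0 < k" "1 \<le> \<beta>" "0 \<le> M" "0 \<le> Cs"
  shows "0 < decay_exponent k \<beta> M Cs" "decay_exponent k \<beta> M Cs \<le> 1/2"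
proof -
  have \<theta>: "0 < hole_ratio k \<beta> Cs" "hole_ratio k \<beta> Cs < 1"
    using assms by (auto simp: hole_ratio_def add_pos_nonneg)
  have "1 < decay_ratio k \<beta> M Cs"
    using \<theta> assms by (simp add: decay_ratio_def)
  moreover have "0 < hole_factor k \<beta> M" "hole_factor k \<beta> M < 1"
    using assms by (auto simp: hole_factor_def add_nonneg_pos)
  ultimately show "0 < decay_exponent k \<beta> M Cs" by (simp add: decay_exponent_def divide_neg_pos)
  show "decay_exponent k \<beta> M Cs \<le> 1/2" unfolding decay_exponent_def by (rule min.cobounded1)
qed

text \<open>The energy estimates use a solution \<open>w\<close> that vanishes on the boundary over \<open>ball y0 R\<close> only through the
  measures \<open>\<mu> = \<bar>w\<bar>\<^sup>2 dx\<close> and \<open>\<nu> = \<bar>\<nabla>w\<bar>\<^sup>2 dx\<close>.  The zero boundary values enter through \<open>poincare\<close>, integration of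
  the gradient along vertical segments; \<open>shift\<close>, integration along oblique segments, compares the mass over a
  ball with the mass over the annulus around it; \<open>caccioppoli\<close> is the boundary Caccioppoli inequality, with
  balls replaced by slabs at the cost of the factor \<open>\<beta>\<close>.\<close>

locale boundary_energy =
  fixes \<psi> :: "'a::euclidean_space \<Rightarrow> real" and \<mu> \<nu> :: "('a \<times> real) measure"
    and y0 :: 'a and R k \<beta> M Cs :: real
  assumes cont: "continuous_on UNIV \<psi>"
    and fin\<mu>: "finite_measure \<mu>" and fin\<nu>: "finite_measure \<nu>"
    and sets\<mu> [measurable_cong, simp]: "sets \<mu> = sets borel" and sets\<nu> [measurable_cong, simp]: "sets \<nu> = sets borel"
    and R: "0 < R" and k: "0 < k" and \<beta>: "1 \<le> \<beta>" and M: "0 \<le> M" and Cs: "0 \<le> Cs"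
    and poincare: "\<And>A h. A \<in> sets borel \<Longrightarrow> A \<subseteq> ball y0 R \<Longrightarrow> 0 < h \<Longrightarrow> h \<le> R \<Longrightarrow>
        measure \<mu> (slab \<psi> A h) \<le> 8 * h\<^sup>2 * measure \<nu> (slab \<psi> A h)"
    and shift: "\<And>y s h. 0 < s \<Longrightarrow> 0 < h \<Longrightarrow> ball y (3 * s) \<subseteq> ball y0 R \<Longrightarrow> h + 4 * M * s \<le> R \<Longrightarrow>
        measure \<mu> (slab \<psi> (ball y s) h) \<le> 8 * measure \<mu> (slab \<psi> (ball y (3 * s) - ball y s) (h + 4 * M * s))
          + Cs * s\<^sup>2 * measure \<nu> (slab \<psi> (ball y (3 * s)) (h + 4 * M * s))"
    and caccioppoli: "\<And>y h. 0 < h \<Longrightarrow> \<beta> * h \<le> R \<Longrightarrow> ball y (\<beta> * h) \<subseteq> ball y0 R \<Longrightarrow>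
        measure \<nu> (slab \<psi> (ball y h) h) \<le> k / h\<^sup>2 * measure \<mu> (slab \<psi> (ball y (\<beta> * h)) (\<beta> * h))"
begin

sublocale \<mu>: finite_measure \<mu> by (rule fin\<mu>)
sublocale \<nu>: finite_measure \<nu> by (rule fin\<nu>)

lemma \<psi>_measurable [measurable]: "\<psi> \<in> borel_measurable borel"
  using cont by (rule borel_measurable_continuous_onI)

lemma slab_sets: "A \<in> sets borel \<Longrightarrow> slab \<psi> A h \<in> sets borel"
  by (rule sets_slab[OF \<psi>_measurable])

lemma \<nu>_mono: "A \<subseteq> B \<Longrightarrow> h \<le> h' \<Longrightarrow> B \<in> sets borel \<Longrightarrow> measure \<nu> (slab \<psi> A h) \<le> measure \<nu> (slab \<psi> B h')"
  by (intro \<nu>.finite_measure_mono slab_mono) (simp_all add: slab_sets)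

lemma \<mu>_mono: "A \<subseteq> B \<Longrightarrow> h \<le> h' \<Longrightarrow> B \<in> sets borel \<Longrightarrow> measure \<mu> (slab \<psi> A h) \<le> measure \<mu> (slab \<psi> B h')"
  by (intro \<mu>.finite_measure_mono slab_mono) (simp_all add: slab_sets)

definition energy :: "'a \<Rightarrow> real \<Rightarrow> real" where
  "energy y s = measure \<nu> (slab \<psi> (ball y s) s)"

lemma energy_nonneg: "0 \<le> energy y s" by (simp add: energy_def)

lemma energy_mono: "s \<le> s' \<Longrightarrow> energy y s \<le> energy y s'"
  unfolding energy_def by (intro \<nu>_mono subset_ball) auto

abbreviation "\<theta> \<equiv> hole_ratio k \<beta> Cs"
abbreviation "\<tau> \<equiv> hole_factor k \<beta> M"
abbreviation "L \<equiv> decay_ratio k \<beta> M Cs"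
abbreviation "\<eta> \<equiv> decay_exponent k \<beta> M Cs"

lemma hole_ratio: "0 < \<theta>" "\<theta> \<le> 1/3" "\<theta> \<le> 1/\<beta>" "2 * k * \<beta>\<^sup>2 * Cs * \<theta>\<^sup>2 \<le> 1"
proof -
  define X where "X = 2 * k * \<beta>\<^sup>2 * Cs"
  have p: "0 \<le> X" using k Cs by (simp add: X_def)
  have \<theta>: "\<theta> = 1 / (3 + \<beta> + X)" by (simp add: hole_ratio_def X_def)
  show 1: "0 < \<theta>" using p \<beta> by (simp add: \<theta>)
  show 3: "\<theta> \<le> 1/3" using p \<beta> unfolding \<theta> by (intro frac_le) auto
  show "\<theta> \<le> 1/\<beta>" using p \<beta> unfolding \<theta> by (intro frac_le) auto
  have "\<theta>\<^sup>2 \<le> \<theta> * 1" unfolding power2_eq_square using 1 3 by (intro mult_left_mono) auto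
  then have "X * \<theta>\<^sup>2 \<le> X * \<theta>" using p by (intro mult_left_mono) auto
  also have "\<dots> \<le> 1" using p \<beta> by (simp add: \<theta>)
  finally show "2 * k * \<beta>\<^sup>2 * Cs * \<theta>\<^sup>2 \<le> 1" by (simp add: X_def)
qed

lemma hole_factor: "0 < \<tau>" "\<tau> < 1"
proof -
  have "0 \<le> 72 * k * \<beta>\<^sup>2 * (1 + 4 * M)\<^sup>2" using k by simp
  then show "0 < \<tau>" "\<tau> < 1" unfolding hole_factor_def by (auto simp: divide_simps)
qed

lemma decay_ratio: "1 < L" "3 \<le> L"
proof -
  have "1 / (1/3) \<le> L" unfolding decay_ratio_def using hole_ratio M by (intro frac_le) auto
  then show "1 < L" "3 \<le> L" by auto
qed

text \<open>Caccioppoli bounds the inner energy by the mass over \<open>ball y \<rho>\<close>.  Outside the hole \<open>ball y s\<close> this mass is at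
  most a multiple of the energy \<open>X\<close> of the complement of the hole, by Poincare; over the hole it is first moved into an
  annulus outside the hole, which costs only \<open>s\<^sup>2\<close> times the total energy \<open>E\<close>.  So the inner energy is at most
  a multiple of \<open>X \<le> E - energy y s\<close> plus half of \<open>E\<close>, and the hole can be filled.\<close>

lemma hole_filling:
  assumes \<rho>: "0 < \<rho>" and sub: "ball y ((1 + 4 * M) * \<rho>) \<subseteq> ball y0 R" "(1 + 4 * M) * \<rho> \<le> R"
  shows "energy y (\<theta> * \<rho>) \<le> \<tau> * energy y ((1 + 4 * M) * \<rho>)"
proof -
  define H where "H = 1 + 4 * M"
  have H: "1 \<le> H" using M by (simp add: H_def)
  define s where "s = \<theta> * \<rho>"
  have s: "0 < s" "3 * s \<le> \<rho>" "\<beta> * s \<le> \<rho>"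
    using hole_ratio(1-3) \<rho> \<beta> by (auto simp: s_def field_simps)
  define T where "T = H * \<rho>"
  have sM: "\<rho> + 4 * M * s \<le> T"
  proof -
    have "4 * M * s \<le> 4 * M * \<rho>" using s M by (intro mult_left_mono) auto
    then show ?thesis by (simp add: T_def H_def algebra_simps)
  qed
  have \<rho>H: "\<rho> \<le> T" "T \<le> R" "0 < T" "3 * s \<le> T" "s \<le> T" "\<rho> \<le> R"
  proof -
    have "0 \<le> 4 * M * s" using M s by simp
    moreover have "T \<le> R" using sub by (simp add: T_def H_def)
    ultimately show "\<rho> \<le> T" "T \<le> R" "0 < T" "3 * s \<le> T" "s \<le> T" "\<rho> \<le> R" using sM s \<rho> by linarith+
  qed
  have ballH: "ball y r \<subseteq> ball y0 R" if "r \<le> T" for r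
    using sub(1) subset_ball[OF that, of y] unfolding T_def H_def by blast
  define X where "X = measure \<nu> (slab \<psi> (ball y (T) - ball y s) (T))"
  define E where "E = energy y (T)"
  have X: "X + energy y s \<le> E"
  proof -
    have "slab \<psi> (ball y T - ball y s) T \<inter> slab \<psi> (ball y s) s = {}" by (auto simp: slab_def)
    then have "X + energy y s = measure \<nu> (slab \<psi> (ball y T - ball y s) T \<union> slab \<psi> (ball y s) s)"
      unfolding X_def energy_def
      by (intro \<nu>.finite_measure_Union[symmetric]) (simp_all add: slab_sets)
    also have "slab \<psi> (ball y T - ball y s) T \<union> slab \<psi> (ball y s) s \<subseteq> slab \<psi> (ball y T) T"
      using \<rho>H by (intro Un_least slab_mono subset_ball) auto
    then have "measure \<nu> (slab \<psi> (ball y T - ball y s) T \<union> slab \<psi> (ball y s) s) \<le> E"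
      unfolding E_def energy_def by (intro \<nu>.finite_measure_mono) (simp_all add: slab_sets)
    finally show ?thesis .
  qed
  have ann: "measure \<mu> (slab \<psi> (ball y r - ball y s) h) \<le> 8 * (T)\<^sup>2 * X"
    if "r \<le> T" "0 < h" "h \<le> T" for r h
  proof -
    have sub': "ball y r - ball y s \<subseteq> ball y0 R" using ballH[OF that(1)] by blast
    have sub'': "ball y (T) - ball y s \<subseteq> ball y0 R" using ballH[of "T"] by blast
    have "measure \<mu> (slab \<psi> (ball y r - ball y s) h) \<le> measure \<mu> (slab \<psi> (ball y (T) - ball y s) (T))"
      using that by (intro \<mu>_mono Diff_mono subset_ball) auto
    also have "\<dots> \<le> 8 * (T)\<^sup>2 * X"
      unfolding X_def using sub'' \<rho> H \<rho>H by (intro poincare) auto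
    finally show ?thesis .
  qed
  have "slab \<psi> (ball y \<rho>) \<rho> = slab \<psi> (ball y \<rho> - ball y s) \<rho> \<union> slab \<psi> (ball y s) \<rho>"
    using s by (auto simp: slab_def)
  then have m1: "measure \<mu> (slab \<psi> (ball y \<rho>) \<rho>) \<le> measure \<mu> (slab \<psi> (ball y \<rho> - ball y s) \<rho>) + measure \<mu> (slab \<psi> (ball y s) \<rho>)"
    by (simp add: measure_Un_le slab_sets)
  have m2: "measure \<mu> (slab \<psi> (ball y \<rho> - ball y s) \<rho>) \<le> 8 * T\<^sup>2 * X"
    using \<rho> \<rho>H by (intro ann) auto
  have m3: "measure \<mu> (slab \<psi> (ball y s) \<rho>) \<le> 8 * measure \<mu> (slab \<psi> (ball y (3 * s) - ball y s) (\<rho> + 4 * M * s))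
          + Cs * s\<^sup>2 * measure \<nu> (slab \<psi> (ball y (3 * s)) (\<rho> + 4 * M * s))"
    using s \<rho> sM \<rho>H by (intro shift ballH) auto
  have m4: "measure \<mu> (slab \<psi> (ball y (3 * s) - ball y s) (\<rho> + 4 * M * s)) \<le> 8 * T\<^sup>2 * X"
    using \<rho> \<rho>H s M sM by (intro ann) (auto intro: add_pos_nonneg)
  have "measure \<nu> (slab \<psi> (ball y (3 * s)) (\<rho> + 4 * M * s)) \<le> E"
    unfolding E_def energy_def using s \<rho>H sM by (intro \<nu>_mono subset_ball) auto
  then have m5: "Cs * s\<^sup>2 * measure \<nu> (slab \<psi> (ball y (3 * s)) (\<rho> + 4 * M * s)) \<le> Cs * s\<^sup>2 * E"
    using Cs by (intro mult_left_mono) auto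
  have m: "measure \<mu> (slab \<psi> (ball y \<rho>) \<rho>) \<le> 72 * T\<^sup>2 * X + Cs * s\<^sup>2 * E"
    using m1 m2 m3 m4 m5 by linarith
  have "energy y s \<le> energy y (\<rho> / \<beta>)" using s \<beta> by (intro energy_mono) (simp add: field_simps)
  also have "\<dots> \<le> k / (\<rho> / \<beta>)\<^sup>2 * measure \<mu> (slab \<psi> (ball y (\<beta> * (\<rho> / \<beta>))) (\<beta> * (\<rho> / \<beta>)))"
    unfolding energy_def using \<rho> \<beta> \<rho>H by (intro caccioppoli ballH) auto
  also have "\<dots> = k * \<beta>\<^sup>2 / \<rho>\<^sup>2 * measure \<mu> (slab \<psi> (ball y \<rho>) \<rho>)"
    using \<beta> by (simp add: power_divide)
  also have "\<dots> \<le> k * \<beta>\<^sup>2 / \<rho>\<^sup>2 * (72 * (T)\<^sup>2 * X + Cs * s\<^sup>2 * E)"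
    using m k by (intro mult_left_mono) auto
  also have "\<dots> = (72 * k * \<beta>\<^sup>2 * H\<^sup>2) * X + (k * \<beta>\<^sup>2 * Cs * \<theta>\<^sup>2) * E"
    using \<rho> by (simp add: s_def T_def power_mult_distrib field_simps)
  also have "\<dots> \<le> (72 * k * \<beta>\<^sup>2 * H\<^sup>2) * (E - energy y s) + (1/2) * E"
    using X k hole_ratio(4) by (intro add_mono mult_left_mono mult_right_mono) (auto simp: E_def energy_nonneg)
  finally have "energy y s * (72 * k * \<beta>\<^sup>2 * H\<^sup>2 + 1) \<le> (72 * k * \<beta>\<^sup>2 * H\<^sup>2 + 1/2) * E"
    by (simp add: algebra_simps)
  moreover have "0 < 72 * k * \<beta>\<^sup>2 * H\<^sup>2 + 1" using k by (intro add_nonneg_pos) auto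
  ultimately have "energy y s \<le> (72 * k * \<beta>\<^sup>2 * H\<^sup>2 + 1/2) / (72 * k * \<beta>\<^sup>2 * H\<^sup>2 + 1) * E"
    by (simp add: pos_le_divide_eq)
  then show ?thesis by (simp add: hole_factor_def H_def s_def E_def T_def)
qed

lemma decay_exponent: "0 < \<eta>" "\<eta> \<le> 1/2" "\<tau> \<le> L powr (- \<eta>)"
proof -
  have ln: "ln \<tau> < 0" "0 < ln L" using hole_factor decay_ratio by auto
  show "0 < \<eta>" "\<eta> \<le> 1/2" by (rule decay_exponent_range[OF k \<beta> M Cs])+
  have "\<eta> \<le> - ln \<tau> / ln L" unfolding decay_exponent_def by (rule min.cobounded2)
  then have "ln \<tau> \<le> - \<eta> * ln L" using ln by (simp add: field_simps)
  then have "exp (ln \<tau>) \<le> exp (- \<eta> * ln L)" by simp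
  then show "\<tau> \<le> L powr (- \<eta>)" using hole_factor decay_ratio by (simp add: powr_def)
qed

text \<open>Iterated hole filling along the radii \<open>S / L ^ j\<close>; the factor \<open>L powr \<eta>\<close> accounts for the radii in between.\<close>

lemma energy_decay:
  assumes "0 < s" "s \<le> S" and sub: "ball y S \<subseteq> ball y0 R" "S \<le> R"
  shows "energy y s \<le> L powr \<eta> * (s / S) powr \<eta> * energy y S"
proof -
  have L: "1 < L" by (rule decay_ratio)
  have S: "0 < S" using assms by simp
  have iter: "energy y (S / L ^ j) \<le> \<tau> ^ j * energy y S" for j
  proof (induction j)
    case (Suc j)
    define \<rho> where "\<rho> = S / L ^ j / (1 + 4 * M)"
    have \<rho>: "0 < \<rho>" "(1 + 4 * M) * \<rho> = S / L ^ j" using S L M by (auto simp: \<rho>_def)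
    have "S / L ^ j \<le> S" using S L by (simp add: divide_le_eq one_le_power less_imp_le)
    then have "ball y ((1 + 4 * M) * \<rho>) \<subseteq> ball y0 R" "(1 + 4 * M) * \<rho> \<le> R"
      using sub subset_ball[of "S / L ^ j" S y] unfolding \<rho>(2) by auto
    then have "energy y (\<theta> * \<rho>) \<le> \<tau> * energy y ((1 + 4 * M) * \<rho>)" using hole_filling \<rho>(1) by blast
    moreover have "\<theta> * \<rho> = S / L ^ Suc j"
      using hole_ratio(1) M by (simp add: \<rho>_def decay_ratio_def field_simps)
    ultimately have "energy y (S / L ^ Suc j) \<le> \<tau> * energy y (S / L ^ j)" using \<rho>(2) by simp
    also have "\<dots> \<le> \<tau> * (\<tau> ^ j * energy y S)" using Suc hole_factor by (intro mult_left_mono) auto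
    finally show ?case by (simp add: mult.assoc)
  qed simp
  obtain j where j: "S / L ^ Suc j < s" "s \<le> S / L ^ j" using geometric_level[OF L S assms(1,2)] .
  have "energy y s \<le> energy y (S / L ^ j)" using j by (intro energy_mono)
  also have "\<dots> \<le> \<tau> ^ j * energy y S" by (rule iter)
  also have "\<dots> \<le> (L powr (- \<eta>)) ^ j * energy y S"
    using decay_exponent hole_factor by (intro mult_right_mono power_mono) (auto simp: energy_nonneg)
  also have "(L powr (- \<eta>)) ^ j = L powr \<eta> * (1 / L ^ Suc j) powr \<eta>"
  proof -
    have "(L powr (- \<eta>)) ^ j = L powr (- \<eta> * real j)" using L by (simp add: powr_powr flip: powr_realpow)
    also have "\<dots> = L powr \<eta> * (L powr (- real (Suc j))) powr \<eta>"
      using L by (simp add: powr_powr algebra_simps flip: powr_add)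
    also have "L powr (- real (Suc j)) = 1 / L ^ Suc j" using L by (simp add: powr_minus_divide powr_realpow del: of_nat_Suc power_Suc)
    finally show ?thesis .
  qed
  also have "L powr \<eta> * (1 / L ^ Suc j) powr \<eta> * energy y S \<le> L powr \<eta> * (s / S) powr \<eta> * energy y S"
    using j L S decay_exponent by (intro mult_right_mono mult_left_mono powr_mono2) (auto simp: field_simps energy_nonneg)
  finally show ?thesis .
qed

end

section \<open>From bounds away from the boundary to a weak-type estimate\<close>

text \<open>Both sides measure the pairs of a centre \<open>z \<in> A\<close> and a point \<open>x\<close> of the slab of height \<open>h'\<close> with
  \<open>fst x \<in> ball z h\<close>.\<close>

lemma average_over_centres:
  fixes \<psi> :: "'a::euclidean_space \<Rightarrow> real" and m :: "('a \<times> real) measure"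
  assumes [measurable]: "\<psi> \<in> borel_measurable borel" and m: "finite_measure m" and [measurable_cong]: "sets m = sets borel"
    and [measurable]: "A \<in> sets borel"
  shows "(\<integral>\<^sup>+z. indicator A z * emeasure m (slab \<psi> (ball z h) h') \<partial>lborel)
    = (\<integral>\<^sup>+x. indicator (slab \<psi> UNIV h') x * emeasure lborel (A \<inter> ball (fst x) h) \<partial>m)"
proof -
  interpret m: finite_measure m by (rule m)
  interpret pair_sigma_finite lborel m
    by (intro pair_sigma_finite.intro sigma_finite_lborel m.sigma_finite_measure_axioms)
  have [measurable]: "fst \<in> borel_measurable (borel :: ('a \<times> real) measure)"
    by (intro borel_measurable_continuous_onI continuous_intros)
  have [measurable]: "slab \<psi> UNIV h' \<in> sets borel" by measurable
  define f where "f z x = (indicator A z * (indicator (slab \<psi> UNIV h') x * (if dist z (fst x) < h then 1 else 0)) :: ennreal)"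
    for z :: 'a and x :: "'a \<times> real"
  have [measurable]: "case_prod f \<in> borel_measurable (lborel \<Otimes>\<^sub>M m)" unfolding f_def by measurable
  have "indicator A z * emeasure m (slab \<psi> (ball z h) h') = (\<integral>\<^sup>+x. f z x \<partial>m)" for z
  proof -
    have "emeasure m (slab \<psi> (ball z h) h') = (\<integral>\<^sup>+x. indicator (slab \<psi> (ball z h) h') x \<partial>m)"
      by (intro nn_integral_indicator[symmetric]) measurable
    also have "\<dots> = (\<integral>\<^sup>+x. indicator (slab \<psi> UNIV h') x * (if dist z (fst x) < h then 1 else 0) \<partial>m)"
      by (intro nn_integral_cong) (auto simp: slab_def indicator_def)
    finally show ?thesis unfolding f_def by (subst nn_integral_cmult) auto
  qed
  then have "(\<integral>\<^sup>+z. indicator A z * emeasure m (slab \<psi> (ball z h) h') \<partial>lborel) = (\<integral>\<^sup>+z. (\<integral>\<^sup>+x. f z x \<partial>m) \<partial>lborel)"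
    by simp
  also have "\<dots> = (\<integral>\<^sup>+x. (\<integral>\<^sup>+z. f z x \<partial>lborel) \<partial>m)"
    by (rule Fubini'[symmetric]) measurable
  also have "(\<lambda>x. \<integral>\<^sup>+z. f z x \<partial>lborel) = (\<lambda>x. indicator (slab \<psi> UNIV h') x * emeasure lborel (A \<inter> ball (fst x) h))"
  proof
    fix x :: "'a \<times> real"
    have "(\<integral>\<^sup>+z. f z x \<partial>lborel) = (\<integral>\<^sup>+z. indicator (slab \<psi> UNIV h') x * indicator (A \<inter> ball (fst x) h) z \<partial>lborel)"
      unfolding f_def by (intro nn_integral_cong) (auto simp: indicator_def dist_commute)
    also have "\<dots> = indicator (slab \<psi> UNIV h') x * emeasure lborel (A \<inter> ball (fst x) h)"
      by (subst nn_integral_cmult_indicator) auto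
    finally show "(\<integral>\<^sup>+z. f z x \<partial>lborel) = indicator (slab \<psi> UNIV h') x * emeasure lborel (A \<inter> ball (fst x) h)" .
  qed
  finally show ?thesis .
qed

text \<open>So small that one step of the iteration from a height to half of it gains more than the factor \<open>2 ^ N\<close> that
  the growth \<open>(R / h) ^ N\<close> of the bound away from the boundary loses.\<close>

definition strip_fraction :: "real \<Rightarrow> real \<Rightarrow> nat \<Rightarrow> nat \<Rightarrow> real" where
  "strip_fraction k \<beta> n N = 1 / (1 + 8 * k * \<beta> ^ n * 2 ^ Suc N)"

definition energy_const :: "real \<Rightarrow> real \<Rightarrow> nat \<Rightarrow> nat \<Rightarrow> real" where
  "energy_const k \<beta> n N = 128 * k * \<beta> ^ n * \<beta>\<^sup>2 * (16 * \<beta> / strip_fraction k \<beta> n N) ^ N"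

definition weak_const :: "real \<Rightarrow> real \<Rightarrow> real \<Rightarrow> real \<Rightarrow> nat \<Rightarrow> nat \<Rightarrow> real \<Rightarrow> real" where
  "weak_const k \<beta> M Cs n N q =
     (if n = 1 then unit_ball_vol 1 * energy_const k \<beta> n N powr (q / 2)
      else unit_ball_vol n * 5 ^ n * energy_const k \<beta> n N *
        (decay_ratio k \<beta> M Cs powr decay_exponent k \<beta> M Cs * (8 * \<beta>) powr decay_exponent k \<beta> M Cs * energy_const k \<beta> n N)
          powr (1 / (real n - 1 - decay_exponent k \<beta> M Cs)))"

context boundary_energy
begin

text \<open>Averaging the Caccioppoli inequality over all centres: a point of the strip of height \<open>h\<close> lies over a
  fixed proportion of the balls of radius \<open>h\<close>, and over at most \<open>\<beta> ^ n\<close> times as many of radius \<open>\<beta> * h\<close>.  Unlike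
  the inequality on one ball, the result controls a thin strip over a large ball.\<close>

lemma strip_caccioppoli:
  assumes h: "0 < h" and \<rho>: "0 < \<rho>" "\<rho> + 2 * \<beta> * h \<le> R"
  shows "measure \<nu> (slab \<psi> (ball y0 \<rho>) h)
     \<le> k * \<beta> ^ DIM('a) / h\<^sup>2 * measure \<mu> (slab \<psi> (ball y0 (\<rho> + 2 * \<beta> * h)) (\<beta> * h))"
proof -
  define v where "v = unit_ball_vol (real DIM('a)) * h ^ DIM('a)"
  have v: "0 < v" using h by (simp add: v_def)
  have vh: "emeasure lborel (ball z h) = ennreal v" for z :: 'a using h by (simp add: v_def emeasure_ball)
  have v\<beta>: "emeasure lborel (ball z (\<beta> * h)) = ennreal (\<beta> ^ DIM('a) * v)" for z :: 'a
    using h \<beta> by (simp add: v_def emeasure_ball power_mult_distrib mult_ac)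
  have \<beta>h: "h \<le> \<beta> * h" "0 < \<beta> * h" using \<beta> h by auto
  have \<beta>hR: "\<beta> * h \<le> R" using \<rho> \<beta>h(2) by linarith
  define A where "A = ball y0 (\<rho> + h)"
  have \<mu>s: "slab \<psi> B r \<in> sets \<mu>" "slab \<psi> B r \<in> sets \<nu>" if "B \<in> sets borel" for B r
    using slab_sets[OF that] by simp_all
  have "ennreal v * emeasure \<nu> (slab \<psi> (ball y0 \<rho>) h) = (\<integral>\<^sup>+x. ennreal v * indicator (slab \<psi> (ball y0 \<rho>) h) x \<partial>\<nu>)"
    by (intro nn_integral_cmult_indicator[symmetric] \<mu>s) auto
  also have "\<dots> \<le> (\<integral>\<^sup>+x. indicator (slab \<psi> UNIV h) x * emeasure lborel (A \<inter> ball (fst x) h) \<partial>\<nu>)"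
  proof (intro nn_integral_mono)
    fix x
    have "A \<inter> ball (fst x) h = ball (fst x) h" if "x \<in> slab \<psi> (ball y0 \<rho>) h"
    proof -
      have "dist y0 (fst x) < \<rho>" using that by (auto simp: slab_def)
      then have "ball (fst x) h \<subseteq> A"
        unfolding A_def using dist_triangle[of y0 _ "fst x"] by (fastforce intro: order_le_less_trans)
      then show ?thesis by blast
    qed
    then show "ennreal v * indicator (slab \<psi> (ball y0 \<rho>) h) x \<le> indicator (slab \<psi> UNIV h) x * emeasure lborel (A \<inter> ball (fst x) h)"
      by (auto simp: indicator_def vh slab_def)
  qed
  also have "\<dots> = (\<integral>\<^sup>+z. indicator A z * emeasure \<nu> (slab \<psi> (ball z h) h) \<partial>lborel)"
    by (intro average_over_centres[symmetric] fin\<nu>) (auto simp: A_def)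
  also have "\<dots> \<le> (\<integral>\<^sup>+z. ennreal (k / h\<^sup>2) * (indicator A z * emeasure \<mu> (slab \<psi> (ball z (\<beta> * h)) (\<beta> * h))) \<partial>lborel)"
  proof (intro nn_integral_mono)
    fix z
    show "indicator A z * emeasure \<nu> (slab \<psi> (ball z h) h) \<le> ennreal (k / h\<^sup>2) * (indicator A z * emeasure \<mu> (slab \<psi> (ball z (\<beta> * h)) (\<beta> * h)))"
    proof (cases "z \<in> A")
      case True
      have "ball z (\<beta> * h) \<subseteq> ball y0 R"
      proof
        fix x assume "x \<in> ball z (\<beta> * h)"
        then have "dist y0 x < (\<rho> + h) + \<beta> * h"
          using True dist_triangle[of y0 x z] by (auto simp: A_def)
        then show "x \<in> ball y0 R" using \<rho> \<beta>h by simp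
      qed
      then have "measure \<nu> (slab \<psi> (ball z h) h) \<le> k / h\<^sup>2 * measure \<mu> (slab \<psi> (ball z (\<beta> * h)) (\<beta> * h))"
        using h \<beta>hR by (intro caccioppoli)
      then show ?thesis using True k h
        by (simp add: \<mu>.emeasure_eq_measure \<nu>.emeasure_eq_measure ennreal_leI flip: ennreal_mult)
    qed simp
  qed
  also have "\<dots> = ennreal (k / h\<^sup>2) * (\<integral>\<^sup>+z. indicator A z * emeasure \<mu> (slab \<psi> (ball z (\<beta> * h)) (\<beta> * h)) \<partial>lborel)"
  proof (rule nn_integral_cmult)
    have "(\<lambda>z. indicator A z * emeasure \<mu> (slab \<psi> (ball z (\<beta> * h)) (\<beta> * h))) \<in> borel_measurable borel"
    proof -
      have [measurable]: "fst \<in> borel_measurable (borel :: ('a \<times> real) measure)"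
        by (intro borel_measurable_continuous_onI continuous_intros)
      have [measurable]: "slab \<psi> UNIV (\<beta> * h) \<in> sets borel" by measurable
      have sp: "space \<mu> = UNIV" using sets_eq_imp_space_eq[OF sets\<mu>] by simp
      have "Measurable.pred (borel \<Otimes>\<^sub>M \<mu>) (\<lambda>zx. snd zx \<in> slab \<psi> UNIV (\<beta> * h) \<and> dist (fst zx) (fst (snd zx)) < \<beta> * h)"
        by measurable
      then have "{zx \<in> space (borel \<Otimes>\<^sub>M \<mu>). snd zx \<in> slab \<psi> UNIV (\<beta> * h) \<and> dist (fst zx) (fst (snd zx)) < \<beta> * h} \<in> sets (borel \<Otimes>\<^sub>M \<mu>)"
        by (rule predE)
      then have "(\<lambda>z::'a. emeasure \<mu> (Pair z -` {zx \<in> space (borel \<Otimes>\<^sub>M \<mu>). snd zx \<in> slab \<psi> UNIV (\<beta> * h) \<and> dist (fst zx) (fst (snd zx)) < \<beta> * h})) \<in> borel_measurable borel"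
        by (rule \<mu>.measurable_emeasure_Pair)
      moreover have "Pair z -` {zx \<in> space (borel \<Otimes>\<^sub>M \<mu>). snd zx \<in> slab \<psi> UNIV (\<beta> * h) \<and> dist (fst zx) (fst (snd zx)) < \<beta> * h}
          = slab \<psi> (ball z (\<beta> * h)) (\<beta> * h)" for z :: 'a
        by (auto simp: space_pair_measure sp slab_def)
      ultimately have "(\<lambda>z. emeasure \<mu> (slab \<psi> (ball z (\<beta> * h)) (\<beta> * h))) \<in> borel_measurable borel" by simp
      then show ?thesis by (intro borel_measurable_times_ennreal borel_measurable_indicator) (auto simp: A_def)
    qed
    then show "(\<lambda>z. indicator A z * emeasure \<mu> (slab \<psi> (ball z (\<beta> * h)) (\<beta> * h))) \<in> borel_measurable lborel" by simp
  qed
  also have "(\<integral>\<^sup>+z. indicator A z * emeasure \<mu> (slab \<psi> (ball z (\<beta> * h)) (\<beta> * h)) \<partial>lborel)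
     = (\<integral>\<^sup>+x. indicator (slab \<psi> UNIV (\<beta> * h)) x * emeasure lborel (A \<inter> ball (fst x) (\<beta> * h)) \<partial>\<mu>)"
    by (intro average_over_centres fin\<mu>) (auto simp: A_def)
  also have "\<dots> \<le> (\<integral>\<^sup>+x. ennreal (\<beta> ^ DIM('a) * v) * indicator (slab \<psi> (ball y0 (\<rho> + 2 * \<beta> * h)) (\<beta> * h)) x \<partial>\<mu>)"
  proof (intro nn_integral_mono)
    fix x
    show "indicator (slab \<psi> UNIV (\<beta> * h)) x * emeasure lborel (A \<inter> ball (fst x) (\<beta> * h))
      \<le> ennreal (\<beta> ^ DIM('a) * v) * indicator (slab \<psi> (ball y0 (\<rho> + 2 * \<beta> * h)) (\<beta> * h)) x"
    proof (cases "x \<in> slab \<psi> UNIV (\<beta> * h) \<and> A \<inter> ball (fst x) (\<beta> * h) \<noteq> {}")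
      case True
      then obtain z where z: "z \<in> A" "dist (fst x) z < \<beta> * h" by auto
      then have "dist y0 (fst x) < (\<rho> + h) + \<beta> * h"
        using dist_triangle[of y0 "fst x" z] by (auto simp: A_def dist_commute)
      then have "fst x \<in> ball y0 (\<rho> + 2 * \<beta> * h)" using \<beta>h by simp
      then have "x \<in> slab \<psi> (ball y0 (\<rho> + 2 * \<beta> * h)) (\<beta> * h)" using True by (auto simp: slab_def)
      moreover have "emeasure lborel (A \<inter> ball (fst x) (\<beta> * h)) \<le> ennreal (\<beta> ^ DIM('a) * v)"
        unfolding v\<beta>[of "fst x", symmetric] by (intro emeasure_mono) auto
      ultimately show ?thesis using True by (simp add: indicator_def)
    qed (auto simp: indicator_def)
  qed
  also have "\<dots> = ennreal (\<beta> ^ DIM('a) * v) * emeasure \<mu> (slab \<psi> (ball y0 (\<rho> + 2 * \<beta> * h)) (\<beta> * h))"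
    by (intro nn_integral_cmult_indicator \<mu>s) auto
  finally have "ennreal v * emeasure \<nu> (slab \<psi> (ball y0 \<rho>) h) \<le> ennreal (k / h\<^sup>2) *
      (ennreal (\<beta> ^ DIM('a) * v) * emeasure \<mu> (slab \<psi> (ball y0 (\<rho> + 2 * \<beta> * h)) (\<beta> * h)))"
    by (simp add: mult_left_mono)
  then have "v * measure \<nu> (slab \<psi> (ball y0 \<rho>) h) \<le> k / h\<^sup>2 * (\<beta> ^ DIM('a) * v * measure \<mu> (slab \<psi> (ball y0 (\<rho> + 2 * \<beta> * h)) (\<beta> * h)))"
    using v k \<beta> by (simp add: \<mu>.emeasure_eq_measure \<nu>.emeasure_eq_measure flip: ennreal_mult)
  also have "\<dots> = v * (k * \<beta> ^ DIM('a) / h\<^sup>2 * measure \<mu> (slab \<psi> (ball y0 (\<rho> + 2 * \<beta> * h)) (\<beta> * h)))"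
    by simp
  finally show ?thesis using v by (rule mult_left_le_imp_le)
qed

lemma strip_fraction: "0 < strip_fraction k \<beta> DIM('a) N" "strip_fraction k \<beta> DIM('a) N \<le> 1"
  "8 * k * \<beta> ^ DIM('a) * (strip_fraction k \<beta> DIM('a) N)\<^sup>2 \<le> 1 / 2 ^ Suc N"
proof -
  define X where "X = 8 * k * \<beta> ^ DIM('a)"
  have X: "0 < X" using k \<beta> by (simp add: X_def)
  have f: "strip_fraction k \<beta> DIM('a) N = 1 / (1 + X * 2 ^ Suc N)" by (simp add: strip_fraction_def X_def)
  have Y: "0 < X * 2 ^ Suc N" using X by simp
  show 1: "0 < strip_fraction k \<beta> DIM('a) N" using Y unfolding f by simp
  show 2: "strip_fraction k \<beta> DIM('a) N \<le> 1" using Y unfolding f by simp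
  have "(strip_fraction k \<beta> DIM('a) N)\<^sup>2 \<le> strip_fraction k \<beta> DIM('a) N * 1"
    unfolding power2_eq_square using 1 2 by (intro mult_left_mono) auto
  then have "X * (strip_fraction k \<beta> DIM('a) N)\<^sup>2 \<le> X * strip_fraction k \<beta> DIM('a) N" using X by (intro mult_left_mono) auto
  also have "\<dots> \<le> X * (1 / (X * 2 ^ Suc N))" unfolding f using X Y by (intro mult_left_mono frac_le) auto
  also have "\<dots> = 1 / 2 ^ Suc N" using X by simp
  finally show "8 * k * \<beta> ^ DIM('a) * (strip_fraction k \<beta> DIM('a) N)\<^sup>2 \<le> 1 / 2 ^ Suc N" by (simp add: X_def)
qed

text \<open>The bound \<open>far\<close> degenerates as \<open>h\<close> tends to \<open>0\<close>.  In a strip of height \<open>e * h j\<close>, Poincare gains \<open>(e * h j)\<^sup>2\<close> and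
  Caccioppoli loses \<open>(h j)\<^sup>2\<close>, so the mass is at most a small multiple \<open>\<sigma>\<close> of the mass in the strip of
  height \<open>\<beta> * h j\<close> over a slightly larger ball.  The latter consists of the next thinner strip and of a part
  at positive distance from the boundary, to which \<open>far\<close> applies.  The choice of \<open>e\<close> makes the contributions
  of \<open>far\<close> summable, and the remainder \<open>\<sigma> ^ j * m j\<close> tends to \<open>0\<close>.\<close>

lemma strip_iteration:
  assumes P: "0 \<le> P"
    and far: "\<And>h. 0 < h \<Longrightarrow> h \<le> R \<Longrightarrow> measure \<mu> (slab \<psi> (ball y0 R) R - slab \<psi> (ball y0 R) h) \<le> P * (R / h) ^ N"
  shows "measure \<mu> (slab \<psi> (ball y0 (R / 2)) (strip_fraction k \<beta> DIM('a) N * (R / (8 * \<beta>)))) \<le> P * (16 * \<beta> / strip_fraction k \<beta> DIM('a) N) ^ N"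
proof -
  define e where "e = strip_fraction k \<beta> DIM('a) N"
  have e: "0 < e" "e \<le> 1" "8 * k * \<beta> ^ DIM('a) * e\<^sup>2 \<le> 1 / 2 ^ Suc N"
    unfolding e_def by (rule strip_fraction)+
  define h where "h j = R / (8 * \<beta>) / 2 ^ j" for j :: nat
  \<comment> \<open>The radii increase from \<open>R / 2\<close> to \<open>R\<close>, each step being the enlargement \<open>2 * \<beta> * h j\<close> of the strip inequality.\<close>
  define \<rho> where "\<rho> j = R - R / 2 ^ Suc j" for j :: nat
  define m where "m j = measure \<mu> (slab \<psi> (ball y0 (\<rho> j)) (e * h j))" for j
  define Q where "Q = P * (16 * \<beta> / e) ^ N"
  have Q: "0 \<le> Q" using P \<beta> e by (simp add: Q_def)
  define \<sigma> where "\<sigma> = 8 * k * \<beta> ^ DIM('a) * e\<^sup>2"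
  have \<sigma>: "0 \<le> \<sigma>" "\<sigma> \<le> 1 / 2 ^ Suc N" using e k \<beta> by (auto simp: \<sigma>_def)
  have step: "m j \<le> \<sigma> * (m (Suc j) + Q * (2 ^ j) ^ N)" for j
  proof -
    have hp: "0 < h j" using R \<beta> by (simp add: h_def)
    have "2 ^ j \<ge> (1::real)" by simp
    then have h8: "\<beta> * h j \<le> R / 8" using R \<beta> by (simp add: h_def divide_le_eq)
    have eh: "e * h j \<le> h j" "0 < e * h j" using e hp by auto
    have hb: "h j \<le> \<beta> * h j" using \<beta> hp by simp
    have "R / 2 ^ Suc j < R / 1"
      using R one_less_power[of "2::real" "Suc j"] by (intro divide_strict_left_mono) (auto simp del: power_Suc)
    then have \<rho>p: "0 < \<rho> j" "\<rho> j \<le> R" using R by (auto simp: \<rho>_def)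
    have ehR: "e * h j \<le> R" using eh h8 hb R by linarith
    have next': "\<rho> j + 2 * \<beta> * h j = \<rho> (Suc j)"
      using \<beta> by (simp add: \<rho>_def h_def field_simps)
    have \<rho>S: "\<rho> (Suc j) \<le> R" using R by (simp add: \<rho>_def)
    have "m j \<le> 8 * (e * h j)\<^sup>2 * measure \<nu> (slab \<psi> (ball y0 (\<rho> j)) (e * h j))"
      unfolding m_def using eh ehR \<rho>p by (intro poincare subset_ball) auto
    also have "\<dots> \<le> 8 * (e * h j)\<^sup>2 * measure \<nu> (slab \<psi> (ball y0 (\<rho> j)) (h j))"
      using eh by (intro mult_left_mono \<nu>_mono) auto
    also have "\<dots> \<le> 8 * (e * h j)\<^sup>2 * (k * \<beta> ^ DIM('a) / (h j)\<^sup>2 * measure \<mu> (slab \<psi> (ball y0 (\<rho> (Suc j))) (\<beta> * h j)))"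
      using strip_caccioppoli[OF hp \<rho>p(1)] \<rho>S unfolding next' by (intro mult_left_mono) auto
    also have "\<dots> = \<sigma> * measure \<mu> (slab \<psi> (ball y0 (\<rho> (Suc j))) (\<beta> * h j))"
      using hp by (simp add: \<sigma>_def power_mult_distrib field_simps)
    also have "\<dots> \<le> \<sigma> * (m (Suc j) + Q * (2 ^ j) ^ N)"
    proof (intro mult_left_mono \<sigma>)
      have hS: "0 < e * h (Suc j)" "e * h (Suc j) \<le> R"
      proof -
        show "0 < e * h (Suc j)" using e R \<beta> by (simp add: h_def)
        have "h (Suc j) \<le> h j" using hp by (simp add: h_def)
        then have "e * h (Suc j) \<le> h j" using e(1,2) hp by (smt (verit) mult_le_cancel_left_pos mult_left_le_one_le)
        then show "e * h (Suc j) \<le> R" using hb h8 R by linarith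
      qed
      have "slab \<psi> (ball y0 (\<rho> (Suc j))) (\<beta> * h j) \<subseteq>
          slab \<psi> (ball y0 (\<rho> (Suc j))) (e * h (Suc j)) \<union> (slab \<psi> (ball y0 R) R - slab \<psi> (ball y0 R) (e * h (Suc j)))"
        using \<rho>S h8 R by (auto simp: slab_def)
      then have "measure \<mu> (slab \<psi> (ball y0 (\<rho> (Suc j))) (\<beta> * h j)) \<le>
          measure \<mu> (slab \<psi> (ball y0 (\<rho> (Suc j))) (e * h (Suc j)) \<union> (slab \<psi> (ball y0 R) R - slab \<psi> (ball y0 R) (e * h (Suc j))))"
        by (intro \<mu>.finite_measure_mono) (auto intro!: slab_sets)
      also have "\<dots> \<le> m (Suc j) + measure \<mu> (slab \<psi> (ball y0 R) R - slab \<psi> (ball y0 R) (e * h (Suc j)))"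
        unfolding m_def by (intro measure_Un_le) (auto intro!: slab_sets)
      also have "\<dots> \<le> m (Suc j) + P * (R / (e * h (Suc j))) ^ N"
        using far[OF hS] by simp
      also have "R / (e * h (Suc j)) = 16 * \<beta> / e * 2 ^ j"
        using R \<beta> e by (simp add: h_def field_simps)
      also have "P * (16 * \<beta> / e * 2 ^ j) ^ N = Q * (2 ^ j) ^ N"
        unfolding Q_def by (simp only: power_mult_distrib mult.assoc)
      finally show "measure \<mu> (slab \<psi> (ball y0 (\<rho> (Suc j))) (\<beta> * h j)) \<le> m (Suc j) + Q * (2 ^ j) ^ N" .
    qed
    finally show ?thesis .
  qed
  have iter: "m 0 \<le> \<sigma> ^ j * m j + Q * (1 - (1/2) ^ j)" for j
  proof (induction j)
    case (Suc j)
    have "\<sigma> ^ Suc j * (2 ^ j) ^ N \<le> (1 / 2 ^ Suc N) ^ Suc j * (2 ^ j) ^ N"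
      using \<sigma> by (intro mult_right_mono power_mono) auto
    also have "\<dots> = (1/2) ^ Suc j * ((2 ^ j) ^ N / (2 ^ Suc j) ^ N)"
      by (simp add: power_divide power_mult_distrib power_mult[symmetric] mult.commute)
    also have "\<dots> \<le> (1/2) ^ Suc j * 1"
      by (intro mult_left_mono) (auto simp: divide_le_eq intro!: power_mono)
    finally have s: "\<sigma> ^ Suc j * (2 ^ j) ^ N \<le> (1/2) ^ Suc j" by simp
    have "m 0 \<le> \<sigma> ^ j * m j + Q * (1 - (1/2) ^ j)" by (rule Suc)
    also have "\<sigma> ^ j * m j \<le> \<sigma> ^ j * (\<sigma> * (m (Suc j) + Q * (2 ^ j) ^ N))"
      using step \<sigma> by (intro mult_left_mono) auto
    also have "\<dots> = \<sigma> ^ Suc j * m (Suc j) + Q * (\<sigma> ^ Suc j * (2 ^ j) ^ N)"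
      by (simp add: algebra_simps)
    also have "Q * (\<sigma> ^ Suc j * (2 ^ j) ^ N) \<le> Q * (1/2) ^ Suc j"
      using s Q by (intro mult_left_mono)
    finally show ?case by (simp add: algebra_simps)
  qed (use Q in simp)
  have "m 0 \<le> Q"
  proof (rule LIMSEQ_le_const)
    have "\<sigma> < 1" using \<sigma>(2) order_trans[of \<sigma> "1 / 2 ^ Suc N" "1 / 2"] by simp
    then show "(\<lambda>j. \<sigma> ^ j * measure \<mu> (space \<mu>) + Q) \<longlonglongrightarrow> Q"
      using \<sigma>(1) by (auto intro!: tendsto_eq_intros LIMSEQ_power_zero)
    have "m 0 \<le> \<sigma> ^ j * measure \<mu> (space \<mu>) + Q" for j
    proof -
      have "\<sigma> ^ j * m j \<le> \<sigma> ^ j * measure \<mu> (space \<mu>)"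
        unfolding m_def using \<sigma> by (intro mult_left_mono \<mu>.bounded_measure) auto
      moreover have "Q * (1 - (1/2) ^ j) \<le> Q * 1" using Q by (intro mult_left_mono) auto
      ultimately show ?thesis using iter[of j] by simp
    qed
    then show "\<exists>N. \<forall>n\<ge>N. m 0 \<le> \<sigma> ^ n * measure \<mu> (space \<mu>) + Q" by blast
  qed
  then show ?thesis by (simp add: m_def h_def \<rho>_def Q_def e_def)
qed

text \<open>With the mass under control up to the boundary, one application of Caccioppoli bounds the energy over
  the whole ball.\<close>

lemma energy_bound:
  assumes P: "0 \<le> P"
    and far: "\<And>h. 0 < h \<Longrightarrow> h \<le> R \<Longrightarrow> measure \<mu> (slab \<psi> (ball y0 R) R - slab \<psi> (ball y0 R) h) \<le> P * (R / h) ^ N"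
  shows "measure \<nu> (slab \<psi> (ball y0 (R / 4)) (R / (8 * \<beta>))) \<le> energy_const k \<beta> DIM('a) N * P / R\<^sup>2"
proof -
  define e where "e = strip_fraction k \<beta> DIM('a) N"
  have e: "0 < e" "e \<le> 1" unfolding e_def by (rule strip_fraction)+
  define h where "h = R / (8 * \<beta>)"
  have h: "0 < h" "\<beta> * h = R / 8" using R \<beta> by (auto simp: h_def)
  have hR: "h \<le> R" using R \<beta> by (simp add: h_def divide_le_eq)
  have eh: "0 < e * h" "e * h \<le> R" using e h hR by (auto intro: order_trans[OF mult_left_le_one_le])
  define Q where "Q = P * (16 * \<beta> / e) ^ N"
  have "slab \<psi> (ball y0 (R / 2)) (R / 8) \<subseteq> slab \<psi> (ball y0 (R / 2)) (e * h) \<union> (slab \<psi> (ball y0 R) R - slab \<psi> (ball y0 R) (e * h))"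
    using R by (auto simp: slab_def)
  then have "measure \<mu> (slab \<psi> (ball y0 (R / 2)) (R / 8)) \<le>
      measure \<mu> (slab \<psi> (ball y0 (R / 2)) (e * h) \<union> (slab \<psi> (ball y0 R) R - slab \<psi> (ball y0 R) (e * h)))"
    by (intro \<mu>.finite_measure_mono) (auto intro!: slab_sets)
  also have "\<dots> \<le> measure \<mu> (slab \<psi> (ball y0 (R / 2)) (e * h)) + measure \<mu> (slab \<psi> (ball y0 R) R - slab \<psi> (ball y0 R) (e * h))"
    by (intro measure_Un_le) (auto intro!: slab_sets)
  also have "measure \<mu> (slab \<psi> (ball y0 (R / 2)) (e * h)) \<le> Q"
    using strip_iteration[OF P far] by (simp add: Q_def e_def h_def)
  also have "measure \<mu> (slab \<psi> (ball y0 R) R - slab \<psi> (ball y0 R) (e * h)) \<le> P * (R / (e * h)) ^ N"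
    by (rule far[OF eh])
  also have "\<dots> \<le> Q"
    unfolding Q_def using P R e \<beta> by (intro mult_left_mono power_mono) (auto simp: h_def field_simps)
  finally have m: "measure \<mu> (slab \<psi> (ball y0 (R / 2)) (R / 8)) \<le> 2 * Q" by simp
  have R2: "R / 4 + 2 * \<beta> * h = R / 2" using h(2) by simp
  have "measure \<nu> (slab \<psi> (ball y0 (R / 4)) h) \<le> k * \<beta> ^ DIM('a) / h\<^sup>2 * measure \<mu> (slab \<psi> (ball y0 (R / 2)) (R / 8))"
    using strip_caccioppoli[OF h(1), of "R / 4", unfolded R2 h(2)] R by simp
  also have "\<dots> \<le> k * \<beta> ^ DIM('a) / h\<^sup>2 * (2 * Q)"
    using m k \<beta> by (intro mult_left_mono) auto
  also have "\<dots> = energy_const k \<beta> DIM('a) N * P / R\<^sup>2"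
    using R \<beta> by (simp add: energy_const_def h_def Q_def e_def power_divide power_mult_distrib mult_ac)
  finally show ?thesis by (simp add: h_def)
qed

text \<open>Let \<open>n \<ge> 2\<close> and \<open>t\<^sup>2 * s ^ (n - 1) < energy y s\<close>.  Energy decay gives \<open>s powr \<alpha> < W\<close> with \<open>\<alpha> = n - 1 - \<eta>\<close> and
  \<open>W\<close> proportional to \<open>(p / t)\<^sup>2\<close>.  Hence the volume of the ball, of order \<open>s * s ^ (n - 1)\<close>, is at most
  \<open>W powr (1 / \<alpha>) * energy y s / t\<^sup>2\<close>, and Vitali's lemma sums the energies.  The powers of \<open>p / t\<close> add up to
  \<open>2 / \<alpha> + 2 = q\<close>; without decay, for \<open>\<eta> = 0\<close>, this would be the critical exponent \<open>2 + 2 / (n - 1)\<close>.  For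
  \<open>n = 1\<close> the threshold \<open>t\<^sup>2\<close> is free of \<open>s\<close>, so a large \<open>t\<close> is never exceeded and every \<open>q\<close> is allowed.\<close>

lemma weak_type:
  assumes p: "0 < p" and t: "0 < t" and T: "T \<in> sets borel"
    and far: "\<And>h. 0 < h \<Longrightarrow> h \<le> R \<Longrightarrow>
        measure \<mu> (slab \<psi> (ball y0 R) R - slab \<psi> (ball y0 R) h) \<le> p\<^sup>2 * R ^ (DIM('a) + 1) * (R / h) ^ N"
    and large: "\<And>y. y \<in> T \<Longrightarrow> y \<in> ball y0 (R / 8) \<and>
        (\<exists>s. 0 < s \<and> s \<le> R / (8 * \<beta>) \<and> t\<^sup>2 * s ^ (DIM('a) - 1) < energy y s)"
    and q: "0 < q" "1 < DIM('a) \<Longrightarrow> q = 2 + 2 / (real DIM('a) - 1 - \<eta>)"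
  shows "emeasure lborel T \<le> ennreal (weak_const k \<beta> M Cs DIM('a) N q * (p / t) powr q * R ^ DIM('a))"
proof (cases "T = {}")
  case False
  define n where "n = DIM('a)"
  define S where "S = R / (8 * \<beta>)"
  define Ce where "Ce = energy_const k \<beta> n N"
  have Ce: "0 < Ce" using k \<beta> strip_fraction[of N] by (simp add: Ce_def energy_const_def n_def)
  have S: "0 < S" "S \<le> R / 8" using R \<beta> by (auto simp: S_def field_simps)
  define E where "E = Ce * p\<^sup>2 * R ^ (n - 1)"
  have E: "0 < E" using Ce p R by (simp add: E_def)
  have n: "1 \<le> n" by (simp add: n_def Suc_leI)
  then have Rn: "R ^ (n + 1) = R ^ (n - 1) * R\<^sup>2" by (simp flip: power_add)
  have bound: "measure \<nu> (slab \<psi> (ball y0 (R / 4)) S) \<le> E"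
  proof -
    have "measure \<nu> (slab \<psi> (ball y0 (R / 4)) S) \<le> Ce * (p\<^sup>2 * R ^ (n + 1)) / R\<^sup>2"
      using energy_bound[OF _ far] p R by (simp add: Ce_def S_def n_def)
    also have "\<dots> = E" unfolding Rn E_def using R by simp
    finally show ?thesis .
  qed
  have sub: "ball y s \<subseteq> ball y0 (R / 4)" if "y \<in> ball y0 (R / 8)" "s \<le> S" for y s
  proof
    fix x assume "x \<in> ball y s"
    then show "x \<in> ball y0 (R / 4)" using that S dist_triangle[of y0 x y] by simp
  qed
  have eS: "energy y S \<le> E" if "y \<in> ball y0 (R / 8)" for y
    using bound \<nu>_mono[OF sub[OF that order_refl], of S S] by (simp add: energy_def)
  show ?thesis
  proof (cases "n = 1")
    case True
    obtain y where y: "y \<in> T" using False by blast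
    obtain s where s: "0 < s" "s \<le> S" "t\<^sup>2 < energy y s"
      using large[OF y] True by (auto simp: n_def S_def)
    have "t\<^sup>2 < E" using s energy_mono[OF s(2), of y] eS[of y] large[OF y] by simp
    then have tE: "1 \<le> Ce * (p / t)\<^sup>2" using True t by (simp add: E_def power_divide)
    have "1 \<le> (Ce * (p / t)\<^sup>2) powr (q / 2)" using tE q by (intro ge_one_powr_ge_zero) auto
    also have "\<dots> = Ce powr (q / 2) * (p / t) powr q"
      using p t Ce by (simp add: powr_mult powr_powr flip: powr_numeral)
    finally have one: "1 \<le> Ce powr (q / 2) * (p / t) powr q" .
    have "emeasure lborel T \<le> emeasure lborel (ball y0 (R / 8))"
      using large by (intro emeasure_mono) auto
    also have "\<dots> = ennreal (unit_ball_vol 1 * (R / 8))" using True R by (simp add: emeasure_ball n_def)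
    also have "\<dots> \<le> ennreal (unit_ball_vol 1 * R * (Ce powr (q / 2) * (p / t) powr q))"
    proof (intro ennreal_leI)
      have "unit_ball_vol 1 * (R / 8) \<le> unit_ball_vol 1 * R * 1" using R by simp
      also have "\<dots> \<le> unit_ball_vol 1 * R * (Ce powr (q / 2) * (p / t) powr q)"
        using R one by (intro mult_left_mono) auto
      finally show "unit_ball_vol 1 * (R / 8) \<le> unit_ball_vol 1 * R * (Ce powr (q / 2) * (p / t) powr q)" .
    qed
    also have "unit_ball_vol 1 * R * (Ce powr (q / 2) * (p / t) powr q) = weak_const k \<beta> M Cs DIM('a) N q * (p / t) powr q * R ^ DIM('a)"
      using True by (simp add: weak_const_def n_def Ce_def mult_ac)
    finally show ?thesis .
  next
    case False
    then have n2: "2 \<le> n" using n by simp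
    define \<alpha> where "\<alpha> = real n - 1 - \<eta>"
    have "real n \<ge> 2" using n2 by simp
    then have \<alpha>: "0 < \<alpha>" using decay_exponent by (simp add: \<alpha>_def)
    define W where "W = L powr \<eta> * S powr (- \<eta>) * E / t\<^sup>2"
    have W: "0 < W" using E S decay_ratio t by (simp add: W_def)
    define c where "c = unit_ball_vol n * 5 ^ n * W powr (1 / \<alpha>) / t\<^sup>2"
    have c: "0 \<le> c" by (simp add: c_def)
    obtain r where r: "\<And>y. y \<in> T \<Longrightarrow> 0 < r y \<and> r y \<le> S \<and> t\<^sup>2 * r y ^ (n - 1) < energy y (r y)"
      using large unfolding S_def n_def by metis
    \<comment> \<open>The energy is projected to the horizontal variable, so that it can be compared with Lebesgue measure on balls.\<close>
    define \<nu>' where "\<nu>' = distr (density \<nu> (\<lambda>x. ennreal c * indicator (slab \<psi> UNIV S) x)) borel fst"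
    have [measurable]: "fst \<in> borel_measurable (borel :: ('a \<times> real) measure)"
      by (intro borel_measurable_continuous_onI continuous_intros)
    have [measurable]: "slab \<psi> UNIV S \<in> sets borel" by (intro slab_sets) simp
    have \<nu>': "emeasure \<nu>' A = ennreal (c * measure \<nu> (slab \<psi> A S))" if [measurable]: "A \<in> sets borel" for A
    proof -
      have sp: "space \<nu> = UNIV" using sets_eq_imp_space_eq[OF sets\<nu>] by simp
      have "emeasure \<nu>' A = emeasure (density \<nu> (\<lambda>x. ennreal c * indicator (slab \<psi> UNIV S) x)) (fst -` A)"
        unfolding \<nu>'_def by (subst emeasure_distr) (auto simp: sp)
      also have "\<dots> = (\<integral>\<^sup>+x. ennreal c * indicator (slab \<psi> UNIV S) x * indicator (fst -` A) x \<partial>\<nu>)"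
      proof (rule emeasure_density)
        have "fst -` A \<inter> space (borel :: ('a \<times> real) measure) \<in> sets borel" by measurable
        then show "fst -` A \<in> sets \<nu>" by simp
      qed measurable
      also have "\<dots> = (\<integral>\<^sup>+x. ennreal c * indicator (slab \<psi> A S) x \<partial>\<nu>)"
        by (intro nn_integral_cong) (auto simp: indicator_def slab_def)
      also have "\<dots> = ennreal c * emeasure \<nu> (slab \<psi> A S)"
        by (intro nn_integral_cmult_indicator) (simp add: slab_sets that)
      finally show ?thesis using c by (simp add: \<nu>.emeasure_eq_measure ennreal_mult)
    qed
    have "emeasure lborel T \<le> emeasure \<nu>' (ball y0 (R / 4))"
    proof (rule vitali_comparison[of lborel \<nu>' T r S])
      fix y assume y: "y \<in> T"
      note ry = r[OF y]
      have yB: "y \<in> ball y0 (R / 8)" using large[OF y] by blast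
      show "0 < r y \<and> r y \<le> S" using ry by blast
      show "ball y (r y) \<subseteq> ball y0 (R / 4)" using sub[OF yB] ry by blast
      have "t\<^sup>2 * r y ^ (n - 1) < L powr \<eta> * (r y / S) powr \<eta> * energy y S"
      proof -
        have "ball y S \<subseteq> ball y0 R" using sub[OF yB order_refl] subset_ball[of "R / 4" R y0] R by auto
        then show ?thesis using energy_decay[of "r y" S y] ry S R by simp
      qed
      also have "\<dots> \<le> L powr \<eta> * (r y / S) powr \<eta> * E"
        using eS[OF yB] by (intro mult_left_mono) auto
      also have "\<dots> = W * t\<^sup>2 * r y powr \<eta>"
        using ry S t by (simp add: W_def powr_divide powr_minus_divide)
      finally have "r y ^ (n - 1) < W * r y powr \<eta>" using t by (simp add: mult_ac)
      moreover have "r y ^ (n - 1) = r y powr \<alpha> * r y powr \<eta>"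
      proof -
        have "r y ^ (n - 1) = r y powr (real (n - 1))" using ry by (simp add: powr_realpow)
        also have "real (n - 1) = \<alpha> + \<eta>" using n by (simp add: \<alpha>_def of_nat_diff)
        finally show ?thesis by (simp add: powr_add)
      qed
      ultimately have "r y powr \<alpha> < W" using ry by simp
      then have "(r y powr \<alpha>) powr (1 / \<alpha>) \<le> W powr (1 / \<alpha>)" using \<alpha> by (intro powr_mono2) auto
      then have rW: "r y \<le> W powr (1 / \<alpha>)" using ry \<alpha> by (simp add: powr_powr)
      have "emeasure lborel (ball y (5 * r y)) = ennreal (unit_ball_vol n * (5 * r y) ^ n)"
        using ry by (simp add: emeasure_ball n_def)
      also have "\<dots> \<le> ennreal (c * measure \<nu> (slab \<psi> (ball y (r y)) S))"
      proof (intro ennreal_leI)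
        have "(5 * r y) ^ n = 5 ^ n * (r y * r y ^ (n - 1))"
          using n power_minus_mult[of n "r y"] by (simp add: power_mult_distrib mult.commute)
        also have "r y * r y ^ (n - 1) \<le> W powr (1 / \<alpha>) * (energy y (r y) / t\<^sup>2)"
          using rW ry t by (intro mult_mono) (auto simp: field_simps)
        also have "energy y (r y) \<le> measure \<nu> (slab \<psi> (ball y (r y)) S)"
          unfolding energy_def using ry by (intro \<nu>_mono) auto
        finally have "(5 * r y) ^ n \<le> 5 ^ n * (W powr (1 / \<alpha>) * (measure \<nu> (slab \<psi> (ball y (r y)) S) / t\<^sup>2))"
          using t by (simp add: divide_right_mono mult_left_mono)
        then have "unit_ball_vol n * (5 * r y) ^ n \<le> unit_ball_vol n * (5 ^ n * (W powr (1 / \<alpha>) * (measure \<nu> (slab \<psi> (ball y (r y)) S) / t\<^sup>2)))"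
          by (intro mult_left_mono) auto
        then show "unit_ball_vol n * (5 * r y) ^ n \<le> c * measure \<nu> (slab \<psi> (ball y (r y)) S)"
          by (simp add: c_def mult_ac)
      qed
      also have "\<dots> = emeasure \<nu>' (ball y (r y))" by (simp add: \<nu>')
      finally show "emeasure lborel (ball y (5 * r y)) \<le> emeasure \<nu>' (ball y (r y))" .
    qed (auto simp: \<nu>'_def)
    also have "\<dots> \<le> ennreal (c * E)"
      using bound c by (simp add: \<nu>' ennreal_leI mult_left_mono)
    also have "c * E = weak_const k \<beta> M Cs DIM('a) N q * (p / t) powr q * R ^ DIM('a)"
    proof -
      define B where "B = L powr \<eta> * (8 * \<beta>) powr \<eta> * Ce"
      have B: "0 < B" using decay_ratio \<beta> Ce by (simp add: B_def)
      have "S powr (- \<eta>) = (8 * \<beta>) powr \<eta> * R powr (- \<eta>)"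
        using R \<beta> by (simp add: S_def powr_divide powr_minus_divide)
      moreover have "R ^ (n - 1) * R powr (- \<eta>) = R powr \<alpha>"
      proof -
        have "R ^ (n - 1) = R powr (real (n - 1))" using R by (simp add: powr_realpow)
        also have "real (n - 1) = \<alpha> + \<eta>" using n by (simp add: \<alpha>_def of_nat_diff)
        finally show ?thesis by (simp flip: powr_add)
      qed
      ultimately have "W = B * (p / t)\<^sup>2 * R powr \<alpha>"
        by (simp add: W_def B_def E_def power_divide mult_ac)
      then have "W powr (1 / \<alpha>) = B powr (1 / \<alpha>) * ((p / t)\<^sup>2) powr (1 / \<alpha>) * R"
        using B p t R \<alpha> by (simp add: powr_mult powr_powr)
      also have "((p / t)\<^sup>2) powr (1 / \<alpha>) = (p / t) powr (2 / \<alpha>)"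
        using p t by (simp add: powr_powr flip: powr_numeral)
      finally have W': "W powr (1 / \<alpha>) = B powr (1 / \<alpha>) * (p / t) powr (2 / \<alpha>) * R" .
      have q': "q = 2 + 2 / \<alpha>" using q(2) n2 by (simp add: n_def \<alpha>_def)
      have "(p / t) powr q = (p / t)\<^sup>2 * (p / t) powr (2 / \<alpha>)"
        unfolding q' powr_add using p t by simp
      moreover have "R ^ n = R * R ^ (n - 1)" using n power_minus_mult[of n R] by (simp add: mult.commute)
      moreover have "weak_const k \<beta> M Cs DIM('a) N q = unit_ball_vol n * 5 ^ n * Ce * B powr (1 / \<alpha>)"
        using \<open>n \<noteq> 1\<close> unfolding weak_const_def n_def[symmetric] by (simp add: B_def Ce_def \<alpha>_def)
      ultimately show ?thesis
        unfolding n_def[symmetric] c_def W' E_def by (simp add: power_divide mult_ac)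
    qed
    finally show ?thesis .
  qed
qed simp

end

section \<open>Smooth functions and cutoffs\<close>

lemma C_k_continuous: "C_k k f \<Longrightarrow> continuous_on UNIV f"
  by (cases k) (auto simp: continuous_on_eq_continuous_at intro: differentiable_imp_continuous_within)

lemma C_k_Suc_imp: "C_k (Suc k) f \<Longrightarrow> C_k k f"
proof (induction k arbitrary: f)
  case 0
  then show ?case using C_k_continuous[of "Suc 0" f] by simp
next
  case (Suc k)
  then show ?case by (metis C_k.simps(2))
qed

lemma C_k_SucI:
  assumes "\<And>x. (f has_derivative f' x) (at x)" "\<And>e. e \<in> Basis \<Longrightarrow> C_k k (\<lambda>x. f' x e)"
  shows "C_k (Suc k) f"
proof -
  have "(\<lambda>x. frechet_derivative f (at x) e) = (\<lambda>x. f' x e)" for e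
    using frechet_derivative_at[OF assms(1)] by metis
  then show ?thesis using assms by (auto simp: differentiable_def)
qed

lemma C_k_SucD:
  assumes "C_k (Suc k) f"
  shows "(f has_derivative frechet_derivative f (at x)) (at x)"
    and "e \<in> Basis \<Longrightarrow> C_k k (\<lambda>x. frechet_derivative f (at x) e)"
  using assms by (auto simp: frechet_derivative_works)

lemma C_k_const: "C_k k (\<lambda>x. c)"
proof (induction k arbitrary: c)
  case (Suc k)
  show ?case by (rule C_k_SucI[where f'="\<lambda>_ _. 0"]) (auto intro: Suc)
qed simp

lemma C_k_add: "C_k k f \<Longrightarrow> C_k k g \<Longrightarrow> C_k k (\<lambda>x. f x + g x)"
proof (induction k arbitrary: f g)
  case (Suc k)
  show ?case
    by (rule C_k_SucI[where f'="\<lambda>x h. frechet_derivative f (at x) h + frechet_derivative g (at x) h"])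
       (use C_k_SucD[OF Suc.prems(1)] C_k_SucD[OF Suc.prems(2)] in \<open>auto intro!: has_derivative_add Suc.IH\<close>)
qed (auto intro: continuous_on_add)

lemma C_k_scaleR: "C_k k f \<Longrightarrow> C_k k g \<Longrightarrow> C_k k (\<lambda>x. f x *\<^sub>R g x)"
proof (induction k arbitrary: f g)
  case (Suc k)
  show ?case
  proof (rule C_k_SucI[where f'="\<lambda>x h. f x *\<^sub>R frechet_derivative g (at x) h + frechet_derivative f (at x) h *\<^sub>R g x"])
    show "((\<lambda>x. f x *\<^sub>R g x) has_derivative (\<lambda>h. f x *\<^sub>R frechet_derivative g (at x) h + frechet_derivative f (at x) h *\<^sub>R g x)) (at x)" for x
      by (intro has_derivative_scaleR C_k_SucD(1)[OF Suc.prems(1)] C_k_SucD(1)[OF Suc.prems(2)])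
    fix e :: 'a assume "e \<in> Basis"
    then show "C_k k (\<lambda>x. f x *\<^sub>R frechet_derivative g (at x) e + frechet_derivative f (at x) e *\<^sub>R g x)"
      by (intro C_k_add Suc.IH C_k_SucD(2)[OF Suc.prems(1)] C_k_SucD(2)[OF Suc.prems(2)]
          C_k_Suc_imp[OF Suc.prems(1)] C_k_Suc_imp[OF Suc.prems(2)])
  qed
qed (auto intro: continuous_on_scaleR)

lemma C_k_diff:
  assumes "C_k k f" "C_k k g" shows "C_k k (\<lambda>x. f x - g x)"
  using C_k_add[OF assms(1) C_k_scaleR[OF C_k_const[of k "-1"] assms(2)]] by simp

text \<open>The function \<open>G j\<close> is the \<open>j\<close>-th derivative of \<open>G 0\<close>; having all of them at hand makes the chain rule
  iterable.\<close>

lemma C_k_compose_real: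
  fixes G :: "nat \<Rightarrow> real \<Rightarrow> real" and N :: "'a::euclidean_space \<Rightarrow> real"
  assumes G: "\<And>j t. (G j has_real_derivative G (Suc j) t) (at t)" and N: "smooth N"
  shows "C_k k (\<lambda>x. G j (N x))"
proof (induction k arbitrary: j)
  case 0
  have "continuous_on UNIV (G j)" using G by (meson DERIV_isCont continuous_at_imp_continuous_on)
  moreover have "continuous_on UNIV N" using N C_k_continuous unfolding smooth_def by blast
  ultimately show ?case using continuous_on_compose2[of UNIV "G j" UNIV N] by auto
next
  case (Suc k)
  have N1: "C_k (Suc k) N" using N by (simp add: smooth_def)
  show ?case
  proof (rule C_k_SucI[where f'="\<lambda>x h. G (Suc j) (N x) *\<^sub>R frechet_derivative N (at x) h"])
    show "((\<lambda>x. G j (N x)) has_derivative (\<lambda>h. G (Suc j) (N x) *\<^sub>R frechet_derivative N (at x) h)) (at x)" for x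
      using has_derivative_compose[OF C_k_SucD(1)[OF N1], of "G j" "\<lambda>h. G (Suc j) (N x) * h" x] G[of j "N x"]
      by (simp add: has_field_derivative_def)
    show "C_k k (\<lambda>x. G (Suc j) (N x) *\<^sub>R frechet_derivative N (at x) e)" if "e \<in> Basis" for e
      by (intro C_k_scaleR Suc C_k_SucD(2)[OF N1] that)
  qed
qed

lemma smooth_const: "smooth (\<lambda>x. c)" by (simp add: smooth_def C_k_const)
lemma smooth_diff: "smooth f \<Longrightarrow> smooth g \<Longrightarrow> smooth (\<lambda>x. f x - g x)" by (simp add: smooth_def C_k_diff)
lemma smooth_scaleR: "smooth f \<Longrightarrow> smooth g \<Longrightarrow> smooth (\<lambda>x. f x *\<^sub>R g x)" by (simp add: smooth_def C_k_scaleR)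

lemma smooth_continuous: "smooth f \<Longrightarrow> continuous_on UNIV f"
  using C_k_continuous unfolding smooth_def by blast

lemma smooth_has_derivative: "smooth f \<Longrightarrow> (f has_derivative frechet_derivative f (at x)) (at x)"
  using C_k_SucD(1)[of 0 f x] unfolding smooth_def by blast

lemma smooth_partial: "smooth f \<Longrightarrow> e \<in> Basis \<Longrightarrow> smooth (\<lambda>x. frechet_derivative f (at x) e)"
  unfolding smooth_def using C_k_SucD(2) by blast

lemma frechet_derivative_smooth_diff:
  assumes "smooth f" "smooth g"
  shows "frechet_derivative (\<lambda>x. f x - g x) (at x) e = frechet_derivative f (at x) e - frechet_derivative g (at x) e"
  using frechet_derivative_at[OF has_derivative_diff[OF smooth_has_derivative[OF assms(1)] smooth_has_derivative[OF assms(2)]], of x]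
  by metis

lemma smooth_norm_sq: "smooth (\<lambda>x::'a::euclidean_space. (x - z) \<bullet> (x - z))"
proof -
  have lin: "C_k k (\<lambda>x. (x - z) \<bullet> e)" for k and e :: 'a
  proof (cases k)
    case 0 then show ?thesis by (auto intro!: continuous_intros)
  next
    case (Suc m)
    show ?thesis unfolding Suc
      by (rule C_k_SucI[where f'="\<lambda>_ h. h \<bullet> e"]) (auto intro!: derivative_eq_intros C_k_const)
  qed
  have "C_k k (\<lambda>x. (x - z) \<bullet> (x - z))" for k
  proof (cases k)
    case 0 then show ?thesis by (auto intro!: continuous_intros)
  next
    case (Suc m)
    show ?thesis unfolding Suc
    proof (rule C_k_SucI[where f'="\<lambda>x h. 2 *\<^sub>R ((x - z) \<bullet> h)"])
      show "((\<lambda>x. (x - z) \<bullet> (x - z)) has_derivative (\<lambda>h. 2 *\<^sub>R ((x - z) \<bullet> h))) (at x)" for x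
        by (auto intro!: derivative_eq_intros simp: inner_commute)
      show "C_k m (\<lambda>x. 2 *\<^sub>R ((x - z) \<bullet> e))" for e by (intro C_k_scaleR C_k_const lin)
    qed
  qed
  then show ?thesis by (simp add: smooth_def)
qed

fun flat_poly :: "nat \<Rightarrow> real poly" where
  "flat_poly 0 = 1"
| "flat_poly (Suc j) = [:0, 0, 1:] * (flat_poly j - pderiv (flat_poly j))"

text \<open>The \<open>j\<close>-th derivative of the function \<open>exp (- 1 / t)\<close>, continued by \<open>0\<close> to \<open>t \<le> 0\<close>: each one is a
  polynomial in \<open>1 / t\<close> times the exponential.\<close>

definition flat :: "nat \<Rightarrow> real \<Rightarrow> real" where
  "flat j t = (if t \<le> 0 then 0 else poly (flat_poly j) (1 / t) * exp (- 1 / t))"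

lemma poly_exp_decay: "((\<lambda>x. poly p x * exp (- x)) \<longlongrightarrow> (0::real)) at_top"
proof -
  have "(\<lambda>x. poly p x * exp (- x)) = (\<lambda>x. \<Sum>i\<le>degree p. coeff p i * (x ^ i / exp x))"
    by (auto simp: poly_altdef sum_distrib_right exp_minus divide_inverse mult.assoc)
  moreover have "((\<lambda>x. \<Sum>i\<le>degree p. coeff p i * (x ^ i / exp x)) \<longlongrightarrow> (\<Sum>i\<le>degree p. coeff p i * 0)) at_top"
    by (intro tendsto_sum tendsto_mult_left tendsto_power_div_exp_0)
  ultimately show ?thesis by simp
qed

lemma flat_derivative: "(flat j has_real_derivative flat (Suc j) t) (at t)"
proof -
  consider "t < 0" | "t = 0" | "0 < t" by linarith
  then show ?thesis
  proof cases
    case 1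
    have "((\<lambda>_. 0) has_real_derivative 0) (at t)" by simp
    then have "(flat j has_real_derivative 0) (at t)"
      by (rule has_field_derivative_transform_within_open[of _ _ _ "{..<0}"]) (use 1 in \<open>auto simp: flat_def\<close>)
    then show ?thesis using 1 by (simp add: flat_def)
  next
    case 2
    have "((\<lambda>h. flat j h / h) \<longlongrightarrow> 0) (at_left 0)"
      by (rule tendsto_eventually) (auto simp: eventually_at_filter flat_def)
    moreover have "((\<lambda>h. flat j h / h) \<longlongrightarrow> 0) (at_right 0)"
    proof -
      have "((\<lambda>h. poly ([:0, 1:] * flat_poly j) (inverse h) * exp (- inverse h)) \<longlongrightarrow> 0) (at_right 0)"
        by (rule filterlim_compose[OF poly_exp_decay filterlim_inverse_at_top_right])
      then show ?thesis
        by (rule Lim_transform_eventually)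
           (auto simp: eventually_at_filter flat_def divide_inverse mult_ac)
    qed
    ultimately have "((\<lambda>h. flat j h / h) \<longlongrightarrow> 0) (at 0)" by (simp add: filterlim_at_split)
    then have "(flat j has_real_derivative 0) (at 0)"
      by (simp add: has_field_derivative_iff flat_def)
    then show ?thesis using 2 by (simp add: flat_def)
  next
    case 3
    have "((\<lambda>t. poly (flat_poly j) (1 / t) * exp (- 1 / t)) has_real_derivative flat (Suc j) t) (at t)"
      using 3 by (auto intro!: derivative_eq_intros DERIV_chain2[OF poly_DERIV] simp: flat_def power2_eq_square field_simps)
    then show ?thesis
      by (rule has_field_derivative_transform_within_open[of _ _ _ "{0<..}"]) (use 3 in \<open>auto simp: flat_def\<close>)
  qed
qed

lemma smooth_flat: "smooth N \<Longrightarrow> smooth (\<lambda>x. flat 0 (N x))"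
  using C_k_compose_real[of flat N] flat_derivative by (simp add: smooth_def)

lemma flat_0: "flat 0 t = (if t \<le> 0 then 0 else exp (- 1 / t))"
  by (simp add: flat_def)

lemma flat_nonneg: "0 \<le> flat 0 t" and flat_le_mono: "s \<le> t \<Longrightarrow> flat 0 s \<le> flat 0 t"
  by (auto simp: flat_0 frac_le)

text \<open>Two compositions with \<open>flat 0\<close>.  The quadratic function \<open>N\<close> is at least \<open>1\<close> on the inner ball and at most
  \<open>0\<close> outside the outer one; \<open>N2\<close> is at most \<open>0\<close> on the inner ball and constant outside the outer one, so
  one minus a normalized \<open>flat 0 \<circ> N2\<close> is the cutoff.\<close>

lemma cutoff_exists:
  fixes z :: "'a::euclidean_space" and r :: real
  assumes r: "0 < r"
  obtains \<phi> :: "'a \<Rightarrow> real" where "smooth \<phi>" "\<And>x. x \<in> ball z r \<Longrightarrow> \<phi> x = 1"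
    "\<And>x. x \<notin> ball z (2 * r) \<Longrightarrow> \<phi> x = 0" "\<And>x. 0 \<le> \<phi> x \<and> \<phi> x \<le> 1"
proof
  define N where "N x = 2 - (1 / r\<^sup>2) *\<^sub>R ((x - z) \<bullet> (x - z))" for x
  define N2 where "N2 x = exp (-1) - flat 0 (N x)" for x
  define \<phi> where "\<phi> x = 1 - (1 / flat 0 (exp (-1))) *\<^sub>R flat 0 (N2 x)" for x
  have "smooth N" unfolding N_def by (intro smooth_diff smooth_scaleR smooth_const smooth_norm_sq)
  then have "smooth N2" unfolding N2_def by (intro smooth_diff smooth_const smooth_flat)
  then show "smooth \<phi>" unfolding \<phi>_def by (intro smooth_diff smooth_const smooth_flat smooth_scaleR)
  have e: "0 < flat 0 (exp (-1))" by (simp add: flat_0)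
  have Nx: "N x = 2 - (dist z x)\<^sup>2 / r\<^sup>2" for x
    by (simp add: N_def dist_norm power2_norm_eq_inner norm_minus_commute[of z])
  show "\<phi> x = 1" if "x \<in> ball z r" for x
  proof -
    have "(dist z x)\<^sup>2 \<le> r\<^sup>2" using that by (intro power_mono) auto
    then have "1 \<le> N x" using r by (simp add: Nx)
    then have "flat 0 1 \<le> flat 0 (N x)" by (rule flat_le_mono)
    then have "N2 x \<le> 0" by (simp add: N2_def flat_0)
    then show ?thesis by (simp add: \<phi>_def flat_0)
  qed
  show "\<phi> x = 0" if "x \<notin> ball z (2 * r)" for x
  proof -
    have "(2 * r)\<^sup>2 \<le> (dist z x)\<^sup>2" using that r by (intro power_mono) auto
    then have "4 * r\<^sup>2 \<le> (dist z x)\<^sup>2" by (simp add: power_mult_distrib)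
    moreover have "0 < r\<^sup>2" using r by simp
    ultimately have "2 * r\<^sup>2 \<le> (dist z x)\<^sup>2" by linarith
    then have "N x \<le> 0" using r by (simp add: Nx field_simps)
    then have "N2 x = exp (-1)" by (simp add: N2_def flat_0)
    then show ?thesis using e by (simp add: \<phi>_def)
  qed
  show "0 \<le> \<phi> x \<and> \<phi> x \<le> 1" for x
  proof -
    have "flat 0 (N2 x) \<le> flat 0 (exp (-1))" by (intro flat_le_mono) (simp add: N2_def flat_nonneg)
    then show ?thesis using e flat_nonneg[of "N2 x"] by (simp add: \<phi>_def)
  qed
qed

lemma test_functions_cutoff:
  assumes \<phi>: "smooth \<phi>" and f: "f \<in> test_functions UNIV"
  shows "(\<lambda>x. \<phi> x *\<^sub>R f x) \<in> test_functions UNIV"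
proof -
  have "closure {x. \<phi> x *\<^sub>R f x \<noteq> 0} \<subseteq> closure {x. f x \<noteq> 0}" by (intro closure_mono) auto
  then have "compact (closure {x. \<phi> x *\<^sub>R f x \<noteq> 0})"
    using f by (metis (mono_tags, lifting) closed_Int_compact closed_closure inf.absorb_iff1 mem_Collect_eq test_functions_def)
  then show ?thesis using \<phi> f by (auto simp: test_functions_def intro: smooth_scaleR)
qed

section \<open>Differences of weak solutions\<close>

lemma test_function_derivative_outside:
  assumes "\<phi> \<in> test_functions D" "x \<notin> closure {x. \<phi> x \<noteq> 0}"
  shows "frechet_derivative \<phi> (at x) e = 0"
proof -
  have "((\<lambda>_. 0) has_derivative (\<lambda>_. 0)) (at x)" by simp
  then have "(\<phi> has_derivative (\<lambda>_. 0)) (at x)"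
  proof (rule has_derivative_transform_within_open[of _ _ _ _ "- closure {x. \<phi> x \<noteq> 0}"])
    show "0 = \<phi> y" if "y \<in> - closure {x. \<phi> x \<noteq> 0}" for y
      using that closure_subset[of "{x. \<phi> x \<noteq> 0}"] by auto
  qed (use assms in auto)
  then show ?thesis using frechet_derivative_at by metis
qed

lemma set_integrable_continuous_scaleR:
  fixes u :: "'a::euclidean_space \<Rightarrow> 'b::euclidean_space"
  assumes u: "loc_integrable D u" and K: "compact K" "K \<subseteq> D"
    and c: "continuous_on UNIV c" "\<And>x. x \<notin> K \<Longrightarrow> c x = 0"
  shows "set_integrable lebesgue D (\<lambda>x. c x *\<^sub>R u x)"
proof -
  have "compact (c ` K)" using c(1) K(1) by (intro compact_continuous_image) (auto intro: continuous_on_subset)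
  then obtain B where B: "\<And>x. x \<in> K \<Longrightarrow> \<bar>c x\<bar> \<le> B"
    by (meson bounded_real compact_imp_bounded image_eqI)
  have B': "\<bar>c x\<bar> \<le> max B 0" for x using B[of x] c(2)[of x] by (cases "x \<in> K") auto
  have uK: "integrable lebesgue (\<lambda>x. indicator K x *\<^sub>R u x)"
    using u K unfolding loc_integrable_def set_integrable_def by blast
  have cm: "c \<in> borel_measurable lebesgue"
    using borel_measurable_continuous_onI[OF c(1)] by (simp add: measurable_completion)
  have eq: "(\<lambda>x. indicator D x *\<^sub>R (c x *\<^sub>R u x)) = (\<lambda>x. c x *\<^sub>R (indicator K x *\<^sub>R u x))"
    using K(2) c(2) by (auto simp: indicator_def fun_eq_iff)
  have "integrable lebesgue (\<lambda>x. c x *\<^sub>R (indicator K x *\<^sub>R u x))"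
  proof (rule Bochner_Integration.integrable_bound)
    show "integrable lebesgue (\<lambda>x. max B 0 *\<^sub>R (indicator K x *\<^sub>R u x))" by (intro integrable_scaleR_right impI uK)
    show "(\<lambda>x. c x *\<^sub>R (indicator K x *\<^sub>R u x)) \<in> borel_measurable lebesgue"
      using cm borel_measurable_integrable[OF uK] by (rule borel_measurable_scaleR)
    show "AE x in lebesgue. norm (c x *\<^sub>R (indicator K x *\<^sub>R u x)) \<le> norm (max B 0 *\<^sub>R (indicator K x *\<^sub>R u x))"
    proof (intro AE_I2)
      fix x show "norm (c x *\<^sub>R (indicator K x *\<^sub>R u x)) \<le> norm (max B 0 *\<^sub>R (indicator K x *\<^sub>R u x))"
        unfolding norm_scaleR using B'[of x] by (intro mult_right_mono) auto
    qed
  qed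
  then show ?thesis unfolding set_integrable_def eq .
qed

lemma test_function_integrable:
  fixes u :: "'a::euclidean_space \<Rightarrow> 'b::euclidean_space" and \<phi> :: "'a \<Rightarrow> real"
  assumes u: "loc_integrable D u" and \<phi>: "\<phi> \<in> test_functions D"
  shows "set_integrable lebesgue D (\<lambda>x. \<phi> x *\<^sub>R u x)"
    and "e \<in> Basis \<Longrightarrow> set_integrable lebesgue D (\<lambda>x. frechet_derivative \<phi> (at x) e *\<^sub>R u x)"
proof -
  let ?K = "closure {x. \<phi> x \<noteq> 0}"
  have K: "compact ?K" "?K \<subseteq> D" and s: "smooth \<phi>" using \<phi> by (auto simp: test_functions_def)
  have out: "\<phi> x = 0" if "x \<notin> ?K" for x using that closure_subset[of "{x. \<phi> x \<noteq> 0}"] by auto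
  show "set_integrable lebesgue D (\<lambda>x. \<phi> x *\<^sub>R u x)"
    by (rule set_integrable_continuous_scaleR[OF u K smooth_continuous[OF s] out])
  show "set_integrable lebesgue D (\<lambda>x. frechet_derivative \<phi> (at x) e *\<^sub>R u x)" if "e \<in> Basis"
    by (rule set_integrable_continuous_scaleR[OF u K smooth_continuous[OF smooth_partial[OF s that]]
          test_function_derivative_outside[OF \<phi>]])
qed

lemma set_integral_restrict:
  assumes "\<And>x. x \<notin> D' \<Longrightarrow> f x = 0" "D' \<subseteq> D"
  shows "(LINT x:D|M. f x) = (LINT x:D'|M. f x)"
  unfolding set_lebesgue_integral_def
  by (intro Bochner_Integration.integral_cong) (use assms in \<open>auto simp: indicator_def\<close>)

lemma test_functions_mono: "D' \<subseteq> D \<Longrightarrow> test_functions D' \<subseteq> test_functions D"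
  by (auto simp: test_functions_def)

lemma test_function_outside:
  assumes "\<phi> \<in> test_functions D" "x \<notin> D"
  shows "\<phi> x = 0" "frechet_derivative \<phi> (at x) e = 0"
proof -
  have "x \<notin> closure {x. \<phi> x \<noteq> 0}" using assms by (auto simp: test_functions_def)
  then show "\<phi> x = 0" "frechet_derivative \<phi> (at x) e = 0"
    using closure_subset[of "{x. \<phi> x \<noteq> 0}"] test_function_derivative_outside[OF assms(1)] by auto
qed

lemma loc_integrable_diff: "loc_integrable D u \<Longrightarrow> loc_integrable D v \<Longrightarrow> loc_integrable D (\<lambda>x. u x - v x)"
  unfolding loc_integrable_def using set_integral_diff(1) by blast

lemma loc_integrable_mono: "loc_integrable D u \<Longrightarrow> D' \<subseteq> D \<Longrightarrow> loc_integrable D' u"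
  unfolding loc_integrable_def by blast

lemma norm_add_sq_le: "(norm (a + b))\<^sup>2 \<le> 2 * (norm a)\<^sup>2 + 2 * (norm b)\<^sup>2"
proof -
  have "(norm (a + b))\<^sup>2 \<le> (norm a + norm b)\<^sup>2" by (intro power_mono norm_triangle_ineq) auto
  also have "\<dots> \<le> 2 * (norm a)\<^sup>2 + 2 * (norm b)\<^sup>2"
    using sum_squares_bound[of "norm a" "norm b"] by (simp add: power2_sum)
  finally show ?thesis .
qed

lemma norm_diff_sq_le: "(norm (a - b))\<^sup>2 \<le> 2 * (norm a)\<^sup>2 + 2 * (norm b)\<^sup>2"
  using norm_add_sq_le[of a "- b"] by simp

lemma square_integrable_diff:
  fixes u v :: "'a::euclidean_space \<Rightarrow> 'b::euclidean_space"
  assumes u: "square_integrable D u" and v: "square_integrable D v"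
  shows "square_integrable D (\<lambda>x. u x - v x)"
proof -
  have [measurable]: "u \<in> borel_measurable (lebesgue_on D)" "v \<in> borel_measurable (lebesgue_on D)"
    using assms by (auto simp: square_integrable_def)
  have "integrable (lebesgue_on D) (\<lambda>x. (norm (u x - v x))\<^sup>2)"
  proof (rule Bochner_Integration.integrable_bound)
    show "integrable (lebesgue_on D) (\<lambda>x. 2 * (norm (u x))\<^sup>2 + 2 * (norm (v x))\<^sup>2)"
      using assms by (auto simp: square_integrable_def)
    show "AE x in lebesgue_on D. norm ((norm (u x - v x))\<^sup>2) \<le> norm (2 * (norm (u x))\<^sup>2 + 2 * (norm (v x))\<^sup>2)"
    proof (intro AE_I2)
      fix x
      show "norm ((norm (u x - v x))\<^sup>2) \<le> norm (2 * (norm (u x))\<^sup>2 + 2 * (norm (v x))\<^sup>2)"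
        using norm_diff_sq_le[of "u x" "v x"] by simp
    qed
  qed measurable
  then show ?thesis by (simp add: square_integrable_def)
qed

lemma weak_partial_diff:
  fixes u v :: "'a::euclidean_space \<Rightarrow> 'b::euclidean_space"
  assumes e: "e \<in> Basis" and u: "weak_partial D e u g" and v: "weak_partial D e v h"
  shows "weak_partial D e (\<lambda>x. u x - v x) (\<lambda>x. g x - h x)"
  unfolding weak_partial_def
proof (intro conjI allI impI)
  have l: "loc_integrable D u" "loc_integrable D v" "loc_integrable D g" "loc_integrable D h"
    using u v by (auto simp: weak_partial_def)
  then show "loc_integrable D (\<lambda>x. u x - v x)" "loc_integrable D (\<lambda>x. g x - h x)"
    by (auto intro: loc_integrable_diff)
  fix \<phi> :: "'a \<Rightarrow> real" assume \<phi>: "\<phi> \<in> test_functions D"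
  show "(LINT x:D|lebesgue. frechet_derivative \<phi> (at x) e *\<^sub>R (u x - v x)) = - (LINT x:D|lebesgue. \<phi> x *\<^sub>R (g x - h x))"
    using u v \<phi> l e
    by (simp add: scaleR_diff_right set_integral_diff(2) test_function_integrable weak_partial_def)
qed

lemma weak_partial_restrict:
  fixes u :: "'a::euclidean_space \<Rightarrow> 'b::euclidean_space"
  assumes u: "weak_partial D e u g" and D: "D' \<subseteq> D"
  shows "weak_partial D' e u g"
  unfolding weak_partial_def
proof (intro conjI allI impI)
  show "loc_integrable D' u" "loc_integrable D' g"
    using u D by (auto simp: weak_partial_def intro: loc_integrable_mono)
  fix \<phi> :: "'a \<Rightarrow> real" assume \<phi>: "\<phi> \<in> test_functions D'"
  then have "\<phi> \<in> test_functions D" using test_functions_mono[OF D] by blast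
  then show "(LINT x:D'|lebesgue. frechet_derivative \<phi> (at x) e *\<^sub>R u x) = - (LINT x:D'|lebesgue. \<phi> x *\<^sub>R g x)"
    using u test_function_outside[OF \<phi>] set_integral_restrict[OF _ D, of "\<lambda>x. frechet_derivative \<phi> (at x) e *\<^sub>R u x" lebesgue]
      set_integral_restrict[OF _ D, of "\<lambda>x. \<phi> x *\<^sub>R g x" lebesgue]
    by (simp add: weak_partial_def)
qed

lemma W12_diff:
  assumes "W12 D u G" "W12 D v H"
  shows "W12 D (\<lambda>x. u x - v x) (\<lambda>e x. G e x - H e x)"
  using assms by (auto simp: W12_def intro: square_integrable_diff weak_partial_diff)

text \<open>Linearity, combined with restriction to a smaller set: in divergence form test functions of \<open>D'\<close> are test
  functions of \<open>D\<close>, and otherwise the second derivatives are restricted.\<close>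

lemma weak_equation_diff:
  fixes \<L> :: "('a::euclidean_space, 'm::finite) elliptic_op"
  assumes u: "weak_equation \<L> D u G" and v: "weak_equation \<L> D v H"
    and D: "D' \<subseteq> D" "D \<in> sets lebesgue" "D' \<in> sets lebesgue"
  shows "weak_equation \<L> D' (\<lambda>x. u x - v x) (\<lambda>e x. G e x - H e x)"
proof (cases \<L>)
  case (DivForm A V B c)
  define F where "F w K i x = (\<Sum>j\<in>Basis. A i j x *v K j x) + V i x *v w x" for w :: "'a \<Rightarrow> complex ^ 'm" and K i x
  define h where "h w K x = (\<Sum>i\<in>Basis. B i x *v K i x) + c x *v w x" for w :: "'a \<Rightarrow> complex ^ 'm" and K x
  let ?w = "\<lambda>x. u x - v x" and ?K = "\<lambda>e x. G e x - H e x"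
  have F: "F ?w ?K i x = F u G i x - F v H i x" for i x
    by (simp add: F_def matrix_vector_mult_diff_distrib sum_subtractf)
  have h: "h ?w ?K x = h u G x - h v H x" for x
    by (simp add: h_def matrix_vector_mult_diff_distrib sum_subtractf)
  have l: "\<And>i. i \<in> Basis \<Longrightarrow> loc_integrable D (F u G i)" "loc_integrable D (h u G)"
     "\<And>i. i \<in> Basis \<Longrightarrow> loc_integrable D (F v H i)" "loc_integrable D (h v H)"
    using u v by (auto simp: DivForm F_def[abs_def] h_def[abs_def])
  have eq: "(LINT x:D|lebesgue. (\<Sum>i\<in>Basis. frechet_derivative \<phi> (at x) i *\<^sub>R F u G i x) + \<phi> x *\<^sub>R h u G x) = 0"
     "(LINT x:D|lebesgue. (\<Sum>i\<in>Basis. frechet_derivative \<phi> (at x) i *\<^sub>R F v H i x) + \<phi> x *\<^sub>R h v H x) = 0"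
    if "\<phi> \<in> test_functions D" for \<phi> :: "'a \<Rightarrow> real"
    using u v that by (auto simp: DivForm F_def h_def)
  have "(\<forall>i\<in>Basis. loc_integrable D' (F ?w ?K i)) \<and> loc_integrable D' (h ?w ?K) \<and>
      (\<forall>\<phi>::'a \<Rightarrow> real. \<phi> \<in> test_functions D' \<longrightarrow>
        (LINT x:D'|lebesgue. (\<Sum>i\<in>Basis. frechet_derivative \<phi> (at x) i *\<^sub>R F ?w ?K i x) + \<phi> x *\<^sub>R h ?w ?K x) = 0)"
  proof (intro conjI ballI allI impI)
    show "loc_integrable D' (F ?w ?K i)" if "i \<in> Basis" for i
      unfolding F[abs_def] using l that D(1) by (blast intro: loc_integrable_mono loc_integrable_diff)
    show "loc_integrable D' (h ?w ?K)"
      unfolding h[abs_def] using l D(1) by (blast intro: loc_integrable_mono loc_integrable_diff)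
    fix \<phi> :: "'a \<Rightarrow> real" assume \<phi>': "\<phi> \<in> test_functions D'"
    then have \<phi>: "\<phi> \<in> test_functions D" using test_functions_mono[OF D(1)] by blast
    let ?q = "\<lambda>F h x. (\<Sum>i\<in>Basis. frechet_derivative \<phi> (at x) i *\<^sub>R F i x) + \<phi> x *\<^sub>R h x"
    have int: "set_integrable lebesgue D (?q F' h')" if "\<And>i. i \<in> Basis \<Longrightarrow> loc_integrable D (F' i)" "loc_integrable D h'"
      for F' :: "'a \<Rightarrow> 'a \<Rightarrow> complex ^ 'm" and h'
    proof (intro set_integral_add(1) test_function_integrable(1)[OF _ \<phi>] that(2))
      have "integrable lebesgue (\<lambda>x. \<Sum>i\<in>Basis. indicator D x *\<^sub>R (frechet_derivative \<phi> (at x) i *\<^sub>R F' i x))"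
        using test_function_integrable(2)[OF that(1) \<phi>]
        by (intro Bochner_Integration.integrable_sum) (simp add: set_integrable_def)
      then show "set_integrable lebesgue D (\<lambda>x. \<Sum>i\<in>Basis. frechet_derivative \<phi> (at x) i *\<^sub>R F' i x)"
        by (simp add: set_integrable_def scaleR_sum_right)
    qed
    have "(LINT x:D'|lebesgue. ?q (F ?w ?K) (h ?w ?K) x) = (LINT x:D|lebesgue. ?q (F ?w ?K) (h ?w ?K) x)"
      by (rule set_integral_restrict[OF _ D(1), symmetric]) (use test_function_outside[OF \<phi>'] in simp)
    also have "\<dots> = (LINT x:D|lebesgue. ?q (F u G) (h u G) x - ?q (F v H) (h v H) x)"
      unfolding F h by (simp add: scaleR_diff_right sum_subtractf algebra_simps)
    also have "\<dots> = 0"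
      using eq[OF \<phi>] by (subst set_integral_diff(2)) (auto intro!: int l)
    finally show "(LINT x:D'|lebesgue. ?q (F ?w ?K) (h ?w ?K) x) = 0" .
  qed
  then show ?thesis unfolding DivForm F_def h_def by (simp add: Let_def)
next
  case (NonDivForm A B c)
  obtain X where X: "\<And>i j. i \<in> Basis \<Longrightarrow> j \<in> Basis \<Longrightarrow> weak_partial D i (G j) (X i j)"
      "\<And>i j K. i \<in> Basis \<Longrightarrow> j \<in> Basis \<Longrightarrow> compact K \<Longrightarrow> K \<subseteq> D \<Longrightarrow> square_integrable K (X i j)"
      "AE x in lebesgue_on D. - (\<Sum>i\<in>Basis. \<Sum>j\<in>Basis. A i j x *v X i j x) + (\<Sum>i\<in>Basis. B i x *v G i x) + c x *v u x = 0"
    using u unfolding NonDivForm weak_equation.simps by blast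
  obtain Y where Y: "\<And>i j. i \<in> Basis \<Longrightarrow> j \<in> Basis \<Longrightarrow> weak_partial D i (H j) (Y i j)"
      "\<And>i j K. i \<in> Basis \<Longrightarrow> j \<in> Basis \<Longrightarrow> compact K \<Longrightarrow> K \<subseteq> D \<Longrightarrow> square_integrable K (Y i j)"
      "AE x in lebesgue_on D. - (\<Sum>i\<in>Basis. \<Sum>j\<in>Basis. A i j x *v Y i j x) + (\<Sum>i\<in>Basis. B i x *v H i x) + c x *v v x = 0"
    using v unfolding NonDivForm weak_equation.simps by blast
  have "AE x in lebesgue_on D. - (\<Sum>i\<in>Basis. \<Sum>j\<in>Basis. A i j x *v (X i j x - Y i j x))
      + (\<Sum>i\<in>Basis. B i x *v (G i x - H i x)) + c x *v (u x - v x) = 0"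
    using X(3) Y(3)
  proof eventually_elim
    case (elim x)
    have "- (\<Sum>i\<in>Basis. \<Sum>j\<in>Basis. A i j x *v (X i j x - Y i j x)) + (\<Sum>i\<in>Basis. B i x *v (G i x - H i x)) + c x *v (u x - v x)
      = (- (\<Sum>i\<in>Basis. \<Sum>j\<in>Basis. A i j x *v X i j x) + (\<Sum>i\<in>Basis. B i x *v G i x) + c x *v u x)
       - (- (\<Sum>i\<in>Basis. \<Sum>j\<in>Basis. A i j x *v Y i j x) + (\<Sum>i\<in>Basis. B i x *v H i x) + c x *v v x)"
      by (simp add: matrix_vector_mult_diff_distrib sum_subtractf)
    then show ?case using elim by simp
  qed
  then have "AE x in lebesgue_on D'. - (\<Sum>i\<in>Basis. \<Sum>j\<in>Basis. A i j x *v (X i j x - Y i j x))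
      + (\<Sum>i\<in>Basis. B i x *v (G i x - H i x)) + c x *v (u x - v x) = 0"
    using D by (auto simp: AE_restrict_space_iff)
  moreover have "weak_partial D' i (\<lambda>x. G j x - H j x) (\<lambda>x. X i j x - Y i j x)" if "i \<in> Basis" "j \<in> Basis" for i j
    by (rule weak_partial_restrict[OF weak_partial_diff D(1)]) (use X Y that in auto)
  moreover have "square_integrable K (\<lambda>x. X i j x - Y i j x)" if "i \<in> Basis" "j \<in> Basis" "compact K" "K \<subseteq> D'" for i j K
    by (rule square_integrable_diff) (use X Y that D in auto)
  ultimately show ?thesis unfolding NonDivForm weak_equation.simps
    by (intro exI[of _ "\<lambda>i j x. X i j x - Y i j x"]) blast
qed

section \<open>Segment inequalities for smooth functions\<close>

abbreviation grad_sq :: "('a::euclidean_space \<Rightarrow> 'b::euclidean_space) \<Rightarrow> 'a \<Rightarrow> real" where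
  "grad_sq v x \<equiv> grad_norm_sq (\<lambda>e x. frechet_derivative v (at x) e) x"

lemma grad_norm_sq_nonneg: "0 \<le> grad_norm_sq G x"
  by (simp add: grad_norm_sq_def sum_nonneg)

lemma grad_sq_continuous: "smooth v \<Longrightarrow> continuous_on UNIV (grad_sq v)"
  unfolding grad_norm_sq_def by (intro continuous_intros smooth_continuous smooth_partial)

lemma grad_norm_sq_diff_le: "grad_norm_sq (\<lambda>e x. G e x - H e x) x \<le> 2 * grad_norm_sq G x + 2 * grad_norm_sq H x"
  unfolding grad_norm_sq_def sum_distrib_left sum.distrib[symmetric]
  by (intro sum_mono norm_diff_sq_le)

lemma directional_derivative_le:
  assumes v: "smooth v"
  shows "(norm (frechet_derivative v (at x) \<omega>))\<^sup>2 \<le> (norm \<omega>)\<^sup>2 * grad_sq v x"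
proof -
  let ?D = "frechet_derivative v (at x)"
  interpret linear ?D using has_derivative_linear[OF smooth_has_derivative[OF v]] .
  have "?D \<omega> = ?D (\<Sum>e\<in>Basis. (\<omega> \<bullet> e) *\<^sub>R e)" by (simp add: euclidean_representation)
  also have "\<dots> = (\<Sum>e\<in>Basis. (\<omega> \<bullet> e) *\<^sub>R ?D e)" by (simp add: sum scale)
  finally have "norm (?D \<omega>) \<le> (\<Sum>e\<in>Basis. norm ((\<omega> \<bullet> e) *\<^sub>R ?D e))" by (metis norm_sum)
  also have "\<dots> = (\<Sum>e\<in>Basis. \<bar>\<omega> \<bullet> e\<bar> * norm (?D e))" by simp
  finally have "(norm (?D \<omega>))\<^sup>2 \<le> (\<Sum>e\<in>Basis. \<bar>\<omega> \<bullet> e\<bar> * norm (?D e))\<^sup>2" by (intro power_mono) auto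
  also have "\<dots> \<le> (\<Sum>e\<in>Basis. \<bar>\<omega> \<bullet> e\<bar>\<^sup>2) * (\<Sum>e\<in>Basis. (norm (?D e))\<^sup>2)"
    by (rule Cauchy_Schwarz_ineq_sum)
  also have "(\<Sum>e\<in>Basis. \<bar>\<omega> \<bullet> e\<bar>\<^sup>2) = (norm \<omega>)\<^sup>2"
    unfolding power2_norm_eq_inner euclidean_inner[of \<omega> \<omega>] by (simp add: power2_eq_square)
  finally show ?thesis by (simp add: grad_norm_sq_def)
qed

text \<open>The fundamental theorem of calculus is applied to the inner product of \<open>v\<close> with the increment \<open>y\<close>.
  The quadratic estimate \<open>a * b \<le> a\<^sup>2 / (2 * t) + t * b\<^sup>2 / 2\<close> instead of the Cauchy-Schwarz inequality for
  integrals leaves a term \<open>\<bar>y\<bar>\<^sup>2 / 2\<close> that is absorbed.\<close>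

lemma segment_inequality:
  fixes v :: "'a::euclidean_space \<Rightarrow> 'b::euclidean_space"
  assumes v: "smooth v" and t: "0 < t"
  shows "ennreal ((norm (v (x + t *\<^sub>R \<omega>) - v x))\<^sup>2)
     \<le> ennreal (t * (norm \<omega>)\<^sup>2) * (\<integral>\<^sup>+s. ennreal (grad_sq v (x + s *\<^sub>R \<omega>)) * indicator {0<..<t} s \<partial>lborel)"
proof -
  define y where "y = v (x + t *\<^sub>R \<omega>) - v x"
  define d where "d s = frechet_derivative v (at (x + s *\<^sub>R \<omega>)) \<omega>" for s
  define q where "q s = (norm \<omega>)\<^sup>2 * grad_sq v (x + s *\<^sub>R \<omega>)" for s
  have qc: "continuous_on UNIV q" unfolding q_def
    by (intro continuous_intros continuous_on_compose2[OF grad_sq_continuous[OF v]]) auto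
  have q0: "0 \<le> q s" for s by (simp add: q_def grad_norm_sq_nonneg)
  have "((\<lambda>s. v (x + s *\<^sub>R \<omega>) \<bullet> y) has_vector_derivative d s \<bullet> y) (at s within {0..t})" for s
  proof -
    interpret linear "frechet_derivative v (at (x + s *\<^sub>R \<omega>))"
      using has_derivative_linear[OF smooth_has_derivative[OF v]] .
    have "((\<lambda>s. x + s *\<^sub>R \<omega>) has_derivative (\<lambda>h. h *\<^sub>R \<omega>)) (at s within {0..t})"
      by (auto intro!: derivative_eq_intros)
    then have "((\<lambda>s. v (x + s *\<^sub>R \<omega>)) has_derivative (\<lambda>h. frechet_derivative v (at (x + s *\<^sub>R \<omega>)) (h *\<^sub>R \<omega>))) (at s within {0..t})"
      by (rule has_derivative_compose) (rule smooth_has_derivative[OF v])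
    then show ?thesis unfolding has_vector_derivative_def
      by (auto intro!: derivative_eq_intros simp: scale d_def)
  qed
  then have "((\<lambda>s. d s \<bullet> y) has_integral (v (x + t *\<^sub>R \<omega>) \<bullet> y - v (x + 0 *\<^sub>R \<omega>) \<bullet> y)) {0..t}"
    using t by (intro fundamental_theorem_of_calculus) auto
  then have int1: "((\<lambda>s. d s \<bullet> y) has_integral (norm y)\<^sup>2) {0..t}"
    by (simp add: y_def power2_norm_eq_inner inner_diff_left)
  have "q integrable_on {0..t}"
    using qc by (intro integrable_continuous_real) (auto intro: continuous_on_subset)
  then have intq: "(q has_integral integral {0..t} q) {0..t}" by (rule integrable_integral)
  have "((\<lambda>s. (norm y)\<^sup>2 / (2 * t) + (t / 2) * q s) has_integral (t *\<^sub>R ((norm y)\<^sup>2 / (2 * t)) + (t / 2) * integral {0..t} q)) {0..t}"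
    using t by (intro has_integral_add has_integral_mult_right intq)
      (use has_integral_const_real[of "(norm y)\<^sup>2 / (2 * t)" 0 t] in simp)
  then have "(norm y)\<^sup>2 \<le> t *\<^sub>R ((norm y)\<^sup>2 / (2 * t)) + (t / 2) * integral {0..t} q"
  proof (rule has_integral_le[OF int1])
    fix s
    have "norm (d s) * norm y \<le> (norm y)\<^sup>2 / (2 * t) + (t / 2) * (norm (d s))\<^sup>2"
    proof -
      have "0 \<le> (norm y - t * norm (d s))\<^sup>2 / (2 * t)" using t by simp
      also have "\<dots> = (norm y)\<^sup>2 / (2 * t) + (t / 2) * (norm (d s))\<^sup>2 - norm (d s) * norm y"
        using t by (simp add: power2_diff field_simps power2_eq_square)
      finally show ?thesis by simp
    qed
    moreover have "d s \<bullet> y \<le> norm (d s) * norm y" by (rule norm_cauchy_schwarz)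
    moreover have "(t / 2) * (norm (d s))\<^sup>2 \<le> (t / 2) * q s"
      unfolding q_def d_def using t by (intro mult_left_mono directional_derivative_le[OF v]) auto
    ultimately show "d s \<bullet> y \<le> (norm y)\<^sup>2 / (2 * t) + (t / 2) * q s" by linarith
  qed
  then have "(norm y)\<^sup>2 \<le> t * integral {0..t} q" using t by simp
  then have "ennreal ((norm y)\<^sup>2) \<le> ennreal t * ennreal (integral {0..t} q)"
    using t by (simp add: ennreal_leI flip: ennreal_mult')
  also have "ennreal (integral {0..t} q) = (\<integral>\<^sup>+s. ennreal (indicator {0..t} s * q s) \<partial>lborel)"
    using q0 by (intro nn_integral_has_integral_lebesgue[OF _ intq, symmetric])
  also have "\<dots> = (\<integral>\<^sup>+s. ennreal ((norm \<omega>)\<^sup>2) * (ennreal (grad_sq v (x + s *\<^sub>R \<omega>)) * indicator {0<..<t} s) \<partial>lborel)"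
  proof (rule nn_integral_cong_AE)
    show "AE s in lborel. ennreal (indicator {0..t} s * q s) = ennreal ((norm \<omega>)\<^sup>2) * (ennreal (grad_sq v (x + s *\<^sub>R \<omega>)) * indicator {0<..<t} s)"
      using AE_lborel_singleton[of 0] AE_lborel_singleton[of t]
      by eventually_elim (auto simp: q_def indicator_def ennreal_mult grad_norm_sq_nonneg)
  qed
  also have "\<dots> = ennreal ((norm \<omega>)\<^sup>2) * (\<integral>\<^sup>+s. ennreal (grad_sq v (x + s *\<^sub>R \<omega>)) * indicator {0<..<t} s \<partial>lborel)"
  proof (rule nn_integral_cmult)
    have "continuous_on UNIV (\<lambda>s. grad_sq v (x + s *\<^sub>R \<omega>))"
      by (intro continuous_on_compose2[OF grad_sq_continuous[OF v]] continuous_intros) auto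
    then have [measurable]: "(\<lambda>s. grad_sq v (x + s *\<^sub>R \<omega>)) \<in> borel_measurable borel" by (rule borel_measurable_continuous_onI)
    show "(\<lambda>s. ennreal (grad_sq v (x + s *\<^sub>R \<omega>)) * indicator {0<..<t} s) \<in> borel_measurable lborel" by measurable
  qed
  finally show ?thesis using t by (simp add: y_def ennreal_mult mult.assoc)
qed

text \<open>The vertical shear \<open>(y, t) \<mapsto> (y, \<psi> y + t)\<close> preserves Lebesgue measure.\<close>

lemma slab_fubini:
  fixes q :: "('a::euclidean_space \<times> real) \<Rightarrow> ennreal"
  assumes q: "q \<in> borel_measurable borel" and [measurable]: "\<psi> \<in> borel_measurable borel" "A \<in> sets borel"
  shows "(\<integral>\<^sup>+x. q x * indicator (slab \<psi> A h) x \<partial>lborel)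
    = (\<integral>\<^sup>+y. indicator A y * (\<integral>\<^sup>+t. q (y, \<psi> y + t) * indicator {0<..<h} t \<partial>lborel) \<partial>lborel)"
proof -
  have [measurable]: "slab \<psi> A h \<in> sets borel" by measurable
  have m: "(\<lambda>x. q x * indicator (slab \<psi> A h) x) \<in> borel_measurable (borel \<Otimes>\<^sub>M borel)"
    unfolding borel_prod using q by measurable
  then have m': "(\<lambda>x. q x * indicator (slab \<psi> A h) x) \<in> borel_measurable (lborel \<Otimes>\<^sub>M lborel)"
    by (simp cong: measurable_cong_sets add: sets_pair_measure_cong[of lborel borel lborel borel])
  have "(\<integral>\<^sup>+x. q x * indicator (slab \<psi> A h) x \<partial>lborel) = (\<integral>\<^sup>+x. q x * indicator (slab \<psi> A h) x \<partial>(lborel \<Otimes>\<^sub>M lborel))"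
    by (simp add: lborel_prod)
  also have "\<dots> = (\<integral>\<^sup>+y. (\<integral>\<^sup>+s. q (y, s) * indicator (slab \<psi> A h) (y, s) \<partial>lborel) \<partial>lborel)"
    using lborel.nn_integral_fst[OF m'] by simp
  also have "\<dots> = (\<integral>\<^sup>+y. indicator A y * (\<integral>\<^sup>+t. q (y, \<psi> y + t) * indicator {0<..<h} t \<partial>lborel) \<partial>lborel)"
  proof (rule nn_integral_cong)
    fix y
    have qy: "(\<lambda>s. q (y, s)) \<in> borel_measurable borel"
      using q by (intro measurable_compose[OF _ q]) (auto intro!: borel_measurable_continuous_onI continuous_intros)
    have "(\<integral>\<^sup>+s. q (y, s) * indicator (slab \<psi> A h) (y, s) \<partial>lborel)
       = (\<integral>\<^sup>+s. indicator A y * (q (y, s) * indicator {\<psi> y<..<\<psi> y + h} s) \<partial>lborel)"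
      by (intro nn_integral_cong) (auto simp: slab_def indicator_def)
    also have "\<dots> = indicator A y * (\<integral>\<^sup>+s. q (y, s) * indicator {\<psi> y<..<\<psi> y + h} s \<partial>lborel)"
      using qy by (intro nn_integral_cmult borel_measurable_times_ennreal borel_measurable_indicator) auto
    also have "(\<integral>\<^sup>+s. q (y, s) * indicator {\<psi> y<..<\<psi> y + h} s \<partial>lborel)
      = (\<integral>\<^sup>+t. q (y, \<psi> y + t) * indicator {\<psi> y<..<\<psi> y + h} (\<psi> y + t) \<partial>lborel)"
      using qy nn_integral_real_affine[of "\<lambda>s. q (y, s) * indicator {\<psi> y<..<\<psi> y + h} s" 1 "\<psi> y"] by simp
    also have "\<dots> = (\<integral>\<^sup>+t. q (y, \<psi> y + t) * indicator {0<..<h} t \<partial>lborel)"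
      by (intro nn_integral_cong) (auto simp: indicator_def)
    finally show "(\<integral>\<^sup>+s. q (y, s) * indicator (slab \<psi> A h) (y, s) \<partial>lborel) =
       indicator A y * (\<integral>\<^sup>+t. q (y, \<psi> y + t) * indicator {0<..<h} t \<partial>lborel)" .
  qed
  finally show ?thesis .
qed

text \<open>The segment inequality on vertical segments, integrated over the slab.  The values on the graph are kept,
  since approximants of a function with zero trace vanish there only in the limit.\<close>

lemma smooth_poincare:
  fixes v :: "('a::euclidean_space \<times> real) \<Rightarrow> 'b::euclidean_space"
  assumes v: "smooth v" and [measurable]: "\<psi> \<in> borel_measurable borel" "A \<in> sets borel" and h: "0 < h"
  shows "(\<integral>\<^sup>+x. ennreal ((norm (v x))\<^sup>2) * indicator (slab \<psi> A h) x \<partial>lborel)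
    \<le> ennreal (2 * h) * (\<integral>\<^sup>+y. ennreal ((norm (v (y, \<psi> y)))\<^sup>2) * indicator A y \<partial>lborel)
      + ennreal (2 * h\<^sup>2) * (\<integral>\<^sup>+x. ennreal (grad_sq v x) * indicator (slab \<psi> A h) x \<partial>lborel)"
proof -
  have [measurable]: "v \<in> borel_measurable borel" "grad_sq v \<in> borel_measurable borel"
    using smooth_continuous[OF v] grad_sq_continuous[OF v] by (auto intro: borel_measurable_continuous_onI)
  have pair [measurable]: "(\<lambda>y. (y, \<psi> y + t)) \<in> borel_measurable borel" for t
    unfolding borel_prod[symmetric] by measurable
  have [measurable]: "(\<lambda>y. v (y, \<psi> y)) \<in> borel_measurable borel"
    using pair[of 0] by (auto intro: measurable_compose)
  define J where "J y = (\<integral>\<^sup>+t. ennreal (grad_sq v (y, \<psi> y + t)) * indicator {0<..<h} t \<partial>lborel)" for y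
  have [measurable]: "J \<in> borel_measurable borel"
  proof -
    have "(\<lambda>z. (fst z, \<psi> (fst z) + snd z)) \<in> (borel \<Otimes>\<^sub>M lborel) \<rightarrow>\<^sub>M (borel \<Otimes>\<^sub>M borel)" by measurable
    then have "(\<lambda>z. (fst z, \<psi> (fst z) + snd z)) \<in> (borel \<Otimes>\<^sub>M lborel) \<rightarrow>\<^sub>M borel" by (simp add: borel_prod)
    from measurable_compose[OF this \<open>grad_sq v \<in> borel_measurable borel\<close>]
    have [measurable]: "(\<lambda>z. grad_sq v (fst z, \<psi> (fst z) + snd z)) \<in> borel_measurable (borel \<Otimes>\<^sub>M lborel)" .
    have "(\<lambda>(y, t). ennreal (grad_sq v (y, \<psi> y + t)) * indicator {0<..<h} t) \<in> borel_measurable (borel \<Otimes>\<^sub>M lborel)"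
      unfolding split_beta by measurable
    then show ?thesis unfolding J_def by (rule lborel.borel_measurable_nn_integral)
  qed
  have pt: "ennreal ((norm (v (y, \<psi> y + t)))\<^sup>2) \<le> ennreal (2 * (norm (v (y, \<psi> y)))\<^sup>2) + ennreal (2 * h) * J y"
    if t: "t \<in> {0<..<h}" for y t
  proof -
    have "ennreal ((norm (v (y, \<psi> y + t) - v (y, \<psi> y)))\<^sup>2)
       \<le> ennreal t * (\<integral>\<^sup>+s. ennreal (grad_sq v (y, \<psi> y + s)) * indicator {0<..<t} s \<partial>lborel)"
      using segment_inequality[OF v, of t "(y, \<psi> y)" "(0, 1)"] t by (simp add: scaleR_prod_def norm_Pair)
    also have "\<dots> \<le> ennreal h * J y"
      unfolding J_def using t by (intro mult_mono nn_integral_mono ennreal_leI) (auto simp: indicator_def)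
    finally have d: "ennreal ((norm (v (y, \<psi> y + t) - v (y, \<psi> y)))\<^sup>2) \<le> ennreal h * J y" .
    have "ennreal ((norm (v (y, \<psi> y + t)))\<^sup>2) \<le> ennreal (2 * (norm (v (y, \<psi> y)))\<^sup>2 + 2 * (norm (v (y, \<psi> y + t) - v (y, \<psi> y)))\<^sup>2)"
      using norm_add_sq_le[of "v (y, \<psi> y)" "v (y, \<psi> y + t) - v (y, \<psi> y)"] by (intro ennreal_leI) simp
    also have "\<dots> = ennreal (2 * (norm (v (y, \<psi> y)))\<^sup>2) + 2 * ennreal ((norm (v (y, \<psi> y + t) - v (y, \<psi> y)))\<^sup>2)"
      by (simp add: ennreal_mult)
    also have "\<dots> \<le> ennreal (2 * (norm (v (y, \<psi> y)))\<^sup>2) + 2 * (ennreal h * J y)"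
      by (intro add_left_mono mult_left_mono d) auto
    also have "2 * (ennreal h * J y) = ennreal (2 * h) * J y" using h by (simp add: ennreal_mult mult.assoc)
    finally show ?thesis .
  qed
  have "(\<integral>\<^sup>+x. ennreal ((norm (v x))\<^sup>2) * indicator (slab \<psi> A h) x \<partial>lborel)
     = (\<integral>\<^sup>+y. indicator A y * (\<integral>\<^sup>+t. ennreal ((norm (v (y, \<psi> y + t)))\<^sup>2) * indicator {0<..<h} t \<partial>lborel) \<partial>lborel)"
    by (intro slab_fubini) auto
  also have "\<dots> \<le> (\<integral>\<^sup>+y. indicator A y * (\<integral>\<^sup>+t. (ennreal (2 * (norm (v (y, \<psi> y)))\<^sup>2) + ennreal (2 * h) * J y) * indicator {0<..<h} t \<partial>lborel) \<partial>lborel)"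
    using pt by (intro nn_integral_mono mult_left_mono) (auto simp: indicator_def)
  also have "\<dots> = (\<integral>\<^sup>+y. ennreal (2 * h) * (ennreal ((norm (v (y, \<psi> y)))\<^sup>2) * indicator A y) + ennreal (2 * h\<^sup>2) * (indicator A y * J y) \<partial>lborel)"
  proof (rule nn_integral_cong)
    fix y
    have "(\<integral>\<^sup>+t. (ennreal (2 * (norm (v (y, \<psi> y)))\<^sup>2) + ennreal (2 * h) * J y) * indicator {0<..<h} t \<partial>lborel)
      = (ennreal (2 * (norm (v (y, \<psi> y)))\<^sup>2) + ennreal (2 * h) * J y) * ennreal h"
      using h by (subst nn_integral_cmult_indicator) auto
    also have "\<dots> = ennreal (2 * h) * ennreal ((norm (v (y, \<psi> y)))\<^sup>2) + ennreal (2 * h\<^sup>2) * J y"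
      using h by (simp add: distrib_right distrib_left ennreal_mult power2_eq_square mult_ac)
    finally show "indicator A y * (\<integral>\<^sup>+t. (ennreal (2 * (norm (v (y, \<psi> y)))\<^sup>2) + ennreal (2 * h) * J y) * indicator {0<..<h} t \<partial>lborel)
      = ennreal (2 * h) * (ennreal ((norm (v (y, \<psi> y)))\<^sup>2) * indicator A y) + ennreal (2 * h\<^sup>2) * (indicator A y * J y)"
      by (simp add: indicator_def)
  qed
  also have "\<dots> = ennreal (2 * h) * (\<integral>\<^sup>+y. ennreal ((norm (v (y, \<psi> y)))\<^sup>2) * indicator A y \<partial>lborel)
      + ennreal (2 * h\<^sup>2) * (\<integral>\<^sup>+y. indicator A y * J y \<partial>lborel)"
    by (subst nn_integral_add, measurable, subst (1 2) nn_integral_cmult, measurable)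
  also have "(\<integral>\<^sup>+y. indicator A y * J y \<partial>lborel) = (\<integral>\<^sup>+x. ennreal (grad_sq v x) * indicator (slab \<psi> A h) x \<partial>lborel)"
    unfolding J_def by (intro slab_fubini[symmetric]) auto
  finally show ?thesis .
qed

lemma nn_integral_lborel_translate:
  fixes f :: "'a::euclidean_space \<Rightarrow> ennreal"
  assumes "f \<in> borel_measurable borel"
  shows "(\<integral>\<^sup>+x. f (x + c) \<partial>lborel) = (\<integral>\<^sup>+x. f x \<partial>lborel)"
proof -
  have "(\<integral>\<^sup>+x. f x \<partial>lborel) = (\<integral>\<^sup>+x. f x \<partial>distr lborel borel ((+) c))" by (simp add: lborel_distr_plus)
  also have "\<dots> = (\<integral>\<^sup>+x. f (c + x) \<partial>lborel)" using assms by (subst nn_integral_distr) auto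
  finally show ?thesis by (simp add: add.commute)
qed

text \<open>The segment inequality for the segments from \<open>x\<close> to \<open>x + \<omega>\<close>, integrated over \<open>D\<close>; for each position on the
  segment the gradient is integrated over a translate of \<open>D\<close>, which lies in \<open>E\<close>.\<close>

lemma smooth_shift:
  fixes v :: "'a::euclidean_space \<Rightarrow> 'b::euclidean_space"
  assumes v: "smooth v" and [measurable]: "D \<in> sets borel" "D1 \<in> sets borel" "E \<in> sets borel"
    and D1: "\<And>x. x \<in> D \<Longrightarrow> x + \<omega> \<in> D1" and E: "\<And>x s. x \<in> D \<Longrightarrow> 0 < s \<Longrightarrow> s < 1 \<Longrightarrow> x + s *\<^sub>R \<omega> \<in> E"
  shows "(\<integral>\<^sup>+x. ennreal ((norm (v x))\<^sup>2) * indicator D x \<partial>lborel)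
    \<le> 2 * (\<integral>\<^sup>+x. ennreal ((norm (v x))\<^sup>2) * indicator D1 x \<partial>lborel)
      + ennreal (2 * (norm \<omega>)\<^sup>2) * (\<integral>\<^sup>+x. ennreal (grad_sq v x) * indicator E x \<partial>lborel)"
proof -
  have [measurable]: "v \<in> borel_measurable borel" "grad_sq v \<in> borel_measurable borel"
    using smooth_continuous[OF v] grad_sq_continuous[OF v] by (auto intro: borel_measurable_continuous_onI)
  define f where "f x s = ennreal (grad_sq v (x + s *\<^sub>R \<omega>)) * indicator {0<..<1} s * indicator D x" for x and s :: real
  have [measurable]: "(\<lambda>z. f (fst z) (snd z)) \<in> borel_measurable (lborel \<Otimes>\<^sub>M lborel)"
    unfolding f_def by measurable
  have fm: "case_prod f \<in> borel_measurable (lborel \<Otimes>\<^sub>M lborel)" unfolding split_beta' by measurable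
  have [measurable]: "f x \<in> borel_measurable borel" "(\<lambda>x. f x s) \<in> borel_measurable borel" for x s unfolding f_def by measurable
  have [measurable]: "(\<lambda>x. \<integral>\<^sup>+s. f x s \<partial>lborel) \<in> borel_measurable borel"
    using lborel.borel_measurable_nn_integral[OF fm] by simp
  have pt: "ennreal ((norm (v x))\<^sup>2) * indicator D x \<le> 2 * (ennreal ((norm (v (x + \<omega>)))\<^sup>2) * indicator D1 (x + \<omega>))
      + ennreal (2 * (norm \<omega>)\<^sup>2) * (\<integral>\<^sup>+s. f x s \<partial>lborel)" for x
  proof (cases "x \<in> D")
    case True
    have "ennreal ((norm (v (x + \<omega>) - v x))\<^sup>2) \<le> ennreal ((norm \<omega>)\<^sup>2) * (\<integral>\<^sup>+s. f x s \<partial>lborel)"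
      using segment_inequality[OF v, of 1 x \<omega>] True by (simp add: f_def)
    then have d: "2 * ennreal ((norm (v (x + \<omega>) - v x))\<^sup>2) \<le> ennreal (2 * (norm \<omega>)\<^sup>2) * (\<integral>\<^sup>+s. f x s \<partial>lborel)"
      by (simp add: ennreal_mult mult.assoc mult_left_mono)
    have "ennreal ((norm (v x))\<^sup>2) \<le> ennreal (2 * (norm (v (x + \<omega>)))\<^sup>2 + 2 * (norm (v (x + \<omega>) - v x))\<^sup>2)"
      using norm_diff_sq_le[of "v (x + \<omega>)" "v (x + \<omega>) - v x"] by (intro ennreal_leI) simp
    also have "\<dots> = 2 * ennreal ((norm (v (x + \<omega>)))\<^sup>2) + 2 * ennreal ((norm (v (x + \<omega>) - v x))\<^sup>2)"
      by (simp add: ennreal_mult)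
    also have "\<dots> \<le> 2 * ennreal ((norm (v (x + \<omega>)))\<^sup>2) + ennreal (2 * (norm \<omega>)\<^sup>2) * (\<integral>\<^sup>+s. f x s \<partial>lborel)"
      by (intro add_left_mono d)
    finally show ?thesis using True D1 by simp
  qed simp
  have "(\<integral>\<^sup>+x. ennreal ((norm (v x))\<^sup>2) * indicator D x \<partial>lborel)
     \<le> (\<integral>\<^sup>+x. 2 * (ennreal ((norm (v (x + \<omega>)))\<^sup>2) * indicator D1 (x + \<omega>)) + ennreal (2 * (norm \<omega>)\<^sup>2) * (\<integral>\<^sup>+s. f x s \<partial>lborel) \<partial>lborel)"
    by (intro nn_integral_mono pt)
  also have "\<dots> = 2 * (\<integral>\<^sup>+x. ennreal ((norm (v (x + \<omega>)))\<^sup>2) * indicator D1 (x + \<omega>) \<partial>lborel)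
     + ennreal (2 * (norm \<omega>)\<^sup>2) * (\<integral>\<^sup>+x. (\<integral>\<^sup>+s. f x s \<partial>lborel) \<partial>lborel)"
    by (subst nn_integral_add, measurable, subst (1 2) nn_integral_cmult, measurable)
  also have "(\<integral>\<^sup>+x. ennreal ((norm (v (x + \<omega>)))\<^sup>2) * indicator D1 (x + \<omega>) \<partial>lborel)
      = (\<integral>\<^sup>+x. ennreal ((norm (v x))\<^sup>2) * indicator D1 x \<partial>lborel)"
    by (rule nn_integral_lborel_translate[of "\<lambda>x. ennreal ((norm (v x))\<^sup>2) * indicator D1 x"]) measurable
  also have "(\<integral>\<^sup>+x. (\<integral>\<^sup>+s. f x s \<partial>lborel) \<partial>lborel) = (\<integral>\<^sup>+s. (\<integral>\<^sup>+x. f x s \<partial>lborel) \<partial>lborel)"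
    using lborel_pair.Fubini'[OF fm] by simp
  also have "\<dots> \<le> (\<integral>\<^sup>+s. (\<integral>\<^sup>+x. ennreal (grad_sq v x) * indicator E x \<partial>lborel) * indicator {0<..<1::real} s \<partial>lborel)"
  proof (rule nn_integral_mono)
    fix s :: real
    show "(\<integral>\<^sup>+x. f x s \<partial>lborel) \<le> (\<integral>\<^sup>+x. ennreal (grad_sq v x) * indicator E x \<partial>lborel) * indicator {0<..<1} s"
    proof (cases "s \<in> {0<..<1}")
      case True
      have "(\<integral>\<^sup>+x. f x s \<partial>lborel) \<le> (\<integral>\<^sup>+x. ennreal (grad_sq v (x + s *\<^sub>R \<omega>)) * indicator E (x + s *\<^sub>R \<omega>) \<partial>lborel)"
        using True E by (intro nn_integral_mono) (auto simp: f_def indicator_def)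
      also have "\<dots> = (\<integral>\<^sup>+x. ennreal (grad_sq v x) * indicator E x \<partial>lborel)"
        by (rule nn_integral_lborel_translate[of "\<lambda>x. ennreal (grad_sq v x) * indicator E x"]) measurable
      finally show ?thesis using True by simp
    qed (simp add: f_def)
  qed
  also have "\<dots> = (\<integral>\<^sup>+x. ennreal (grad_sq v x) * indicator E x \<partial>lborel)"
    by (subst nn_integral_cmult_indicator) auto
  finally show ?thesis by (simp add: mult_left_mono add_left_mono)
qed

section \<open>Functions with prescribed trace\<close>

definition sobolev_measurable ::
    "'a set \<Rightarrow> ('a::euclidean_space \<Rightarrow> 'b::euclidean_space) \<Rightarrow> ('a \<Rightarrow> 'a \<Rightarrow> 'b) \<Rightarrow> bool" where
  "sobolev_measurable S u G \<longleftrightarrow> u \<in> borel_measurable (lebesgue_on S) \<and> (\<forall>e\<in>Basis. G e \<in> borel_measurable (lebesgue_on S))"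

lemma W12_measurable: "W12 S u G \<Longrightarrow> sobolev_measurable S u G"
  by (auto simp: W12_def sobolev_measurable_def square_integrable_def)

lemma sobolev_measurable_subset: "sobolev_measurable S u G \<Longrightarrow> D \<subseteq> S \<Longrightarrow> sobolev_measurable D u G"
  unfolding sobolev_measurable_def by (auto intro: measurable_restrict_mono)

lemma borel_measurable_lebesgue_on: "f \<in> borel_measurable borel \<Longrightarrow> f \<in> borel_measurable (lebesgue_on S)"
  by (intro measurable_restrict_space1 measurable_completion) simp

lemma indicator_lebesgue_measurable:
  assumes "q \<in> borel_measurable (lebesgue_on D)" "D \<in> sets lebesgue"
  shows "(\<lambda>x. ennreal (q x) * indicator D x) \<in> borel_measurable lebesgue"
  using assms by (subst borel_measurable_restrict_space_iff_ennreal[symmetric]) auto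

lemma nn_integral_lebesgue_borel:
  "f \<in> borel_measurable borel \<Longrightarrow> (\<integral>\<^sup>+x. f x \<partial>lebesgue) = (\<integral>\<^sup>+x. f x \<partial>lborel)"
  by (rule nn_integral_completion)

text \<open>The quantity that tends to \<open>0\<close> in the definition of the trace.\<close>

definition sobolev_error ::
    "'a set \<Rightarrow> ('a::euclidean_space \<Rightarrow> 'b::euclidean_space) \<Rightarrow> ('a \<Rightarrow> 'b) \<Rightarrow> ('a \<Rightarrow> 'a \<Rightarrow> 'b) \<Rightarrow> ennreal" where
  "sobolev_error S v u G = (\<integral>\<^sup>+x\<in>S. ennreal ((norm (v x - u x))\<^sup>2
                + grad_norm_sq (\<lambda>e x. frechet_derivative v (at x) e - G e x) x) \<partial>lebesgue)"

lemma sobolev_error_ge: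
  assumes "D \<subseteq> S"
  shows "(\<integral>\<^sup>+x. ennreal ((norm (v x - u x))\<^sup>2) * indicator D x \<partial>lebesgue) \<le> sobolev_error S v u G"
    "(\<integral>\<^sup>+x. ennreal (grad_norm_sq (\<lambda>e x. frechet_derivative v (at x) e - G e x) x) * indicator D x \<partial>lebesgue) \<le> sobolev_error S v u G"
  unfolding sobolev_error_def using assms
  by (intro nn_integral_mono; auto simp: indicator_def grad_norm_sq_nonneg intro!: ennreal_leI)+

lemma sobolev_error_measurable:
  assumes v: "smooth v" and u: "sobolev_measurable S u G"
  shows "(\<lambda>x. (norm (v x - u x))\<^sup>2 + grad_norm_sq (\<lambda>e x. frechet_derivative v (at x) e - G e x) x) \<in> borel_measurable (lebesgue_on S)"
proof -
  have [measurable]: "v \<in> borel_measurable (lebesgue_on S)"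
    "\<And>e. e \<in> Basis \<Longrightarrow> (\<lambda>x. frechet_derivative v (at x) e) \<in> borel_measurable (lebesgue_on S)"
    using smooth_continuous[OF v] smooth_continuous[OF smooth_partial[OF v]]
    by (auto intro!: borel_measurable_lebesgue_on borel_measurable_continuous_onI)
  have [measurable]: "u \<in> borel_measurable (lebesgue_on S)" "\<And>e. e \<in> Basis \<Longrightarrow> G e \<in> borel_measurable (lebesgue_on S)"
    using u by (auto simp: sobolev_measurable_def)
  show ?thesis unfolding grad_norm_sq_def by measurable
qed

lemma grad_norm_sq_measurable: "sobolev_measurable S u G \<Longrightarrow> grad_norm_sq G \<in> borel_measurable (lebesgue_on S)"
  unfolding sobolev_measurable_def grad_norm_sq_def[abs_def]
  by (auto intro!: borel_measurable_sum borel_measurable_power borel_measurable_norm)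

text \<open>Exchanges a Sobolev function for a smooth approximant and back; the factors \<open>2\<close> come from squaring sums.\<close>

lemma approximate_norm:
  assumes v: "smooth v" and u: "sobolev_measurable D u G" and D: "D \<in> sets borel" "D \<subseteq> S"
  shows "(\<integral>\<^sup>+x. ennreal ((norm (u x))\<^sup>2) * indicator D x \<partial>lebesgue)
     \<le> 2 * sobolev_error S v u G + 2 * (\<integral>\<^sup>+x. ennreal ((norm (v x))\<^sup>2) * indicator D x \<partial>lborel)" (is ?A)
    and "(\<integral>\<^sup>+x. ennreal ((norm (v x))\<^sup>2) * indicator D x \<partial>lborel)
     \<le> 2 * sobolev_error S v u G + 2 * (\<integral>\<^sup>+x. ennreal ((norm (u x))\<^sup>2) * indicator D x \<partial>lebesgue)" (is ?B)
    and "(\<integral>\<^sup>+x. ennreal (grad_sq v x) * indicator D x \<partial>lborel)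
     \<le> 2 * sobolev_error S v u G + 2 * (\<integral>\<^sup>+x. ennreal (grad_norm_sq G x) * indicator D x \<partial>lebesgue)" (is ?C)
proof -
  have Dl: "D \<in> sets lebesgue" using D by (simp add: sets_completionI_sets)
  have vb: "v \<in> borel_measurable borel" "grad_sq v \<in> borel_measurable borel"
    using smooth_continuous[OF v] grad_sq_continuous[OF v] by (auto intro: borel_measurable_continuous_onI)
  have vl: "v \<in> borel_measurable (lebesgue_on D)" "\<And>e. e \<in> Basis \<Longrightarrow> (\<lambda>x. frechet_derivative v (at x) e) \<in> borel_measurable (lebesgue_on D)"
    using smooth_continuous[OF v] smooth_continuous[OF smooth_partial[OF v]]
    by (auto intro!: borel_measurable_lebesgue_on borel_measurable_continuous_onI)
  have ul: "u \<in> borel_measurable (lebesgue_on D)" "\<And>e. e \<in> Basis \<Longrightarrow> G e \<in> borel_measurable (lebesgue_on D)"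
    using u by (auto simp: sobolev_measurable_def)
  have m1: "(\<lambda>x. ennreal ((norm (v x - u x))\<^sup>2) * indicator D x) \<in> borel_measurable lebesgue"
    using vl ul by (intro indicator_lebesgue_measurable Dl) measurable
  have m2: "(\<lambda>x. ennreal ((norm (v x))\<^sup>2) * indicator D x) \<in> borel_measurable lebesgue"
    using vl by (intro indicator_lebesgue_measurable Dl) measurable
  have m3: "(\<lambda>x. ennreal ((norm (u x))\<^sup>2) * indicator D x) \<in> borel_measurable lebesgue"
    using ul by (intro indicator_lebesgue_measurable Dl) measurable
  have m4: "(\<lambda>x. ennreal (grad_norm_sq (\<lambda>e x. frechet_derivative v (at x) e - G e x) x) * indicator D x) \<in> borel_measurable lebesgue"
    using vl ul by (intro indicator_lebesgue_measurable Dl) (auto simp: grad_norm_sq_def)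
  have m5: "(\<lambda>x. ennreal (grad_norm_sq G x) * indicator D x) \<in> borel_measurable lebesgue"
    by (intro indicator_lebesgue_measurable Dl grad_norm_sq_measurable[OF u])
  have vv: "(\<integral>\<^sup>+x. ennreal ((norm (v x))\<^sup>2) * indicator D x \<partial>lebesgue) = (\<integral>\<^sup>+x. ennreal ((norm (v x))\<^sup>2) * indicator D x \<partial>lborel)"
    using vb D by (intro nn_integral_lebesgue_borel) auto
  have gg: "(\<integral>\<^sup>+x. ennreal (grad_sq v x) * indicator D x \<partial>lebesgue) = (\<integral>\<^sup>+x. ennreal (grad_sq v x) * indicator D x \<partial>lborel)"
    using vb D by (intro nn_integral_lebesgue_borel) auto
  have key: "(\<integral>\<^sup>+x. f x \<partial>lebesgue) \<le> 2 * (\<integral>\<^sup>+x. g x \<partial>lebesgue) + 2 * (\<integral>\<^sup>+x. h x \<partial>lebesgue)"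
    if "\<And>x. f x \<le> 2 * g x + 2 * h x" "g \<in> borel_measurable lebesgue" "h \<in> borel_measurable lebesgue" for f g h :: "'a \<Rightarrow> ennreal"
  proof -
    have "(\<integral>\<^sup>+x. f x \<partial>lebesgue) \<le> (\<integral>\<^sup>+x. 2 * g x + 2 * h x \<partial>lebesgue)" by (intro nn_integral_mono that)
    also have "\<dots> = 2 * (\<integral>\<^sup>+x. g x \<partial>lebesgue) + 2 * (\<integral>\<^sup>+x. h x \<partial>lebesgue)"
      using that(2,3) by (simp add: nn_integral_add nn_integral_cmult)
    finally show ?thesis .
  qed
  have two: "ennreal a \<le> 2 * ennreal b + 2 * ennreal c" if "a \<le> 2 * b + 2 * c" "0 \<le> b" "0 \<le> c" for a b c
  proof -
    have "ennreal a \<le> ennreal (2 * b + 2 * c)" by (rule ennreal_leI[OF that(1)])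
    also have "\<dots> = 2 * ennreal b + 2 * ennreal c" using that by (simp add: ennreal_mult)
    finally show ?thesis .
  qed
  have "(\<integral>\<^sup>+x. ennreal ((norm (u x))\<^sup>2) * indicator D x \<partial>lebesgue) \<le> 2 * (\<integral>\<^sup>+x. ennreal ((norm (v x - u x))\<^sup>2) * indicator D x \<partial>lebesgue)
     + 2 * (\<integral>\<^sup>+x. ennreal ((norm (v x))\<^sup>2) * indicator D x \<partial>lebesgue)"
  proof (rule key[OF _ m1 m2])
    fix x
    have "(norm (u x))\<^sup>2 \<le> 2 * (norm (v x - u x))\<^sup>2 + 2 * (norm (v x))\<^sup>2"
      using norm_diff_sq_le[of "v x - u x" "v x"] by simp
    from two[OF this] show "ennreal ((norm (u x))\<^sup>2) * indicator D x
       \<le> 2 * (ennreal ((norm (v x - u x))\<^sup>2) * indicator D x) + 2 * (ennreal ((norm (v x))\<^sup>2) * indicator D x)"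
      by (auto simp: indicator_def)
  qed
  then show ?A unfolding vv
    by (rule order_trans) (intro add_right_mono mult_left_mono sobolev_error_ge(1) D(2), simp)
  have "(\<integral>\<^sup>+x. ennreal ((norm (v x))\<^sup>2) * indicator D x \<partial>lebesgue) \<le> 2 * (\<integral>\<^sup>+x. ennreal ((norm (v x - u x))\<^sup>2) * indicator D x \<partial>lebesgue)
     + 2 * (\<integral>\<^sup>+x. ennreal ((norm (u x))\<^sup>2) * indicator D x \<partial>lebesgue)"
  proof (rule key[OF _ m1 m3])
    fix x
    have "(norm (v x))\<^sup>2 \<le> 2 * (norm (v x - u x))\<^sup>2 + 2 * (norm (u x))\<^sup>2"
      using norm_add_sq_le[of "v x - u x" "u x"] by simp
    from two[OF this] show "ennreal ((norm (v x))\<^sup>2) * indicator D x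
       \<le> 2 * (ennreal ((norm (v x - u x))\<^sup>2) * indicator D x) + 2 * (ennreal ((norm (u x))\<^sup>2) * indicator D x)"
      by (auto simp: indicator_def)
  qed
  then show ?B unfolding vv
    by (rule order_trans) (intro add_right_mono mult_left_mono sobolev_error_ge(1) D(2), simp)
  have "(\<integral>\<^sup>+x. ennreal (grad_sq v x) * indicator D x \<partial>lebesgue)
     \<le> 2 * (\<integral>\<^sup>+x. ennreal (grad_norm_sq (\<lambda>e x. frechet_derivative v (at x) e - G e x) x) * indicator D x \<partial>lebesgue)
     + 2 * (\<integral>\<^sup>+x. ennreal (grad_norm_sq G x) * indicator D x \<partial>lebesgue)"
  proof (rule key[OF _ m4 m5])
    fix x
    have "grad_sq v x \<le> 2 * grad_norm_sq (\<lambda>e x. frechet_derivative v (at x) e - G e x) x + 2 * grad_norm_sq G x"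
      unfolding grad_norm_sq_def sum_distrib_left sum.distrib[symmetric]
    proof (intro sum_mono)
      fix e :: 'a
      show "(norm (frechet_derivative v (at x) e))\<^sup>2 \<le> 2 * (norm (frechet_derivative v (at x) e - G e x))\<^sup>2 + 2 * (norm (G e x))\<^sup>2"
        using norm_add_sq_le[of "frechet_derivative v (at x) e - G e x" "G e x"] by simp
    qed
    from two[OF this] show "ennreal (grad_sq v x) * indicator D x
       \<le> 2 * (ennreal (grad_norm_sq (\<lambda>e x. frechet_derivative v (at x) e - G e x) x) * indicator D x) + 2 * (ennreal (grad_norm_sq G x) * indicator D x)"
      by (auto simp: indicator_def grad_norm_sq_nonneg)
  qed
  then show ?C unfolding gg
    by (rule order_trans) (intro add_right_mono mult_left_mono sobolev_error_ge(2) D(2), simp)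
qed

lemma has_traceE:
  assumes "has_trace \<psi> U u G g"
  obtains v where "\<And>k::nat. smooth (v k)"
    "\<And>K. compact K \<Longrightarrow> K \<subseteq> U \<Longrightarrow> (\<lambda>k. sobolev_error (K \<inter> graph_domain \<psi>) (v k) u G) \<longlonglongrightarrow> 0"
    "\<And>K. compact K \<Longrightarrow> K \<subseteq> U \<Longrightarrow> (\<lambda>k. \<integral>\<^sup>+z\<in>K. ennreal ((norm (v k z - g z))\<^sup>2) \<partial>surface_measure \<psi>) \<longlonglongrightarrow> 0"
  using assms unfolding has_trace_def sobolev_error_def by blast

lemma le_of_null_error:
  fixes a c :: ennreal
  assumes "\<And>k. a \<le> ennreal p * X k + ennreal q * Y k + c" "X \<longlonglongrightarrow> 0" "Y \<longlonglongrightarrow> 0"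
  shows "a \<le> c"
proof (rule LIMSEQ_le_const)
  have "(\<lambda>k. ennreal p * X k + ennreal q * Y k + c) \<longlonglongrightarrow> ennreal p * 0 + ennreal q * 0 + c"
    using assms(2,3) by (intro tendsto_add tendsto_const ennreal_tendsto_cmult) auto
  then show "(\<lambda>k. ennreal p * X k + ennreal q * Y k + c) \<longlonglongrightarrow> c" by simp
qed (use assms(1) in blast)

text \<open>The Poincare inequality for smooth approximants, whose boundary term tends to \<open>0\<close> because the trace
  vanishes.\<close>

lemma trace_poincare:
  fixes \<psi> :: "real ^ 'n \<Rightarrow> real"
  assumes tr: "has_trace \<psi> U w G (\<lambda>_. 0)" and K: "compact K" "K \<subseteq> U"
    and \<psi>: "\<psi> \<in> borel_measurable borel" and A: "A \<in> sets borel" and h: "0 < h"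
    and in_K: "\<And>y t. y \<in> A \<Longrightarrow> 0 \<le> t \<Longrightarrow> t \<le> h \<Longrightarrow> (y, \<psi> y + t) \<in> K"
    and meas: "sobolev_measurable (slab \<psi> A h) w G"
    and surf: "\<And>q. q \<in> borel_measurable borel \<Longrightarrow> (\<integral>\<^sup>+y. q (y, \<psi> y) \<partial>lborel) \<le> (\<integral>\<^sup>+z. q z \<partial>surface_measure \<psi>)"
  shows "(\<integral>\<^sup>+x. ennreal ((norm (w x))\<^sup>2) * indicator (slab \<psi> A h) x \<partial>lebesgue)
     \<le> ennreal (8 * h\<^sup>2) * (\<integral>\<^sup>+x. ennreal (grad_norm_sq G x) * indicator (slab \<psi> A h) x \<partial>lebesgue)"
proof -
  obtain v where "\<And>k::nat. smooth (v k)"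
    "\<And>K. compact K \<Longrightarrow> K \<subseteq> U \<Longrightarrow> (\<lambda>k. sobolev_error (K \<inter> graph_domain \<psi>) (v k) w G) \<longlonglongrightarrow> 0"
    "\<And>K. compact K \<Longrightarrow> K \<subseteq> U \<Longrightarrow> (\<lambda>k. \<integral>\<^sup>+z\<in>K. ennreal ((norm (v k z - 0))\<^sup>2) \<partial>surface_measure \<psi>) \<longlonglongrightarrow> 0"
    by (rule has_traceE[OF tr]) (rule that)
  note er = this(2)[OF K] and bd = this(3)[OF K] and v = this(1)
  let ?D = "slab \<psi> A h" and ?S = "K \<inter> graph_domain \<psi>"
  have D: "?D \<in> sets borel" using sets_slab[OF \<psi> A] .
  have DS: "?D \<subseteq> ?S"
  proof
    fix x assume "x \<in> ?D"
    then show "x \<in> ?S" using in_K[of "fst x" "snd x - \<psi> (fst x)"] by (auto simp: slab_def graph_domain_def)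
  qed
  define X where "X k = sobolev_error ?S (v k) w G" for k
  define Y where "Y k = (\<integral>\<^sup>+z\<in>K. ennreal ((norm (v k z - 0))\<^sup>2) \<partial>surface_measure \<psi>)" for k
  define g where "g = (\<integral>\<^sup>+x. ennreal (grad_norm_sq G x) * indicator ?D x \<partial>lebesgue)"
  have "(\<integral>\<^sup>+x. ennreal ((norm (w x))\<^sup>2) * indicator ?D x \<partial>lebesgue) \<le> ennreal (2 + 8 * h\<^sup>2) * X k + ennreal (4 * h) * Y k + ennreal (8 * h\<^sup>2) * g" for k
  proof -
    have vb: "v k \<in> borel_measurable borel" using smooth_continuous[OF v] by (rule borel_measurable_continuous_onI)
    have "(\<integral>\<^sup>+y. ennreal ((norm (v k (y, \<psi> y)))\<^sup>2) * indicator A y \<partial>lborel)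
       \<le> (\<integral>\<^sup>+y. ennreal ((norm (v k (y, \<psi> y) - 0))\<^sup>2) * indicator K (y, \<psi> y) \<partial>lborel)"
      using in_K[of _ 0] h by (intro nn_integral_mono) (auto simp: indicator_def)
    also have "\<dots> \<le> Y k"
      unfolding Y_def
      by (rule surf[of "\<lambda>z. ennreal ((norm (v k z - 0))\<^sup>2) * indicator K z"])
         (use vb compact_imp_closed[OF K(1)] in \<open>auto intro!: borel_measurable_times_ennreal borel_measurable_indicator borel_closed\<close>)
    finally have b: "(\<integral>\<^sup>+y. ennreal ((norm (v k (y, \<psi> y)))\<^sup>2) * indicator A y \<partial>lborel) \<le> Y k" .
    have "(\<integral>\<^sup>+x. ennreal ((norm (w x))\<^sup>2) * indicator ?D x \<partial>lebesgue)
       \<le> 2 * X k + 2 * (\<integral>\<^sup>+x. ennreal ((norm (v k x))\<^sup>2) * indicator ?D x \<partial>lborel)"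
      unfolding X_def by (rule approximate_norm(1)[OF v meas D DS])
    also have "(\<integral>\<^sup>+x. ennreal ((norm (v k x))\<^sup>2) * indicator ?D x \<partial>lborel) \<le> ennreal (2 * h) * Y k + ennreal (2 * h\<^sup>2) * (2 * X k + 2 * g)"
      unfolding X_def g_def
      by (rule order_trans[OF smooth_poincare[OF v \<psi> A h]]) (intro add_mono mult_left_mono b approximate_norm(3)[OF v meas D DS]; simp)
    also have "2 * X k + 2 * (ennreal (2 * h) * Y k + ennreal (2 * h\<^sup>2) * (2 * X k + 2 * g))
       = ennreal (2 + 8 * h\<^sup>2) * X k + ennreal (4 * h) * Y k + ennreal (8 * h\<^sup>2) * g"
    proof -
      have 1: "ennreal (2 + 8 * h\<^sup>2) = 2 + 8 * ennreal (h\<^sup>2)" "ennreal (8 * h\<^sup>2) = 8 * ennreal (h\<^sup>2)" "ennreal (2 * h\<^sup>2) = 2 * ennreal (h\<^sup>2)"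
        "ennreal (2 * h) = 2 * ennreal h" "ennreal (4 * h) = 4 * ennreal h"
        using h by (auto simp: ennreal_mult)
      have 2: "(2::ennreal) * (2 * z) = 4 * z" "(2::ennreal) * (4 * z) = 8 * z" for z by (simp_all flip: mult.assoc)
      show ?thesis unfolding 1 by (simp add: distrib_left distrib_right mult.assoc mult.left_commute[of "ennreal _" 2] 2 add_ac)
    qed
    finally show ?thesis by (simp add: mult_left_mono add_left_mono)
  qed
  then show ?thesis unfolding g_def[symmetric]
    by (rule le_of_null_error) (use er bd in \<open>auto simp: X_def[abs_def] Y_def[abs_def]\<close>)
qed

lemma trace_shift:
  fixes \<psi> :: "real ^ 'n \<Rightarrow> real"
  assumes tr: "has_trace \<psi> U w G g0" and K: "compact K" "K \<subseteq> U"
    and D: "D \<in> sets borel" "D1 \<in> sets borel" "E \<in> sets borel" "D \<subseteq> K \<inter> graph_domain \<psi>" "D1 \<subseteq> E" "E \<subseteq> K \<inter> graph_domain \<psi>" "D \<subseteq> E"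
    and D1: "\<And>x. x \<in> D \<Longrightarrow> x + \<omega> \<in> D1" and E: "\<And>x s. x \<in> D \<Longrightarrow> 0 < s \<Longrightarrow> s < 1 \<Longrightarrow> x + s *\<^sub>R \<omega> \<in> E"
    and meas: "sobolev_measurable E w G"
  shows "(\<integral>\<^sup>+x. ennreal ((norm (w x))\<^sup>2) * indicator D x \<partial>lebesgue)
     \<le> 8 * (\<integral>\<^sup>+x. ennreal ((norm (w x))\<^sup>2) * indicator D1 x \<partial>lebesgue)
       + ennreal (8 * (norm \<omega>)\<^sup>2) * (\<integral>\<^sup>+x. ennreal (grad_norm_sq G x) * indicator E x \<partial>lebesgue)"
proof -
  obtain v where "\<And>k::nat. smooth (v k)"
    "\<And>K. compact K \<Longrightarrow> K \<subseteq> U \<Longrightarrow> (\<lambda>k. sobolev_error (K \<inter> graph_domain \<psi>) (v k) w G) \<longlonglongrightarrow> 0"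
    "\<And>K. compact K \<Longrightarrow> K \<subseteq> U \<Longrightarrow> (\<lambda>k. \<integral>\<^sup>+z\<in>K. ennreal ((norm (v k z - g0 z))\<^sup>2) \<partial>surface_measure \<psi>) \<longlonglongrightarrow> 0"
    by (rule has_traceE[OF tr]) (rule that)
  note er = this(2)[OF K] and v = this(1)
  let ?S = "K \<inter> graph_domain \<psi>"
  have mD: "sobolev_measurable D w G" "sobolev_measurable D1 w G"
    using sobolev_measurable_subset[OF meas] D by auto
  have DS: "D1 \<subseteq> ?S" using D by blast
  define X where "X k = sobolev_error ?S (v k) w G" for k
  define g where "g = (\<integral>\<^sup>+x. ennreal (grad_norm_sq G x) * indicator E x \<partial>lebesgue)"
  define w1 where "w1 = (\<integral>\<^sup>+x. ennreal ((norm (w x))\<^sup>2) * indicator D1 x \<partial>lebesgue)"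
  have "(\<integral>\<^sup>+x. ennreal ((norm (w x))\<^sup>2) * indicator D x \<partial>lebesgue)
     \<le> ennreal (10 + 8 * (norm \<omega>)\<^sup>2) * X k + ennreal 0 * X k + (8 * w1 + ennreal (8 * (norm \<omega>)\<^sup>2) * g)" for k
  proof -
    have "(\<integral>\<^sup>+x. ennreal ((norm (w x))\<^sup>2) * indicator D x \<partial>lebesgue)
       \<le> 2 * X k + 2 * (\<integral>\<^sup>+x. ennreal ((norm (v k x))\<^sup>2) * indicator D x \<partial>lborel)"
      unfolding X_def by (rule approximate_norm(1)[OF v mD(1) D(1) D(4)])
    also have "(\<integral>\<^sup>+x. ennreal ((norm (v k x))\<^sup>2) * indicator D x \<partial>lborel)
       \<le> 2 * (2 * X k + 2 * w1) + ennreal (2 * (norm \<omega>)\<^sup>2) * (2 * X k + 2 * g)"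
      unfolding X_def g_def w1_def
    proof -
      have "(\<integral>\<^sup>+x. ennreal ((norm (v k x))\<^sup>2) * indicator D x \<partial>lborel)
        \<le> 2 * (\<integral>\<^sup>+x. ennreal ((norm (v k x))\<^sup>2) * indicator D1 x \<partial>lborel)
          + ennreal (2 * (norm \<omega>)\<^sup>2) * (\<integral>\<^sup>+x. ennreal (grad_sq (v k) x) * indicator E x \<partial>lborel)"
        by (rule smooth_shift[OF v D(1-3)]) (use D1 E in auto)
      also have "\<dots> \<le> 2 * (2 * sobolev_error ?S (v k) w G + 2 * (\<integral>\<^sup>+x. ennreal ((norm (w x))\<^sup>2) * indicator D1 x \<partial>lebesgue))
        + ennreal (2 * (norm \<omega>)\<^sup>2) * (2 * sobolev_error ?S (v k) w G + 2 * (\<integral>\<^sup>+x. ennreal (grad_norm_sq G x) * indicator E x \<partial>lebesgue))"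
        by (intro add_mono mult_left_mono approximate_norm(2)[OF v mD(2) D(2) DS] approximate_norm(3)[OF v meas D(3) D(6)]) auto
      finally show "(\<integral>\<^sup>+x. ennreal ((norm (v k x))\<^sup>2) * indicator D x \<partial>lborel)
        \<le> 2 * (2 * sobolev_error ?S (v k) w G + 2 * (\<integral>\<^sup>+x. ennreal ((norm (w x))\<^sup>2) * indicator D1 x \<partial>lebesgue))
        + ennreal (2 * (norm \<omega>)\<^sup>2) * (2 * sobolev_error ?S (v k) w G + 2 * (\<integral>\<^sup>+x. ennreal (grad_norm_sq G x) * indicator E x \<partial>lebesgue))" .
    qed
    also have "2 * X k + 2 * (2 * (2 * X k + 2 * w1) + ennreal (2 * (norm \<omega>)\<^sup>2) * (2 * X k + 2 * g))
       = ennreal (10 + 8 * (norm \<omega>)\<^sup>2) * X k + ennreal 0 * X k + (8 * w1 + ennreal (8 * (norm \<omega>)\<^sup>2) * g)"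
    proof -
      have 1: "ennreal (10 + 8 * (norm \<omega>)\<^sup>2) = 2 + 8 + 8 * ennreal ((norm \<omega>)\<^sup>2)" "ennreal (8 * (norm \<omega>)\<^sup>2) = 8 * ennreal ((norm \<omega>)\<^sup>2)"
         "ennreal (2 * (norm \<omega>)\<^sup>2) = 2 * ennreal ((norm \<omega>)\<^sup>2)"
        by (auto simp: ennreal_mult)
      have 2: "(2::ennreal) * (2 * z) = 4 * z" "(2::ennreal) * (4 * z) = 8 * z" for z by (simp_all flip: mult.assoc)
      show ?thesis unfolding 1 by (simp only: distrib_left distrib_right mult.assoc mult.left_commute[of "ennreal _" 2] 2 add_ac ennreal_0 mult_zero_left add_0_left)
    qed
    finally show ?thesis by (simp add: mult_left_mono add_left_mono)
  qed
  then show ?thesis unfolding g_def[symmetric] w1_def[symmetric]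
    by (rule le_of_null_error) (use er in \<open>auto simp: X_def[abs_def]\<close>)
qed

lemma graph_domain_open:
  assumes c: "continuous_on UNIV \<psi>"
  shows "open (graph_domain \<psi>)"
  unfolding graph_domain_def
  by (intro open_Collect_less continuous_on_compose2[OF c] continuous_intros) auto

text \<open>The approximants of \<open>u\<close> and \<open>v\<close> are subtracted; on \<open>U\<close> the data agree, so the difference of the boundary
  values tends to \<open>0\<close>.\<close>

lemma has_trace_diff:
  fixes \<psi> :: "real ^ 'n \<Rightarrow> real" and u v :: "(real ^ 'n) \<times> real \<Rightarrow> 'b::euclidean_space"
  assumes u: "has_trace \<psi> UNIV u G f" and v: "has_trace \<psi> UNIV v H g"
    and fg: "continuous_on UNIV f" "continuous_on UNIV g" "\<And>z. z \<in> U \<Longrightarrow> f z = g z"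
    and \<psi>: "continuous_on UNIV \<psi>"
    and meas: "\<And>r. sobolev_measurable (ball 0 r \<inter> graph_domain \<psi>) u G" "\<And>r. sobolev_measurable (ball 0 r \<inter> graph_domain \<psi>) v H"
  shows "has_trace \<psi> U (\<lambda>x. u x - v x) (\<lambda>e x. G e x - H e x) (\<lambda>_. 0)"
proof -
  obtain a where a: "\<And>k::nat. smooth (a k)"
    "\<And>K. compact K \<Longrightarrow> K \<subseteq> UNIV \<Longrightarrow> (\<lambda>k. sobolev_error (K \<inter> graph_domain \<psi>) (a k) u G) \<longlonglongrightarrow> 0"
    "\<And>K. compact K \<Longrightarrow> K \<subseteq> UNIV \<Longrightarrow> (\<lambda>k. \<integral>\<^sup>+z\<in>K. ennreal ((norm (a k z - f z))\<^sup>2) \<partial>surface_measure \<psi>) \<longlonglongrightarrow> 0"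
    by (rule has_traceE[OF u]) (rule that)
  obtain b where b: "\<And>k::nat. smooth (b k)"
    "\<And>K. compact K \<Longrightarrow> K \<subseteq> UNIV \<Longrightarrow> (\<lambda>k. sobolev_error (K \<inter> graph_domain \<psi>) (b k) v H) \<longlonglongrightarrow> 0"
    "\<And>K. compact K \<Longrightarrow> K \<subseteq> UNIV \<Longrightarrow> (\<lambda>k. \<integral>\<^sup>+z\<in>K. ennreal ((norm (b k z - g z))\<^sup>2) \<partial>surface_measure \<psi>) \<longlonglongrightarrow> 0"
    by (rule has_traceE[OF v]) (rule that)
  have null: "Z \<longlonglongrightarrow> 0" if "\<And>k. Z k \<le> 2 * X k + 2 * Y k" "X \<longlonglongrightarrow> 0" "Y \<longlonglongrightarrow> 0" for X Y Z :: "nat \<Rightarrow> ennreal"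
  proof (rule tendsto_sandwich[of "\<lambda>_. 0"])
    have "(\<lambda>k. 2 * X k + 2 * Y k) \<longlonglongrightarrow> 2 * 0 + 2 * 0"
      using that(2,3) by (intro tendsto_add ennreal_tendsto_cmult) auto
    then show "(\<lambda>k. 2 * X k + 2 * Y k) \<longlonglongrightarrow> 0" by simp
  qed (use that in auto)
  have two: "ennreal r \<le> 2 * ennreal s + 2 * ennreal t" if "r \<le> 2 * s + 2 * t" "0 \<le> s" "0 \<le> t" for r s t
  proof -
    have "ennreal r \<le> ennreal (2 * s + 2 * t)" by (rule ennreal_leI[OF that(1)])
    also have "\<dots> = 2 * ennreal s + 2 * ennreal t" using that by (simp add: ennreal_mult)
    finally show ?thesis .
  qed
  have \<Omega>: "graph_domain \<psi> \<in> sets borel" using graph_domain_open[OF \<psi>] by simp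
  show ?thesis unfolding has_trace_def
  proof (intro exI[of _ "\<lambda>k x. a k x - b k x"] conjI allI impI)
    show "smooth (\<lambda>x. a k x - b k x)" for k by (intro smooth_diff a b)
    fix K assume K: "compact K \<and> K \<subseteq> U"
    then have KU: "compact K" "K \<subseteq> UNIV" by auto
    let ?S = "K \<inter> graph_domain \<psi>"
    obtain r where r: "K \<subseteq> ball 0 r" using KU(1) compact_imp_bounded bounded_subset_ballD by blast
    have S: "?S \<in> sets lebesgue" using \<Omega> compact_imp_closed[OF KU(1)] by (intro sets_completionI_sets) auto
    have mu: "sobolev_measurable ?S u G" using sobolev_measurable_subset[OF meas(1)[of r]] r by blast
    have mv: "sobolev_measurable ?S v H" using sobolev_measurable_subset[OF meas(2)[of r]] r by blast
    show "(\<lambda>k. \<integral>\<^sup>+x\<in>?S. ennreal ((norm (a k x - b k x - (u x - v x)))\<^sup>2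
                + grad_norm_sq (\<lambda>e x. frechet_derivative (\<lambda>x. a k x - b k x) (at x) e - (G e x - H e x)) x) \<partial>lebesgue) \<longlonglongrightarrow> 0"
    proof (rule null[OF _ a(2)[OF KU] b(2)[OF KU]])
      fix k
      define qa where "qa x = (norm (a k x - u x))\<^sup>2 + grad_norm_sq (\<lambda>e x. frechet_derivative (a k) (at x) e - G e x) x" for x
      define qb where "qb x = (norm (b k x - v x))\<^sup>2 + grad_norm_sq (\<lambda>e x. frechet_derivative (b k) (at x) e - H e x) x" for x
      have q0: "0 \<le> qa x" "0 \<le> qb x" for x by (auto simp: qa_def qb_def grad_norm_sq_nonneg)
      have qm: "(\<lambda>x. ennreal (qa x) * indicator ?S x) \<in> borel_measurable lebesgue" "(\<lambda>x. ennreal (qb x) * indicator ?S x) \<in> borel_measurable lebesgue"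
        unfolding qa_def qb_def
        by (intro indicator_lebesgue_measurable S sobolev_error_measurable a b mu mv)+
      have "(norm (a k x - b k x - (u x - v x)))\<^sup>2 + grad_norm_sq (\<lambda>e x. frechet_derivative (\<lambda>x. a k x - b k x) (at x) e - (G e x - H e x)) x
         \<le> 2 * qa x + 2 * qb x" for x
      proof -
        have 1: "(norm (a k x - b k x - (u x - v x)))\<^sup>2 \<le> 2 * (norm (a k x - u x))\<^sup>2 + 2 * (norm (b k x - v x))\<^sup>2"
          using norm_diff_sq_le[of "a k x - u x" "b k x - v x"] by (simp add: algebra_simps)
        have 2: "grad_norm_sq (\<lambda>e x. frechet_derivative (\<lambda>x. a k x - b k x) (at x) e - (G e x - H e x)) x
          = grad_norm_sq (\<lambda>e x. (frechet_derivative (a k) (at x) e - G e x) - (frechet_derivative (b k) (at x) e - H e x)) x"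
          unfolding grad_norm_sq_def frechet_derivative_smooth_diff[OF a(1) b(1)] by (simp add: algebra_simps)
        have "\<dots> \<le> 2 * grad_norm_sq (\<lambda>e x. frechet_derivative (a k) (at x) e - G e x) x + 2 * grad_norm_sq (\<lambda>e x. frechet_derivative (b k) (at x) e - H e x) x"
          by (rule grad_norm_sq_diff_le)
        then show ?thesis using 1 2 by (simp add: qa_def qb_def)
      qed
      then have "(\<integral>\<^sup>+x\<in>?S. ennreal ((norm (a k x - b k x - (u x - v x)))\<^sup>2
                + grad_norm_sq (\<lambda>e x. frechet_derivative (\<lambda>x. a k x - b k x) (at x) e - (G e x - H e x)) x) \<partial>lebesgue)
         \<le> (\<integral>\<^sup>+x. 2 * (ennreal (qa x) * indicator ?S x) + 2 * (ennreal (qb x) * indicator ?S x) \<partial>lebesgue)"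
        using two[OF _ q0] by (intro nn_integral_mono) (auto simp: indicator_def)
      also have "\<dots> = 2 * sobolev_error ?S (a k) u G + 2 * sobolev_error ?S (b k) v H"
        using qm by (simp add: nn_integral_add nn_integral_cmult sobolev_error_def qa_def qb_def)
      finally show "(\<integral>\<^sup>+x\<in>?S. ennreal ((norm (a k x - b k x - (u x - v x)))\<^sup>2
                + grad_norm_sq (\<lambda>e x. frechet_derivative (\<lambda>x. a k x - b k x) (at x) e - (G e x - H e x)) x) \<partial>lebesgue)
         \<le> 2 * sobolev_error ?S (a k) u G + 2 * sobolev_error ?S (b k) v H" .
    qed
    show "(\<lambda>k. \<integral>\<^sup>+z\<in>K. ennreal ((norm (a k z - b k z - 0))\<^sup>2) \<partial>surface_measure \<psi>) \<longlonglongrightarrow> 0"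
    proof (rule null[OF _ a(3)[OF KU] b(3)[OF KU]])
      fix k
      have [measurable]: "a k \<in> borel_measurable borel" "b k \<in> borel_measurable borel" "f \<in> borel_measurable borel" "g \<in> borel_measurable borel"
        using smooth_continuous[OF a(1)] smooth_continuous[OF b(1)] fg by (auto intro: borel_measurable_continuous_onI)
      have [measurable]: "K \<in> sets borel" using compact_imp_closed[OF KU(1)] by simp
      have sm [measurable_cong]: "sets (surface_measure \<psi>) = sets borel" by (simp add: surface_measure_def)
      have "(norm (a k z - b k z - 0))\<^sup>2 \<le> 2 * (norm (a k z - f z))\<^sup>2 + 2 * (norm (b k z - g z))\<^sup>2" if "z \<in> K" for z
        using norm_diff_sq_le[of "a k z - f z" "b k z - g z"] fg(3)[of z] K that by (auto simp: algebra_simps)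
      then have "(\<integral>\<^sup>+z\<in>K. ennreal ((norm (a k z - b k z - 0))\<^sup>2) \<partial>surface_measure \<psi>)
        \<le> (\<integral>\<^sup>+z. 2 * (ennreal ((norm (a k z - f z))\<^sup>2) * indicator K z) + 2 * (ennreal ((norm (b k z - g z))\<^sup>2) * indicator K z) \<partial>surface_measure \<psi>)"
        using two by (intro nn_integral_mono) (auto simp: indicator_def)
      also have "\<dots> = 2 * (\<integral>\<^sup>+z\<in>K. ennreal ((norm (a k z - f z))\<^sup>2) \<partial>surface_measure \<psi>) + 2 * (\<integral>\<^sup>+z\<in>K. ennreal ((norm (b k z - g z))\<^sup>2) \<partial>surface_measure \<psi>)"
        by (subst nn_integral_add, measurable, subst (1 2) nn_integral_cmult, measurable)
      finally show "(\<integral>\<^sup>+z\<in>K. ennreal ((norm (a k z - b k z - 0))\<^sup>2) \<partial>surface_measure \<psi>)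
        \<le> 2 * (\<integral>\<^sup>+z\<in>K. ennreal ((norm (a k z - f z))\<^sup>2) \<partial>surface_measure \<psi>) + 2 * (\<integral>\<^sup>+z\<in>K. ennreal ((norm (b k z - g z))\<^sup>2) \<partial>surface_measure \<psi>)" .
    qed
  qed
qed

section \<open>Lipschitz graphs and surface measure\<close>

lemma gradient_eq:
  assumes "GDERIV \<psi> y :> D"
  shows "gradient \<psi> y = D"
proof -
  have "D' = D" if "GDERIV \<psi> y :> D'" for D'
  proof -
    have "(\<lambda>h. h \<bullet> D') = (\<lambda>h. h \<bullet> D)"
      using that assms unfolding gderiv_def by (rule has_derivative_unique)
    then show ?thesis by (metis vector_eq_ldot)
  qed
  then have "(THE D. GDERIV \<psi> y :> D) = D" using assms by blast
  then show ?thesis using assms by (auto simp: gradient_def)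
qed

lemma gderiv_directional:
  fixes \<psi> :: "'a::euclidean_space \<Rightarrow> real"
  assumes "GDERIV \<psi> p :> D"
  shows "((\<lambda>s. (\<psi> (p + s *\<^sub>R h) - \<psi> p) / s) \<longlongrightarrow> h \<bullet> D) (at 0)"
proof -
  have "((\<lambda>s::real. p + s *\<^sub>R h) has_derivative (\<lambda>s. s *\<^sub>R h)) (at 0)" by (auto intro!: derivative_eq_intros)
  moreover have "(\<psi> has_derivative (\<lambda>h. h \<bullet> D)) (at (p + 0 *\<^sub>R h))" using assms by (simp add: gderiv_def)
  ultimately have "((\<lambda>s. \<psi> (p + s *\<^sub>R h)) has_derivative (\<lambda>s. (s *\<^sub>R h) \<bullet> D)) (at 0)"
    by (rule has_derivative_compose)
  then have "((\<lambda>s. \<psi> (p + s *\<^sub>R h)) has_real_derivative (h \<bullet> D)) (at 0)"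
    by (simp add: has_field_derivative_def mult_commute_abs)
  then show ?thesis by (simp add: has_field_derivative_iff)
qed

text \<open>The limit along \<open>1 / (n + 1)\<close> is a Borel function of \<open>p\<close> whether or not \<open>\<psi>\<close> is differentiable at \<open>p\<close>; this
  settles the measurability of the gradient.\<close>

definition directional :: "('a::euclidean_space \<Rightarrow> real) \<Rightarrow> 'a \<Rightarrow> 'a \<Rightarrow> real" where
  "directional \<psi> h p = lim (\<lambda>n. (\<psi> (p + (1 / real (Suc n)) *\<^sub>R h) - \<psi> p) / (1 / real (Suc n)))"

lemma directional_measurable [measurable]:
  assumes "continuous_on UNIV \<psi>"
  shows "directional \<psi> h \<in> borel_measurable borel"
  unfolding directional_def[abs_def]
  by (intro borel_measurable_lim_metric borel_measurable_continuous_onI continuous_intros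
      continuous_on_compose2[OF assms]) auto

lemma directional_eq:
  fixes \<psi> :: "'a::euclidean_space \<Rightarrow> real"
  assumes "GDERIV \<psi> p :> D"
  shows "directional \<psi> h p = h \<bullet> D"
proof -
  have "filterlim (\<lambda>n. 1 / real (Suc n)) (at 0) sequentially"
    unfolding filterlim_at using LIMSEQ_inverse_real_of_nat by (auto simp: inverse_eq_divide)
  from filterlim_compose[OF gderiv_directional[OF assms, of h] this]
  show ?thesis unfolding directional_def by (rule limI)
qed

lemma lipschitz_graph_continuous: "lipschitz_graph M \<psi> \<Longrightarrow> continuous_on UNIV \<psi>"
  unfolding lipschitz_graph_def using lipschitz_on_continuous_on by blast

lemma lipschitz_graph_AE: "lipschitz_graph M \<psi> \<Longrightarrow> AE y in lborel. \<exists>D. GDERIV \<psi> y :> D \<and> norm D \<le> M"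
  unfolding lipschitz_graph_def by (simp add: AE_completion_iff)

lemma AE_lborel_translate:
  fixes P :: "'a::euclidean_space \<Rightarrow> bool"
  assumes "AE x in lborel. P x"
  shows "AE x in lborel. P (c + x)"
proof -
  have "AE x in distr lborel borel ((+) c). P x" using assms by (simp only: lborel_distr_plus)
  then show ?thesis by (rule AE_distrD[rotated]) simp
qed

text \<open>An almost everywhere bound on the gradient says nothing about a given segment, so \<open>\<psi>\<close> is averaged over small
  balls.  The difference quotients are bounded, hence the average \<open>a\<close> along a segment may be differentiated
  under the integral, and the mean value theorem bounds its increment by \<open>M * norm h\<close>.  The average differs
  from \<open>\<psi>\<close> by at most \<open>L * \<epsilon>\<close>, where \<open>L\<close> is the Lipschitz constant that is known to exist.\<close>

lemma lipschitz_graph_bound: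
  fixes \<psi> :: "real ^ 'n \<Rightarrow> real"
  assumes lip: "lipschitz_graph M \<psi>" and M: "0 \<le> M"
  shows "\<bar>\<psi> x - \<psi> y\<bar> \<le> M * norm (x - y)"
proof -
  have c\<psi>: "continuous_on UNIV \<psi>" by (rule lipschitz_graph_continuous[OF lip])
  have [measurable]: "\<psi> \<in> borel_measurable borel" using c\<psi> by (rule borel_measurable_continuous_onI)
  obtain L where L: "L-lipschitz_on UNIV \<psi>" using lip by (auto simp: lipschitz_graph_def)
  have L0: "0 \<le> L" using L by (rule lipschitz_on_nonneg)
  have Ld: "\<bar>\<psi> p - \<psi> q\<bar> \<le> L * norm (p - q)" for p q
    using lipschitz_onD[OF L, of p q] by (simp add: dist_norm)
  have one_sided: "\<psi> (y + h) - \<psi> y \<le> M * norm h" for y h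
  proof (rule field_le_epsilon)
    fix e :: real assume e: "0 < e"
    define \<epsilon> where "\<epsilon> = (e / 2) / (L + 1)"
    have \<epsilon>: "0 < \<epsilon>" using e L0 by (simp add: \<epsilon>_def)
    have L\<epsilon>: "2 * (L * \<epsilon>) \<le> e"
    proof -
      have "2 * (L * \<epsilon>) \<le> 2 * ((L + 1) * \<epsilon>)" using \<epsilon> by (intro mult_left_mono mult_right_mono) auto
      also have "(L + 1) * \<epsilon> = e / 2"
      proof -
        have "L + 1 \<noteq> 0" using L0 by simp
        then have "(L + 1) * (x / (L + 1)) = x" for x by simp
        then show ?thesis unfolding \<epsilon>_def .
      qed
      finally show ?thesis by simp
    qed
    define B where "B = cball (0 :: real ^ 'n) \<epsilon>"
    have [measurable]: "B \<in> sets borel" by (simp add: B_def)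
    have Bfin: "emeasure lborel B < top" by (simp add: B_def emeasure_cball \<epsilon> less_imp_le)
    define V where "V = measure lborel B"
    have V: "0 < V" using \<epsilon> by (simp add: V_def B_def content_cball)
    define a where "a t = (LINT z|lborel. indicator B z *\<^sub>R \<psi> (y + t *\<^sub>R h + z))" for t :: real
    have inta: "integrable lborel (\<lambda>z. indicator B z *\<^sub>R \<psi> (q + z))" for q
      unfolding B_def by (intro borel_integrable_compact continuous_on_compose2[OF c\<psi>] continuous_intros) auto
    have deriv: "(a has_real_derivative (LINT z|lborel. indicator B z *\<^sub>R directional \<psi> h (y + t *\<^sub>R h + z))) (at t)" for t
      unfolding has_field_derivative_def has_derivative_at
    proof -
      let ?d = "LINT z|lborel. indicator B z *\<^sub>R directional \<psi> h (y + t *\<^sub>R h + z)"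
      have "((\<lambda>s. (a (t + s) - a t) / s) \<longlongrightarrow> ?d) (at 0)"
        unfolding tendsto_at_iff_sequentially
      proof (intro allI impI)
        fix s :: "nat \<Rightarrow> real" assume s: "\<forall>i. s i \<in> UNIV - {0}" "s \<longlonglongrightarrow> 0"
        have fs: "filterlim s (at 0) sequentially" using s by (auto simp: filterlim_at)
        let ?q = "\<lambda>i z. indicator B z *\<^sub>R ((\<psi> (y + t *\<^sub>R h + z + s i *\<^sub>R h) - \<psi> (y + t *\<^sub>R h + z)) / s i)"
        have lim: "(\<lambda>i. LINT z|lborel. ?q i z) \<longlonglongrightarrow> ?d"
        proof (rule integral_dominated_convergence[where w="\<lambda>z. indicator B z * (L * norm h)"])
          show "(\<lambda>z. indicator B z *\<^sub>R directional \<psi> h (y + t *\<^sub>R h + z)) \<in> borel_measurable lborel"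
            using directional_measurable[OF c\<psi>, of h] by measurable
          show "?q i \<in> borel_measurable lborel" for i by measurable
          show "integrable lborel (\<lambda>z. indicator B z * (L * norm h))"
            using Bfin by (intro integrable_mult_left integrable_real_indicator) auto
          show "AE z in lborel. norm (?q i z) \<le> indicator B z * (L * norm h)" for i
          proof (rule AE_I2)
            fix z
            have "\<bar>\<psi> (y + t *\<^sub>R h + z + s i *\<^sub>R h) - \<psi> (y + t *\<^sub>R h + z)\<bar> \<le> \<bar>s i\<bar> * (L * norm h)"
              using Ld[of "y + t *\<^sub>R h + z + s i *\<^sub>R h" "y + t *\<^sub>R h + z"] by (simp add: mult_ac)
            then show "norm (?q i z) \<le> indicator B z * (L * norm h)"
              using s(1) by (auto simp: indicator_def divide_le_eq mult.commute)
          qed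
          show "AE z in lborel. (\<lambda>i. ?q i z) \<longlonglongrightarrow> indicator B z *\<^sub>R directional \<psi> h (y + t *\<^sub>R h + z)"
            using AE_lborel_translate[OF lipschitz_graph_AE[OF lip], of "y + t *\<^sub>R h"]
          proof eventually_elim
            case (elim z)
            then obtain D where D: "GDERIV \<psi> (y + t *\<^sub>R h + z) :> D" by blast
            show ?case
              using filterlim_compose[OF gderiv_directional[OF D, of h] fs]
              by (intro tendsto_scaleR tendsto_const) (simp add: directional_eq[OF D])
          qed
        qed
        have eq: "(LINT z|lborel. ?q i z) = (a (t + s i) - a t) / s i" for i
        proof -
          have "(LINT z|lborel. ?q i z) = (LINT z|lborel. (indicator B z *\<^sub>R \<psi> (y + (t + s i) *\<^sub>R h + z) - indicator B z *\<^sub>R \<psi> (y + t *\<^sub>R h + z)) / s i)"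
            by (intro Bochner_Integration.integral_cong) (auto simp: indicator_def algebra_simps)
          also have "\<dots> = (a (t + s i) - a t) / s i"
            unfolding a_def using inta by simp
          finally show ?thesis .
        qed
        show "((\<lambda>s. (a (t + s) - a t) / s) \<circ> s) \<longlonglongrightarrow> ?d" using lim unfolding o_def by (simp only: eq)
      qed
      then have "(a has_real_derivative ?d) (at t)" by (simp add: DERIV_def)
      then show "bounded_linear ((*) ?d) \<and> (\<lambda>s. norm (a (t + s) - a t - ?d * s) / norm s) \<midarrow>0\<rightarrow> 0"
        by (simp add: has_field_derivative_def has_derivative_at)
    qed
    obtain t where t: "a 1 - a 0 = (1 - 0) * (LINT z|lborel. indicator B z *\<^sub>R directional \<psi> h (y + t *\<^sub>R h + z))"
      using MVT2[of 0 1 a "\<lambda>t. LINT z|lborel. indicator B z *\<^sub>R directional \<psi> h (y + t *\<^sub>R h + z)"] deriv by auto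
    have BM: "(LINT z|lborel. indicator B z *\<^sub>R c) = c * V" for c :: real
      by (simp add: V_def mult.commute)
    have intB: "integrable lborel (\<lambda>z. indicator B z *\<^sub>R c)" for c :: real
      using Bfin by (intro integrable_scaleR_left integrable_real_indicator) auto
    have a1: "a 1 - a 0 \<le> M * norm h * V"
    proof -
      have AEd: "AE z in lborel. \<bar>directional \<psi> h (y + t *\<^sub>R h + z)\<bar> \<le> M * norm h"
        using AE_lborel_translate[OF lipschitz_graph_AE[OF lip], of "y + t *\<^sub>R h"]
      proof eventually_elim
        case (elim z)
        then obtain D where D: "GDERIV \<psi> (y + t *\<^sub>R h + z) :> D" "norm D \<le> M" by blast
        have "\<bar>h \<bullet> D\<bar> \<le> norm h * norm D" by (rule Cauchy_Schwarz_ineq2)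
        also have "\<dots> \<le> norm h * M" using D(2) by (intro mult_left_mono) auto
        finally show ?case by (simp add: directional_eq[OF D(1)] mult.commute)
      qed
      have "(LINT z|lborel. indicator B z *\<^sub>R directional \<psi> h (y + t *\<^sub>R h + z)) \<le> (LINT z|lborel. indicator B z *\<^sub>R (M * norm h))"
      proof (rule integral_mono_AE)
        show "integrable lborel (\<lambda>z. indicator B z *\<^sub>R directional \<psi> h (y + t *\<^sub>R h + z))"
        proof (rule Bochner_Integration.integrable_bound[OF intB[of "M * norm h"]])
          show "(\<lambda>z. indicator B z *\<^sub>R directional \<psi> h (y + t *\<^sub>R h + z)) \<in> borel_measurable lborel"
            using directional_measurable[OF c\<psi>, of h] by measurable
          show "AE z in lborel. norm (indicator B z *\<^sub>R directional \<psi> h (y + t *\<^sub>R h + z)) \<le> norm (indicator B z *\<^sub>R (M * norm h))"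
            using AEd by eventually_elim (use M in \<open>auto simp: indicator_def\<close>)
        qed
        show "AE z in lborel. indicator B z *\<^sub>R directional \<psi> h (y + t *\<^sub>R h + z) \<le> indicator B z *\<^sub>R (M * norm h)"
          using AEd by eventually_elim (auto simp: indicator_def)
      qed (rule intB)
      from this[unfolded BM] show ?thesis using t by simp
    qed
    have near: "\<bar>a t - \<psi> (y + t *\<^sub>R h) * V\<bar> \<le> L * \<epsilon> * V" for t
    proof -
      let ?p = "y + t *\<^sub>R h"
      have "a t - \<psi> ?p * V = (LINT z|lborel. indicator B z *\<^sub>R \<psi> (?p + z) - indicator B z *\<^sub>R \<psi> ?p)"
        unfolding a_def BM[symmetric] by (intro Bochner_Integration.integral_diff[symmetric] inta intB)
      also have "\<bar>\<dots>\<bar> \<le> (LINT z|lborel. \<bar>indicator B z *\<^sub>R \<psi> (?p + z) - indicator B z *\<^sub>R \<psi> ?p\<bar>)"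
        by (rule integral_abs_bound)
      also have "\<dots> \<le> (LINT z|lborel. indicator B z *\<^sub>R (L * \<epsilon>))"
      proof (rule integral_mono)
        fix z :: "real ^ 'n"
        have "\<bar>\<psi> (?p + z) - \<psi> ?p\<bar> \<le> L * \<epsilon>" if "z \<in> B"
        proof -
          have "\<bar>\<psi> (?p + z) - \<psi> ?p\<bar> \<le> L * norm z" using Ld[of "?p + z" ?p] by simp
          also have "\<dots> \<le> L * \<epsilon>" using that L0 by (intro mult_left_mono) (auto simp: B_def)
          finally show ?thesis .
        qed
        then show "\<bar>indicator B z *\<^sub>R \<psi> (?p + z) - indicator B z *\<^sub>R \<psi> ?p\<bar> \<le> indicator B z *\<^sub>R (L * \<epsilon>)"
          by (auto simp: indicator_def)
      qed (intro integrable_abs Bochner_Integration.integrable_diff inta intB)+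
      finally show ?thesis unfolding BM .
    qed
    have "(\<psi> (y + h) - \<psi> y) * V \<le> (a 1 - a 0) + 2 * (L * \<epsilon> * V)"
      using near[of 1] near[of 0] by (simp add: algebra_simps)
    also have "\<dots> \<le> (M * norm h + 2 * (L * \<epsilon>)) * V" using a1 by (simp add: algebra_simps)
    finally have "\<psi> (y + h) - \<psi> y \<le> M * norm h + 2 * (L * \<epsilon>)" using V by simp
    then show "\<psi> (y + h) - \<psi> y \<le> M * norm h + e" using L\<epsilon> by simp
  qed
  show ?thesis
    using one_sided[of y "x - y"] one_sided[of x "y - x"] by (auto simp: abs_le_iff norm_minus_commute)
qed

text \<open>The density agrees almost everywhere with a Borel function of the directional derivatives, and Lebesgue
  measure is complete.\<close>

lemma surface_density:
  fixes \<psi> :: "real ^ 'n \<Rightarrow> real"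
  assumes lip: "lipschitz_graph M \<psi>" and M: "0 \<le> M"
  shows "(\<lambda>y. ennreal (sqrt (1 + (norm (gradient \<psi> y))\<^sup>2))) \<in> borel_measurable lebesgue"
    and "AE y in lebesgue. 1 \<le> ennreal (sqrt (1 + (norm (gradient \<psi> y))\<^sup>2)) \<and> ennreal (sqrt (1 + (norm (gradient \<psi> y))\<^sup>2)) \<le> ennreal (1 + M)"
proof -
  have c\<psi>: "continuous_on UNIV \<psi>" by (rule lipschitz_graph_continuous[OF lip])
  let ?w = "\<lambda>y. ennreal (sqrt (1 + (norm (gradient \<psi> y))\<^sup>2))"
  define w' where "w' y = ennreal (sqrt (1 + (\<Sum>e\<in>Basis. (directional \<psi> e y)\<^sup>2)))" for y
  have [measurable]: "directional \<psi> e \<in> borel_measurable borel" for e by (rule directional_measurable[OF c\<psi>])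
  have w'm: "w' \<in> borel_measurable lebesgue"
    unfolding w'_def[abs_def] by (intro measurable_completion) measurable
  have AEw: "AE y in lebesgue. ?w y = w' y"
    using lipschitz_graph_AE[OF lip] unfolding AE_completion_iff
  proof eventually_elim
    case (elim y)
    then obtain D where D: "GDERIV \<psi> y :> D" by blast
    have "(norm D)\<^sup>2 = (\<Sum>e\<in>Basis. (e \<bullet> D)\<^sup>2)"
      unfolding power2_norm_eq_inner euclidean_inner[of D D] by (simp add: power2_eq_square inner_commute)
    then show ?case by (simp add: w'_def gradient_eq[OF D] directional_eq[OF D])
  qed
  show "?w \<in> borel_measurable lebesgue"
  proof (rule measurableI)
    fix A :: "ennreal set" assume A: "A \<in> sets borel"
    show "?w -` A \<inter> space lebesgue \<in> sets lebesgue"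
      by (rule completion.in_sets_AE[OF _ measurable_sets[OF w'm A]]) (use AEw in \<open>eventually_elim, auto\<close>)
  qed auto
  show "AE y in lebesgue. 1 \<le> ?w y \<and> ?w y \<le> ennreal (1 + M)"
    using lipschitz_graph_AE[OF lip] unfolding AE_completion_iff
  proof eventually_elim
    case (elim y)
    then obtain D where D: "GDERIV \<psi> y :> D" "norm D \<le> M" by blast
    have "sqrt (1 + (norm D)\<^sup>2) \<le> 1 + norm D"
      by (rule real_le_lsqrt) (auto simp: power2_sum)
    then show ?case using D by (auto simp: gradient_eq[OF D(1)] intro!: ennreal_leI)
  qed
qed

lemma surface_integral_bounds:
  fixes \<psi> :: "real ^ 'n \<Rightarrow> real"
  assumes lip: "lipschitz_graph M \<psi>" and M: "0 \<le> M" and q [measurable]: "q \<in> borel_measurable borel"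
  shows "(\<integral>\<^sup>+y. q (y, \<psi> y) \<partial>lborel) \<le> (\<integral>\<^sup>+z. q z \<partial>surface_measure \<psi>)"
    and "(\<integral>\<^sup>+z. q z \<partial>surface_measure \<psi>) \<le> ennreal (1 + M) * (\<integral>\<^sup>+y. q (y, \<psi> y) \<partial>lborel)"
proof -
  have c\<psi>: "continuous_on UNIV \<psi>" by (rule lipschitz_graph_continuous[OF lip])
  have g: "(\<lambda>y. (y, \<psi> y)) \<in> borel_measurable borel"
    by (intro borel_measurable_continuous_onI continuous_intros c\<psi>)
  then have gl: "(\<lambda>y. (y, \<psi> y)) \<in> borel_measurable lebesgue" by (intro measurable_completion) simp
  let ?w = "\<lambda>y. ennreal (sqrt (1 + (norm (gradient \<psi> y))\<^sup>2))"
  note w = surface_density[OF lip M]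
  have qg: "(\<lambda>y. q (y, \<psi> y)) \<in> borel_measurable borel" using measurable_compose[OF g q] .
  then have qgl: "(\<lambda>y. q (y, \<psi> y)) \<in> borel_measurable lebesgue" by (intro measurable_completion) simp
  have "(\<integral>\<^sup>+z. q z \<partial>surface_measure \<psi>) = (\<integral>\<^sup>+y. q (y, \<psi> y) \<partial>density lebesgue ?w)"
    unfolding surface_measure_def using gl by (subst nn_integral_distr) (auto simp: q)
  also have "\<dots> = (\<integral>\<^sup>+y. ?w y * q (y, \<psi> y) \<partial>lebesgue)"
    by (rule nn_integral_density[OF w(1) qgl])
  finally have eq: "(\<integral>\<^sup>+z. q z \<partial>surface_measure \<psi>) = (\<integral>\<^sup>+y. ?w y * q (y, \<psi> y) \<partial>lebesgue)" .
  have "(\<integral>\<^sup>+y. q (y, \<psi> y) \<partial>lebesgue) \<le> (\<integral>\<^sup>+y. ?w y * q (y, \<psi> y) \<partial>lebesgue)"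
  proof (rule nn_integral_mono_AE)
    show "AE y in lebesgue. q (y, \<psi> y) \<le> ?w y * q (y, \<psi> y)"
      using w(2)
    proof eventually_elim
      case (elim y)
      then have "1 * q (y, \<psi> y) \<le> ?w y * q (y, \<psi> y)" by (intro mult_right_mono) auto
      then show ?case by simp
    qed
  qed
  then show "(\<integral>\<^sup>+y. q (y, \<psi> y) \<partial>lborel) \<le> (\<integral>\<^sup>+z. q z \<partial>surface_measure \<psi>)"
    unfolding eq by (simp add: nn_integral_completion)
  have "(\<integral>\<^sup>+y. ?w y * q (y, \<psi> y) \<partial>lebesgue) \<le> (\<integral>\<^sup>+y. ennreal (1 + M) * q (y, \<psi> y) \<partial>lebesgue)"
    by (rule nn_integral_mono_AE) (use w(2) in \<open>eventually_elim, auto intro: mult_right_mono\<close>)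
  also have "\<dots> = ennreal (1 + M) * (\<integral>\<^sup>+y. q (y, \<psi> y) \<partial>lebesgue)" by (rule nn_integral_cmult[OF qgl])
  finally show "(\<integral>\<^sup>+z. q z \<partial>surface_measure \<psi>) \<le> ennreal (1 + M) * (\<integral>\<^sup>+y. q (y, \<psi> y) \<partial>lborel)"
    unfolding eq by (simp add: nn_integral_completion)
qed

section \<open>Whitney balls and the nontangential maximal function\<close>

lemma frontier_graph_domain:
  assumes c: "continuous_on UNIV \<psi>"
  shows "frontier (graph_domain \<psi>) = {x. snd x = \<psi> (fst x)}"
proof -
  have "closure (graph_domain \<psi>) = {x. \<psi> (fst x) \<le> snd x}"
  proof
    have "closed {x. \<psi> (fst x) \<le> snd x}"
      by (intro closed_Collect_le continuous_on_compose2[OF c] continuous_intros) auto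
    then show "closure (graph_domain \<psi>) \<subseteq> {x. \<psi> (fst x) \<le> snd x}"
      by (intro closure_minimal) (auto simp: graph_domain_def)
    show "{x. \<psi> (fst x) \<le> snd x} \<subseteq> closure (graph_domain \<psi>)"
    proof
      fix x assume x: "x \<in> {x. \<psi> (fst x) \<le> snd x}"
      let ?a = "\<lambda>n. (fst x, snd x + inverse (real (Suc n)))"
      have "?a \<longlonglongrightarrow> (fst x, snd x + 0)"
        by (intro tendsto_intros LIMSEQ_inverse_real_of_nat)
      moreover have "?a n \<in> graph_domain \<psi>" for n
      proof -
        have "0 < inverse (real (Suc n))" by simp
        then show ?thesis using x unfolding graph_domain_def mem_Collect_eq fst_conv snd_conv by linarith
      qed
      ultimately show "x \<in> closure (graph_domain \<psi>)"
        unfolding closure_sequential by (intro exI[of _ ?a]) (simp del: of_nat_Suc)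
    qed
  qed
  moreover have "interior (graph_domain \<psi>) = graph_domain \<psi>" using graph_domain_open[OF c] by (rule interior_open)
  ultimately show ?thesis unfolding frontier_def by (auto simp: graph_domain_def)
qed

abbreviation depth :: "(real ^ 'n \<Rightarrow> real) \<Rightarrow> (real ^ 'n) \<times> real \<Rightarrow> real" where
  "depth \<psi> x \<equiv> infdist x (frontier (graph_domain \<psi>))"

lemma norm_fst_snd_le: "norm (fst x) \<le> norm x" "\<bar>snd x\<bar> \<le> norm x"
  using norm_fst_le[of "fst x" "snd x"] norm_snd_le[of "snd x" "fst x"] by simp_all

lemma norm_prod_le: "norm x \<le> norm (fst x) + \<bar>snd x\<bar>"
  using norm_Pair_le[of "fst x" "snd x"] by simp

text \<open>The vertical segment to the graph is at least as long as the distance to the boundary; conversely the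
  height above the graph vanishes at the nearest boundary point and is Lipschitz with constant \<open>1 + M\<close>.\<close>

lemma depth_height:
  assumes c: "continuous_on UNIV \<psi>" and lip: "\<And>x y. \<bar>\<psi> x - \<psi> y\<bar> \<le> M * norm (x - y)" and M: "0 \<le> M"
    and x: "x \<in> graph_domain \<psi>"
  shows "0 < depth \<psi> x" "depth \<psi> x \<le> snd x - \<psi> (fst x)" "snd x - \<psi> (fst x) \<le> (1 + M) * depth \<psi> x"
    "\<exists>y. dist x (y, \<psi> y) = depth \<psi> x"
proof -
  let ?F = "frontier (graph_domain \<psi>)"
  have F: "?F = {x. snd x = \<psi> (fst x)}" by (rule frontier_graph_domain[OF c])
  have ne: "?F \<noteq> {}" unfolding F by (auto intro: exI[of _ "\<psi> undefined"])
  have cl: "closed ?F" by simp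
  have "dist x (fst x, \<psi> (fst x)) = \<bar>snd x - \<psi> (fst x)\<bar>"
    by (simp add: dist_norm norm_prod_def)
  also have "\<dots> = snd x - \<psi> (fst x)" using x by (simp add: graph_domain_def)
  finally show "depth \<psi> x \<le> snd x - \<psi> (fst x)"
    using infdist_le[of "(fst x, \<psi> (fst x))" ?F x] F by simp
  obtain z where z: "z \<in> ?F" "depth \<psi> x = dist x z" by (rule infdist_attains_inf[OF cl ne])
  have zs: "snd z = \<psi> (fst z)" using z(1) unfolding F by simp
  then have zz: "z = (fst z, \<psi> (fst z))" by (simp add: prod_eq_iff)
  show "\<exists>y. dist x (y, \<psi> y) = depth \<psi> x" by (rule exI[of _ "fst z"]) (simp only: zz[symmetric] z(2))
  have "snd x - \<psi> (fst x) = (snd x - snd z) + (\<psi> (fst z) - \<psi> (fst x))" using zs by simp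
  also have "\<dots> \<le> norm (x - z) + M * norm (fst z - fst x)"
    using norm_fst_snd_le(2)[of "x - z"] lip[of "fst z" "fst x"] by (intro add_mono) auto
  also have "\<dots> \<le> norm (x - z) + M * norm (x - z)"
    using norm_fst_snd_le(1)[of "x - z"] M by (intro add_left_mono mult_left_mono) (auto simp: norm_minus_commute)
  finally show le: "snd x - \<psi> (fst x) \<le> (1 + M) * depth \<psi> x"
    using z(2) by (simp add: dist_norm algebra_simps)
  have "0 < snd x - \<psi> (fst x)" using x by (simp add: graph_domain_def)
  then have "0 < (1 + M) * depth \<psi> x" using le by linarith
  then show "0 < depth \<psi> x" using M by (simp add: zero_less_mult_iff)
qed

text \<open>A segment from \<open>x\<close> to a point outside the domain meets the boundary.\<close>

lemma whitney_ball_in_domain: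
  fixes \<psi> :: "real ^ 'n \<Rightarrow> real"
  assumes x: "x \<in> graph_domain \<psi>" and d: "0 < depth \<psi> x"
  shows "ball x (depth \<psi> x / 4) \<subseteq> graph_domain \<psi>"
proof
  fix z assume z: "z \<in> ball x (depth \<psi> x / 4)"
  show "z \<in> graph_domain \<psi>"
  proof (rule ccontr)
    assume "z \<notin> graph_domain \<psi>"
    then have "closed_segment x z \<inter> frontier (graph_domain \<psi>) \<noteq> {}"
      using x by (intro connected_Int_frontier) auto
    then obtain z' where z': "z' \<in> closed_segment x z" "z' \<in> frontier (graph_domain \<psi>)" by blast
    have "depth \<psi> x \<le> dist x z'" using z'(2) by (rule infdist_le)
    also have "\<dots> \<le> dist x z" using dist_in_closed_segment[OF z'(1)] by (simp add: dist_commute)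
    finally show False using z d by simp
  qed
qed

definition whitney_average :: "('a::euclidean_space) set \<Rightarrow> ('a \<Rightarrow> 'b::euclidean_space) \<Rightarrow> 'a \<Rightarrow> ennreal" where
  "whitney_average \<Omega> u x = (let B = ball x (infdist x (frontier \<Omega>) / 4)
        in ennreal_powr ((\<integral>\<^sup>+y\<in>B. ennreal ((norm (u y))\<^sup>2) \<partial>lebesgue) / emeasure lebesgue B) (1/2))"

lemma nontangential_max_eq: "nontangential_max \<Omega> a u z = (SUP x\<in>cone \<Omega> a z. whitney_average \<Omega> u x)"
  by (simp add: nontangential_max_def whitney_average_def)

text \<open>A point \<open>x\<close> belongs to the cone at \<open>z\<close> if and only if \<open>z\<close> belongs to a ball around \<open>x\<close>, so superlevel sets
  are unions of balls.\<close>

lemma open_nontangential_max: "open {z. t < nontangential_max \<Omega> a u z}"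
proof -
  have "{z. t < nontangential_max \<Omega> a u z} = (\<Union>x\<in>{x\<in>\<Omega>. t < whitney_average \<Omega> u x}. ball x (a * infdist x (frontier \<Omega>)))"
    unfolding nontangential_max_eq less_SUP_iff cone_def by auto
  then show ?thesis by auto
qed

lemma nontangential_max_measurable: "nontangential_max \<Omega> a u \<in> borel_measurable borel"
  by (rule borel_measurableI_greater) (auto intro: borel_open open_nontangential_max)

lemma whitney_average_le: "x \<in> cone \<Omega> a z \<Longrightarrow> whitney_average \<Omega> u x \<le> nontangential_max \<Omega> a u z"
  unfolding nontangential_max_eq by (rule SUP_upper)

section \<open>Solutions vanishing on a part of the boundary\<close>

text \<open>The measure \<open>q dx\<close> on \<open>S\<close>, transferred to the Borel sets because products with \<open>lborel\<close> are formed.\<close>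

definition mass_measure :: "'a set \<Rightarrow> ('a::euclidean_space \<Rightarrow> real) \<Rightarrow> 'a measure" where
  "mass_measure S q = distr (density lebesgue (\<lambda>x. ennreal (q x) * indicator S x)) borel (\<lambda>x. x)"

lemma sets_mass_measure [simp]: "sets (mass_measure S q) = sets borel"
  by (simp add: mass_measure_def)

lemma emeasure_mass_measure:
  assumes q: "q \<in> borel_measurable (lebesgue_on S)" and S: "S \<in> sets lebesgue" and A: "A \<in> sets borel"
  shows "emeasure (mass_measure S q) A = (\<integral>\<^sup>+x. ennreal (q x) * indicator (A \<inter> S) x \<partial>lebesgue)"
proof -
  have id: "(\<lambda>x. x) \<in> density lebesgue (\<lambda>x. ennreal (q x) * indicator S x) \<rightarrow>\<^sub>M borel"
    by (simp add: measurable_completion)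
  have "emeasure (mass_measure S q) A = emeasure (density lebesgue (\<lambda>x. ennreal (q x) * indicator S x)) A"
    unfolding mass_measure_def using emeasure_distr[OF id A] by simp
  also have "\<dots> = (\<integral>\<^sup>+x. ennreal (q x) * indicator S x * indicator A x \<partial>lebesgue)"
    using A by (intro emeasure_density indicator_lebesgue_measurable[OF q S]) simp
  also have "\<dots> = (\<integral>\<^sup>+x. ennreal (q x) * indicator (A \<inter> S) x \<partial>lebesgue)"
    by (intro nn_integral_cong) (auto simp: indicator_def)
  finally show ?thesis .
qed

lemma nn_integral_lebesgue_on:
  assumes "S \<in> sets lebesgue"
  shows "(\<integral>\<^sup>+x. f x \<partial>lebesgue_on S) = (\<integral>\<^sup>+x. f x * indicator S x \<partial>lebesgue)"
  using assms by (subst nn_integral_restrict_space) auto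

lemma finite_mass_measure:
  assumes q: "integrable (lebesgue_on S) q" "\<And>x. 0 \<le> q x" and S: "S \<in> sets lebesgue"
  shows "finite_measure (mass_measure S q)"
proof (rule finite_measureI)
  have "emeasure (mass_measure S q) (space (mass_measure S q)) = (\<integral>\<^sup>+x. ennreal (q x) * indicator S x \<partial>lebesgue)"
    using emeasure_mass_measure[OF borel_measurable_integrable[OF q(1)] S, of UNIV] by (simp add: mass_measure_def)
  also have "\<dots> = (\<integral>\<^sup>+x. ennreal (q x) \<partial>lebesgue_on S)" by (rule nn_integral_lebesgue_on[OF S, symmetric])
  also have "\<dots> \<noteq> \<infinity>" using q by (simp add: nn_integral_eq_integral)
  finally show "emeasure (mass_measure S q) (space (mass_measure S q)) \<noteq> \<infinity>" .
qed

lemma set_integral_eq_nn: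
  assumes q: "integrable (lebesgue_on S) q" "\<And>x. 0 \<le> q x" and S: "S \<in> sets lebesgue"
  shows "ennreal (LINT x:S|lebesgue. q x) = (\<integral>\<^sup>+x. ennreal (q x) * indicator S x \<partial>lebesgue)"
proof -
  have i: "integrable lebesgue (\<lambda>x. indicator S x *\<^sub>R q x)" using q(1) S by (simp add: integrable_restrict_space)
  have "ennreal (LINT x:S|lebesgue. q x) = (\<integral>\<^sup>+x. ennreal (indicator S x *\<^sub>R q x) \<partial>lebesgue)"
    unfolding set_lebesgue_integral_def using q(2) by (intro nn_integral_eq_integral[OF i, symmetric]) (auto simp: indicator_def)
  also have "\<dots> = (\<integral>\<^sup>+x. ennreal (q x) * indicator S x \<partial>lebesgue)"
    by (intro nn_integral_cong) (auto simp: indicator_def)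
  finally show ?thesis .
qed

lemma W12_integrable:
  assumes "W12 S u G"
  shows "integrable (lebesgue_on S) (\<lambda>x. (norm (u x))\<^sup>2)" "integrable (lebesgue_on S) (grad_norm_sq G)"
  using assms unfolding W12_def square_integrable_def grad_norm_sq_def[abs_def]
  by (auto intro!: Bochner_Integration.integrable_sum)

lemma has_trace_subset: "has_trace \<psi> U u G g \<Longrightarrow> U' \<subseteq> U \<Longrightarrow> has_trace \<psi> U' u G g"
  unfolding has_trace_def by (meson order_trans)

lemma graph_height_le:
  fixes \<psi> :: "'a::euclidean_space \<Rightarrow> real"
  assumes lip: "\<And>x y. \<bar>\<psi> x - \<psi> y\<bar> \<le> M * norm (x - y)"
  shows "\<bar>(snd x - \<psi> (fst x)) - (snd z - \<psi> (fst z))\<bar> \<le> \<bar>snd x - snd z\<bar> + M * norm (fst x - fst z)"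
  using lip[of "fst x" "fst z"] by linarith

lemma graph_height_dist:
  fixes \<psi> :: "'a::euclidean_space \<Rightarrow> real"
  assumes lip: "\<And>x y. \<bar>\<psi> x - \<psi> y\<bar> \<le> M * norm (x - y)" and M: "0 \<le> M"
  shows "\<bar>(snd x - \<psi> (fst x)) - (snd z - \<psi> (fst z))\<bar> \<le> (1 + M) * dist x z"
proof -
  have "M * norm (fst x - fst z) \<le> M * dist x z"
    using norm_fst_snd_le(1)[of "x - z"] M by (intro mult_left_mono) (auto simp: dist_norm)
  moreover have "\<bar>snd x - snd z\<bar> \<le> dist x z" using norm_fst_snd_le(2)[of "x - z"] by (simp add: dist_norm)
  ultimately show ?thesis using graph_height_le[OF lip, of x z] by (simp add: algebra_simps)
qed

lemma dist_graph_point: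
  fixes \<psi> :: "'a::euclidean_space \<Rightarrow> real"
  assumes lip: "\<And>x y. \<bar>\<psi> x - \<psi> y\<bar> \<le> M * norm (x - y)"
  shows "dist x (y, \<psi> y) \<le> (1 + M) * norm (fst x - y) + \<bar>snd x - \<psi> (fst x)\<bar>"
proof -
  have "dist x (y, \<psi> y) \<le> norm (fst x - y) + \<bar>snd x - \<psi> y\<bar>"
    using norm_prod_le[of "x - (y, \<psi> y)"] by (simp add: dist_norm)
  also have "\<bar>snd x - \<psi> y\<bar> \<le> \<bar>snd x - \<psi> (fst x)\<bar> + M * norm (fst x - y)"
    using lip[of "fst x" y] by linarith
  finally show ?thesis by (simp add: algebra_simps)
qed

text \<open>In the application \<open>w\<close> is the difference of two solutions whose data agree near \<open>(y0, \<psi> y0)\<close>.  The ball in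
  \<open>trace\<close> is so large that it contains the slab of height \<open>R\<close> over \<open>ball y0 R\<close> together with all balls on
  which the Caccioppoli inequality is used.\<close>

locale vanishing_solution =
  fixes \<psi> :: "real ^ 'n \<Rightarrow> real" and \<L> :: "((real ^ 'n) \<times> real, 'm::finite) elliptic_op"
    and w :: "(real ^ 'n) \<times> real \<Rightarrow> complex ^ 'm" and G :: "(real ^ 'n) \<times> real \<Rightarrow> (real ^ 'n) \<times> real \<Rightarrow> complex ^ 'm"
    and y0 :: "real ^ 'n" and R M \<kappa> :: real
  assumes lip_graph: "lipschitz_graph M \<psi>" and M: "0 \<le> M" and \<kappa>: "0 < \<kappa>" and R: "0 < R"
    and cacc: "boundary_caccioppoli \<psi> \<L> \<kappa>"
    and W: "W12_loc (graph_domain \<psi>) w G"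
    and eq: "\<And>x r. weak_equation \<L> (ball x r \<inter> graph_domain \<psi>) w G"
    and trace: "has_trace \<psi> (ball (y0, \<psi> y0) (3 * (2 + M) * R)) w G (\<lambda>_. 0)"
begin

definition "\<Lambda> = 2 + M"
definition "U = ball (y0, \<psi> y0) (3 * \<Lambda> * R)"
definition "D = U \<inter> graph_domain \<psi>"
definition "\<mu> = mass_measure D (\<lambda>x. (norm (w x))\<^sup>2)"
definition "\<nu> = mass_measure D (grad_norm_sq G)"

lemma \<Lambda>: "2 \<le> \<Lambda>" using M by (simp add: \<Lambda>_def)

lemma lip: "\<bar>\<psi> x - \<psi> y\<bar> \<le> M * norm (x - y)"
  by (rule lipschitz_graph_bound[OF lip_graph M])

lemma cont: "continuous_on UNIV \<psi>" by (rule lipschitz_graph_continuous[OF lip_graph])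

lemma \<psi>_borel [measurable]: "\<psi> \<in> borel_measurable borel" using cont by (rule borel_measurable_continuous_onI)

lemma \<Omega>_sets: "ball x r \<inter> graph_domain \<psi> \<in> sets lebesgue" "ball x r \<inter> graph_domain \<psi> \<in> sets borel"
  using graph_domain_open[OF cont] by (auto intro!: sets_completionI_sets)

lemma W12_ball: "W12 (ball x r \<inter> graph_domain \<psi>) w G" using W unfolding W12_loc_def by blast

lemma D_W12: "W12 D w G" "D \<in> sets lebesgue" "D \<in> sets borel"
  unfolding D_def U_def by (rule W12_ball, rule \<Omega>_sets, rule \<Omega>_sets)

lemma grad_nonneg: "0 \<le> grad_norm_sq G x" by (rule grad_norm_sq_nonneg)

lemma \<mu>_eq: "A \<in> sets borel \<Longrightarrow> A \<subseteq> D \<Longrightarrow> emeasure \<mu> A = (\<integral>\<^sup>+x. ennreal ((norm (w x))\<^sup>2) * indicator A x \<partial>lebesgue)"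
  unfolding \<mu>_def by (subst emeasure_mass_measure)
    (auto simp: D_W12 Int_absorb2 intro: borel_measurable_integrable[OF W12_integrable(1)[OF D_W12(1)]])

lemma \<nu>_eq: "A \<in> sets borel \<Longrightarrow> A \<subseteq> D \<Longrightarrow> emeasure \<nu> A = (\<integral>\<^sup>+x. ennreal (grad_norm_sq G x) * indicator A x \<partial>lebesgue)"
  unfolding \<nu>_def by (subst emeasure_mass_measure)
    (auto simp: D_W12 Int_absorb2 intro: borel_measurable_integrable[OF W12_integrable(2)[OF D_W12(1)]])

lemma fin: "finite_measure \<mu>" "finite_measure \<nu>"
  unfolding \<mu>_def \<nu>_def by (intro finite_mass_measure W12_integrable[OF D_W12(1)] D_W12(2); simp add: grad_nonneg)+

sublocale \<mu>: finite_measure \<mu> by (rule fin)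
sublocale \<nu>: finite_measure \<nu> by (rule fin)

lemma sets\<mu>\<nu> [simp]: "sets \<mu> = sets borel" "sets \<nu> = sets borel" by (simp_all add: \<mu>_def \<nu>_def)

definition "K = cball (y0, \<psi> y0) (\<Lambda> * R)"

lemma K: "compact K" "K \<subseteq> U"
proof -
  have "\<Lambda> * R < 3 * \<Lambda> * R" using R \<Lambda> by simp
  then show "K \<subseteq> U" unfolding K_def U_def subset_iff mem_ball mem_cball by (blast intro: order_le_less_trans)
qed (simp add: K_def)

lemma graph_strip_in_K:
  assumes "y \<in> ball y0 R" "0 \<le> t" "t \<le> R"
  shows "(y, \<psi> y + t) \<in> K"
proof -
  have "dist (y, \<psi> y + t) (y0, \<psi> y0) \<le> (1 + M) * norm (y - y0) + t"
    using dist_graph_point[OF lip, of "(y, \<psi> y + t)" y0] assms by simp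
  also have "\<dots> \<le> (1 + M) * R + R"
    using assms M by (intro add_mono mult_left_mono) (auto simp: dist_norm norm_minus_commute)
  finally show ?thesis by (simp add: K_def \<Lambda>_def dist_commute algebra_simps)
qed

lemma slab_in_K: "A \<subseteq> ball y0 R \<Longrightarrow> h \<le> R \<Longrightarrow> slab \<psi> A h \<subseteq> K \<inter> graph_domain \<psi>"
proof
  fix x assume "A \<subseteq> ball y0 R" "h \<le> R" "x \<in> slab \<psi> A h"
  then show "x \<in> K \<inter> graph_domain \<psi>"
    using graph_strip_in_K[of "fst x" "snd x - \<psi> (fst x)"] by (auto simp: slab_def graph_domain_def)
qed

lemma slab_in_D: "A \<subseteq> ball y0 R \<Longrightarrow> h \<le> R \<Longrightarrow> slab \<psi> A h \<subseteq> D"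
  using slab_in_K K unfolding D_def by blast

lemma meas_sub: "S \<subseteq> D \<Longrightarrow> sobolev_measurable S w G"
  using sobolev_measurable_subset[OF W12_measurable[OF D_W12(1)]] .

lemma poincare_w:
  assumes A: "A \<in> sets borel" "A \<subseteq> ball y0 R" and h: "0 < h" "h \<le> R"
  shows "measure \<mu> (slab \<psi> A h) \<le> 8 * h\<^sup>2 * measure \<nu> (slab \<psi> A h)"
proof -
  have s: "slab \<psi> A h \<in> sets borel" "slab \<psi> A h \<subseteq> D" using sets_slab[OF \<psi>_borel A(1)] slab_in_D[OF A(2) h(2)] by auto
  have "emeasure \<mu> (slab \<psi> A h) \<le> ennreal (8 * h\<^sup>2) * emeasure \<nu> (slab \<psi> A h)"
    unfolding \<mu>_eq[OF s] \<nu>_eq[OF s]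
  proof (rule trace_poincare[OF trace, of K])
    show "K \<subseteq> ball (y0, \<psi> y0) (3 * (2 + M) * R)" using K by (simp add: U_def \<Lambda>_def)
    show "(y, \<psi> y + t) \<in> K" if "y \<in> A" "0 \<le> t" "t \<le> h" for y t
      using graph_strip_in_K[of y t] that A h by auto
    show "sobolev_measurable (slab \<psi> A h) w G" by (rule meas_sub[OF s(2)])
    show "(\<integral>\<^sup>+y. q (y, \<psi> y) \<partial>lborel) \<le> (\<integral>\<^sup>+z. q z \<partial>surface_measure \<psi>)" if "q \<in> borel_measurable borel" for q
      by (rule surface_integral_bounds(1)[OF lip_graph M that])
  qed (use K A h in auto)
  then have "ennreal (measure \<mu> (slab \<psi> A h)) \<le> ennreal (8 * h\<^sup>2 * measure \<nu> (slab \<psi> A h))"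
    by (simp add: \<mu>.emeasure_eq_measure \<nu>.emeasure_eq_measure flip: ennreal_mult)
  then show ?thesis by (subst (asm) ennreal_le_iff) auto
qed

text \<open>A horizontal motion by \<open>2 * s\<close> takes \<open>ball y s\<close> out of itself and keeps it in \<open>ball y (3 * s)\<close>.  Raising the
  points by \<open>2 * s * M\<close> at the same time keeps the segments inside the domain.\<close>

lemma shift_w:
  assumes s: "0 < s" and h: "0 < h" and B: "ball y (3 * s) \<subseteq> ball y0 R" and hs: "h + 4 * M * s \<le> R"
  shows "measure \<mu> (slab \<psi> (ball y s) h) \<le> 8 * measure \<mu> (slab \<psi> (ball y (3 * s) - ball y s) (h + 4 * M * s))
          + 32 * (1 + M\<^sup>2) * s\<^sup>2 * measure \<nu> (slab \<psi> (ball y (3 * s)) (h + 4 * M * s))"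
proof -
  obtain e :: "real ^ 'n" where e: "e \<in> Basis" using nonempty_Basis by blast
  have ne: "norm e = 1" using e by simp
  define \<omega> where "\<omega> = ((2 * s) *\<^sub>R e, 2 * s * M)"
  have n\<omega>: "(norm \<omega>)\<^sup>2 = 4 * s\<^sup>2 * (1 + M\<^sup>2)"
    using s by (simp add: \<omega>_def norm_Pair ne power_mult_distrib algebra_simps)
  have Ms: "0 \<le> M * s" using M s by simp
  let ?D = "slab \<psi> (ball y s) h" and ?D1 = "slab \<psi> (ball y (3 * s) - ball y s) (h + 4 * M * s)"
    and ?E = "slab \<psi> (ball y (3 * s)) (h + 4 * M * s)"
  have bb: "ball y s \<subseteq> ball y (3 * s)" using s by auto
  have sets: "?D \<in> sets borel" "?D1 \<in> sets borel" "?E \<in> sets borel" by (auto intro!: sets_slab)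
  have EK: "?E \<subseteq> K \<inter> graph_domain \<psi>" by (rule slab_in_K[OF B hs])
  have ED: "?E \<subseteq> D" by (rule slab_in_D[OF B hs])
  have DE: "?D \<subseteq> ?E" "?D1 \<subseteq> ?E" by (intro slab_mono; use bb Ms in auto)+
  have move: "x + \<sigma> *\<^sub>R \<omega> \<in> ?E" "\<sigma> = 1 \<Longrightarrow> x + \<sigma> *\<^sub>R \<omega> \<in> ?D1" if x: "x \<in> ?D" and \<sigma>: "0 < \<sigma>" "\<sigma> \<le> 1" for x \<sigma>
  proof -
    let ?x = "fst x" and ?y = "fst x + (\<sigma> * (2 * s)) *\<^sub>R e"
    have f: "fst (x + \<sigma> *\<^sub>R \<omega>) = ?y" "snd (x + \<sigma> *\<^sub>R \<omega>) = snd x + \<sigma> * (2 * s * M)" by (auto simp: \<omega>_def)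
    have "\<sigma> * (2 * s) \<le> 1 * (2 * s)" using \<sigma> s by (intro mult_right_mono) auto
    then have \<sigma>s: "\<sigma> * (2 * s) \<le> 2 * s" by simp
    have \<sigma>s0: "0 \<le> \<sigma> * (2 * s)" using \<sigma> s by simp
    have nxy: "norm (?y - ?x) = \<sigma> * (2 * s)" using \<sigma>s0 by (simp add: ne)
    have xs: "dist y ?x < s" using x by (simp add: slab_def)
    have d: "dist y ?y < 3 * s" using dist_triangle[of y ?y ?x] nxy xs \<sigma>s by (simp add: dist_norm norm_minus_commute)
    have "\<bar>\<psi> ?y - \<psi> ?x\<bar> \<le> M * (\<sigma> * (2 * s))" using lip[of ?y ?x] unfolding nxy .
    moreover have "M * (\<sigma> * (2 * s)) \<le> M * (2 * s)" using \<sigma>s M by (intro mult_left_mono) auto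
    moreover have "\<psi> ?x < snd x" "snd x < \<psi> ?x + h" using x by (auto simp: slab_def)
    moreover have "\<sigma> * (2 * s * M) = M * (\<sigma> * (2 * s))" by simp
    ultimately have hh: "\<psi> ?y < snd x + \<sigma> * (2 * s * M)" "snd x + \<sigma> * (2 * s * M) < \<psi> ?y + (h + 4 * M * s)"
      by linarith+
    show "x + \<sigma> *\<^sub>R \<omega> \<in> ?E" using d hh unfolding slab_def mem_Collect_eq f by auto
    show "x + \<sigma> *\<^sub>R \<omega> \<in> ?D1" if "\<sigma> = 1"
    proof -
      have "2 * s \<le> dist ?x ?y" using nxy that by (simp add: dist_norm norm_minus_commute)
      then have "\<not> dist y ?y < s" using dist_triangle[of ?x ?y y] xs by (simp add: dist_commute)
      then show ?thesis using d hh unfolding slab_def mem_Collect_eq f by auto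
    qed
  qed
  have "emeasure \<mu> ?D \<le> 8 * emeasure \<mu> ?D1 + ennreal (8 * (norm \<omega>)\<^sup>2) * emeasure \<nu> ?E"
    unfolding \<mu>_eq[OF sets(1) order_trans[OF DE(1) ED]] \<mu>_eq[OF sets(2) order_trans[OF DE(2) ED]] \<nu>_eq[OF sets(3) ED]
  proof (rule trace_shift[OF trace, of K])
    show "K \<subseteq> ball (y0, \<psi> y0) (3 * (2 + M) * R)" using K by (simp add: U_def \<Lambda>_def)
    show "x + \<omega> \<in> ?D1" if "x \<in> ?D" for x using move(2)[OF that, of 1] by simp
    show "x + \<sigma> *\<^sub>R \<omega> \<in> ?E" if "x \<in> ?D" "0 < \<sigma>" "\<sigma> < 1" for x \<sigma> using move(1)[OF that(1,2)] that by simp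
    show "sobolev_measurable ?E w G" by (rule meas_sub[OF ED])
  qed (use K sets EK DE in auto)
  also have "ennreal (8 * (norm \<omega>)\<^sup>2) = ennreal (32 * (1 + M\<^sup>2) * s\<^sup>2)" by (simp add: n\<omega> mult_ac)
  finally have "ennreal (measure \<mu> ?D) \<le> ennreal (8 * measure \<mu> ?D1 + 32 * (1 + M\<^sup>2) * s\<^sup>2 * measure \<nu> ?E)"
    by (simp add: \<mu>.emeasure_eq_measure \<nu>.emeasure_eq_measure ennreal_mult)
  then show ?thesis by (subst (asm) ennreal_le_iff) auto
qed

lemma measure_\<mu>_LINT: "ball x r \<subseteq> U \<Longrightarrow> measure \<mu> (ball x r \<inter> graph_domain \<psi>) = (LINT z:ball x r \<inter> graph_domain \<psi>|lebesgue. (norm (w z))\<^sup>2)"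
  and measure_\<nu>_LINT: "ball x r \<subseteq> U \<Longrightarrow> measure \<nu> (ball x r \<inter> graph_domain \<psi>) = (LINT z:ball x r \<inter> graph_domain \<psi>|lebesgue. grad_norm_sq G z)"
proof -
  assume U: "ball x r \<subseteq> U"
  let ?B = "ball x r \<inter> graph_domain \<psi>"
  have BD: "?B \<subseteq> D" using U by (auto simp: D_def)
  note i = W12_integrable[OF W12_ball[of x r]]
  have nn: "0 \<le> (LINT z:?B|lebesgue. (norm (w z))\<^sup>2)" "0 \<le> (LINT z:?B|lebesgue. grad_norm_sq G z)"
    unfolding set_lebesgue_integral_def by (auto intro!: integral_nonneg_AE simp: grad_nonneg)
  have "ennreal (measure \<mu> ?B) = ennreal (LINT z:?B|lebesgue. (norm (w z))\<^sup>2)"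
    using \<mu>_eq[OF \<Omega>_sets(2) BD] set_integral_eq_nn[OF i(1) _ \<Omega>_sets(1)] by (simp add: \<mu>.emeasure_eq_measure)
  then show "measure \<mu> ?B = (LINT z:?B|lebesgue. (norm (w z))\<^sup>2)" using nn by simp
  have "ennreal (measure \<nu> ?B) = ennreal (LINT z:?B|lebesgue. grad_norm_sq G z)"
    using \<nu>_eq[OF \<Omega>_sets(2) BD] set_integral_eq_nn[OF i(2) grad_nonneg \<Omega>_sets(1)] by (simp add: \<nu>.emeasure_eq_measure)
  then show "measure \<nu> ?B = (LINT z:?B|lebesgue. grad_norm_sq G z)" using nn by simp
qed

text \<open>A slab of size \<open>h\<close> over \<open>y\<close> lies in the ball of radius \<open>\<Lambda> * h\<close> around the boundary point, and the ball of
  twice that radius lies in the slab of size \<open>2 * \<Lambda>\<^sup>2 * h\<close>.\<close>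

lemma caccioppoli_w:
  assumes h: "0 < h" and hR: "2 * \<Lambda>\<^sup>2 * h \<le> R" and B: "ball y (2 * \<Lambda>\<^sup>2 * h) \<subseteq> ball y0 R"
  shows "measure \<nu> (slab \<psi> (ball y h) h) \<le> (\<kappa> / \<Lambda>\<^sup>2) / h\<^sup>2 * measure \<mu> (slab \<psi> (ball y (2 * \<Lambda>\<^sup>2 * h)) (2 * \<Lambda>\<^sup>2 * h))"
proof -
  define x0 where "x0 = (y, \<psi> y)"
  define r where "r = \<Lambda> * h"
  have r: "0 < r" using \<Lambda> h by (simp add: r_def)
  have r2: "2 * r \<le> 2 * \<Lambda>\<^sup>2 * h" "\<Lambda> * (2 * r) = 2 * \<Lambda>\<^sup>2 * h"
  proof -
    have "1 * (\<Lambda> * h) \<le> \<Lambda> * (\<Lambda> * h)" using \<Lambda> h by (intro mult_right_mono) auto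
    then show "2 * r \<le> 2 * \<Lambda>\<^sup>2 * h" by (simp add: r_def power2_eq_square mult_ac)
    show "\<Lambda> * (2 * r) = 2 * \<Lambda>\<^sup>2 * h" by (simp add: r_def power2_eq_square)
  qed
  have \<beta>h: "0 < 2 * \<Lambda>\<^sup>2 * h" using \<Lambda> h by simp
  have "y \<in> ball y (2 * \<Lambda>\<^sup>2 * h)" using \<beta>h by simp
  then have "y \<in> ball y0 R" using B by blast
  then have yR: "norm (y - y0) < R" by (simp add: dist_norm norm_minus_commute)
  have "dist x0 (y0, \<psi> y0) \<le> (1 + M) * norm (y - y0)"
    using dist_graph_point[OF lip, of x0 y0] by (simp add: x0_def)
  also have "\<dots> \<le> (1 + M) * R" using yR M by (intro mult_left_mono) auto
  finally have x0: "dist (y0, \<psi> y0) x0 \<le> (1 + M) * R" by (simp add: dist_commute)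
  have U2: "ball x0 (2 * r) \<subseteq> U"
  proof
    fix x assume "x \<in> ball x0 (2 * r)"
    then have "dist (y0, \<psi> y0) x < (1 + M) * R + R"
      using dist_triangle[of "(y0, \<psi> y0)" x x0] x0 r2(1) hR by simp
    also have "(1 + M) * R + R \<le> 3 * \<Lambda> * R" using R M by (simp add: \<Lambda>_def algebra_simps)
    finally show "x \<in> U" by (simp add: U_def)
  qed
  have U1: "ball x0 r \<subseteq> U" by (rule order_trans[OF subset_ball U2]) (use r in simp)
  have "x0 \<in> frontier (graph_domain \<psi>)" unfolding frontier_graph_domain[OF cont] by (simp add: x0_def)
  moreover have "has_trace \<psi> (ball x0 (2 * r)) w G (\<lambda>_. 0)"
    by (rule has_trace_subset[OF trace]) (use U2 in \<open>simp add: U_def \<Lambda>_def\<close>)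
  ultimately have "(LINT x:ball x0 r \<inter> graph_domain \<psi>|lebesgue. grad_norm_sq G x)
          \<le> \<kappa> / r\<^sup>2 * (LINT x:ball x0 (2 * r) \<inter> graph_domain \<psi>|lebesgue. (norm (w x))\<^sup>2)"
    using cacc W12_ball[of x0 "2 * r"] eq[of x0 "2 * r"] r unfolding boundary_caccioppoli_def by blast
  then have c: "measure \<nu> (ball x0 r \<inter> graph_domain \<psi>) \<le> \<kappa> / r\<^sup>2 * measure \<mu> (ball x0 (2 * r) \<inter> graph_domain \<psi>)"
    unfolding measure_\<mu>_LINT[OF U2] measure_\<nu>_LINT[OF U1] .
  have s1: "slab \<psi> (ball y h) h \<subseteq> ball x0 r \<inter> graph_domain \<psi>"
  proof
    fix x assume x: "x \<in> slab \<psi> (ball y h) h"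
    have "dist x x0 \<le> (1 + M) * norm (fst x - y) + \<bar>snd x - \<psi> (fst x)\<bar>" unfolding x0_def by (rule dist_graph_point[OF lip])
    also have "\<dots> < (1 + M) * h + h"
      using x M by (intro add_le_less_mono mult_left_mono) (auto simp: slab_def dist_norm norm_minus_commute)
    finally show "x \<in> ball x0 r \<inter> graph_domain \<psi>" using x by (auto simp: r_def \<Lambda>_def dist_commute algebra_simps slab_def graph_domain_def)
  qed
  have s2: "ball x0 (2 * r) \<inter> graph_domain \<psi> \<subseteq> slab \<psi> (ball y (2 * \<Lambda>\<^sup>2 * h)) (2 * \<Lambda>\<^sup>2 * h)"
  proof
    fix x assume x: "x \<in> ball x0 (2 * r) \<inter> graph_domain \<psi>"
    then have d: "dist x x0 < 2 * r" by (simp add: dist_commute)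
    have "norm (fst x - y) \<le> dist x x0" using norm_fst_snd_le(1)[of "x - x0"] by (simp add: dist_norm x0_def)
    then have "fst x \<in> ball y (2 * \<Lambda>\<^sup>2 * h)" using d r2(1) by (simp add: dist_norm norm_minus_commute)
    moreover have "snd x - \<psi> (fst x) < 2 * \<Lambda>\<^sup>2 * h"
    proof -
      have "snd x - \<psi> (fst x) \<le> (1 + M) * dist x x0" using graph_height_dist[OF lip M, of x x0] by (simp add: x0_def)
      also have "\<dots> < \<Lambda> * (2 * r)" using d M r by (intro mult_le_less_imp_less) (auto simp: \<Lambda>_def)
      finally show ?thesis unfolding r2(2) .
    qed
    ultimately show "x \<in> slab \<psi> (ball y (2 * \<Lambda>\<^sup>2 * h)) (2 * \<Lambda>\<^sup>2 * h)" using x by (auto simp: slab_def graph_domain_def)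
  qed
  have "measure \<nu> (slab \<psi> (ball y h) h) \<le> measure \<nu> (ball x0 r \<inter> graph_domain \<psi>)"
    using s1 \<Omega>_sets by (intro \<nu>.finite_measure_mono) auto
  also note c
  also have "\<kappa> / r\<^sup>2 * measure \<mu> (ball x0 (2 * r) \<inter> graph_domain \<psi>) \<le> \<kappa> / r\<^sup>2 * measure \<mu> (slab \<psi> (ball y (2 * \<Lambda>\<^sup>2 * h)) (2 * \<Lambda>\<^sup>2 * h))"
    using s2 \<kappa> by (intro mult_left_mono \<mu>.finite_measure_mono) (auto intro!: sets_slab)
  also have "\<kappa> / r\<^sup>2 = (\<kappa> / \<Lambda>\<^sup>2) / h\<^sup>2" by (simp add: r_def power_mult_distrib)
  finally show ?thesis .
qed

lemma energy_instance: "boundary_energy \<psi> \<mu> \<nu> y0 R (\<kappa> / \<Lambda>\<^sup>2) (2 * \<Lambda>\<^sup>2) M (32 * (1 + M\<^sup>2))"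
proof
  have "1 * 1 \<le> \<Lambda> * \<Lambda>" using \<Lambda> by (intro mult_mono) auto
  then show "1 \<le> 2 * \<Lambda>\<^sup>2" by (simp add: power2_eq_square)
  show "0 < \<kappa> / \<Lambda>\<^sup>2" using \<kappa> \<Lambda> by simp
qed (use cont fin R M poincare_w shift_w caccioppoli_w in auto)

text \<open>Both sides measure the pairs \<open>(z, x)\<close> with \<open>x \<in> A\<close> and \<open>dist z x < s\<close>.\<close>

lemma mass_average:
  assumes s: "0 < s" and A: "A \<in> sets borel"
  shows "emeasure \<mu> A * emeasure lborel (ball (0 :: (real ^ 'n) \<times> real) s) = (\<integral>\<^sup>+z. emeasure \<mu> (A \<inter> ball z s) \<partial>lborel)"
proof -
  interpret pair_sigma_finite lborel \<mu>
    by (intro pair_sigma_finite.intro sigma_finite_lborel \<mu>.sigma_finite_measure_axioms)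
  have [measurable_cong]: "sets \<mu> = sets borel" by simp
  have [measurable]: "A \<in> sets borel" by (rule A)
  define f where "f z x = (indicator A x * (if dist z x < s then 1 else 0) :: ennreal)" for z x :: "(real ^ 'n) \<times> real"
  have [measurable]: "case_prod f \<in> borel_measurable (lborel \<Otimes>\<^sub>M \<mu>)" unfolding f_def by measurable
  have v: "emeasure lborel (ball x s) = emeasure lborel (ball (0 :: (real ^ 'n) \<times> real) s)" for x :: "(real ^ 'n) \<times> real"
    using s by (simp add: emeasure_ball)
  have "(\<integral>\<^sup>+z. emeasure \<mu> (A \<inter> ball z s) \<partial>lborel) = (\<integral>\<^sup>+z. (\<integral>\<^sup>+x. f z x \<partial>\<mu>) \<partial>lborel)"
  proof (rule nn_integral_cong)
    fix z
    have "emeasure \<mu> (A \<inter> ball z s) = (\<integral>\<^sup>+x. indicator (A \<inter> ball z s) x \<partial>\<mu>)"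
      by (intro nn_integral_indicator[symmetric]) auto
    also have "\<dots> = (\<integral>\<^sup>+x. f z x \<partial>\<mu>)" by (intro nn_integral_cong) (auto simp: f_def indicator_def)
    finally show "emeasure \<mu> (A \<inter> ball z s) = (\<integral>\<^sup>+x. f z x \<partial>\<mu>)" .
  qed
  also have "\<dots> = (\<integral>\<^sup>+x. (\<integral>\<^sup>+z. f z x \<partial>lborel) \<partial>\<mu>)" by (rule Fubini'[symmetric]) measurable
  also have "\<dots> = (\<integral>\<^sup>+x. emeasure lborel (ball (0 :: (real ^ 'n) \<times> real) s) * indicator A x \<partial>\<mu>)"
  proof (rule nn_integral_cong)
    fix x
    have "(\<integral>\<^sup>+z. f z x \<partial>lborel) = (\<integral>\<^sup>+z. indicator A x * indicator (ball x s) z \<partial>lborel)"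
      unfolding f_def by (intro nn_integral_cong) (auto simp: indicator_def dist_commute)
    also have "\<dots> = indicator A x * emeasure lborel (ball x s)" by (subst nn_integral_cmult_indicator) auto
    also have "\<dots> = indicator A x * emeasure lborel (ball (0 :: (real ^ 'n) \<times> real) s)" by (rule arg_cong[OF v])
    also have "\<dots> = emeasure lborel (ball (0 :: (real ^ 'n) \<times> real) s) * indicator A x" by (rule mult.commute)
    finally show "(\<integral>\<^sup>+z. f z x \<partial>lborel) = emeasure lborel (ball (0 :: (real ^ 'n) \<times> real) s) * indicator A x" .
  qed
  also have "\<dots> = emeasure lborel (ball (0 :: (real ^ 'n) \<times> real) s) * emeasure \<mu> A"
    by (intro nn_integral_cmult_indicator) simp
  finally show ?thesis by (simp add: mult.commute)
qed

text \<open>At height at least \<open>h\<close> every ball of radius \<open>s = h / (8 * \<Lambda>)\<close> that matters lies in the Whitney ball of its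
  centre, so averaging the mass over such balls leads to the assumed bound.  Of the exponent \<open>3 * n + 1\<close>, the
  part \<open>2 * n\<close> comes from this bound and \<open>n + 1\<close> from the volume of the small balls.\<close>

lemma far_bound:
  assumes Q: "0 \<le> Q"
    and whitney: "\<And>x. x \<in> graph_domain \<psi> \<Longrightarrow> norm (fst x - y0) < 2 * R \<Longrightarrow> snd x - \<psi> (fst x) < 2 * R \<Longrightarrow>
        (\<integral>\<^sup>+z. ennreal ((norm (w z))\<^sup>2) * indicator (ball x (depth \<psi> x / 4)) z \<partial>lebesgue)
          \<le> ennreal (Q * R ^ (CARD('n) + 1) * (R / depth \<psi> x) ^ (2 * CARD('n)))"
    and h: "0 < h" "h \<le> R"
  shows "measure \<mu> (slab \<psi> (ball y0 R) R - slab \<psi> (ball y0 R) h)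
     \<le> Q * (16 * \<Lambda>\<^sup>2) ^ (CARD('n) + 1) * (2 * \<Lambda>) ^ (2 * CARD('n)) * R ^ (CARD('n) + 1) * (R / h) ^ (3 * CARD('n) + 1)"
proof -
  define n where "n = CARD('n)"
  define A where "A = slab \<psi> (ball y0 R) R - slab \<psi> (ball y0 R) h"
  define s where "s = h / (8 * \<Lambda>)"
  have s: "0 < s" using h \<Lambda> by (simp add: s_def)
  have A: "A \<in> sets borel" unfolding A_def by (auto intro!: sets_slab)
  have AD: "A \<subseteq> D" using slab_in_D[of "ball y0 R" R] by (auto simp: A_def)
  define b where "b = Q * R ^ (n + 1) * (2 * \<Lambda> * R / h) ^ (2 * n)"
  have b: "0 \<le> b" using Q R h \<Lambda> by (simp add: b_def)
  have dim: "DIM((real ^ 'n) \<times> real) = n + 1" by (simp add: n_def)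
  have Ms: "(1 + M) * s \<le> h / 8"
  proof -
    have "(1 + M) * s \<le> \<Lambda> * s" using s by (intro mult_right_mono) (auto simp: \<Lambda>_def)
    then show ?thesis using \<Lambda> by (simp add: s_def)
  qed
  have sh: "s \<le> h / 8" unfolding s_def using h \<Lambda> by (intro divide_left_mono) auto
  have loc: "emeasure \<mu> (A \<inter> ball z s) \<le> ennreal b * indicator (ball (y0, \<psi> y0) (2 * \<Lambda> * R)) z" for z
  proof (cases "A \<inter> ball z s = {}")
    case False
    then obtain x where x: "x \<in> A" "dist z x < s" by auto
    have xh: "h \<le> snd x - \<psi> (fst x)" "snd x - \<psi> (fst x) < R" "norm (fst x - y0) < R" "0 < snd x - \<psi> (fst x)"
      using x(1) by (auto simp: A_def slab_def dist_norm norm_minus_commute)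
    have "\<bar>(snd z - \<psi> (fst z)) - (snd x - \<psi> (fst x))\<bar> \<le> (1 + M) * dist z x" by (rule graph_height_dist[OF lip M])
    also have "\<dots> \<le> (1 + M) * s" using x M by (intro mult_left_mono) auto
    also note Ms
    finally have "\<bar>(snd z - \<psi> (fst z)) - (snd x - \<psi> (fst x))\<bar> \<le> h / 8" .
    then have zh: "7 / 8 * h \<le> snd z - \<psi> (fst z)" "snd z - \<psi> (fst z) < 2 * R"
      using xh h by linarith+
    have z\<Omega>: "z \<in> graph_domain \<psi>" using zh(1) h unfolding graph_domain_def mem_Collect_eq by linarith
    have "norm (fst z - y0) \<le> norm (fst z - fst x) + norm (fst x - y0)" using norm_triangle_ineq[of "fst z - fst x" "fst x - y0"] by simp
    also have "norm (fst z - fst x) \<le> dist z x" using norm_fst_snd_le(1)[of "z - x"] by (simp add: dist_norm)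
    finally have zy: "norm (fst z - y0) < 2 * R" using x(2) xh(3) sh h by simp
    note dep = depth_height[OF cont lip M z\<Omega>]
    have d\<Lambda>: "7 / 8 * h \<le> \<Lambda> * depth \<psi> z"
    proof -
      have "(1 + M) * depth \<psi> z \<le> \<Lambda> * depth \<psi> z" using dep(1) by (intro mult_right_mono) (auto simp: \<Lambda>_def)
      then show ?thesis using zh(1) dep(3) by linarith
    qed
    have sd: "s \<le> depth \<psi> z / 4"
    proof -
      have "h / 2 \<le> \<Lambda> * depth \<psi> z" using d\<Lambda> h by linarith
      then show ?thesis using \<Lambda> by (simp add: s_def field_simps)
    qed
    have "emeasure \<mu> (A \<inter> ball z s) = (\<integral>\<^sup>+x. ennreal ((norm (w x))\<^sup>2) * indicator (A \<inter> ball z s) x \<partial>lebesgue)"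
      using A AD by (intro \<mu>_eq) auto
    also have "\<dots> \<le> (\<integral>\<^sup>+x. ennreal ((norm (w x))\<^sup>2) * indicator (ball z (depth \<psi> z / 4)) x \<partial>lebesgue)"
      using sd by (intro nn_integral_mono mult_left_mono) (auto simp: indicator_def)
    also have "\<dots> \<le> ennreal (Q * R ^ (n + 1) * (R / depth \<psi> z) ^ (2 * n))"
      unfolding n_def by (rule whitney[OF z\<Omega> zy zh(2)])
    also have "\<dots> \<le> ennreal b"
    proof (rule ennreal_leI)
      have "R / depth \<psi> z \<le> 2 * \<Lambda> * R / h"
      proof -
        have "h \<le> 2 * (\<Lambda> * depth \<psi> z)" using d\<Lambda> h by linarith
        then have "R * h \<le> R * (2 * (\<Lambda> * depth \<psi> z))" using R by (intro mult_left_mono) auto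
        then show ?thesis using dep(1) h by (simp add: field_simps)
      qed
      then have "(R / depth \<psi> z) ^ (2 * n) \<le> (2 * \<Lambda> * R / h) ^ (2 * n)" using R dep(1) by (intro power_mono) auto
      then show "Q * R ^ (n + 1) * (R / depth \<psi> z) ^ (2 * n) \<le> b" unfolding b_def using Q R by (intro mult_left_mono) auto
    qed
    finally have "emeasure \<mu> (A \<inter> ball z s) \<le> ennreal b" .
    moreover have "z \<in> ball (y0, \<psi> y0) (2 * \<Lambda> * R)"
    proof -
      have "dist z (y0, \<psi> y0) \<le> (1 + M) * norm (fst z - y0) + \<bar>snd z - \<psi> (fst z)\<bar>" by (rule dist_graph_point[OF lip])
      also have "\<dots> < (1 + M) * (2 * R) + 2 * R"
        using zy zh h M by (intro add_le_less_mono mult_left_mono) auto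
      finally show ?thesis by (simp add: \<Lambda>_def dist_commute algebra_simps)
    qed
    ultimately show ?thesis by simp
  qed simp
  have "emeasure \<mu> A * emeasure lborel (ball (0 :: (real ^ 'n) \<times> real) s) \<le> (\<integral>\<^sup>+z. ennreal b * indicator (ball (y0, \<psi> y0) (2 * \<Lambda> * R)) z \<partial>lborel)"
    unfolding mass_average[OF s A] by (intro nn_integral_mono loc)
  also have "\<dots> = ennreal b * emeasure lborel (ball (y0, \<psi> y0) (2 * \<Lambda> * R))"
    by (rule nn_integral_cmult_indicator) simp
  finally have "measure \<mu> A * (unit_ball_vol (real (n + 1)) * s ^ (n + 1)) \<le> b * (unit_ball_vol (real (n + 1)) * (2 * \<Lambda> * R) ^ (n + 1))"
    using s b R \<Lambda> by (simp add: emeasure_ball dim \<mu>.emeasure_eq_measure n_def flip: ennreal_mult)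
  then have "unit_ball_vol (real (n + 1)) * (measure \<mu> A * s ^ (n + 1)) \<le> unit_ball_vol (real (n + 1)) * (b * (2 * \<Lambda> * R) ^ (n + 1))"
    by (simp only: mult_ac)
  then have "measure \<mu> A * s ^ (n + 1) \<le> b * (2 * \<Lambda> * R) ^ (n + 1)"
    by (rule mult_left_le_imp_le) simp
  then have "measure \<mu> A \<le> b * (2 * \<Lambda> * R) ^ (n + 1) / s ^ (n + 1)" using s by (simp add: pos_le_divide_eq)
  also have "\<dots> = b * (2 * \<Lambda> * R / s) ^ (n + 1)" by (simp only: power_divide times_divide_eq_right)
  also have "2 * \<Lambda> * R / s = 16 * \<Lambda>\<^sup>2 * (R / h)" using h \<Lambda> by (simp add: s_def power2_eq_square field_simps)
  also have "b * (16 * \<Lambda>\<^sup>2 * (R / h)) ^ (n + 1)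
     = Q * (16 * \<Lambda>\<^sup>2) ^ (n + 1) * (2 * \<Lambda>) ^ (2 * n) * R ^ (n + 1) * (R / h) ^ (3 * n + 1)"
  proof -
    have "(2 * \<Lambda> * R / h) ^ (2 * n) = (2 * \<Lambda>) ^ (2 * n) * (R / h) ^ (2 * n)" by (simp only: power_mult_distrib[symmetric] times_divide_eq_right)
    moreover have "(16 * \<Lambda>\<^sup>2 * (R / h)) ^ (n + 1) = (16 * \<Lambda>\<^sup>2) ^ (n + 1) * (R / h) ^ (n + 1)" by (rule power_mult_distrib)
    moreover have "(R / h) ^ (3 * n + 1) = (R / h) ^ (2 * n) * (R / h) ^ (n + 1)" by (simp flip: power_add)
    ultimately show ?thesis unfolding b_def by (simp only: mult_ac)
  qed
  finally show ?thesis by (simp only: A_def n_def)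
qed

end

section \<open>Weak type of the nontangential maximal function near the boundary\<close>

lemma W12_loc_diff: "W12_loc D u G \<Longrightarrow> W12_loc D v H \<Longrightarrow> W12_loc D (\<lambda>x. u x - v x) (\<lambda>e x. G e x - H e x)"
  unfolding W12_loc_def by (blast intro: W12_diff)

lemma ennreal_powr_half_le:
  assumes m: "0 < m" and c: "0 \<le> c"
  shows "ennreal_powr (I / ennreal m) (1/2) \<le> ennreal c \<longleftrightarrow> I \<le> ennreal (c\<^sup>2 * m)"
proof (cases I)
  case (real i)
  have "I / ennreal m = ennreal (i / m)" using real m by (simp add: divide_ennreal)
  then have "ennreal_powr (I / ennreal m) (1/2) = ennreal (sqrt (i / m))"
    using real m by (simp add: ennreal_powr_ennreal powr_half_sqrt)
  then have "ennreal_powr (I / ennreal m) (1/2) \<le> ennreal c \<longleftrightarrow> sqrt (i / m) \<le> c"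
    using c by simp
  also have "\<dots> \<longleftrightarrow> i / m \<le> c\<^sup>2" using c real m by (metis real_sqrt_le_iff real_sqrt_abs abs_of_nonneg)
  also have "\<dots> \<longleftrightarrow> i \<le> c\<^sup>2 * m" using m by (simp add: pos_divide_le_eq)
  also have "\<dots> \<longleftrightarrow> I \<le> ennreal (c\<^sup>2 * m)" using real m by (simp add: ennreal_le_iff)
  finally show ?thesis .
next
  case top
  then have "I / ennreal m = top" using m by (simp add: ennreal_top_divide)
  then show ?thesis using top by (simp add: top_unique)
qed

lemma whitney_average_le_iff:
  fixes x :: "'a::euclidean_space"
  assumes d: "0 < infdist x (frontier \<Omega>)" and c: "0 \<le> c"
  shows "whitney_average \<Omega> u x \<le> ennreal c \<longleftrightarrow>
     (\<integral>\<^sup>+y. ennreal ((norm (u y))\<^sup>2) * indicator (ball x (infdist x (frontier \<Omega>) / 4)) y \<partial>lebesgue)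
        \<le> ennreal (c\<^sup>2 * (unit_ball_vol (real DIM('a)) * (infdist x (frontier \<Omega>) / 4) ^ DIM('a)))"
  using d unfolding whitney_average_def Let_def
  by (subst ennreal_powr_half_le[OF _ c, symmetric]) (auto simp: emeasure_ball)

lemma whitney_average_diff:
  fixes u v :: "'a::euclidean_space \<Rightarrow> 'b::euclidean_space"
  assumes d: "0 < infdist x (frontier \<Omega>)"
    and u: "u \<in> borel_measurable (lebesgue_on (ball x (infdist x (frontier \<Omega>) / 4)))"
    and v: "v \<in> borel_measurable (lebesgue_on (ball x (infdist x (frontier \<Omega>) / 4)))"
  shows "whitney_average \<Omega> u x \<le> 2 * max (whitney_average \<Omega> v x) (whitney_average \<Omega> (\<lambda>y. u y - v y) x)"
proof (cases "max (whitney_average \<Omega> v x) (whitney_average \<Omega> (\<lambda>y. u y - v y) x)")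
  case (real c)
  let ?B = "ball x (infdist x (frontier \<Omega>) / 4)"
  define m where "m = unit_ball_vol (real DIM('a)) * (infdist x (frontier \<Omega>) / 4) ^ DIM('a)"
  have m: "0 < m" using d by (simp add: m_def)
  have B: "?B \<in> sets lebesgue" by (intro sets_completionI_sets) simp
  have "whitney_average \<Omega> v x \<le> ennreal c" "whitney_average \<Omega> (\<lambda>y. u y - v y) x \<le> ennreal c"
    using real max.cobounded1[of "whitney_average \<Omega> v x" "whitney_average \<Omega> (\<lambda>y. u y - v y) x"]
      max.cobounded2[of "whitney_average \<Omega> (\<lambda>y. u y - v y) x" "whitney_average \<Omega> v x"] by simp_all
  then have I: "(\<integral>\<^sup>+y. ennreal ((norm (v y))\<^sup>2) * indicator ?B y \<partial>lebesgue) \<le> ennreal (c\<^sup>2 * m)"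
     "(\<integral>\<^sup>+y. ennreal ((norm (u y - v y))\<^sup>2) * indicator ?B y \<partial>lebesgue) \<le> ennreal (c\<^sup>2 * m)"
    using iffD1[OF whitney_average_le_iff[OF d real(1), of v]] iffD1[OF whitney_average_le_iff[OF d real(1), of "\<lambda>y. u y - v y"]]
    unfolding m_def by blast+
  have meas: "(\<lambda>y. ennreal ((norm (v y))\<^sup>2) * indicator ?B y) \<in> borel_measurable lebesgue"
     "(\<lambda>y. ennreal ((norm (u y - v y))\<^sup>2) * indicator ?B y) \<in> borel_measurable lebesgue"
    using u v by (auto intro!: indicator_lebesgue_measurable B)
  have "(\<integral>\<^sup>+y. ennreal ((norm (u y))\<^sup>2) * indicator ?B y \<partial>lebesgue)
    \<le> (\<integral>\<^sup>+y. 2 * (ennreal ((norm (v y))\<^sup>2) * indicator ?B y) + 2 * (ennreal ((norm (u y - v y))\<^sup>2) * indicator ?B y) \<partial>lebesgue)"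
  proof (rule nn_integral_mono)
    fix y
    have "ennreal ((norm (u y))\<^sup>2) \<le> ennreal (2 * (norm (v y))\<^sup>2 + 2 * (norm (u y - v y))\<^sup>2)"
      using norm_add_sq_le[of "v y" "u y - v y"] by (intro ennreal_leI) simp
    then show "ennreal ((norm (u y))\<^sup>2) * indicator ?B y \<le> 2 * (ennreal ((norm (v y))\<^sup>2) * indicator ?B y) + 2 * (ennreal ((norm (u y - v y))\<^sup>2) * indicator ?B y)"
      by (auto simp: indicator_def ennreal_mult)
  qed
  also have "\<dots> = 2 * (\<integral>\<^sup>+y. ennreal ((norm (v y))\<^sup>2) * indicator ?B y \<partial>lebesgue) + 2 * (\<integral>\<^sup>+y. ennreal ((norm (u y - v y))\<^sup>2) * indicator ?B y \<partial>lebesgue)"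
    using meas by (simp add: nn_integral_add nn_integral_cmult)
  also have "\<dots> \<le> 2 * ennreal (c\<^sup>2 * m) + 2 * ennreal (c\<^sup>2 * m)" by (intro add_mono mult_left_mono I) auto
  also have "\<dots> = ennreal ((2 * c)\<^sup>2 * m)"
  proof -
    have "2 * ennreal (c\<^sup>2 * m) + 2 * ennreal (c\<^sup>2 * m) = ennreal (2 * (c\<^sup>2 * m) + 2 * (c\<^sup>2 * m))"
    proof -
      have "2 * ennreal X + 2 * ennreal X = ennreal (2 * X + 2 * X)" if "0 \<le> X" for X
      proof -
        have "2 * ennreal X = ennreal (2 * X)" using that by (simp add: ennreal_mult)
        then show ?thesis using ennreal_plus[of "2 * X" "2 * X"] that by simp
      qed
      then show ?thesis using m by simp
    qed
    also have "2 * (c\<^sup>2 * m) + 2 * (c\<^sup>2 * m) = (2 * c)\<^sup>2 * m" by (simp add: power_mult_distrib)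
    finally show ?thesis .
  qed
  finally have "whitney_average \<Omega> u x \<le> ennreal (2 * c)"
    using whitney_average_le_iff[OF d, of "2 * c" u] real(1) by (simp add: m_def)
  also have "\<dots> = 2 * ennreal c" using real(1) by (simp add: ennreal_mult)
  finally show ?thesis using real(2) by simp
next
  case top
  then show ?thesis by (simp only:) (simp add: ennreal_mult_top)
qed

text \<open>Let \<open>(y, \<psi> y)\<close> be the boundary point nearest to \<open>x\<close>.  All boundary points over a ball around \<open>y\<close> of radius
  \<open>(a - 1) / (1 + M)\<close> times the depth of \<open>x\<close> have \<open>x\<close> in their cones, so there the maximal function is at least
  the average at \<open>x\<close>, which is therefore bounded by means of the maximal function.\<close>

lemma whitney_le_average:
  fixes \<psi> :: "real ^ 'n \<Rightarrow> real"
  assumes c: "continuous_on UNIV \<psi>" and lip: "\<And>x y. \<bar>\<psi> x - \<psi> y\<bar> \<le> M * norm (x - y)" and M: "0 \<le> M"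
    and x: "x \<in> graph_domain \<psi>" and a: "1 < a" and p: "0 < p"
    and \<rho>: "norm (fst x - y0) + depth \<psi> x + (a - 1) / (1 + M) * depth \<psi> x \<le> \<rho>"
    and av: "ball_average_le y0 \<rho> (\<lambda>y. ennreal_powr (nontangential_max (graph_domain \<psi>) a u (y, \<psi> y)) p) \<theta>" and \<theta>: "0 \<le> \<theta>"
  shows "whitney_average (graph_domain \<psi>) u x \<le> ennreal ((\<theta> * (\<rho> / ((a - 1) / (1 + M) * depth \<psi> x)) ^ CARD('n)) powr (1 / p))"
proof -
  define \<delta> where "\<delta> = depth \<psi> x"
  define r where "r = (a - 1) / (1 + M) * \<delta>"
  define W where "W = whitney_average (graph_domain \<psi>) u x"
  note dep = depth_height[OF c lip M x]
  have \<delta>: "0 < \<delta>" using dep(1) by (simp add: \<delta>_def)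
  have r: "0 < r" using \<delta> a M by (simp add: r_def)
  have rM: "(1 + M) * r = (a - 1) * \<delta>" using M by (simp add: r_def)
  obtain y where y: "dist x (y, \<psi> y) = \<delta>" using dep(4) by (auto simp: \<delta>_def)
  have yx: "norm (fst x - y) \<le> \<delta>" using norm_fst_snd_le(1)[of "x - (y, \<psi> y)"] y by (simp add: dist_norm)
  have \<rho>': "norm (fst x - y0) + \<delta> + r \<le> \<rho>" using \<rho> by (simp add: r_def \<delta>_def)
  have \<rho>0: "0 < \<rho>" using \<rho>' r \<delta> norm_ge_zero[of "fst x - y0"] by linarith
  have see: "W \<le> nontangential_max (graph_domain \<psi>) a u (z, \<psi> z)" if "z \<in> ball y r" for z
    unfolding W_def
  proof (rule whitney_average_le)
    have "dist (y, \<psi> y) (z, \<psi> z) \<le> (1 + M) * norm (y - z)" using dist_graph_point[OF lip, of "(y, \<psi> y)" z] by simp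
    also have "\<dots> < (1 + M) * r" using that M by (intro mult_strict_left_mono) (auto simp: dist_norm)
    finally have "dist x (z, \<psi> z) < \<delta> + (a - 1) * \<delta>"
      using dist_triangle[of x "(z, \<psi> z)" "(y, \<psi> y)"] y rM by simp
    then show "x \<in> cone (graph_domain \<psi>) a (z, \<psi> z)" using x by (simp add: cone_def \<delta>_def algebra_simps)
  qed
  have sub: "ball y r \<subseteq> ball y0 \<rho>"
  proof
    fix z assume z: "z \<in> ball y r"
    have "dist y0 z \<le> dist y0 (fst x) + dist (fst x) y + dist y z"
      using dist_triangle[of y0 z "fst x"] dist_triangle[of "fst x" z y] by simp
    then show "z \<in> ball y0 \<rho>" using z yx \<rho>' by (simp add: dist_norm norm_minus_commute)
  qed
  have "ennreal_powr W p * emeasure lborel (ball y r) = (\<integral>\<^sup>+z. ennreal_powr W p * indicator (ball y r) z \<partial>lborel)"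
    by (rule nn_integral_cmult_indicator[symmetric]) simp
  also have "\<dots> \<le> (\<integral>\<^sup>+z. ennreal_powr (nontangential_max (graph_domain \<psi>) a u (z, \<psi> z)) p * indicator (ball y0 \<rho>) z \<partial>lborel)"
  proof (rule nn_integral_mono)
    fix z
    show "ennreal_powr W p * indicator (ball y r) z \<le> ennreal_powr (nontangential_max (graph_domain \<psi>) a u (z, \<psi> z)) p * indicator (ball y0 \<rho>) z"
      using see[of z] sub ennreal_powr_mono[of W _ p] p by (auto simp: indicator_def subset_iff)
  qed
  also have "\<dots> \<le> ennreal \<theta> * emeasure lborel (ball y0 \<rho>)" using av by (simp add: ball_average_le_def)
  finally have le: "ennreal_powr W p * ennreal (unit_ball_vol (real CARD('n)) * r ^ CARD('n)) \<le> ennreal (\<theta> * (unit_ball_vol (real CARD('n)) * \<rho> ^ CARD('n)))"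
    using r \<rho>0 \<theta> by (simp add: emeasure_ball flip: ennreal_mult)
  have vr: "0 < unit_ball_vol (real CARD('n)) * r ^ CARD('n)" using r by simp
  have "ennreal_powr W p \<le> ennreal (\<theta> * (\<rho> / r) ^ CARD('n))"
  proof (cases "ennreal_powr W p")
    case (real e)
    then have "e * (unit_ball_vol (real CARD('n)) * r ^ CARD('n)) \<le> \<theta> * (unit_ball_vol (real CARD('n)) * \<rho> ^ CARD('n))"
      using le vr \<theta> \<rho>0 by (simp flip: ennreal_mult)
    then have "unit_ball_vol (real CARD('n)) * (e * r ^ CARD('n)) \<le> unit_ball_vol (real CARD('n)) * (\<theta> * \<rho> ^ CARD('n))"
      by (simp only: mult_ac)
    then have "e * r ^ CARD('n) \<le> \<theta> * \<rho> ^ CARD('n)" by (rule mult_left_le_imp_le) simp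
    then have "e \<le> \<theta> * (\<rho> / r) ^ CARD('n)" using r by (simp add: power_divide field_simps)
    then show ?thesis using real by (simp add: ennreal_leI)
  next
    case top
    have "ennreal (unit_ball_vol (real CARD('n)) * r ^ CARD('n)) \<noteq> 0" using vr by (simp only: ennreal_eq_0_iff not_le)
    then have "top \<le> ennreal (\<theta> * (unit_ball_vol (real CARD('n)) * \<rho> ^ CARD('n)))"
      using le unfolding top by (simp only: ennreal_top_mult if_False)
    then show ?thesis by (simp only: top_unique ennreal_neq_top)
  qed
  then have "ennreal_powr (ennreal_powr W p) (1 / p) \<le> ennreal_powr (ennreal (\<theta> * (\<rho> / r) ^ CARD('n))) (1 / p)"
    using p by (intro ennreal_powr_mono) auto
  also have "ennreal_powr (ennreal (\<theta> * (\<rho> / r) ^ CARD('n))) (1 / p) = ennreal ((\<theta> * (\<rho> / r) ^ CARD('n)) powr (1 / p))"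
    using \<theta> \<rho>0 r by (intro ennreal_powr_ennreal) simp
  also have "ennreal_powr (ennreal_powr W p) (1 / p) = W" using p by (simp add: ennreal_powr_powr)
  finally show ?thesis unfolding W_def r_def \<delta>_def .
qed

definition near_max :: "'a::euclidean_space set \<Rightarrow> real \<Rightarrow> real \<Rightarrow> ('a \<Rightarrow> 'b::euclidean_space) \<Rightarrow> 'a \<Rightarrow> ennreal" where
  "near_max \<Omega> a \<rho> u z = (SUP x\<in>{x \<in> cone \<Omega> a z. infdist x (frontier \<Omega>) < \<rho>}. whitney_average \<Omega> u x)"

lemma open_near_max: "open {z. t < near_max \<Omega> a \<rho> u z}"
proof -
  have "{z. t < near_max \<Omega> a \<rho> u z} = (\<Union>x\<in>{x\<in>\<Omega>. infdist x (frontier \<Omega>) < \<rho> \<and> t < whitney_average \<Omega> u x}. ball x (a * infdist x (frontier \<Omega>)))"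
    unfolding near_max_def less_SUP_iff cone_def by auto
  then show ?thesis by auto
qed

lemma near_max_measurable: "near_max \<Omega> a \<rho> u \<in> borel_measurable borel"
  by (rule borel_measurableI_greater) (auto intro: borel_open open_near_max)

text \<open>Collects the constants in the passage from a large Whitney average at \<open>x\<close> to a large energy in the slab of
  size \<open>(2 + M) * (a + 1)\<close> times the depth of \<open>x\<close>.\<close>

definition near_ratio :: "real \<Rightarrow> real \<Rightarrow> nat \<Rightarrow> real" where
  "near_ratio M a n = unit_ball_vol (real (n + 1)) / (8 * (4 * (2 + M) * (a + 1)) ^ (n + 1))"

context vanishing_solution
begin

text \<open>Suppose the Whitney average at a point \<open>x\<close> of the cone at \<open>(y, \<psi> y)\<close> exceeds \<open>t\<close>.  The Whitney ball lies in
  the slab over \<open>y\<close> of a size \<open>s\<close> comparable to the depth of \<open>x\<close>, so the mass of that slab exceeds a multiple of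
  \<open>t\<^sup>2 * s ^ (n + 1)\<close>, and by Poincare its energy exceeds a multiple of \<open>t\<^sup>2 * s ^ (n - 1)\<close>.  This is the
  situation of the weak-type estimate for energies.\<close>

lemma near_weak_type:
  assumes Q: "0 < Q" and a: "1 < a" and t: "0 < t" and \<rho>: "\<Lambda> * (a + 1) * \<rho> \<le> R / (8 * (2 * \<Lambda>\<^sup>2))"
    and whitney: "\<And>x. x \<in> graph_domain \<psi> \<Longrightarrow> norm (fst x - y0) < 2 * R \<Longrightarrow> snd x - \<psi> (fst x) < 2 * R \<Longrightarrow>
        (\<integral>\<^sup>+z. ennreal ((norm (w z))\<^sup>2) * indicator (ball x (depth \<psi> x / 4)) z \<partial>lebesgue)
          \<le> ennreal (Q * R ^ (CARD('n) + 1) * (R / depth \<psi> x) ^ (2 * CARD('n)))"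
    and q: "0 < q" "1 < CARD('n) \<Longrightarrow> q = 2 + 2 / (real CARD('n) - 1 - decay_exponent (\<kappa> / \<Lambda>\<^sup>2) (2 * \<Lambda>\<^sup>2) M (32 * (1 + M\<^sup>2)))"
  shows "emeasure lborel {y \<in> ball y0 (R / 8). ennreal t < near_max (graph_domain \<psi>) a \<rho> w (y, \<psi> y)}
     \<le> ennreal (weak_const (\<kappa> / \<Lambda>\<^sup>2) (2 * \<Lambda>\<^sup>2) M (32 * (1 + M\<^sup>2)) CARD('n) (3 * CARD('n) + 1) q
         * (sqrt (Q * (16 * \<Lambda>\<^sup>2) ^ (CARD('n) + 1) * (2 * \<Lambda>) ^ (2 * CARD('n))) / (sqrt (near_ratio M a CARD('n)) * t)) powr q * R ^ CARD('n))"
proof -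
  interpret be: boundary_energy \<psi> \<mu> \<nu> y0 R "\<kappa> / \<Lambda>\<^sup>2" "2 * \<Lambda>\<^sup>2" M "32 * (1 + M\<^sup>2)"
    by (rule energy_instance)
  define n where "n = CARD('n)"
  define P where "P = Q * (16 * \<Lambda>\<^sup>2) ^ (n + 1) * (2 * \<Lambda>) ^ (2 * n)"
  have P: "0 < P" using Q \<Lambda> by (simp add: P_def)
  define c where "c = near_ratio M a n"
  have \<Lambda>M: "\<Lambda> = 2 + M" by (simp add: \<Lambda>_def)
  define b where "b = \<Lambda> * (a + 1)"
  have b: "0 < b" using \<Lambda> a by (simp add: b_def)
  have c: "0 < c" using M a by (simp add: c_def near_ratio_def)
  have ceq: "c * (8 * (4 * b) ^ (n + 1)) = unit_ball_vol (real (n + 1))"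
  proof -
    have "4 * (2 + M) * (a + 1) = 4 * b" by (simp add: b_def \<Lambda>M)
    then have "c = unit_ball_vol (real (n + 1)) / (8 * (4 * b) ^ (n + 1))" by (simp only: c_def near_ratio_def)
    moreover have "8 * (4 * b) ^ (n + 1) \<noteq> 0" using b by simp
    ultimately show ?thesis using nonzero_eq_divide_eq[of "8 * (4 * b) ^ (n + 1)" c "unit_ball_vol (real (n + 1))"] by blast
  qed
  define T where "T = {y \<in> ball y0 (R / 8). ennreal t < near_max (graph_domain \<psi>) a \<rho> w (y, \<psi> y)}"
  have "open T"
  proof -
    have "open ((\<lambda>y. (y, \<psi> y)) -` {z. ennreal t < near_max (graph_domain \<psi>) a \<rho> w z})"
      by (intro open_vimage open_near_max continuous_intros cont)
    moreover have "T = ball y0 (R / 8) \<inter> (\<lambda>y. (y, \<psi> y)) -` {z. ennreal t < near_max (graph_domain \<psi>) a \<rho> w z}"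
      by (auto simp: T_def)
    ultimately show ?thesis by auto
  qed
  then have Tb: "T \<in> sets borel" by simp
  have R8: "R / (8 * (2 * \<Lambda>\<^sup>2)) \<le> R / 8"
  proof -
    have "1 \<le> 2 * \<Lambda>\<^sup>2" by (rule be.\<beta>)
    then show ?thesis using R by (intro divide_left_mono) auto
  qed
  have "emeasure lborel T \<le> ennreal (weak_const (\<kappa> / \<Lambda>\<^sup>2) (2 * \<Lambda>\<^sup>2) M (32 * (1 + M\<^sup>2)) DIM(real ^ 'n) (3 * n + 1) q
         * (sqrt P / (sqrt c * t)) powr q * R ^ DIM(real ^ 'n))"
  proof (rule be.weak_type)
    show "0 < sqrt P" "0 < sqrt c * t" using P c t by auto
    show "T \<in> sets borel" by (rule Tb)
    show "measure \<mu> (slab \<psi> (ball y0 R) R - slab \<psi> (ball y0 R) h) \<le> (sqrt P)\<^sup>2 * R ^ (DIM(real ^ 'n) + 1) * (R / h) ^ (3 * n + 1)"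
      if "0 < h" "h \<le> R" for h
      using far_bound[OF _ whitney that] Q P by (simp add: P_def n_def)
    show "0 < q" by (rule q)
    show "q = 2 + 2 / (real DIM(real ^ 'n) - 1 - decay_exponent (\<kappa> / \<Lambda>\<^sup>2) (2 * \<Lambda>\<^sup>2) M (32 * (1 + M\<^sup>2)))" if "1 < DIM(real ^ 'n)"
      using q(2) that by simp
    fix y assume y: "y \<in> T"
    then have "ennreal t < near_max (graph_domain \<psi>) a \<rho> w (y, \<psi> y)" by (simp add: T_def)
    then obtain x where x: "x \<in> graph_domain \<psi>" "dist x (y, \<psi> y) < a * depth \<psi> x" "depth \<psi> x < \<rho>"
        and tx: "ennreal t < whitney_average (graph_domain \<psi>) w x"
      unfolding near_max_def less_SUP_iff cone_def by auto
    note dep = depth_height[OF cont lip M x(1)]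
    define \<delta> where "\<delta> = depth \<psi> x"
    define s where "s = b * \<delta>"
    have \<delta>: "0 < \<delta>" using dep(1) by (simp add: \<delta>_def)
    have s: "0 < s" using b \<delta> by (simp add: s_def)
    have "s \<le> b * \<rho>" using x(3) b by (simp add: s_def \<delta>_def)
    then have sR: "s \<le> R / (8 * (2 * \<Lambda>\<^sup>2))" using \<rho> by (simp add: b_def)
    have yR: "y \<in> ball y0 (R / 8)" using y by (simp add: T_def)
    have sub: "ball y s \<subseteq> ball y0 R"
    proof
      fix z assume "z \<in> ball y s"
      then show "z \<in> ball y0 R" using yR sR R8 R dist_triangle[of y0 z y] by simp
    qed
    have sR': "s \<le> R" using sR R8 R by linarith
    have incl: "ball x (\<delta> / 4) \<subseteq> slab \<psi> (ball y s) s"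
    proof
      fix z assume z: "z \<in> ball x (\<delta> / 4)"
      have ad: "dist z (y, \<psi> y) < (a + 1) * \<delta>"
        using z x(2) \<delta> dist_triangle[of z "(y, \<psi> y)" x] by (simp add: \<delta>_def dist_commute algebra_simps)
      have "1 * ((a + 1) * \<delta>) \<le> \<Lambda> * ((a + 1) * \<delta>)" using \<Lambda> a \<delta> by (intro mult_right_mono) auto
      then have as: "(a + 1) * \<delta> \<le> s" by (simp add: s_def b_def mult.assoc)
      have "norm (fst z - y) \<le> dist z (y, \<psi> y)" using norm_fst_snd_le(1)[of "z - (y, \<psi> y)"] by (simp add: dist_norm)
      then have 1: "fst z \<in> ball y s" using ad as by (simp add: dist_norm norm_minus_commute)
      have "snd z - \<psi> (fst z) \<le> (1 + M) * dist z (y, \<psi> y)" using graph_height_dist[OF lip M, of z "(y, \<psi> y)"] by simp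
      also have "\<dots> \<le> (1 + M) * ((a + 1) * \<delta>)" using ad M by (intro mult_left_mono) auto
      also have "\<dots> < \<Lambda> * ((a + 1) * \<delta>)" using a \<delta> by (intro mult_strict_right_mono) (auto simp: \<Lambda>_def)
      finally have 2: "snd z < \<psi> (fst z) + s" by (simp add: s_def b_def mult.assoc)
      have "z \<in> graph_domain \<psi>" using whitney_ball_in_domain[OF x(1) dep(1)] z by (auto simp: \<delta>_def)
      then have 3: "\<psi> (fst z) < snd z" by (simp add: graph_domain_def)
      show "z \<in> slab \<psi> (ball y s) s" using 1 2 3 by (simp add: slab_def)
    qed
    have slabD: "slab \<psi> (ball y s) s \<subseteq> D" by (rule slab_in_D[OF sub sR'])
    have "\<not> whitney_average (graph_domain \<psi>) w x \<le> ennreal t" using tx by simp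
    then have "\<not> (\<integral>\<^sup>+z. ennreal ((norm (w z))\<^sup>2) * indicator (ball x (\<delta> / 4)) z \<partial>lebesgue) \<le> ennreal (t\<^sup>2 * (unit_ball_vol (real (n + 1)) * (\<delta> / 4) ^ (n + 1)))"
      using whitney_average_le_iff[of x "graph_domain \<psi>" t w] \<delta> t by (simp add: \<delta>_def n_def)
    then have "ennreal (t\<^sup>2 * (unit_ball_vol (real (n + 1)) * (\<delta> / 4) ^ (n + 1))) < (\<integral>\<^sup>+z. ennreal ((norm (w z))\<^sup>2) * indicator (ball x (\<delta> / 4)) z \<partial>lebesgue)"
      by simp
    also have "\<dots> \<le> (\<integral>\<^sup>+z. ennreal ((norm (w z))\<^sup>2) * indicator (slab \<psi> (ball y s) s) z \<partial>lebesgue)"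
      using incl by (intro nn_integral_mono mult_left_mono) (auto simp: indicator_def subset_iff)
    also have "\<dots> = emeasure \<mu> (slab \<psi> (ball y s) s)"
      by (intro \<mu>_eq[symmetric] slabD sets_slab) auto
    finally have "t\<^sup>2 * (unit_ball_vol (real (n + 1)) * (\<delta> / 4) ^ (n + 1)) < measure \<mu> (slab \<psi> (ball y s) s)"
      using \<delta> by (simp add: \<mu>.emeasure_eq_measure ennreal_less_iff)
    also have "\<dots> \<le> 8 * s\<^sup>2 * be.energy y s"
      unfolding be.energy_def using sub s sR' by (intro poincare_w) auto
    also have "t\<^sup>2 * (unit_ball_vol (real (n + 1)) * (\<delta> / 4) ^ (n + 1)) = 8 * s\<^sup>2 * ((sqrt c * t)\<^sup>2 * s ^ (n - 1))"
    proof -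
      have n1: "1 \<le> n" by (simp add: n_def Suc_leI)
      define X where "X = (\<delta> / 4) ^ (n + 1)"
      define Y where "Y = (4 * b) ^ (n + 1)"
      have 1: "s\<^sup>2 * s ^ (n - 1) = s ^ (n + 1)" using n1 by (simp flip: power_add)
      have "\<delta> / 4 * (4 * b) = s" by (simp add: s_def)
      then have 2: "X * Y = s ^ (n + 1)" unfolding X_def Y_def by (simp only: power_mult_distrib[symmetric])
      have 3: "(sqrt c * t)\<^sup>2 = c * t\<^sup>2" using c by (simp add: power_mult_distrib)
      have "t\<^sup>2 * ((c * (8 * Y)) * X) = 8 * (c * t\<^sup>2) * (X * Y)" by (simp only: mult_ac)
      also have "\<dots> = 8 * (c * t\<^sup>2) * (s\<^sup>2 * s ^ (n - 1))" unfolding 1 2 ..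
      also have "\<dots> = 8 * s\<^sup>2 * ((sqrt c * t)\<^sup>2 * s ^ (n - 1))" unfolding 3 by (simp only: mult_ac)
      finally show ?thesis unfolding ceq[symmetric] X_def Y_def .
    qed
    finally have "(sqrt c * t)\<^sup>2 * s ^ (n - 1) < be.energy y s"
      by (rule mult_left_less_imp_less) simp
    then show "y \<in> ball y0 (R / 8) \<and> (\<exists>s>0. s \<le> R / (8 * (2 * \<Lambda>\<^sup>2)) \<and> (sqrt c * t)\<^sup>2 * s ^ (DIM(real ^ 'n) - 1) < be.energy y s)"
      using yR s sR by (auto simp: n_def)
  qed
  note res = this
  have dim: "DIM(real ^ 'n) = CARD('n)" by simp
  show ?thesis using res unfolding dim T_def P_def c_def n_def .
qed

end

section \<open>The splitting near a stopping ball\<close>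

lemma nontangential_bound_powr:
  assumes b: "nontangential_bound \<psi> a p C f u" and p: "0 < p" and C: "C \<le> C'" "0 < C'"
  shows "(\<integral>\<^sup>+z. ennreal_powr (nontangential_max (graph_domain \<psi>) a u z) p \<partial>surface_measure \<psi>)
    \<le> ennreal (C' powr p) * (\<integral>\<^sup>+z. ennreal_powr (ennreal (norm (f z))) p \<partial>surface_measure \<psi>)"
proof -
  let ?I = "\<integral>\<^sup>+z. ennreal_powr (nontangential_max (graph_domain \<psi>) a u z) p \<partial>surface_measure \<psi>"
  let ?J = "\<integral>\<^sup>+z. ennreal_powr (ennreal (norm (f z))) p \<partial>surface_measure \<psi>"
  have "ennreal_powr ?I (1/p) \<le> ennreal C * ennreal_powr ?J (1/p)"
    using b unfolding nontangential_bound_def Lp_norm_def .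
  also have "\<dots> \<le> ennreal C' * ennreal_powr ?J (1/p)" using C by (intro mult_right_mono ennreal_leI) auto
  finally have "ennreal_powr (ennreal_powr ?I (1/p)) p \<le> ennreal_powr (ennreal C' * ennreal_powr ?J (1/p)) p"
    using p by (intro ennreal_powr_mono) auto
  then show ?thesis using p C by (simp add: ennreal_powr_powr ennreal_powr_mult)
qed

lemma nontangential_bound_of_powr:
  assumes p: "0 < p" and C: "0 < C"
    and le: "(\<integral>\<^sup>+z. ennreal_powr (nontangential_max (graph_domain \<psi>) a u z) p \<partial>surface_measure \<psi>)
    \<le> ennreal C * (\<integral>\<^sup>+z. ennreal_powr (ennreal (norm (f z))) p \<partial>surface_measure \<psi>)"
  shows "nontangential_bound \<psi> a p (C powr (1/p)) f u"
proof -
  have "ennreal_powr (\<integral>\<^sup>+z. ennreal_powr (nontangential_max (graph_domain \<psi>) a u z) p \<partial>surface_measure \<psi>) (1/p)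
    \<le> ennreal_powr (ennreal C * (\<integral>\<^sup>+z. ennreal_powr (ennreal (norm (f z))) p \<partial>surface_measure \<psi>)) (1/p)"
    using p by (intro ennreal_powr_mono le) auto
  then show ?thesis unfolding nontangential_bound_def Lp_norm_def using C by (simp add: ennreal_powr_mult)
qed

lemma whitney_average_cong: "(\<And>y. norm (u y) = norm (v y)) \<Longrightarrow> whitney_average \<Omega> u x = whitney_average \<Omega> v x"
  by (simp add: whitney_average_def)

lemma graph_comp_measurable:
  fixes \<psi> :: "real ^ 'n \<Rightarrow> real"
  assumes "continuous_on UNIV \<psi>" "F \<in> borel_measurable borel"
  shows "(\<lambda>y. F (y, \<psi> y)) \<in> borel_measurable borel"
  by (rule measurable_compose[OF _ assms(2)]) (intro borel_measurable_continuous_onI continuous_intros assms(1))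

text \<open>Near a stopping ball \<open>ball y0 \<rho>\<close>, cut off the data at distance \<open>r\<close>, a large multiple of \<open>\<rho>\<close>, and let \<open>v\<close> be the
  solution for the truncated data.  The estimate at the exponent \<open>p0\<close> makes \<open>V = N(v)\<close> small in the mean, of
  relative size \<open>\<gamma>\<close>.  The difference \<open>w = u - v\<close> vanishes on the boundary near the ball.  The Whitney
  averages of \<open>u\<close> at depth at least \<open>\<rho>\<close> are controlled by averages of \<open>N(u)\<close> over larger balls, hence at most
  \<open>A0 * \<tau>\<close>; at depth less than \<open>\<rho>\<close> it remains to estimate \<open>w\<close>, whose near part is of weak type \<open>q\<close>.
  
  The constants are named by equations between \<open>M\<close>, \<open>a\<close>, \<open>\<kappa>\<close>, \<open>C0\<close>, \<open>p0\<close>, \<open>q\<close> and the dimension alone, so they can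
  be fixed before the domain, the operator and the data are given.\<close>

lemma local_estimate:
  fixes \<psi> :: "real ^ 'n \<Rightarrow> real" and \<L> :: "((real ^ 'n) \<times> real, 'm::finite) elliptic_op"
    and f u :: "(real ^ 'n) \<times> real \<Rightarrow> complex ^ 'm"
  assumes M: "0 \<le> M" and p0: "1 < p0" and \<kappa>: "0 < \<kappa>" and a: "1 < a"
    and q: "0 < q" "1 < CARD('n) \<Longrightarrow> q = 2 + 2 / (real CARD('n) - 1 - decay_exponent (\<kappa> / \<Lambda>\<^sup>2) (2 * \<Lambda>\<^sup>2) M (32 * (1 + M\<^sup>2)))"
    and \<Lambda>: "\<Lambda> = 2 + M" and CR: "CR = 16 * \<Lambda>\<^sup>2 * (\<Lambda> * (a + 6))" and c1: "c1 = (a - 1) / (1 + M)"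
    and KV: "KV = max C0 1 powr p0 * (1 + M) * (6 * \<Lambda> * CR) ^ CARD('n)" and K1: "K1 = 1 + KV"
    and Q0: "Q0 = 4 * unit_ball_vol (real (CARD('n) + 1)) * K1\<^sup>2 * ((4 + 2 * a) / c1) ^ (2 * CARD('n))"
    and c4: "c4 = sqrt (Q0 * (16 * \<Lambda>\<^sup>2) ^ (CARD('n) + 1) * (2 * \<Lambda>) ^ (2 * CARD('n))) / sqrt (near_ratio M a CARD('n))"
    and KR: "KR = \<bar>weak_const (\<kappa> / \<Lambda>\<^sup>2) (2 * \<Lambda>\<^sup>2) M (32 * (1 + M\<^sup>2)) CARD('n) (3 * CARD('n) + 1) q\<bar> * c4 powr q * CR ^ CARD('n) / unit_ball_vol (real CARD('n))"
    and A0: "A0 = ((2 * a + 6) / c1) powr (real CARD('n) / p0)"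
    and lip_graph: "lipschitz_graph M \<psi>" and cacc: "boundary_caccioppoli \<psi> \<L> \<kappa>"
    and solvable: "\<And>f. f \<in> test_functions UNIV \<Longrightarrow> \<exists>u. dirichlet_solution \<psi> \<L> f u \<and> nontangential_bound \<psi> a p0 C0 f u"
    and f: "f \<in> test_functions UNIV" and u: "dirichlet_solution \<psi> \<L> f u"
    and \<gamma>: "0 < \<gamma>" "\<gamma> \<le> 1" and \<rho>: "0 < \<rho>" and \<tau>: "0 < \<tau>"
    and avF: "\<And>\<rho>'. 2 * \<rho> \<le> \<rho>' \<Longrightarrow> ball_average_le y0 \<rho>' (\<lambda>y. ennreal_powr (nontangential_max (graph_domain \<psi>) a u (y, \<psi> y)) p0) (\<tau> powr p0)"
    and avg: "\<And>\<rho>'. 2 * \<rho> \<le> \<rho>' \<Longrightarrow> ball_average_le y0 \<rho>' (\<lambda>y. ennreal_powr (ennreal (norm (f (y, \<psi> y)))) p0) ((\<gamma> * \<tau>) powr p0)"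
  shows "local_splitting p0 q A0 (KV + KR + 1) \<gamma> \<tau> y0 \<rho> (\<lambda>y. nontangential_max (graph_domain \<psi>) a u (y, \<psi> y))"
proof -
  define n where "n = CARD('n)"
  let ?\<Omega> = "graph_domain \<psi>"
  have cont: "continuous_on UNIV \<psi>" by (rule lipschitz_graph_continuous[OF lip_graph])
  have lip: "\<bar>\<psi> x - \<psi> y\<bar> \<le> M * norm (x - y)" for x y by (rule lipschitz_graph_bound[OF lip_graph M])
  have \<Omega>: "?\<Omega> \<in> sets lebesgue" "?\<Omega> \<in> sets borel" using graph_domain_open[OF cont] by (auto intro!: sets_completionI_sets)
  have \<Lambda>2: "2 \<le> \<Lambda>" using M \<Lambda> by simp
  have c1p: "0 < c1" "c1 \<le> a"
  proof -
    show "0 < c1" using a M by (simp add: c1)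
    have "c1 \<le> (a - 1) / 1" unfolding c1 using a M by (intro divide_left_mono) auto
    then show "c1 \<le> a" by simp
  qed
  have LL: "4 \<le> \<Lambda>\<^sup>2" using \<Lambda>2 power_mono[of 2 \<Lambda> 2] by simp
  have CR1: "1 \<le> CR" "40 \<le> CR"
  proof -
    have "4 * 2 \<le> \<Lambda>\<^sup>2 * \<Lambda>" using mult_mono[OF LL \<Lambda>2] by simp
    then have "(4 * 2) * (1 + 6) \<le> (\<Lambda>\<^sup>2 * \<Lambda>) * (a + 6)" using mult_mono[of "4 * 2" "\<Lambda>\<^sup>2 * \<Lambda>" "1 + 6" "a + 6"] a \<Lambda>2 by simp
    then have "16 * ((4 * 2) * (1 + 6)) \<le> 16 * ((\<Lambda>\<^sup>2 * \<Lambda>) * (a + 6))" by (intro mult_left_mono) auto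
    also have "\<dots> = CR" by (simp only: CR mult.assoc)
    finally show "40 \<le> CR" by simp
    then show "1 \<le> CR" by simp
  qed
  define R where "R = CR * \<rho>"
  have R: "0 < R" using CR1 \<rho> by (simp add: R_def)
  have R5: "5 * \<rho> \<le> R / 8" using CR1 \<rho> by (simp add: R_def)
  have R\<rho>: "\<rho> \<le> R" using R5 \<rho> by simp
  have KV0: "0 < KV" using M CR1 \<Lambda>2 by (simp add: KV)
  have K1': "1 \<le> K1" using KV0 by (simp add: K1)
  have nr: "0 < near_ratio M a CARD('n)" using M a by (simp add: near_ratio_def)
  have Q0p: "0 < Q0" using K1' c1p a by (simp add: Q0)
  have c40: "0 \<le> c4" using Q0p nr \<Lambda>2 by (simp add: c4)
  have KR0: "0 \<le> KR" using c40 CR1 by (simp add: KR)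
  define z0 where "z0 = (y0, \<psi> y0)"
  define r where "r = 3 * \<Lambda> * R"
  have r: "0 < r" using \<Lambda>2 R by (simp add: r_def)
  obtain \<phi> :: "(real ^ 'n) \<times> real \<Rightarrow> real" where \<phi>: "smooth \<phi>" "\<And>x. x \<in> ball z0 r \<Longrightarrow> \<phi> x = 1"
    "\<And>x. x \<notin> ball z0 (2 * r) \<Longrightarrow> \<phi> x = 0" "\<And>x. 0 \<le> \<phi> x \<and> \<phi> x \<le> 1"
    by (rule cutoff_exists[OF r, of z0]) blast
  define g where "g x = \<phi> x *\<^sub>R f x" for x
  have g: "g \<in> test_functions UNIV" unfolding g_def by (rule test_functions_cutoff[OF \<phi>(1) f])
  obtain v where v: "dirichlet_solution \<psi> \<L> g v" "nontangential_bound \<psi> a p0 C0 g v"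
    using solvable[OF g] by blast
  obtain G where G: "W12_loc ?\<Omega> u G" "weak_equation \<L> ?\<Omega> u G" "has_trace \<psi> UNIV u G f"
    using u by (auto simp: dirichlet_solution_def)
  obtain H where H: "W12_loc ?\<Omega> v H" "weak_equation \<L> ?\<Omega> v H" "has_trace \<psi> UNIV v H g"
    using v by (auto simp: dirichlet_solution_def)
  define w where "w x = u x - v x" for x
  define F where "F y = nontangential_max ?\<Omega> a u (y, \<psi> y)" for y
  \<comment> \<open>The two parts: the solution for the truncated data, and the near part of the difference.\<close>
  define V where "V y = nontangential_max ?\<Omega> a v (y, \<psi> y)" for y
  define Rr where "Rr y = near_max ?\<Omega> a \<rho> w (y, \<psi> y)" for y
  have fg_cont: "continuous_on UNIV f" "continuous_on UNIV g"
    using f g by (auto simp: test_functions_def intro: smooth_continuous)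
  have meas: "sobolev_measurable (ball x s \<inter> ?\<Omega>) u G" "sobolev_measurable (ball x s \<inter> ?\<Omega>) v H" for x s
    using G(1) H(1) unfolding W12_loc_def by (blast intro: W12_measurable)+
  interpret vs: vanishing_solution \<psi> \<L> w "\<lambda>e x. G e x - H e x" y0 R M \<kappa>
  proof
    show "W12_loc ?\<Omega> w (\<lambda>e x. G e x - H e x)" unfolding w_def[abs_def] by (rule W12_loc_diff[OF G(1) H(1)])
    show "weak_equation \<L> (ball x s \<inter> ?\<Omega>) w (\<lambda>e x. G e x - H e x)" for x s
      unfolding w_def[abs_def]
      by (rule weak_equation_diff[OF G(2) H(2)]) (use \<Omega> in \<open>auto intro!: sets_completionI_sets\<close>)
    show "has_trace \<psi> (ball (y0, \<psi> y0) (3 * (2 + M) * R)) w (\<lambda>e x. G e x - H e x) (\<lambda>_. 0)"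
      unfolding w_def[abs_def]
    proof (rule has_trace_diff[OF G(3) H(3) fg_cont])
      fix z assume "z \<in> ball (y0, \<psi> y0) (3 * (2 + M) * R)"
      then have "\<phi> z = 1" by (intro \<phi>(2)) (simp add: z0_def r_def \<Lambda>)
      then show "f z = g z" by (simp add: g_def)
    qed (use cont meas in auto)
  qed (use lip_graph M \<kappa> R cacc in auto)
  have vs\<Lambda>: "vs.\<Lambda> = \<Lambda>" by (simp add: vs.\<Lambda>_def \<Lambda>)
  have Vm: "V \<in> borel_measurable borel" unfolding V_def[abs_def] by (rule graph_comp_measurable[OF cont nontangential_max_measurable])
  have Rm: "Rr \<in> borel_measurable borel" unfolding Rr_def[abs_def] by (rule graph_comp_measurable[OF cont near_max_measurable])
  have V_le: "(\<integral>\<^sup>+y. ennreal_powr (V y) p0 \<partial>lborel) \<le> ennreal (KV * (\<gamma> * \<tau>) powr p0) * emeasure lborel (ball y0 \<rho>)"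
  proof -
    let ?C = "max C0 1"
    have gm: "(\<lambda>z. ennreal_powr (ennreal (norm (g z))) p0) \<in> borel_measurable borel"
      using borel_measurable_continuous_onI[OF fg_cont(2)] by measurable
    have Nm: "(\<lambda>z. ennreal_powr (nontangential_max ?\<Omega> a v z) p0) \<in> borel_measurable borel"
      using nontangential_max_measurable by measurable
    have "(\<integral>\<^sup>+y. ennreal_powr (V y) p0 \<partial>lborel) \<le> (\<integral>\<^sup>+z. ennreal_powr (nontangential_max ?\<Omega> a v z) p0 \<partial>surface_measure \<psi>)"
      unfolding V_def using surface_integral_bounds(1)[OF lip_graph M Nm] .
    also have "\<dots> \<le> ennreal (?C powr p0) * (\<integral>\<^sup>+z. ennreal_powr (ennreal (norm (g z))) p0 \<partial>surface_measure \<psi>)"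
      by (rule nontangential_bound_powr[OF v(2)]) (use p0 in auto)
    also have "\<dots> \<le> ennreal (?C powr p0) * (ennreal (1 + M) * (\<integral>\<^sup>+y. ennreal_powr (ennreal (norm (g (y, \<psi> y)))) p0 \<partial>lborel))"
      by (intro mult_left_mono surface_integral_bounds(2)[OF lip_graph M gm]) auto
    also have "(\<integral>\<^sup>+y. ennreal_powr (ennreal (norm (g (y, \<psi> y)))) p0 \<partial>lborel)
       \<le> (\<integral>\<^sup>+y. ennreal_powr (ennreal (norm (f (y, \<psi> y)))) p0 * indicator (ball y0 (2 * r)) y \<partial>lborel)"
    proof (rule nn_integral_mono)
      fix y
      show "ennreal_powr (ennreal (norm (g (y, \<psi> y)))) p0 \<le> ennreal_powr (ennreal (norm (f (y, \<psi> y)))) p0 * indicator (ball y0 (2 * r)) y"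
      proof (cases "(y, \<psi> y) \<in> ball z0 (2 * r)")
        case True
        have "dist y0 y \<le> dist z0 (y, \<psi> y)" using norm_fst_snd_le(1)[of "z0 - (y, \<psi> y)"] by (simp add: dist_norm z0_def)
        then have "y \<in> ball y0 (2 * r)" using True by simp
        moreover have "norm (g (y, \<psi> y)) \<le> 1 * norm (f (y, \<psi> y))"
          unfolding g_def norm_scaleR using \<phi>(4) by (intro mult_right_mono) auto
        ultimately show ?thesis using p0 by (auto intro!: ennreal_powr_mono ennreal_leI)
      qed (simp add: g_def \<phi>(3))
    qed
    also have "\<dots> \<le> ennreal ((\<gamma> * \<tau>) powr p0) * emeasure lborel (ball y0 (2 * r))"
    proof -
      have "2 * \<rho> \<le> 2 * r"
      proof -
        have "1 * R \<le> (3 * \<Lambda>) * R" using \<Lambda>2 R by (intro mult_right_mono) auto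
        then show ?thesis using R\<rho> R unfolding r_def by linarith
      qed
      from avg[OF this] show ?thesis by (simp add: ball_average_le_def)
    qed
    also have "ennreal (?C powr p0) * (ennreal (1 + M) * (ennreal ((\<gamma> * \<tau>) powr p0) * emeasure lborel (ball y0 (2 * r))))
       = ennreal (KV * (\<gamma> * \<tau>) powr p0) * emeasure lborel (ball y0 \<rho>)"
    proof -
      have "(2 * r) ^ n = (6 * \<Lambda> * CR) ^ n * \<rho> ^ n" unfolding power_mult_distrib[symmetric] by (simp add: r_def R_def mult_ac)
      then have eq: "?C powr p0 * ((1 + M) * ((\<gamma> * \<tau>) powr p0 * (unit_ball_vol (real n) * (2 * r) ^ n)))
         = KV * (\<gamma> * \<tau>) powr p0 * (unit_ball_vol (real n) * \<rho> ^ n)"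
        unfolding KV n_def[symmetric] by (simp only: mult_ac)
      have "ennreal (?C powr p0) * (ennreal (1 + M) * (ennreal ((\<gamma> * \<tau>) powr p0) * emeasure lborel (ball y0 (2 * r))))
         = ennreal (?C powr p0 * ((1 + M) * ((\<gamma> * \<tau>) powr p0 * (unit_ball_vol (real n) * (2 * r) ^ n))))"
        using r M by (simp add: emeasure_ball n_def ennreal_mult del: ennreal_plus)
      also have "\<dots> = ennreal (KV * (\<gamma> * \<tau>) powr p0) * emeasure lborel (ball y0 \<rho>)"
        unfolding eq using \<rho> KV0 by (simp add: emeasure_ball n_def ennreal_mult)
      finally show ?thesis .
    qed
    finally show ?thesis by (simp add: mult_left_mono)
  qed
  \<comment> \<open>The truncated solution also has controlled averages, since its total \<open>p0\<close>-mass is controlled.\<close>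
  have avV: "ball_average_le y0 \<rho>' (\<lambda>y. ennreal_powr (V y) p0) (KV * \<tau> powr p0)" if "\<rho> \<le> \<rho>'" for \<rho>'
  proof -
    have "(\<integral>\<^sup>+y. ennreal_powr (V y) p0 * indicator (ball y0 \<rho>') y \<partial>lborel) \<le> (\<integral>\<^sup>+y. ennreal_powr (V y) p0 \<partial>lborel)"
      by (intro nn_integral_mono) (auto simp: indicator_def)
    also note V_le
    also have "ennreal (KV * (\<gamma> * \<tau>) powr p0) * emeasure lborel (ball y0 \<rho>) \<le> ennreal (KV * \<tau> powr p0) * emeasure lborel (ball y0 \<rho>')"
    proof (rule mult_mono[OF ennreal_leI emeasure_mono[OF subset_ball[OF that]]])
      have "(\<gamma> * \<tau>) powr p0 \<le> \<tau> powr p0" using \<gamma> \<tau> p0 by (intro powr_mono2) (auto simp: mult_left_le_one_le)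
      then show "KV * (\<gamma> * \<tau>) powr p0 \<le> KV * \<tau> powr p0" using KV0 by (intro mult_left_mono) auto
    qed auto
    finally show ?thesis by (simp add: ball_average_le_def)
  qed
  have meas_ball: "u \<in> borel_measurable (lebesgue_on (ball x (depth \<psi> x / 4)))" "v \<in> borel_measurable (lebesgue_on (ball x (depth \<psi> x / 4)))"
    if x: "x \<in> ?\<Omega>" for x
  proof -
    have eq: "ball x (depth \<psi> x / 4) \<inter> ?\<Omega> = ball x (depth \<psi> x / 4)"
      using whitney_ball_in_domain[OF x depth_height(1)[OF cont lip M x]] by blast
    show "u \<in> borel_measurable (lebesgue_on (ball x (depth \<psi> x / 4)))" "v \<in> borel_measurable (lebesgue_on (ball x (depth \<psi> x / 4)))"
      using meas[of x "depth \<psi> x / 4"] unfolding sobolev_measurable_def eq by simp_all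
  qed
  have far: "whitney_average ?\<Omega> u x \<le> ennreal (A0 * \<tau>)"
    if y: "y \<in> ball y0 (5 * \<rho>)" and x: "x \<in> cone ?\<Omega> a (y, \<psi> y)" "\<rho> \<le> depth \<psi> x" for x y
  proof -
    have x\<Omega>: "x \<in> ?\<Omega>" "dist x (y, \<psi> y) < a * depth \<psi> x" using x by (auto simp: cone_def)
    define \<delta> where "\<delta> = depth \<psi> x"
    have \<delta>: "0 < \<delta>" "\<rho> \<le> \<delta>" using depth_height(1)[OF cont lip M x\<Omega>(1)] x(2) by (auto simp: \<delta>_def)
    define \<rho>' where "\<rho>' = (2 * a + 6) * \<delta>"
    have "norm (fst x - y) \<le> a * \<delta>" using norm_fst_snd_le(1)[of "x - (y, \<psi> y)"] x\<Omega>(2) by (simp add: dist_norm \<delta>_def)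
    moreover have "norm (y - y0) \<le> 5 * \<delta>" using y \<delta>(2) by (simp add: dist_norm norm_minus_commute)
    ultimately have "norm (fst x - y0) \<le> a * \<delta> + 5 * \<delta>" using norm_triangle_ineq[of "fst x - y" "y - y0"] by simp
    moreover have "c1 * \<delta> \<le> a * \<delta>" using c1p \<delta> by (intro mult_right_mono) auto
    ultimately have "norm (fst x - y0) + \<delta> + c1 * \<delta> \<le> \<rho>'" by (simp add: \<rho>'_def algebra_simps)
    then have 1: "norm (fst x - y0) + depth \<psi> x + (a - 1) / (1 + M) * depth \<psi> x \<le> \<rho>'" by (simp add: c1 \<delta>_def)
    have "2 * \<delta> \<le> \<rho>'" unfolding \<rho>'_def using a \<delta> by (intro mult_right_mono) auto
    then have "2 * \<rho> \<le> \<rho>'" using \<delta> by linarith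
    from whitney_le_average[OF cont lip M x\<Omega>(1) a _ 1 avF[OF this]] p0
    have "whitney_average ?\<Omega> u x \<le> ennreal ((\<tau> powr p0 * (\<rho>' / (c1 * \<delta>)) ^ n) powr (1 / p0))"
      by (simp add: c1 \<delta>_def n_def)
    also have "\<rho>' / (c1 * \<delta>) = (2 * a + 6) / c1" using \<delta> by (simp add: \<rho>'_def)
    also have "(\<tau> powr p0 * ((2 * a + 6) / c1) ^ n) powr (1 / p0) = A0 * \<tau>"
    proof -
      have pos: "0 < (2 * a + 6) / c1" using c1p a by simp
      then have "((2 * a + 6) / c1) ^ n = ((2 * a + 6) / c1) powr real n" by (simp only: powr_realpow)
      then have "(\<tau> powr p0 * ((2 * a + 6) / c1) ^ n) powr (1 / p0) = (\<tau> powr p0) powr (1 / p0) * (((2 * a + 6) / c1) powr real n) powr (1 / p0)"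
        using pos by (simp only: powr_mult)
      also have "\<dots> = \<tau> * A0" using p0 \<tau> by (simp add: powr_powr A0 n_def)
      finally show ?thesis by simp
    qed
    finally show ?thesis .
  qed
  have max_dec: "F y \<le> 2 * max (V y) (Rr y)" if y: "y \<in> ball y0 (5 * \<rho>)" and large: "ennreal (A0 * \<tau>) < F y" for y
  proof -
    have "F y \<le> max (ennreal (A0 * \<tau>)) (2 * max (V y) (Rr y))"
      unfolding F_def nontangential_max_eq
    proof (rule SUP_least)
      fix x assume x: "x \<in> cone ?\<Omega> a (y, \<psi> y)"
      then have x\<Omega>: "x \<in> ?\<Omega>" by (simp add: cone_def)
      show "whitney_average ?\<Omega> u x \<le> max (ennreal (A0 * \<tau>)) (2 * max (V y) (Rr y))"
      proof (cases "\<rho> \<le> depth \<psi> x")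
        case True
        then show ?thesis using far[OF y x] by (simp add: le_max_iff_disj)
      next
        case False
        have "whitney_average ?\<Omega> u x \<le> 2 * max (whitney_average ?\<Omega> v x) (whitney_average ?\<Omega> w x)"
          unfolding w_def[abs_def]
          by (rule whitney_average_diff[OF depth_height(1)[OF cont lip M x\<Omega>] meas_ball[OF x\<Omega>]])
        also have "\<dots> \<le> 2 * max (V y) (Rr y)"
        proof (intro mult_left_mono max.mono)
          show "whitney_average ?\<Omega> v x \<le> V y" unfolding V_def by (rule whitney_average_le[OF x])
          show "whitney_average ?\<Omega> w x \<le> Rr y" unfolding Rr_def near_max_def
            using x False by (intro SUP_upper) auto
        qed auto
        finally show ?thesis by (simp add: le_max_iff_disj)
      qed
    qed
    then show ?thesis using large by (auto simp: le_max_iff_disj)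
  qed
  \<comment> \<open>Crude interior bound for \<open>w\<close>: both \<open>u\<close> and \<open>v\<close> have Whitney averages bounded by \<open>\<tau>\<close> times a power of \<open>R / depth\<close>.\<close>
  define Q where "Q = Q0 * \<tau>\<^sup>2"
  have Q: "0 < Q" using Q0p \<tau> by (simp add: Q_def)
  have whitney: "(\<integral>\<^sup>+z. ennreal ((norm (w z))\<^sup>2) * indicator (ball x (depth \<psi> x / 4)) z \<partial>lebesgue)
          \<le> ennreal (Q * R ^ (CARD('n) + 1) * (R / depth \<psi> x) ^ (2 * CARD('n)))"
    if x: "x \<in> ?\<Omega>" "norm (fst x - y0) < 2 * R" "snd x - \<psi> (fst x) < 2 * R" for x
  proof -
    note dep = depth_height[OF cont lip M x(1)]
    define \<delta> where "\<delta> = depth \<psi> x"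
    have \<delta>: "0 < \<delta>" "\<delta> \<le> 2 * R" using dep(1,2) x(3) by (auto simp: \<delta>_def)
    define \<rho>' where "\<rho>' = (4 + 2 * a) * R"
    have "c1 * \<delta> \<le> a * (2 * R)" using c1p \<delta> a by (intro mult_mono) auto
    then have \<rho>1: "norm (fst x - y0) + \<delta> + c1 * \<delta> \<le> \<rho>'" "c1 * \<delta> \<le> \<rho>'"
      using x(2) \<delta> R by (auto simp: \<rho>'_def algebra_simps)
    then have 1: "norm (fst x - y0) + depth \<psi> x + (a - 1) / (1 + M) * depth \<psi> x \<le> \<rho>'" by (simp add: c1 \<delta>_def)
    have "2 * R \<le> \<rho>'" unfolding \<rho>'_def using a R by (intro mult_right_mono) auto
    then have 2: "2 * \<rho> \<le> \<rho>'" "\<rho> \<le> \<rho>'" using R\<rho> \<rho> by linarith+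
    define X where "X = (\<rho>' / (c1 * \<delta>)) ^ n"
    have c1\<delta>: "0 < c1 * \<delta>" using c1p \<delta> by simp
    have X: "1 \<le> X" unfolding X_def using \<rho>1(2) c1\<delta> by (intro one_le_power) simp
    define am where "am = K1 * \<tau> * X"
    have am: "0 \<le> am" using K1' \<tau> X by (simp add: am_def)
    have bd: "(k * \<tau> powr p0 * X) powr (1 / p0) \<le> am" if k: "0 \<le> k" "k \<le> K1" for k
    proof -
      \<comment> \<open>As \<open>K1\<close> and \<open>X\<close> are at least \<open>1\<close>, the exponent \<open>1 / p0\<close> on them may be replaced by \<open>1\<close>.\<close>
      have "(k * \<tau> powr p0 * X) powr (1 / p0) \<le> (K1 * \<tau> powr p0 * X) powr (1 / p0)"
        using k X p0 by (intro powr_mono2 mult_right_mono) auto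
      also have "\<dots> = K1 powr (1 / p0) * \<tau> * X powr (1 / p0)"
        using K1' \<tau> X p0 by (simp add: powr_mult powr_powr)
      also have "\<dots> \<le> K1 powr 1 * \<tau> * X powr 1"
        using K1' X p0 \<tau> by (intro mult_mono powr_mono) auto
      finally show ?thesis using K1' X by (simp add: am_def)
    qed
    have "whitney_average ?\<Omega> u x \<le> ennreal ((\<tau> powr p0 * X) powr (1 / p0))"
      using whitney_le_average[OF cont lip M x(1) a _ 1 avF[OF 2(1)]] p0 by (simp add: X_def c1 \<delta>_def n_def)
    also have "\<dots> \<le> ennreal am" using bd[of 1] K1' by (intro ennreal_leI) simp
    finally have wu: "whitney_average ?\<Omega> u x \<le> ennreal am" .
    have "whitney_average ?\<Omega> v x \<le> ennreal ((KV * \<tau> powr p0 * X) powr (1 / p0))"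
      using whitney_le_average[OF cont lip M x(1) a _ 1 avV[OF 2(2), unfolded V_def]] p0 KV0 by (simp add: X_def c1 \<delta>_def n_def)
    also have "\<dots> \<le> ennreal am" using bd[of KV] KV0 by (intro ennreal_leI) (simp add: K1)
    finally have wv: "whitney_average ?\<Omega> v x \<le> ennreal am" .
    have wm: "w \<in> borel_measurable (lebesgue_on (ball x (depth \<psi> x / 4)))"
      unfolding w_def[abs_def] using meas_ball[OF x(1)] by measurable
    have "whitney_average ?\<Omega> w x \<le> 2 * max (whitney_average ?\<Omega> u x) (whitney_average ?\<Omega> (\<lambda>y. w y - u y) x)"
      by (rule whitney_average_diff[OF dep(1) wm meas_ball(1)[OF x(1)]])
    also have "whitney_average ?\<Omega> (\<lambda>y. w y - u y) x = whitney_average ?\<Omega> v x"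
      by (rule whitney_average_cong) (simp add: w_def)
    also have "2 * max (whitney_average ?\<Omega> u x) (whitney_average ?\<Omega> v x) \<le> 2 * ennreal am"
      using wu wv by (intro mult_left_mono max.boundedI) auto
    also have "2 * ennreal am = ennreal (2 * am)" using am by (simp add: ennreal_mult)
    finally have "(\<integral>\<^sup>+z. ennreal ((norm (w z))\<^sup>2) * indicator (ball x (depth \<psi> x / 4)) z \<partial>lebesgue)
       \<le> ennreal ((2 * am)\<^sup>2 * (unit_ball_vol (real DIM((real ^ 'n) \<times> real)) * (depth \<psi> x / 4) ^ DIM((real ^ 'n) \<times> real)))"
      by (rule iffD1[OF whitney_average_le_iff[OF dep(1)], rotated]) (use am in simp)
    also have "\<dots> \<le> ennreal (Q * R ^ (n + 1) * (R / \<delta>) ^ (2 * n))"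
    proof (rule ennreal_leI)
      have "DIM((real ^ 'n) \<times> real) = n + 1" by (simp add: n_def)
      moreover have "(\<delta> / 4) ^ (n + 1) \<le> R ^ (n + 1)" using \<delta> R by (intro power_mono) auto
      moreover have "(2 * am)\<^sup>2 * unit_ball_vol (real (n + 1)) = Q * (R / \<delta>) ^ (2 * n)"
      proof -
        have "X\<^sup>2 = (\<rho>' / (c1 * \<delta>)) ^ (2 * n)" unfolding X_def power_mult[symmetric] by (simp add: mult.commute)
        also have "\<rho>' / (c1 * \<delta>) = ((4 + 2 * a) / c1) * (R / \<delta>)" by (simp add: \<rho>'_def)
        finally have X2: "X\<^sup>2 = ((4 + 2 * a) / c1) ^ (2 * n) * (R / \<delta>) ^ (2 * n)" by (simp only: power_mult_distrib)
        have "(2 * am)\<^sup>2 * unit_ball_vol (real (n + 1)) = 4 * K1\<^sup>2 * \<tau>\<^sup>2 * X\<^sup>2 * unit_ball_vol (real (n + 1))"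
          by (simp add: am_def power_mult_distrib)
        also have "\<dots> = Q * (R / \<delta>) ^ (2 * n)" unfolding X2 Q_def Q0 n_def[symmetric] by (simp only: mult_ac)
        finally show ?thesis .
      qed
      moreover have "0 \<le> (2 * am)\<^sup>2 * unit_ball_vol (real (n + 1))" by simp
      ultimately have "(2 * am)\<^sup>2 * unit_ball_vol (real (n + 1)) * (\<delta> / 4) ^ (n + 1) \<le> Q * (R / \<delta>) ^ (2 * n) * R ^ (n + 1)"
        by (metis mult_left_mono)
      then show "(2 * am)\<^sup>2 * (unit_ball_vol (real DIM((real ^ 'n) \<times> real)) * (depth \<psi> x / 4) ^ DIM((real ^ 'n) \<times> real)) \<le> Q * R ^ (n + 1) * (R / \<delta>) ^ (2 * n)"
        unfolding \<open>DIM((real ^ 'n) \<times> real) = n + 1\<close> \<delta>_def by (simp only: mult_ac)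
    qed
    finally show ?thesis by (simp only: n_def \<delta>_def)
  qed
  have weak: "emeasure lborel {y\<in>ball y0 (5 * \<rho>). ennreal t < Rr y} \<le> ennreal (KR * (\<tau> / t) powr q) * emeasure lborel (ball y0 \<rho>)"
    if t: "0 < t" for t
  proof -
    define wc where "wc = weak_const (\<kappa> / \<Lambda>\<^sup>2) (2 * \<Lambda>\<^sup>2) M (32 * (1 + M\<^sup>2)) n (3 * n + 1) q"
    define P where "P = (16 * \<Lambda>\<^sup>2) ^ (n + 1) * (2 * \<Lambda>) ^ (2 * n)"
    have "vs.\<Lambda> * (a + 1) * \<rho> \<le> R / (8 * (2 * vs.\<Lambda>\<^sup>2))"
    proof -
      have "R / (8 * (2 * \<Lambda>\<^sup>2)) = \<Lambda> * (a + 6) * \<rho>" using \<Lambda>2 by (simp add: R_def CR)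
      moreover have "\<Lambda> * (a + 1) * \<rho> \<le> \<Lambda> * (a + 6) * \<rho>" using \<Lambda>2 \<rho> by (intro mult_right_mono mult_left_mono) auto
      ultimately show ?thesis by (simp only: vs\<Lambda>)
    qed
    from vs.near_weak_type[OF Q a t this whitney q(1)] q(2)
    have "emeasure lborel {y \<in> ball y0 (R / 8). ennreal t < near_max ?\<Omega> a \<rho> w (y, \<psi> y)}
       \<le> ennreal (wc * (sqrt (Q * P) / (sqrt (near_ratio M a n) * t)) powr q * R ^ n)"
      unfolding vs\<Lambda> wc_def P_def n_def by (simp only: mult.assoc)
    also have "\<dots> \<le> ennreal (KR * (\<tau> / t) powr q * (unit_ball_vol (real n) * \<rho> ^ n))"
    proof (rule ennreal_leI)
      have "sqrt (Q * P) = \<tau> * sqrt (Q0 * P)"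
        using \<tau> by (simp add: Q_def real_sqrt_mult)
      then have s: "sqrt (Q * P) / (sqrt (near_ratio M a n) * t) = c4 * (\<tau> / t)"
        by (simp add: c4 P_def n_def mult.assoc)
      have "(c4 * (\<tau> / t)) powr q = c4 powr q * (\<tau> / t) powr q" by (rule powr_mult)
      then have "wc * (sqrt (Q * P) / (sqrt (near_ratio M a n) * t)) powr q * R ^ n = wc * (c4 powr q * (\<tau> / t) powr q * (CR ^ n * \<rho> ^ n))"
        unfolding s R_def by (simp add: power_mult_distrib)
      also have "\<dots> \<le> \<bar>wc\<bar> * (c4 powr q * (\<tau> / t) powr q * (CR ^ n * \<rho> ^ n))"
        using CR1 \<rho> by (intro mult_right_mono) auto
      also have "\<dots> = KR * (\<tau> / t) powr q * (unit_ball_vol (real n) * \<rho> ^ n)"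
      proof -
        have "unit_ball_vol (real n) \<noteq> 0" by (simp add: less_imp_neq[symmetric])
        then show ?thesis unfolding KR wc_def n_def[symmetric] by simp
      qed
      finally show "wc * (sqrt (Q * P) / (sqrt (near_ratio M a n) * t)) powr q * R ^ n \<le> KR * (\<tau> / t) powr q * (unit_ball_vol (real n) * \<rho> ^ n)" .
    qed
    also have "\<dots> = ennreal (KR * (\<tau> / t) powr q) * emeasure lborel (ball y0 \<rho>)"
      using KR0 \<rho> by (simp add: emeasure_ball n_def flip: ennreal_mult)
    finally have big: "emeasure lborel {y \<in> ball y0 (R / 8). ennreal t < Rr y} \<le> ennreal (KR * (\<tau> / t) powr q) * emeasure lborel (ball y0 \<rho>)"
      by (simp add: Rr_def)
    have "{y\<in>ball y0 (5 * \<rho>). ennreal t < Rr y} \<subseteq> {y \<in> ball y0 (R / 8). ennreal t < Rr y}" using R5 by auto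
    moreover have "{y \<in> ball y0 (R / 8). ennreal t < Rr y} \<in> sets lborel"
    proof -
      have "{y. ennreal t < Rr y} \<in> sets borel" using Rm by simp
      then have "ball y0 (R / 8) \<inter> {y. ennreal t < Rr y} \<in> sets borel" by auto
      then show ?thesis by (simp add: Int_def)
    qed
    ultimately show ?thesis using big by (meson emeasure_mono order_trans)
  qed
  have mono: "ennreal (k * x) * m \<le> ennreal ((KV + KR + 1) * x) * m" if "k \<le> KV + KR + 1" "0 \<le> x" for k x m
    using that by (intro mult_right_mono ennreal_leI) auto
  show ?thesis unfolding local_splitting_def
  proof (rule exI[of _ V], rule exI[of _ Rr], intro conjI Vm Rm)
    show "\<forall>y\<in>ball y0 (5 * \<rho>). ennreal (A0 * \<tau>) < nontangential_max ?\<Omega> a u (y, \<psi> y) \<longrightarrow>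
        nontangential_max ?\<Omega> a u (y, \<psi> y) \<le> 2 * max (V y) (Rr y)"
      using max_dec unfolding F_def by blast
    show "(\<integral>\<^sup>+y. ennreal_powr (V y) p0 \<partial>lborel) \<le> ennreal ((KV + KR + 1) * (\<gamma> * \<tau>) powr p0) * emeasure lborel (ball y0 \<rho>)"
      by (rule order_trans[OF V_le mono]) (use KR0 in auto)
    show "\<forall>t>0. emeasure lborel {y\<in>ball y0 (5 * \<rho>). ennreal t < Rr y}
        \<le> ennreal ((KV + KR + 1) * (\<tau> / t) powr q) * emeasure lborel (ball y0 \<rho>)"
      by (intro allI impI, rule order_trans[OF weak mono]) (use KV0 in auto)
  qed
qed

section \<open>Extrapolation beyond the critical exponent\<close>

text \<open>With \<open>n = d - 1\<close> the critical exponent \<open>2 (d - 1) / (d - 2)\<close> equals \<open>2 + 2 / (n - 1)\<close>, so the energy decay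
  \<open>\<eta>\<close> lifts the exponent of the weak-type estimate strictly above it.  For \<open>n = 1\<close> there is nothing to exceed.\<close>

lemma supercritical_exponent:
  assumes \<eta>: "0 < \<eta>" "\<eta> \<le> 1/2" and n: "1 \<le> n"
  shows "\<exists>\<epsilon>>0. \<forall>p. ereal p < crit_exponent (n + 1) + ereal \<epsilon> \<longrightarrow>
    (\<exists>q>p. 0 < q \<and> (1 < n \<longrightarrow> q = 2 + 2 / (real n - 1 - \<eta>)))"
proof (cases "n = 1")
  case True
  then have "\<exists>q>p. 0 < q \<and> (1 < n \<longrightarrow> q = 2 + 2 / (real n - 1 - \<eta>))" for p :: real
    by (intro exI[of _ "max p 0 + 1"]) auto
  then show ?thesis by (intro exI[of _ 1]) auto
next
  case False
  then have n2: "2 \<le> real n" using n by simp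
  define c where "c = 2 / (real n - 1 - \<eta>) - 2 / (real n - 1)"
  have "2 / (real n - 1) < 2 / (real n - 1 - \<eta>)" using n2 \<eta> by (intro divide_strict_left_mono) auto
  then have c: "0 < c" by (simp add: c_def)
  have "2 * real n / (real n - 1) = 2 + 2 / (real n - 1)" using n2 by (simp add: field_simps)
  then have "crit_exponent (n + 1) + ereal c = ereal (2 + 2 / (real n - 1 - \<eta>))"
    using False by (simp add: crit_exponent_def c_def)
  moreover have "0 < 2 + 2 / (real n - 1 - \<eta>)" using n2 \<eta> by (intro add_pos_nonneg) auto
  ultimately show ?thesis using c by (intro exI[of _ c]) auto
qed

lemma finite_boundary_norm:
  fixes f :: "(real ^ 'n) \<times> real \<Rightarrow> complex ^ 'm" and \<psi> :: "real ^ 'n \<Rightarrow> real"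
  assumes f: "f \<in> test_functions UNIV" and p: "0 < p"
  shows "(\<integral>\<^sup>+y. ennreal_powr (ennreal (norm (f (y, \<psi> y)))) p \<partial>lborel) < top"
proof -
  have fc: "continuous_on UNIV f" using f by (auto simp: test_functions_def intro: smooth_continuous)
  have cpt: "compact (closure {z. f z \<noteq> 0})" using f by (simp add: test_functions_def)
  have "bounded (f ` closure {z. f z \<noteq> 0})"
    by (intro compact_imp_bounded compact_continuous_image cpt continuous_on_subset[OF fc]) auto
  then obtain B where B: "0 < B" "\<And>z. z \<in> closure {z. f z \<noteq> 0} \<Longrightarrow> norm (f z) \<le> B"
    unfolding bounded_pos by auto
  obtain s where s: "0 < s" "closure {z. f z \<noteq> 0} \<subseteq> ball 0 s"
    using compact_imp_bounded[OF cpt] bounded_subset_ballD by metis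
  have "(\<integral>\<^sup>+y. ennreal_powr (ennreal (norm (f (y, \<psi> y)))) p \<partial>lborel)
    \<le> (\<integral>\<^sup>+y. ennreal (B powr p) * indicator (ball 0 s) y \<partial>(lborel :: (real ^ 'n) measure))"
  proof (rule nn_integral_mono)
    fix y
    show "ennreal_powr (ennreal (norm (f (y, \<psi> y)))) p \<le> ennreal (B powr p) * indicator (ball (0::real ^ 'n) s) y"
    proof (cases "f (y, \<psi> y) = 0")
      case False
      then have c: "(y, \<psi> y) \<in> closure {z. f z \<noteq> 0}" using closure_subset[of "{z. f z \<noteq> 0}"] by auto
      then have "norm (y, \<psi> y) < s" using s(2) by auto
      then have "y \<in> ball 0 s" using norm_fst_snd_le(1)[of "(y, \<psi> y)"] by simp
      then show ?thesis using B(2)[OF c] p by (simp add: ennreal_powr_ennreal powr_mono2 ennreal_leI)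
    qed (use p in \<open>simp add: ennreal_powr_def\<close>)
  qed
  also have "\<dots> = ennreal (B powr p) * emeasure lborel (ball (0 :: real ^ 'n) s)"
    by (simp add: nn_integral_cmult_indicator)
  also have "\<dots> < top" using s by (simp add: emeasure_ball ennreal_mult_less_top)
  finally show ?thesis .
qed

theorem theorem1p2:
  fixes d :: nat and M p0 \<kappa> C0 a :: real
  assumes "d = CARD('n::finite) + 1"
    and "0 \<le> M" and "1 < p0" and "ereal p0 < crit_exponent d"
    and "0 < \<kappa>" and "1 + 2 * M < a"
  shows "\<exists>\<epsilon>>0. \<forall>p. p0 < p \<and> ereal p < crit_exponent d + ereal \<epsilon> \<longrightarrow>
    (\<exists>C>0. \<forall>(\<psi> :: real ^ 'n \<Rightarrow> real) (\<L> :: ((real ^ 'n) \<times> real, 'm::finite) elliptic_op).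
       lipschitz_graph M \<psi> \<and>
       elliptic (graph_domain \<psi>) \<L> \<and>
       boundary_caccioppoli \<psi> \<L> \<kappa> \<and>
       (\<forall>f \<in> test_functions UNIV. \<exists>u.
          dirichlet_solution \<psi> \<L> f u \<and> nontangential_bound \<psi> a p0 C0 f u) \<longrightarrow>
       (\<forall>f \<in> test_functions UNIV. \<forall>u.
          dirichlet_solution \<psi> \<L> f u \<and> nontangential_bound \<psi> a p0 C0 f u \<longrightarrow>
          nontangential_bound \<psi> a p C f u))"
proof -
  note M = \<open>0 \<le> M\<close> and p0 = \<open>1 < p0\<close> and \<kappa> = \<open>0 < \<kappa>\<close>
  have a: "1 < a" using M \<open>1 + 2 * M < a\<close> by linarith
  \<comment> \<open>All constants are fixed before the domain, the operator and the data.\<close>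
  define \<Lambda> where "\<Lambda> = 2 + M"
  define \<eta> where "\<eta> = decay_exponent (\<kappa> / \<Lambda>\<^sup>2) (2 * \<Lambda>\<^sup>2) M (32 * (1 + M\<^sup>2))"
  define CR where "CR = 16 * \<Lambda>\<^sup>2 * (\<Lambda> * (a + 6))"
  define c1 where "c1 = (a - 1) / (1 + M)"
  define KV where "KV = max C0 1 powr p0 * (1 + M) * (6 * \<Lambda> * CR) ^ CARD('n)"
  define K1 where "K1 = 1 + KV"
  define Q0 where "Q0 = 4 * unit_ball_vol (real (CARD('n) + 1)) * K1\<^sup>2 * ((4 + 2 * a) / c1) ^ (2 * CARD('n))"
  define c4 where "c4 = sqrt (Q0 * (16 * \<Lambda>\<^sup>2) ^ (CARD('n) + 1) * (2 * \<Lambda>) ^ (2 * CARD('n))) / sqrt (near_ratio M a CARD('n))"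
  define A0 where "A0 = ((2 * a + 6) / c1) powr (real CARD('n) / p0)"
  have \<Lambda>2: "2 \<le> \<Lambda>" using M by (simp add: \<Lambda>_def)
  have LL: "4 \<le> \<Lambda>\<^sup>2" using \<Lambda>2 power_mono[of 2 \<Lambda> 2] by simp
  have CR: "0 \<le> CR" using \<Lambda>2 a by (simp add: CR_def)
  have "0 < \<kappa> / \<Lambda>\<^sup>2" using \<kappa> \<Lambda>2 by simp
  then have \<eta>: "0 < \<eta>" "\<eta> \<le> 1/2"
    using decay_exponent_range[of "\<kappa> / \<Lambda>\<^sup>2" "2 * \<Lambda>\<^sup>2" M "32 * (1 + M\<^sup>2)"] \<kappa> M LL unfolding \<eta>_def by simp_all
  have "1 \<le> CARD('n)" by (simp add: Suc_le_eq)
  from supercritical_exponent[OF \<eta> this] obtain \<epsilon> where \<epsilon>: "0 < \<epsilon>"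
    "\<And>p. ereal p < crit_exponent d + ereal \<epsilon> \<Longrightarrow>
      \<exists>q>p. 0 < q \<and> (1 < CARD('n) \<longrightarrow> q = 2 + 2 / (real CARD('n) - 1 - \<eta>))"
    unfolding \<open>d = CARD('n) + 1\<close> by blast
  show ?thesis
  proof (rule exI[of _ \<epsilon>], intro conjI \<epsilon>(1) allI impI)
    fix p assume p: "p0 < p \<and> ereal p < crit_exponent d + ereal \<epsilon>"
    obtain q where q: "p < q" "0 < q" "1 < CARD('n) \<Longrightarrow> q = 2 + 2 / (real CARD('n) - 1 - \<eta>)"
      using \<epsilon>(2)[of p] p by blast
    define KR where "KR = \<bar>weak_const (\<kappa> / \<Lambda>\<^sup>2) (2 * \<Lambda>\<^sup>2) M (32 * (1 + M\<^sup>2)) CARD('n) (3 * CARD('n) + 1) q\<bar>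
      * c4 powr q * CR ^ CARD('n) / unit_ball_vol (real CARD('n))"
    have "0 \<le> KV" "0 \<le> KR" using M CR \<Lambda>2 by (simp_all add: KV_def KR_def)
    then have K: "0 < KV + KR + 1" by simp
    have p0p: "0 < p0" "p0 < p" using p0 p by auto
    obtain C where C: "0 < C" and extrapolate: "\<forall>F g :: real ^ 'n \<Rightarrow> ennreal.
     F \<in> borel_measurable borel \<longrightarrow> g \<in> borel_measurable borel \<longrightarrow>
     (\<forall>t. open {x. ennreal t < F x}) \<longrightarrow>
     (\<integral>\<^sup>+x. ennreal_powr (F x) p0 \<partial>lborel) < top \<longrightarrow> (\<integral>\<^sup>+x. ennreal_powr (g x) p0 \<partial>lborel) < top \<longrightarrow>
     (\<forall>\<gamma> y \<rho> \<tau>. 0 < \<gamma> \<longrightarrow> \<gamma> \<le> 1 \<longrightarrow> 0 < \<rho> \<longrightarrow> 0 < \<tau> \<longrightarrow>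
        (\<forall>\<rho>'\<ge>2 * \<rho>. ball_average_le y \<rho>' (\<lambda>x. ennreal_powr (F x) p0) (\<tau> powr p0)) \<longrightarrow>
        (\<forall>\<rho>'\<ge>2 * \<rho>. ball_average_le y \<rho>' (\<lambda>x. ennreal_powr (g x) p0) ((\<gamma> * \<tau>) powr p0)) \<longrightarrow>
        local_splitting p0 q A0 (KV + KR + 1) \<gamma> \<tau> y \<rho> F) \<longrightarrow>
     (\<integral>\<^sup>+x. ennreal_powr (F x) p \<partial>lborel) \<le> ennreal C * (\<integral>\<^sup>+x. ennreal_powr (g x) p \<partial>lborel)"
      by (rule real_variable_extrapolation[OF p0p q(1) K, of A0, where ?'a="real ^ 'n"]) (rule that)
    \<comment> \<open>The factor \<open>1 + M\<close> is lost on returning from Lebesgue measure to surface measure.\<close>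
    define C' where "C' = (1 + M) * C"
    have C': "0 < C'" using C M by (simp add: C'_def)
    show "\<exists>C>0. \<forall>(\<psi> :: real ^ 'n \<Rightarrow> real) (\<L> :: ((real ^ 'n) \<times> real, 'm::finite) elliptic_op).
       lipschitz_graph M \<psi> \<and> elliptic (graph_domain \<psi>) \<L> \<and> boundary_caccioppoli \<psi> \<L> \<kappa> \<and>
       (\<forall>f \<in> test_functions UNIV. \<exists>u. dirichlet_solution \<psi> \<L> f u \<and> nontangential_bound \<psi> a p0 C0 f u) \<longrightarrow>
       (\<forall>f \<in> test_functions UNIV. \<forall>u.
          dirichlet_solution \<psi> \<L> f u \<and> nontangential_bound \<psi> a p0 C0 f u \<longrightarrow> nontangential_bound \<psi> a p C f u)"
    proof (rule exI[of _ "C' powr (1/p)"], intro conjI allI impI ballI)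
      show "0 < C' powr (1/p)" using C' by simp
    next
      fix \<psi> :: "real ^ 'n \<Rightarrow> real" and \<L> :: "((real ^ 'n) \<times> real, 'm::finite) elliptic_op"
        and f u :: "(real ^ 'n) \<times> real \<Rightarrow> complex ^ 'm"
      assume asm: "lipschitz_graph M \<psi> \<and> elliptic (graph_domain \<psi>) \<L> \<and> boundary_caccioppoli \<psi> \<L> \<kappa> \<and>
         (\<forall>f \<in> test_functions UNIV. \<exists>u. dirichlet_solution \<psi> \<L> f u \<and> nontangential_bound \<psi> a p0 C0 f u)"
        and f: "f \<in> test_functions UNIV"
        and u: "dirichlet_solution \<psi> \<L> f u \<and> nontangential_bound \<psi> a p0 C0 f u"
      have lip: "lipschitz_graph M \<psi>" and cacc: "boundary_caccioppoli \<psi> \<L> \<kappa>" using asm by auto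
      have cont: "continuous_on UNIV \<psi>" by (rule lipschitz_graph_continuous[OF lip])
      let ?N = "nontangential_max (graph_domain \<psi>) a u"
      let ?F = "\<lambda>y. ?N (y, \<psi> y)" and ?g = "\<lambda>y. ennreal (norm (f (y, \<psi> y)))"
      have fb: "(\<lambda>z. ennreal (norm (f z))) \<in> borel_measurable borel"
        using f smooth_continuous[of f]
        by (intro measurable_compose[OF _ measurable_ennreal] borel_measurable_continuous_onI continuous_on_norm) (auto simp: test_functions_def)
      have Nm: "(\<lambda>z. ennreal_powr (?N z) s) \<in> borel_measurable borel" for s
        using nontangential_max_measurable by measurable
      have fm: "(\<lambda>z. ennreal_powr (ennreal (norm (f z))) s) \<in> borel_measurable borel" for s
        using fb by measurable
      have g_fin: "(\<integral>\<^sup>+y. ennreal_powr (?g y) p0 \<partial>lborel) < top"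
        using p0 by (intro finite_boundary_norm[OF f]) simp
      have "(\<integral>\<^sup>+y. ennreal_powr (?F y) p0 \<partial>lborel) \<le> (\<integral>\<^sup>+z. ennreal_powr (?N z) p0 \<partial>surface_measure \<psi>)"
        by (rule surface_integral_bounds(1)[OF lip M Nm])
      also have "\<dots> \<le> ennreal (max C0 1 powr p0) * (\<integral>\<^sup>+z. ennreal_powr (ennreal (norm (f z))) p0 \<partial>surface_measure \<psi>)"
        by (rule nontangential_bound_powr) (use u p0 in auto)
      also have "\<dots> \<le> ennreal (max C0 1 powr p0) * (ennreal (1 + M) * (\<integral>\<^sup>+y. ennreal_powr (?g y) p0 \<partial>lborel))"
        by (intro mult_left_mono surface_integral_bounds(2)[OF lip M fm]) auto
      also have "\<dots> < top" using g_fin by (simp add: ennreal_mult_less_top)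
      finally have F_fin: "(\<integral>\<^sup>+y. ennreal_powr (?F y) p0 \<partial>lborel) < top" .
      have "(\<integral>\<^sup>+y. ennreal_powr (?F y) p \<partial>lborel) \<le> ennreal C * (\<integral>\<^sup>+y. ennreal_powr (?g y) p \<partial>lborel)"
      proof (rule extrapolate[rule_format, OF graph_comp_measurable[OF cont nontangential_max_measurable] graph_comp_measurable[OF cont fb] _ F_fin g_fin])
        have "open ((\<lambda>y. (y, \<psi> y)) -` {z. ennreal t < ?N z})" for t
          by (intro open_vimage open_nontangential_max continuous_intros cont)
        then show "open {y. ennreal t < ?F y}" for t by (simp add: vimage_def)
      next
        fix \<gamma> y0 \<rho> \<tau> assume "0 < \<gamma>" "\<gamma> \<le> 1" "0 < \<rho>" "0 < \<tau>"
          and "\<And>\<rho>'. 2 * \<rho> \<le> \<rho>' \<Longrightarrow> ball_average_le y0 \<rho>' (\<lambda>y. ennreal_powr (?F y) p0) (\<tau> powr p0)"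
          and "\<And>\<rho>'. 2 * \<rho> \<le> \<rho>' \<Longrightarrow> ball_average_le y0 \<rho>' (\<lambda>y. ennreal_powr (?g y) p0) ((\<gamma> * \<tau>) powr p0)"
        then show "local_splitting p0 q A0 (KV + KR + 1) \<gamma> \<tau> y0 \<rho> ?F"
          using asm u
          by (intro local_estimate[OF M p0 \<kappa> a q(2) q(3)[unfolded \<eta>_def] \<Lambda>_def CR_def c1_def KV_def K1_def Q0_def c4_def KR_def A0_def
                lip cacc _ f]) auto
      qed
      then have "(\<integral>\<^sup>+y. ennreal_powr (?F y) p \<partial>lborel) \<le> ennreal C * (\<integral>\<^sup>+z. ennreal_powr (ennreal (norm (f z))) p \<partial>surface_measure \<psi>)"
        using mult_left_mono[OF surface_integral_bounds(1)[OF lip M fm, of p], of "ennreal C"] by (auto intro: order_trans)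
      then have "ennreal (1 + M) * (\<integral>\<^sup>+y. ennreal_powr (?F y) p \<partial>lborel)
          \<le> ennreal C' * (\<integral>\<^sup>+z. ennreal_powr (ennreal (norm (f z))) p \<partial>surface_measure \<psi>)"
        using M C by (simp add: C'_def ennreal_mult mult.assoc mult_left_mono del: ennreal_plus)
      with surface_integral_bounds(2)[OF lip M Nm]
      have "(\<integral>\<^sup>+z. ennreal_powr (?N z) p \<partial>surface_measure \<psi>)
          \<le> ennreal C' * (\<integral>\<^sup>+z. ennreal_powr (ennreal (norm (f z))) p \<partial>surface_measure \<psi>)"
        by (rule order_trans)
      then show "nontangential_bound \<psi> a p (C' powr (1/p)) f u"
        using p p0 C' by (intro nontangential_bound_of_powr) auto
    qed
  qed
qed

end
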